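(* Let $X$ be a closed complex manifold of complex dimension $n \geq 2$ with a Kähler metric form $\omega_0$, and let $\widetilde\omega_t$, $t\in[0,T)$, be the maximal smooth solution of the Kähler-Ricci flow $$\frac{\partial \widetilde\omega_t}{\partial t} = -\mathrm{Ric}(\widetilde\omega_t)-\widetilde\omega_t,\qquad \widetilde\omega_0=\omega_0 .$$ Suppose the flow has a finite time singularity, i.e. $T<\infty$, and let $[\omega_T] = -c_1(X)+e^{-T}\left([\omega_0]+c_1(X)\right)\in H^{1,1}(X,\mathbb{R})$ be the limiting cohomology class. If $[\omega_T]^n>0$, then the Ricci curvature does not have a uniform lower bound: there is no constant $D>0$ such that $\mathrm{Ric}(\widetilde\omega_t)\geq -D\,\widetilde\omega_t$ on $X$ for all $t\in[0,T)$.
   Context: $X$ is a closed (compact, without boundary) complex manifold with fixed complex structure, and metrics are identified with their Kähler forms. $\mathrm{Ric}(\omega)$ is the Ricci form, locally $-\sqrt{-1}\,\partial\bar\partial\log\det(g_{i\bar j})$, and the convention is $c_1(X)=[\mathrm{Ric}(\omega)]$ (so no factor $2\pi$ appears). Inequalities between real $(1,1)$-forms are pointwise, in the sense of the associated Hermitian forms. $H^{1,1}(X,\mathbb{R})=H^2(X;\mathbb{R})\cap H^{1,1}(X;\mathbb{C})$, and $\mathrm{KC}(X)\subset H^{1,1}(X,\mathbb{R})$ is the open cone of Kähler classes. Along the flow, $[\widetilde\omega_t]=-c_1(X)+e^{-t}([\omega_0]+c_1(X))$. The maximal existence time is $$T=\sup\{t \mid -c_1(X)+e^{-t}([\omega_0]+c_1(X))\in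 \mathrm{KC}(X)\}\in(0,\infty],$$ it being known that the smooth solution exists exactly on $[0,T)$. For a class $[\alpha]\in H^{1,1}(X,\mathbb{R})$, $[\alpha]^n$ denotes the top self-intersection number $\int_X\alpha^n$; thus $[\omega_T]^n=\lim_{t\to T}\int_X\widetilde\omega_t^n$, and $[\omega_T]^n>0$ means that the global volume does not tend to zero as $t\to T$.
   Formalization: The closed complex manifold X is assumed connected (the usual convention); without this the claim fails, e.g. for the disjoint union of complex projective space (Fubini–Study metric) and a flat complex torus. *)

theory Defs
  imports "HOL-Analysis.Analysis"
begin

section \<open>Smooth and holomorphic maps\<close>

text \<open>Derivatives are taken within \<open>S\<close>, so that for \<open>S = [0,T) \<times> V\<close> smoothness includes one-sided
  smoothness at the initial time. All sets \<open>S\<close> used below are open or of this form, so the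
  derivatives are unique.\<close>

primrec Ck_on :: "nat \<Rightarrow> ('v::euclidean_space \<Rightarrow> 'w::real_normed_vector) \<Rightarrow> 'v set \<Rightarrow> bool" where
  "Ck_on 0 f S = continuous_on S f"
| "Ck_on (Suc k) f S =
     (\<exists>f'. (\<forall>x\<in>S. (f has_derivative f' x) (at x within S)) \<and> (\<forall>v. Ck_on k (\<lambda>x. f' x v) S))"

definition smooth_on :: "('v::euclidean_space \<Rightarrow> 'w::real_normed_vector) \<Rightarrow> 'v set \<Rightarrow> bool" where
  "smooth_on f S \<longleftrightarrow> (\<forall>k. Ck_on k f S)"

definition holomorphic_map_on :: "(complex ^ 'n::finite \<Rightarrow> complex ^ 'n) \<Rightarrow> (complex ^ 'n) set \<Rightarrow> bool" where
  "holomorphic_map_on f S \<longleftrightarrow>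
     (\<forall>x\<in>S. \<exists>f'. (f has_derivative f') (at x) \<and> (\<forall>c v. f' (c *s v) = c *s f' v))"

section \<open>Closed complex manifolds\<close>

text \<open>The underlying space is the whole of a Hausdorff type; the complex structure is given by a
  holomorphic atlas. A chart \<open>(U, \<phi>)\<close> is relevant on its domain \<open>U\<close> only. As usual, manifolds are
  connected; second countability follows from compactness.\<close>

type_synonym ('a, 'n) chart = "'a set \<times> ('a \<Rightarrow> complex ^ 'n)"

abbreviation chart_dom :: "('a, 'n::finite) chart \<Rightarrow> 'a set" where
  "chart_dom c \<equiv> fst c"

abbreviation chart_map :: "('a, 'n::finite) chart \<Rightarrow> 'a \<Rightarrow> complex ^ 'n" where
  "chart_map c \<equiv> snd c"

definition chart_img :: "('a, 'n::finite) chart \<Rightarrow> (complex ^ 'n) set" where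
  "chart_img c = chart_map c ` chart_dom c"

definition chart_inv :: "('a, 'n::finite) chart \<Rightarrow> complex ^ 'n \<Rightarrow> 'a" where
  "chart_inv c = inv_into (chart_dom c) (chart_map c)"

definition transition :: "('a, 'n::finite) chart \<Rightarrow> ('a, 'n) chart \<Rightarrow> complex ^ 'n \<Rightarrow> complex ^ 'n" where
  "transition c c' = chart_map c' \<circ> chart_inv c"

definition is_chart :: "('a::topological_space, 'n::finite) chart \<Rightarrow> bool" where
  "is_chart c \<longleftrightarrow> open (chart_dom c) \<and> open (chart_img c) \<and>
     homeomorphism (chart_dom c) (chart_img c) (chart_map c) (chart_inv c)"

definition closed_complex_manifold :: "('a::t2_space, 'n::finite) chart set \<Rightarrow> bool" where
  "closed_complex_manifold A \<longleftrightarrow>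
     compact (UNIV :: 'a set) \<and> connected (UNIV :: 'a set) \<and>
     (\<forall>c\<in>A. is_chart c) \<and> (\<Union>c\<in>A. chart_dom c) = UNIV \<and>
     (\<forall>c\<in>A. \<forall>c'\<in>A.
        holomorphic_map_on (transition c c') (chart_map c ` (chart_dom c \<inter> chart_dom c')))"

section \<open>Real differential forms\<close>

text \<open>A form is given by its expressions in the charts of the atlas: \<open>\<alpha> c z v w\<close> is the value at the
  point with coordinate \<open>z\<close> in the chart \<open>c\<close> on the real tangent vectors \<open>v\<close>, \<open>w\<close>, the real tangent
  space being identified with \<open>complex ^ 'n\<close> by the chart. Only values at \<open>z \<in> chart_img c\<close> for
  charts \<open>c\<close> of the atlas are meaningful.\<close>

type_synonym ('a, 'n) form1 =
  "('a, 'n) chart \<Rightarrow> complex ^ 'n \<Rightarrow> complex ^ 'n \<Rightarrow> real"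

type_synonym ('a, 'n) form2 =
  "('a, 'n) chart \<Rightarrow> complex ^ 'n \<Rightarrow> complex ^ 'n \<Rightarrow> complex ^ 'n \<Rightarrow> real"

definition smooth_form1 :: "('a, 'n::finite) chart set \<Rightarrow> ('a, 'n) form1 \<Rightarrow> bool" where
  "smooth_form1 A \<eta> \<longleftrightarrow>
     (\<forall>c\<in>A. (\<forall>z\<in>chart_img c. linear (\<eta> c z)) \<and>
             (\<forall>v. smooth_on (\<lambda>z. \<eta> c z v) (chart_img c))) \<and>
     (\<forall>c\<in>A. \<forall>c'\<in>A. \<forall>p\<in>chart_dom c \<inter> chart_dom c'. \<forall>v.
        let \<tau>' = frechet_derivative (transition c c') (at (chart_map c p))
        in \<eta> c (chart_map c p) v = \<eta> c' (chart_map c' p) (\<tau>' v))"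

definition smooth_form2 :: "('a, 'n::finite) chart set \<Rightarrow> ('a, 'n) form2 \<Rightarrow> bool" where
  "smooth_form2 A \<alpha> \<longleftrightarrow>
     (\<forall>c\<in>A. (\<forall>z\<in>chart_img c. (\<forall>v. linear (\<alpha> c z v)) \<and> (\<forall>v w. \<alpha> c z w v = - \<alpha> c z v w)) \<and>
             (\<forall>v w. smooth_on (\<lambda>z. \<alpha> c z v w) (chart_img c))) \<and>
     (\<forall>c\<in>A. \<forall>c'\<in>A. \<forall>p\<in>chart_dom c \<inter> chart_dom c'. \<forall>v w.
        let \<tau>' = frechet_derivative (transition c c') (at (chart_map c p))
        in \<alpha> c (chart_map c p) v w = \<alpha> c' (chart_map c' p) (\<tau>' v) (\<tau>' w))"

definition ext_deriv1 :: "('a, 'n::finite) form1 \<Rightarrow> ('a, 'n) form2" where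
  "ext_deriv1 \<eta> c z v w =
     frechet_derivative (\<lambda>y. \<eta> c y w) (at z) v - frechet_derivative (\<lambda>y. \<eta> c y v) (at z) w"

definition ext_deriv2 ::
  "('a, 'n::finite) form2 \<Rightarrow> ('a, 'n) chart \<Rightarrow> complex ^ 'n \<Rightarrow>
     complex ^ 'n \<Rightarrow> complex ^ 'n \<Rightarrow> complex ^ 'n \<Rightarrow> real" where
  "ext_deriv2 \<alpha> c z u v w =
     frechet_derivative (\<lambda>y. \<alpha> c y v w) (at z) u
     - frechet_derivative (\<lambda>y. \<alpha> c y u w) (at z) v
     + frechet_derivative (\<lambda>y. \<alpha> c y u v) (at z) w"

definition closed_form2 :: "('a, 'n::finite) chart set \<Rightarrow> ('a, 'n) form2 \<Rightarrow> bool" where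
  "closed_form2 A \<alpha> \<longleftrightarrow> smooth_form2 A \<alpha> \<and>
     (\<forall>c\<in>A. \<forall>z\<in>chart_img c. \<forall>u v w. ext_deriv2 \<alpha> c z u v w = 0)"

definition cohomologous :: "('a, 'n::finite) chart set \<Rightarrow> ('a, 'n) form2 \<Rightarrow> ('a, 'n) form2 \<Rightarrow> bool" where
  "cohomologous A \<alpha> \<beta> \<longleftrightarrow> (\<exists>\<eta>. smooth_form1 A \<eta> \<and>
     (\<forall>c\<in>A. \<forall>z\<in>chart_img c. \<forall>v w. \<alpha> c z v w - \<beta> c z v w = ext_deriv1 \<eta> c z v w))"

section \<open>De Rham classes of degree two\<close>

type_synonym ('a, 'n) dR_class = "('a, 'n) form2 set"

definition dR_class :: "('a, 'n::finite) chart set \<Rightarrow> ('a, 'n) form2 \<Rightarrow> ('a, 'n) dR_class" where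
  "dR_class A \<alpha> = {\<beta>. closed_form2 A \<beta> \<and> cohomologous A \<beta> \<alpha>}"

definition class_add ::
  "('a, 'n::finite) chart set \<Rightarrow> ('a, 'n) dR_class \<Rightarrow> ('a, 'n) dR_class \<Rightarrow> ('a, 'n) dR_class" where
  "class_add A P Q = (\<Union>\<alpha>\<in>P. \<Union>\<beta>\<in>Q. dR_class A (\<lambda>c z v w. \<alpha> c z v w + \<beta> c z v w))"

definition class_scale ::
  "('a, 'n::finite) chart set \<Rightarrow> real \<Rightarrow> ('a, 'n) dR_class \<Rightarrow> ('a, 'n) dR_class" where
  "class_scale A r P = (\<Union>\<alpha>\<in>P. dR_class A (\<lambda>c z v w. r * \<alpha> c z v w))"

section \<open>Kaehler forms and the Ricci form\<close>

definition type11 :: "('a, 'n::finite) chart set \<Rightarrow> ('a, 'n) form2 \<Rightarrow> bool" where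
  "type11 A \<alpha> \<longleftrightarrow>
     (\<forall>c\<in>A. \<forall>z\<in>chart_img c. \<forall>v w. \<alpha> c z (\<i> *s v) (\<i> *s w) = \<alpha> c z v w)"

text \<open>For a real (1,1)-form \<open>\<alpha>\<close>, the number \<open>\<alpha>(v, \<i>v)\<close> is twice the value at \<open>v\<close> of the associated
  Hermitian form.\<close>

definition form_le :: "('a, 'n::finite) chart set \<Rightarrow> ('a, 'n) form2 \<Rightarrow> ('a, 'n) form2 \<Rightarrow> bool" where
  "form_le A \<alpha> \<beta> \<longleftrightarrow>
     (\<forall>c\<in>A. \<forall>z\<in>chart_img c. \<forall>v. \<alpha> c z v (\<i> *s v) \<le> \<beta> c z v (\<i> *s v))"

definition kaehler_form :: "('a, 'n::finite) chart set \<Rightarrow> ('a, 'n) form2 \<Rightarrow> bool" where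
  "kaehler_form A \<omega> \<longleftrightarrow> closed_form2 A \<omega> \<and> type11 A \<omega> \<and>
     (\<forall>c\<in>A. \<forall>z\<in>chart_img c. \<forall>v. v \<noteq> 0 \<longrightarrow> 0 < \<omega> c z v (\<i> *s v))"

definition kaehler_cone :: "('a, 'n::finite) chart set \<Rightarrow> ('a, 'n) dR_class set" where
  "kaehler_cone A = dR_class A ` {\<omega>. kaehler_form A \<omega>}"

definition d_z :: "'n::finite \<Rightarrow> (complex ^ 'n \<Rightarrow> complex) \<Rightarrow> complex ^ 'n \<Rightarrow> complex" where
  "d_z i f z = (frechet_derivative f (at z) (axis i 1)
                - \<i> * frechet_derivative f (at z) (axis i \<i>)) / 2"

definition d_zbar :: "'n::finite \<Rightarrow> (complex ^ 'n \<Rightarrow> complex) \<Rightarrow> complex ^ 'n \<Rightarrow> complex" where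
  "d_zbar i f z = (frechet_derivative f (at z) (axis i 1)
                   + \<i> * frechet_derivative f (at z) (axis i \<i>)) / 2"

text \<open>The two translations between a real (1,1)-form and its Hermitian coefficient matrix \<open>h\<close>, where
  the form is \<open>\<i> \<Sum> h\<^sub>i\<^sub>j dz\<^sub>i \<and> dzbar\<^sub>j\<close>.\<close>

definition hermitian_coeff ::
  "(complex ^ 'n::finite \<Rightarrow> complex ^ 'n \<Rightarrow> real) \<Rightarrow> complex ^ 'n ^ 'n" where
  "hermitian_coeff a =
     (\<chi> i j. (complex_of_real (a (axis i 1) (axis j \<i>)) - \<i> * complex_of_real (a (axis i 1) (axis j 1))) / 2)"

definition form_of_coeff ::
  "complex ^ 'n::finite ^ 'n \<Rightarrow> complex ^ 'n \<Rightarrow> complex ^ 'n \<Rightarrow> real" where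
  "form_of_coeff h v w =
     Re (\<i> * (\<Sum>i\<in>UNIV. \<Sum>j\<in>UNIV. h $ i $ j * (v $ i * cnj (w $ j) - w $ i * cnj (v $ j))))"

definition Ric :: "('a, 'n::finite) form2 \<Rightarrow> ('a, 'n) form2" where
  "Ric \<omega> c z = form_of_coeff
     (\<chi> i j. - d_z i (d_zbar j (\<lambda>y. complex_of_real (ln (Re (det (hermitian_coeff (\<omega> c y))))))) z)"

text \<open>All Ricci forms of Kaehler metrics are cohomologous, so the union is a single class.\<close>

definition c1 :: "('a, 'n::finite) chart set \<Rightarrow> ('a, 'n) dR_class" where
  "c1 A = (\<Union>\<omega>\<in>{\<omega>. kaehler_form A \<omega>}. dR_class A (Ric \<omega>))"

section \<open>Integration and the top self-intersection number\<close>

definition partition_of_unity ::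
  "('a::topological_space, 'n::finite) chart set \<Rightarrow> ('a, 'n) chart set \<Rightarrow> (('a, 'n) chart \<Rightarrow> 'a \<Rightarrow> real) \<Rightarrow> bool"
  where
  "partition_of_unity A F \<rho> \<longleftrightarrow> finite F \<and> F \<subseteq> A \<and>
     (\<forall>c\<in>F. (\<forall>p. 0 \<le> \<rho> c p) \<and> closure {p. \<rho> c p \<noteq> 0} \<subseteq> chart_dom c \<and>
             (\<forall>c'\<in>A. smooth_on (\<rho> c \<circ> chart_inv c') (chart_img c'))) \<and>
     (\<forall>p. (\<Sum>c\<in>F. \<rho> c p) = 1)"

text \<open>A form \<open>\<theta>\<close> of top degree is given in a chart by its value on the oriented real basis
  \<open>e\<^sub>1, \<i>e\<^sub>1, \<dots>, e\<^sub>n, \<i>e\<^sub>n\<close>, that is, by its density with respect to Lebesgue measure. The integral does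
  not depend on the partition of unity.\<close>

definition top_integral ::
  "('a::topological_space, 'n::finite) chart set \<Rightarrow> (('a, 'n) chart \<Rightarrow> complex ^ 'n \<Rightarrow> real) \<Rightarrow> real" where
  "top_integral A \<theta> = (THE I. \<exists>F \<rho>. partition_of_unity A F \<rho> \<and>
     I = (\<Sum>c\<in>F. integral (chart_img c) (\<lambda>z. \<rho> c (chart_inv c z) * \<theta> c z)))"

definition real_basis :: "'n::finite \<times> bool \<Rightarrow> complex ^ 'n" where
  "real_basis k = axis (fst k) (if snd k then \<i> else 1)"

text \<open>The value of \<open>a \<and> \<dots> \<and> a\<close> (\<open>n\<close> factors) on the oriented real basis: the antisymmetrisation
  of the product, divided by \<open>(2!)\<^sup>n\<close>. Since the basis vectors come in pairs, no ordering of the index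
  type \<open>'n\<close> is needed.\<close>

definition wedge_power_top :: "(complex ^ 'n::finite \<Rightarrow> complex ^ 'n \<Rightarrow> real) \<Rightarrow> real" where
  "wedge_power_top a =
     (\<Sum>\<sigma> | \<sigma> permutes (UNIV :: ('n \<times> bool) set).
        of_int (sign \<sigma>) * (\<Prod>j\<in>UNIV. a (real_basis (\<sigma> (j, False))) (real_basis (\<sigma> (j, True)))))
     / 2 ^ CARD('n)"

text \<open>The integral is the same for all forms in a class, by Stokes' theorem.\<close>

definition top_self_intersection ::
  "('a::topological_space, 'n::finite) chart set \<Rightarrow> ('a, 'n) dR_class \<Rightarrow> real" where
  "top_self_intersection A P =
     the_elem ((\<lambda>\<alpha>. top_integral A (\<lambda>c z. wedge_power_top (\<alpha> c z))) ` P)"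

section \<open>The Kaehler-Ricci flow\<close>

definition flow_class :: "('a, 'n::finite) chart set \<Rightarrow> ('a, 'n) form2 \<Rightarrow> real \<Rightarrow> ('a, 'n) dR_class" where
  "flow_class A \<omega>\<^sub>0 t =
     class_add A (class_scale A (-1) (c1 A))
       (class_scale A (exp (- t)) (class_add A (dR_class A \<omega>\<^sub>0) (c1 A)))"

definition max_existence_time :: "('a, 'n::finite) chart set \<Rightarrow> ('a, 'n) form2 \<Rightarrow> ereal" where
  "max_existence_time A \<omega>\<^sub>0 = Sup (ereal ` {t. flow_class A \<omega>\<^sub>0 t \<in> kaehler_cone A})"

definition time_interval :: "ereal \<Rightarrow> real set" where
  "time_interval T = {t. 0 \<le> t \<and> ereal t < T}"

definition krf_solution ::
  "('a, 'n::finite) chart set \<Rightarrow> ('a, 'n) form2 \<Rightarrow> ereal \<Rightarrow> (real \<Rightarrow> ('a, 'n) form2) \<Rightarrow> bool" where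
  "krf_solution A \<omega>\<^sub>0 T \<omega> \<longleftrightarrow>
     (\<forall>t\<in>time_interval T. kaehler_form A (\<omega> t)) \<and>
     (\<forall>c\<in>A. \<forall>v w. smooth_on (\<lambda>(t, z). \<omega> t c z v w) (time_interval T \<times> chart_img c)) \<and>
     (\<forall>c\<in>A. \<forall>z\<in>chart_img c. \<omega> 0 c z = \<omega>\<^sub>0 c z) \<and>
     (\<forall>t\<in>time_interval T. \<forall>c\<in>A. \<forall>z\<in>chart_img c. \<forall>v w.
        ((\<lambda>s. \<omega> s c z v w) has_real_derivative (- Ric (\<omega> t) c z v w - \<omega> t c z v w))
          (at t within time_interval T))"

definition maximal_krf_solution ::
  "('a, 'n::finite) chart set \<Rightarrow> ('a, 'n) form2 \<Rightarrow> ereal \<Rightarrow> (real \<Rightarrow> ('a, 'n) form2) \<Rightarrow> bool" where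
  "maximal_krf_solution A \<omega>\<^sub>0 T \<omega> \<longleftrightarrow> krf_solution A \<omega>\<^sub>0 T \<omega> \<and>
     \<not> (\<exists>T' \<omega>'. T < T' \<and> krf_solution A \<omega>\<^sub>0 T' \<omega>' \<and>
          (\<forall>t\<in>time_interval T. \<forall>c\<in>A. \<forall>z\<in>chart_img c. \<omega>' t c z = \<omega> t c z))"

end

theory Submission
  imports Defs "HOL-Complex_Analysis.Complex_Analysis"
begin

text \<open>Suppose \<open>Ric \<omega>\<^sub>t \<ge> -D \<omega>\<^sub>t\<close>. The flow equation then gives \<open>\<omega>\<^sub>t \<le> exp (D T) \<omega>\<^sub>0\<close>. The logarithm \<open>v\<^sub>t\<close>
  of the ratio of the volume forms of \<open>\<omega>\<^sub>t\<close> and \<open>\<omega>\<^sub>0\<close> satisfies \<open>dd\<^sup>c v\<^sub>t = Ric \<omega>\<^sub>0 - Ric \<omega>\<^sub>t\<close>, so its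
  Laplacian in a chart is bounded above, and a weak Harnack inequality bounds the integral of
  \<open>v\<^sub>t - min v\<^sub>t\<close> uniformly in \<open>t\<close>. If \<open>min v\<^sub>t\<close> were very negative, then so would be \<open>v\<^sub>t\<close> off a small set,
  and the volume of \<open>\<omega>\<^sub>t\<close> would be small; but by Stokes' theorem the volume tends to \<open>[\<omega>\<^sub>T]\<^sup>n > 0\<close>.
  Hence the volume form of \<open>\<omega>\<^sub>t\<close> and, because of the upper bound, \<open>\<omega>\<^sub>t\<close> itself are bounded below
  uniformly for \<open>t\<close> near \<open>T\<close>. For \<open>s < T < t\<close> close to \<open>T\<close> the form
  \<open>\<omega>\<^sub>s + (exp (-t) - exp (-s)) (\<omega>\<^sub>0 + Ric \<omega>\<^sub>0)\<close> is therefore still positive. It lies in the class of the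
  flow at time \<open>t\<close>, which contradicts the choice of \<open>T\<close> as a supremum.\<close>

section \<open>Calculus of smooth maps\<close>

text \<open>The metrics \<open>\<omega> t\<close> have no known limit at \<open>T\<close>, so every
  constant must be independent of \<open>t\<close>. The information at the limit is cohomological:
  the volume passes to the limit because it is a polynomial in \<open>exp (- t)\<close>. An upper
  bound for the metric and a lower bound for its determinant together bound the smallest eigenvalue,
  which is why control of the volume form suffices. The Harnack step is done in charts with the flat
  Laplacian: dd^c v is bounded above as a (1,1)-form, hence so is its trace in coordinates, and no
  analysis with respect to the varying metric is required. What it yields is local, so connectedness
  is used to pass from the minimum point to all other charts. Since \<open>T\<close> is a supremum
  over classes, a single Kaehler form in one class beyond \<open>T\<close> refutes it, and no
  solution of the flow past \<open>T\<close> has to be constructed. The same perturbation at time 0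
  gives \<open>T > 0\<close>, without which there would be no times near \<open>T\<close> to work
  at.\<close>

lemma Ck_on_SucI:
  assumes "\<And>x. x \<in> S \<Longrightarrow> (f has_derivative f' x) (at x within S)"
    and "\<And>v. Ck_on k (\<lambda>x. f' x v) S"
  shows "Ck_on (Suc k) f S"
  using assms by auto

lemma Ck_on_SucE:
  assumes "Ck_on (Suc k) f S"
  obtains f' where "\<And>x. x \<in> S \<Longrightarrow> (f has_derivative f' x) (at x within S)"
    and "\<And>v. Ck_on k (\<lambda>x. f' x v) S"
  using assms by auto

lemma Ck_on_cong_imp:
  "(\<And>x. x \<in> S \<Longrightarrow> f x = g x) \<Longrightarrow> Ck_on k f S \<Longrightarrow> Ck_on k g S"
proof (induction k arbitrary: f g)
  case 0
  then show ?case by (simp cong: continuous_on_cong)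
next
  case (Suc k)
  from Suc.prems(2) obtain f' where f': "\<And>x. x\<in>S \<Longrightarrow> (f has_derivative f' x) (at x within S)"
    "\<And>v. Ck_on k (\<lambda>x. f' x v) S" by auto
  have "(g has_derivative f' x) (at x within S)" if "x \<in> S" for x
    using has_derivative_transform[OF that _ f'(1)[OF that], of g] Suc.prems(1) by simp
  with f'(2) show ?case by auto
qed

lemma Ck_on_cong:
  "(\<And>x. x \<in> S \<Longrightarrow> f x = g x) \<Longrightarrow> Ck_on k f S \<longleftrightarrow> Ck_on k g S"
  using Ck_on_cong_imp[of S f g k] Ck_on_cong_imp[of S g f k] by auto

lemma Ck_on_subset: "Ck_on k f S \<Longrightarrow> S' \<subseteq> S \<Longrightarrow> Ck_on k f S'"
proof (induction k arbitrary: f)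
  case 0
  then show ?case by (auto intro: continuous_on_subset)
next
  case (Suc k)
  from Suc.prems(1) obtain f' where f': "\<And>x. x\<in>S \<Longrightarrow> (f has_derivative f' x) (at x within S)"
    "\<And>v. Ck_on k (\<lambda>x. f' x v) S" by auto
  have "(f has_derivative f' x) (at x within S')" if "x \<in> S'" for x
    using has_derivative_subset[OF f'(1)] that Suc.prems(2) by auto
  then show ?case using Suc.IH[OF f'(2) Suc.prems(2)] by (rule Ck_on_SucI)
qed

lemma Ck_on_Suc_imp_continuous: "Ck_on (Suc k) f S \<Longrightarrow> continuous_on S f"
  by (auto simp: continuous_on_eq_continuous_within intro: has_derivative_continuous)

lemma Ck_on_Suc_imp: "Ck_on (Suc k) f S \<Longrightarrow> Ck_on k f S"
proof (induction k arbitrary: f)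
  case 0
  then show ?case using Ck_on_Suc_imp_continuous[of 0 f S] by simp
next
  case (Suc k)
  from Suc.prems obtain f' where f': "\<And>x. x\<in>S \<Longrightarrow> (f has_derivative f' x) (at x within S)"
    "\<And>v. Ck_on (Suc k) (\<lambda>x. f' x v) S" by (subst (asm) Ck_on.simps) auto
  with Suc.IH have "\<And>v. Ck_on k (\<lambda>x. f' x v) S" by blast
  with f'(1) show ?case by auto
qed

lemma Ck_on_imp_continuous: "Ck_on k f S \<Longrightarrow> continuous_on S f"
  by (cases k) (auto dest: Ck_on_Suc_imp_continuous simp del: Ck_on.simps(2))

lemma Ck_on_const: "Ck_on k (\<lambda>x. c) S"
proof (induction k arbitrary: c)
  case (Suc k)
  have "((\<lambda>x. c) has_derivative (\<lambda>v. 0)) (at x within S)" for x by simp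
  with Suc show ?case by (auto intro!: exI[of _ "\<lambda>_ _. 0"])
qed simp

lemma Ck_on_linear_comp:
  assumes "bounded_linear L"
  shows "Ck_on k f S \<Longrightarrow> Ck_on k (\<lambda>x. L (f x)) S"
proof (induction k arbitrary: f)
  case 0
  then show ?case using assms by (auto intro: linear_continuous_on_compose bounded_linear.continuous_on)
next
  case (Suc k)
  from Suc.prems obtain f' where f': "\<And>x. x\<in>S \<Longrightarrow> (f has_derivative f' x) (at x within S)"
    "\<And>v. Ck_on k (\<lambda>x. f' x v) S" by auto
  have "((\<lambda>x. L (f x)) has_derivative (\<lambda>v. L (f' x v))) (at x within S)" if "x \<in> S" for x
    using bounded_linear.has_derivative[OF assms f'(1)[OF that]] .
  with f'(2) Suc.IH show ?case by (auto intro!: exI[of _ "\<lambda>x v. L (f' x v)"])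
qed

lemma Ck_on_add: "Ck_on k f S \<Longrightarrow> Ck_on k g S \<Longrightarrow> Ck_on k (\<lambda>x. f x + g x) S"
proof (induction k arbitrary: f g)
  case 0
  then show ?case by (auto intro: continuous_intros)
next
  case (Suc k)
  obtain f' where 1: "\<And>x. x\<in>S \<Longrightarrow> (f has_derivative f' x) (at x within S)"
    "\<And>v. Ck_on k (\<lambda>x. f' x v) S" using Ck_on_SucE[OF Suc.prems(1)] by metis
  obtain g' where 2: "\<And>x. x\<in>S \<Longrightarrow> (g has_derivative g' x) (at x within S)"
    "\<And>v. Ck_on k (\<lambda>x. g' x v) S" using Ck_on_SucE[OF Suc.prems(2)] by metis
  show ?case
    by (rule Ck_on_SucI[of S _ "\<lambda>x v. f' x v + g' x v"])
      (use 1 2 Suc.IH in \<open>auto intro!: has_derivative_add\<close>)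
qed

lemma Ck_on_bilinear:
  assumes "bounded_bilinear pr"
  shows "Ck_on k f S \<Longrightarrow> Ck_on k g S \<Longrightarrow> Ck_on k (\<lambda>x. pr (f x) (g x)) S"
proof (induction k arbitrary: f g)
  case 0
  then show ?case using bounded_bilinear.continuous_on[OF assms, of S f g] by simp
next
  case (Suc k)
  obtain f' where 1: "\<And>x. x\<in>S \<Longrightarrow> (f has_derivative f' x) (at x within S)"
    "\<And>v. Ck_on k (\<lambda>x. f' x v) S" using Ck_on_SucE[OF Suc.prems(1)] by metis
  obtain g' where 2: "\<And>x. x\<in>S \<Longrightarrow> (g has_derivative g' x) (at x within S)"
    "\<And>v. Ck_on k (\<lambda>x. g' x v) S" using Ck_on_SucE[OF Suc.prems(2)] by metis
  show ?case
  proof (rule Ck_on_SucI[of S _ "\<lambda>x v. pr (f x) (g' x v) + pr (f' x v) (g x)"])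
    show "Ck_on k (\<lambda>x. pr (f x) (g' x v) + pr (f' x v) (g x)) S" for v
      by (rule Ck_on_add[OF Suc.IH[OF Ck_on_Suc_imp[OF Suc.prems(1)] 2(2)]
            Suc.IH[OF 1(2) Ck_on_Suc_imp[OF Suc.prems(2)]]])
  qed (rule bounded_bilinear.FDERIV[OF assms 1(1) 2(1)])
qed

lemma Ck_on_sum: "(\<And>i. i \<in> I \<Longrightarrow> Ck_on k (f i) S) \<Longrightarrow> Ck_on k (\<lambda>x. \<Sum>i\<in>I. f i x) S"
  by (induction I rule: infinite_finite_induct) (auto intro: Ck_on_const Ck_on_add)

lemma Ck_on_bounded_linear: "bounded_linear L \<Longrightarrow> Ck_on k L S"
proof (cases k)
  case 0
  then show "bounded_linear L \<Longrightarrow> ?thesis" by (simp add: linear_continuous_on)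
next
  case (Suc m)
  assume "bounded_linear L"
  with Suc show ?thesis
    by (auto intro!: exI[of _ "\<lambda>x. L"] Ck_on_const bounded_linear_imp_has_derivative)
qed

lemma Ck_on_compose:
  fixes f :: "'u::euclidean_space \<Rightarrow> 'v::euclidean_space" and g :: "'v \<Rightarrow> 'w::real_normed_vector"
  shows "Ck_on k g T \<Longrightarrow> Ck_on k f S \<Longrightarrow> f ` S \<subseteq> T \<Longrightarrow> Ck_on k (\<lambda>x. g (f x)) S"
proof (induction k arbitrary: g)
  case 0
  then show ?case by (auto intro: continuous_on_compose2)
next
  case (Suc k)
  from Suc.prems(1) obtain g' where g': "\<And>x. x\<in>T \<Longrightarrow> (g has_derivative g' x) (at x within T)"
    "\<And>v. Ck_on k (\<lambda>x. g' x v) T" by auto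
  from Suc.prems(2) obtain f' where f': "\<And>x. x\<in>S \<Longrightarrow> (f has_derivative f' x) (at x within S)"
    "\<And>v. Ck_on k (\<lambda>x. f' x v) S" by auto
  have d: "((\<lambda>x. g (f x)) has_derivative (\<lambda>v. g' (f x) (f' x v))) (at x within S)" if "x \<in> S" for x
    using has_derivative_in_compose2[OF g'(1) Suc.prems(3) that f'(1)[OF that]] .
  \<comment> \<open>The direction \<open>f' x v\<close> varies with \<open>x\<close>, while the
    induction hypothesis concerns a fixed direction; the basis expansion separates the two.\<close>
  have eq: "g' (f x) (f' x v) = (\<Sum>b\<in>Basis. (f' x v \<bullet> b) *\<^sub>R g' (f x) b)" if "x \<in> S" for x v
  proof -
    have "linear (g' (f x))" using g'(1)[of "f x"] that Suc.prems(3) has_derivative_linear by blast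
    then have "g' (f x) (\<Sum>b\<in>Basis. (f' x v \<bullet> b) *\<^sub>R b) = (\<Sum>b\<in>Basis. (f' x v \<bullet> b) *\<^sub>R g' (f x) b)"
      by (simp add: linear_sum linear_cmul)
    then show ?thesis by (simp add: euclidean_representation)
  qed
  have "Ck_on k (\<lambda>x. g' (f x) (f' x v)) S" for v
  proof (rule Ck_on_cong_imp[OF eq[symmetric]])
    have 1: "Ck_on k (\<lambda>x. f' x v \<bullet> b) S" for b
      using Ck_on_linear_comp[OF bounded_linear_inner_left f'(2)] .
    have 2: "Ck_on k (\<lambda>x. g' (f x) b) S" for b
      using Suc.IH[OF g'(2) Ck_on_Suc_imp[OF Suc.prems(2)] Suc.prems(3)] .
    show "Ck_on k (\<lambda>x. \<Sum>b\<in>Basis. (f' x v \<bullet> b) *\<^sub>R g' (f x) b) S"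
      by (rule Ck_on_sum, rule Ck_on_bilinear[OF bounded_bilinear_scaleR 1 2])
  qed
  with d show ?case by (auto intro!: exI[of _ "\<lambda>x v. g' (f x) (f' x v)"])
qed

lemma smooth_onI: "(\<And>k. Ck_on k f S) \<Longrightarrow> smooth_on f S"
  by (simp add: smooth_on_def)

lemma smooth_onD: "smooth_on f S \<Longrightarrow> Ck_on k f S"
  by (simp add: smooth_on_def)

lemma smooth_on_cong: "(\<And>x. x \<in> S \<Longrightarrow> f x = g x) \<Longrightarrow> smooth_on f S \<longleftrightarrow> smooth_on g S"
  using Ck_on_cong unfolding smooth_on_def by blast

lemma smooth_on_subset: "smooth_on f S \<Longrightarrow> S' \<subseteq> S \<Longrightarrow> smooth_on f S'"
  by (meson Ck_on_subset smooth_on_def)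

lemma smooth_on_continuous: "smooth_on f S \<Longrightarrow> continuous_on S f"
  using Ck_on_imp_continuous smooth_onD by blast

lemma smooth_on_const [intro, simp]: "smooth_on (\<lambda>x. c) S"
  by (simp add: smooth_on_def Ck_on_const)

lemma smooth_on_linear_comp: "bounded_linear L \<Longrightarrow> smooth_on f S \<Longrightarrow> smooth_on (\<lambda>x. L (f x)) S"
  by (simp add: smooth_on_def Ck_on_linear_comp)

lemma smooth_on_bounded_linear: "bounded_linear L \<Longrightarrow> smooth_on L S"
  by (simp add: smooth_on_def Ck_on_bounded_linear)

lemma smooth_on_add [intro]: "smooth_on f S \<Longrightarrow> smooth_on g S \<Longrightarrow> smooth_on (\<lambda>x. f x + g x) S"
  by (simp add: smooth_on_def Ck_on_add)

lemma smooth_on_bilinear: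
  "bounded_bilinear pr \<Longrightarrow> smooth_on f S \<Longrightarrow> smooth_on g S \<Longrightarrow> smooth_on (\<lambda>x. pr (f x) (g x)) S"
  by (simp add: smooth_on_def Ck_on_bilinear)

lemma smooth_on_mult [intro]:
  fixes f g :: "_ \<Rightarrow> 'x::real_normed_algebra"
  shows "smooth_on f S \<Longrightarrow> smooth_on g S \<Longrightarrow> smooth_on (\<lambda>x. f x * g x) S"
  by (rule smooth_on_bilinear[OF bounded_bilinear_mult])

lemma smooth_on_minus [intro]: "smooth_on f S \<Longrightarrow> smooth_on (\<lambda>x. - f x) S"
  by (rule smooth_on_linear_comp[OF bounded_linear_minus[OF bounded_linear_ident]])

lemma smooth_on_diff [intro]: "smooth_on f S \<Longrightarrow> smooth_on g S \<Longrightarrow> smooth_on (\<lambda>x. f x - g x) S"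
  using smooth_on_add[of f S "\<lambda>x. - g x"] smooth_on_minus[of g S] by simp

lemma smooth_on_sum [intro]:
  "(\<And>i. i \<in> I \<Longrightarrow> smooth_on (f i) S) \<Longrightarrow> smooth_on (\<lambda>x. \<Sum>i\<in>I. f i x) S"
  by (simp add: smooth_on_def Ck_on_sum)

lemma smooth_on_prod [intro]:
  fixes f :: "_ \<Rightarrow> _ \<Rightarrow> 'x::{real_normed_algebra_1,comm_ring_1}"
  shows "(\<And>i. i \<in> I \<Longrightarrow> smooth_on (f i) S) \<Longrightarrow> smooth_on (\<lambda>x. \<Prod>i\<in>I. f i x) S"
  by (induction I rule: infinite_finite_induct) auto

lemma smooth_on_compose:
  "smooth_on g T \<Longrightarrow> smooth_on f S \<Longrightarrow> f ` S \<subseteq> T \<Longrightarrow> smooth_on (\<lambda>x. g (f x)) S"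
  unfolding smooth_on_def by (blast intro: Ck_on_compose)

lemma smooth_on_Pair:
  assumes "smooth_on f S" "smooth_on g S"
  shows "smooth_on (\<lambda>x. (f x, g x)) S"
proof -
  have "smooth_on (\<lambda>x. (f x, 0) + (0, g x)) S"
    by (intro smooth_on_add smooth_on_linear_comp[of "\<lambda>y. (y, 0)"] smooth_on_linear_comp[of "\<lambda>y. (0, y)"] assms)
      (auto intro: bounded_linear_Pair bounded_linear_ident bounded_linear_zero)
  then show ?thesis by simp
qed

lemma smooth_onE:
  assumes "smooth_on f S"
  obtains f' where "\<And>x. x \<in> S \<Longrightarrow> (f has_derivative f' x) (at x within S)"
    and "\<And>v. Ck_on k (\<lambda>x. f' x v) S"
  using smooth_onD[OF assms, of "Suc k"] that by auto

lemma smooth_on_has_derivative: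
  assumes "smooth_on f S" "open S" "x \<in> S"
  shows "(f has_derivative frechet_derivative f (at x)) (at x)"
proof -
  obtain f' where "(f has_derivative f' x) (at x within S)" using smooth_onE[OF assms(1)] assms(3) by metis
  then have "f differentiable (at x)" using assms at_within_open differentiable_def by metis
  then show ?thesis by (simp add: frechet_derivative_works)
qed

lemma smooth_on_frechet_derivative:
  assumes "smooth_on f S" "open S"
  shows "smooth_on (\<lambda>x. frechet_derivative f (at x) v) S"
proof (rule smooth_onI)
  fix k
  obtain f' where f': "\<And>x. x \<in> S \<Longrightarrow> (f has_derivative f' x) (at x within S)"
    "\<And>v. Ck_on k (\<lambda>x. f' x v) S" using smooth_onE[OF assms(1)] by metis
  have "f' x = frechet_derivative f (at x)" if "x \<in> S" for x
    using f'(1)[OF that] at_within_open[OF that assms(2)] frechet_derivative_at by metis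
  then show "Ck_on k (\<lambda>x. frechet_derivative f (at x) v) S"
    using Ck_on_cong_imp[OF _ f'(2)[of v], of "\<lambda>x. frechet_derivative f (at x) v"] by simp
qed

text \<open>On an open set the local derivatives all coincide with the Frechet derivative, so they
  patch together. The lemma serves functions given by different formulas near different points, such
  as a bump function seen in a foreign chart.\<close>

lemma Ck_on_locally:
  assumes "open S" "\<And>x. x \<in> S \<Longrightarrow> \<exists>U. open U \<and> x \<in> U \<and> Ck_on k f (U \<inter> S)"
  shows "Ck_on k f S"
  using assms(2)
proof (induction k arbitrary: f)
  case 0
  have "\<exists>U. open U \<and> x \<in> U \<and> continuous_on (U \<inter> S) f" if "x \<in> S" for x
    using 0[OF that] by simp
  then have "isCont f x" if "x \<in> S" for x
    using that assms(1) by (metis IntI continuous_on_eq_continuous_at open_Int)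
  then show ?case using assms(1) by (simp add: continuous_on_eq_continuous_at)
next
  case (Suc k)
  have *: "\<exists>U. open U \<and> x \<in> U \<and> (\<forall>y\<in>U\<inter>S. f differentiable (at y)) \<and>
      (\<forall>v. Ck_on k (\<lambda>x. frechet_derivative f (at x) v) (U \<inter> S))" if "x \<in> S" for x
  proof -
    from Suc.prems[OF that] obtain U f' where U: "open U" "x \<in> U"
      and f': "\<And>x. x\<in>U\<inter>S \<Longrightarrow> (f has_derivative f' x) (at x within U\<inter>S)"
      "\<And>v. Ck_on k (\<lambda>x. f' x v) (U\<inter>S)" by auto
    have d: "(f has_derivative f' y) (at y)" if "y \<in> U \<inter> S" for y
      using f'(1)[OF that] at_within_open[OF that] U(1) assms(1) by (metis open_Int)
    then have "f' y = frechet_derivative f (at y)" if "y \<in> U \<inter> S" for y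
      using that frechet_derivative_at by blast
    then have "Ck_on k (\<lambda>x. frechet_derivative f (at x) v) (U \<inter> S)" for v
      using Ck_on_cong_imp[OF _ f'(2)[of v], of "\<lambda>x. frechet_derivative f (at x) v"] by simp
    with d U show ?thesis unfolding differentiable_def by blast
  qed
  have "(f has_derivative frechet_derivative f (at x)) (at x within S)" if "x \<in> S" for x
    using *[OF that] that by (meson IntI frechet_derivative_works has_derivative_at_withinI)
  moreover have "Ck_on k (\<lambda>x. frechet_derivative f (at x) v) S" for v
    using * by (intro Suc.IH) blast
  ultimately show ?case by (rule Ck_on_SucI)
qed

lemma smooth_on_locally:
  assumes "open S" "\<And>x. x \<in> S \<Longrightarrow> \<exists>U. open U \<and> x \<in> U \<and> smooth_on f (U \<inter> S)"
  shows "smooth_on f S"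
  using assms unfolding smooth_on_def by (meson Ck_on_locally)

section \<open>Smooth elementary functions and a flat function\<close>

lemma smooth_on_id: "smooth_on (\<lambda>x. x) S"
  by (rule smooth_on_bounded_linear[OF bounded_linear_ident])

lemma smooth_on_inverse:
  "smooth_on (inverse :: real \<Rightarrow> real) (- {0})"
proof (rule smooth_onI)
  fix k show "Ck_on k (inverse :: real \<Rightarrow> real) (- {0})"
  proof (induction k)
    case 0
    then show ?case by (auto intro: continuous_intros)
  next
    case (Suc k)
    have "(inverse has_derivative (\<lambda>v. - (inverse x * v * inverse x))) (at x within - {0})" if "x \<in> - {0}" for x :: real
      using that by (intro has_derivative_inverse') auto
    moreover have "Ck_on k (\<lambda>x. - (inverse x * v * inverse x)) (- {0})" for v :: real
      by (intro Ck_on_linear_comp[OF bounded_linear_minus[OF bounded_linear_ident]]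
        Ck_on_bilinear[OF bounded_bilinear_mult] Suc Ck_on_const)
    ultimately show ?case by (auto intro!: exI[of _ "\<lambda>x v. - (inverse x * v * inverse x)"])
  qed
qed

lemma smooth_on_divide:
  fixes f g :: "_ \<Rightarrow> real"
  assumes "smooth_on f S" "smooth_on g S" "\<And>x. x \<in> S \<Longrightarrow> g x \<noteq> 0"
  shows "smooth_on (\<lambda>x. f x / g x) S"
  unfolding divide_inverse
  using assms by (intro smooth_on_mult smooth_on_compose[OF smooth_on_inverse]) auto

lemma smooth_on_ln: "smooth_on ln {0::real<..}"
proof (rule smooth_onI)
  fix k show "Ck_on k ln {0::real<..}"
  proof (cases k)
    case 0
    then show ?thesis by (auto intro: continuous_intros)
  next
    case (Suc m)
    have "(ln has_derivative (\<lambda>v. v * inverse x)) (at x within {0<..})" if "x \<in> {0<..}" for x :: real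
      using that has_derivative_ln[OF _ has_derivative_ident, of x "{0<..}"] by (simp add: divide_inverse)
    moreover have "Ck_on m (\<lambda>x. v * inverse x) {0<..}" for v :: real
      by (intro Ck_on_bilinear[OF bounded_bilinear_mult] Ck_on_const
          Ck_on_subset[OF smooth_onD[OF smooth_on_inverse]]) auto
    ultimately show ?thesis unfolding Suc by (auto intro!: exI[of _ "\<lambda>x v. v * inverse x"])
  qed
qed

text \<open>The functions x^(-m) exp(-1/x), continued by 0. The power is carried along because
  differentiation stays within this family: a derivative is a combination of two members with larger
  \<open>m\<close>, so smoothness follows by an induction over all \<open>m\<close> at once.\<close>

definition exp_bump :: "nat \<Rightarrow> real \<Rightarrow> real" where
  "exp_bump m x = (if x \<le> 0 then 0 else inverse x ^ m * exp (- inverse x))"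

lemma exp_bump_tendsto: "(exp_bump m \<longlongrightarrow> 0) (at 0)"
proof -
  have "((\<lambda>x::real. inverse x ^ m * exp (- inverse x)) \<longlongrightarrow> 0) (at_right 0)"
    by real_asymp
  then have "(exp_bump m \<longlongrightarrow> 0) (at_right 0)"
    by (rule Lim_transform_eventually) (auto simp: exp_bump_def eventually_at_filter)
  moreover have "(exp_bump m \<longlongrightarrow> 0) (at_left 0)"
    by (rule Lim_transform_eventually[OF tendsto_const]) (auto simp: exp_bump_def eventually_at_filter)
  ultimately show ?thesis by (simp add: filterlim_split_at)
qed

lemma exp_bump_has_derivative:
  "(exp_bump m has_real_derivative (exp_bump (m + 2) x - real m * exp_bump (Suc m) x)) (at x)"
proof -
  consider "x < 0" | "x = 0" | "x > 0" by linarith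
  then show ?thesis
  proof cases
    case 1
    have "((\<lambda>_. 0::real) has_real_derivative 0) (at x)" by simp
    then have "(exp_bump m has_real_derivative 0) (at x)"
      by (rule has_field_derivative_transform_within_open[of _ _ _ "{..<0}"]) (use 1 in \<open>auto simp: exp_bump_def\<close>)
    then show ?thesis using 1 by (simp add: exp_bump_def)
  next
    case 2
    \<comment> \<open>At 0 the difference quotient of \<open>exp_bump m\<close> is
      \<open>exp_bump (Suc m)\<close>.\<close>
    have "((\<lambda>h. (exp_bump m (0 + h) - exp_bump m 0) / h) \<longlongrightarrow> 0) (at 0)"
      by (rule Lim_transform_eventually[OF exp_bump_tendsto[of "Suc m"]])
        (auto simp: exp_bump_def eventually_at_filter divide_inverse mult_ac)
    then show ?thesis using 2 by (simp add: exp_bump_def DERIV_def)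
  next
    case 3
    have "((\<lambda>x. inverse x ^ m * exp (- inverse x)) has_real_derivative (exp_bump (m + 2) x - real m * exp_bump (Suc m) x)) (at x)"
    proof -
      have "((\<lambda>x. inverse x ^ m * exp (- inverse x)) has_real_derivative
          real m * (- (inverse x ^ Suc (Suc 0))) * inverse x ^ (m - Suc 0) * exp (- inverse x)
          + exp (- inverse x) * inverse x ^ Suc (Suc 0) * inverse x ^ m) (at x)"
        using 3 by (auto intro!: derivative_eq_intros)
      moreover have *: "real m * (- (inverse x ^ Suc (Suc 0))) * inverse x ^ (m - Suc 0) = - (real m * inverse x ^ Suc m)"
        by (cases m) auto
      moreover have "exp_bump (m + 2) x - real m * exp_bump (Suc m) x
        = - (real m * inverse x ^ Suc m) * exp (- inverse x) + exp (- inverse x) * inverse x ^ Suc (Suc 0) * inverse x ^ m"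
        using 3 by (simp add: exp_bump_def algebra_simps)
      ultimately show ?thesis by (simp only: *)
    qed
    then show ?thesis
      by (rule has_field_derivative_transform_within_open[of _ _ _ "{0<..}"]) (use 3 in \<open>auto simp: exp_bump_def\<close>)
  qed
qed

lemma smooth_on_exp_bump: "smooth_on (exp_bump m) S"
proof (rule smooth_onI)
  fix k show "Ck_on k (exp_bump m) S"
  proof (induction k arbitrary: m)
    case 0
    then show ?case using exp_bump_has_derivative[THEN DERIV_isCont]
      by (auto intro: continuous_at_imp_continuous_on)
  next
    case (Suc k)
    show ?case
    proof (rule Ck_on_SucI[of S _ "\<lambda>x v. (exp_bump (m + 2) x + (- real m) * exp_bump (Suc m) x) * v"])
      show "Ck_on k (\<lambda>x. (exp_bump (m + 2) x + (- real m) * exp_bump (Suc m) x) * v) S" for v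
        by (rule Ck_on_bilinear[OF bounded_bilinear_mult Ck_on_add[OF Suc
          Ck_on_bilinear[OF bounded_bilinear_mult Ck_on_const Suc]] Ck_on_const])
      show "(exp_bump m has_derivative (\<lambda>v. (exp_bump (m + 2) x + (- real m) * exp_bump (Suc m) x) * v)) (at x within S)" for x
        using has_derivative_at_withinI[OF exp_bump_has_derivative[unfolded has_field_derivative_def, of m x]] by simp
    qed
  qed
qed

lemma exp_bump_nonneg: "0 \<le> exp_bump m x" by (simp add: exp_bump_def)

lemma exp_bump_pos_iff: "0 < exp_bump m x \<longleftrightarrow> 0 < x" by (simp add: exp_bump_def)

text \<open>The second difference \<open>u(z+hv+hw) - u(z+hv) - u(z+hw) + u(z)\<close> is symmetric in \<open>v\<close> and \<open>w\<close>
  and, by the mean value theorem, equals \<open>h\<^sup>2\<close> times either mixed derivative up to a small error.\<close>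

lemma second_difference_bound:
  fixes u :: "'v::real_normed_vector \<Rightarrow> real"
  assumes d: "\<And>x. x \<in> ball z r \<Longrightarrow> (u has_derivative u' x) (at x)" and "r > 0"
    and A: "((\<lambda>x. u' x v) has_derivative A) (at z)" and "e > 0"
  shows "\<forall>\<^sub>F h in at_right 0. \<bar>u (z + h *\<^sub>R v + h *\<^sub>R w) - u (z + h *\<^sub>R v) - u (z + h *\<^sub>R w) + u z - h\<^sup>2 * A w\<bar> \<le> e * h\<^sup>2"
proof -
  \<comment> \<open>The two increments at which the derivative is compared have norms with sum at
    most 2 h (norm v + norm w); the summand 1 keeps \<open>N\<close> positive when both vectors
    vanish.\<close>
  define N where "N = 2 * (norm v + norm w) + 1"
  have N: "N > 0" by (auto simp: N_def intro: add_nonneg_pos)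
  have linA: "linear A" using A has_derivative_linear by blast
  obtain d0 where d0: "d0 > 0" and
    err: "\<And>y. norm (y - z) < d0 \<Longrightarrow> \<bar>u' y v - u' z v - A (y - z)\<bar> \<le> e / N * norm (y - z)"
    using A \<open>e > 0\<close> N unfolding has_derivative_at_alt by (metis divide_pos_pos real_norm_def)
  have "\<forall>\<^sub>F h in at_right 0. h < min d0 r / N"
    using eventually_at_right_real[of 0 "min d0 r / N"] d0 \<open>r>0\<close> N
    by (auto elim!: eventually_mono)
  moreover have "\<forall>\<^sub>F h in at_right 0. (h::real) > 0" by (rule eventually_at_right_less)
  ultimately show ?thesis
  proof eventually_elim
    case (elim h)
    define \<phi> where "\<phi> s = u (z + h *\<^sub>R w + s *\<^sub>R v) - u (z + s *\<^sub>R v)" for s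
    have small: "norm (h *\<^sub>R w + s *\<^sub>R v) \<le> h * (norm v + norm w)" "norm (s *\<^sub>R v) \<le> h * (norm v + norm w)"
      if "0 \<le> s" "s \<le> h" for s
    proof -
      have *: "s * norm v \<le> h * norm v" using that by (simp add: mult_right_mono)
      have "norm (h *\<^sub>R w + s *\<^sub>R v) \<le> h * norm w + s * norm v"
        using norm_triangle_ineq[of "h *\<^sub>R w" "s *\<^sub>R v"] that elim by simp
      then show "norm (h *\<^sub>R w + s *\<^sub>R v) \<le> h * (norm v + norm w)" using * by (simp add: algebra_simps)
      have "0 \<le> h * norm w" using elim by simp
      then show "norm (s *\<^sub>R v) \<le> h * (norm v + norm w)" using * that unfolding norm_scaleR distrib_left by linarith
    qed
    have hN: "h * (norm v + norm w) < d0" "h * (norm v + norm w) < r" 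
    proof -
      have "h * N < min d0 r" using elim N by (simp add: field_simps)
      moreover have "h * (norm v + norm w) \<le> h * N" using elim by (simp add: N_def)
      ultimately show "h * (norm v + norm w) < d0" "h * (norm v + norm w) < r" by auto
    qed
    have inb: "z + h *\<^sub>R w + s *\<^sub>R v \<in> ball z r" "z + s *\<^sub>R v \<in> ball z r" if "0 \<le> s" "s \<le> h" for s
    proof -
      have "norm (h *\<^sub>R w + s *\<^sub>R v) < r" "norm (s *\<^sub>R v) < r" using small[OF that] hN by linarith+
      then show "z + h *\<^sub>R w + s *\<^sub>R v \<in> ball z r" "z + s *\<^sub>R v \<in> ball z r"
        by (simp_all add: dist_commute[of z] dist_norm[of _ z] add.assoc del: norm_scaleR)
    qed
    have der: "(\<phi> has_real_derivative (u' (z + h *\<^sub>R w + s *\<^sub>R v) v - u' (z + s *\<^sub>R v) v)) (at s)"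
      if "0 \<le> s" "s \<le> h" for s
    proof -
      have "((\<lambda>s. u (z + h *\<^sub>R w + s *\<^sub>R v)) has_derivative (\<lambda>t. u' (z + h *\<^sub>R w + s *\<^sub>R v) (t *\<^sub>R v))) (at s)"
        by (rule has_derivative_compose[where g=u and f="\<lambda>s. z + h *\<^sub>R w + s *\<^sub>R v" and g'="u' (z + h *\<^sub>R w + s *\<^sub>R v)", OF _ d[OF inb(1)[OF that]]]) (auto intro!: derivative_eq_intros)
      moreover have "((\<lambda>s. u (z + s *\<^sub>R v)) has_derivative (\<lambda>t. u' (z + s *\<^sub>R v) (t *\<^sub>R v))) (at s)"
        by (rule has_derivative_compose[where g=u and f="\<lambda>s. z + s *\<^sub>R v" and g'="u' (z + s *\<^sub>R v)", OF _ d[OF inb(2)[OF that]]]) (auto intro!: derivative_eq_intros)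
      ultimately have "(\<phi> has_derivative (\<lambda>t. u' (z + h *\<^sub>R w + s *\<^sub>R v) (t *\<^sub>R v) - u' (z + s *\<^sub>R v) (t *\<^sub>R v))) (at s)"
        unfolding \<phi>_def by (rule has_derivative_diff)
      moreover have "linear (u' (z + h *\<^sub>R w + s *\<^sub>R v))" "linear (u' (z + s *\<^sub>R v))"
        using d[OF inb(1)[OF that]] d[OF inb(2)[OF that]] has_derivative_linear by blast+
      then have "(\<lambda>t. u' (z + h *\<^sub>R w + s *\<^sub>R v) (t *\<^sub>R v) - u' (z + s *\<^sub>R v) (t *\<^sub>R v))
          = (*) (u' (z + h *\<^sub>R w + s *\<^sub>R v) v - u' (z + s *\<^sub>R v) v)"
        by (simp add: fun_eq_iff linear_cmul algebra_simps)
      ultimately show ?thesis by (simp only: has_field_derivative_def)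
    qed
    obtain \<xi> where \<xi>: "0 < \<xi>" "\<xi> < h"
      and eq: "\<phi> h - \<phi> 0 = (h - 0) * (u' (z + h *\<^sub>R w + \<xi> *\<^sub>R v) v - u' (z + \<xi> *\<^sub>R v) v)"
      using MVT2[of 0 h \<phi> "\<lambda>s. u' (z + h *\<^sub>R w + s *\<^sub>R v) v - u' (z + s *\<^sub>R v) v"] elim der by auto
    have e1: "\<bar>u' (z + h *\<^sub>R w + \<xi> *\<^sub>R v) v - u' z v - A (h *\<^sub>R w + \<xi> *\<^sub>R v)\<bar> \<le> e / N * norm (h *\<^sub>R w + \<xi> *\<^sub>R v)"
      using err[of "z + h *\<^sub>R w + \<xi> *\<^sub>R v"] small[of \<xi>] \<xi> hN by (simp add: add.assoc)
    have e2: "\<bar>u' (z + \<xi> *\<^sub>R v) v - u' z v - A (\<xi> *\<^sub>R v)\<bar> \<le> e / N * norm (\<xi> *\<^sub>R v)"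
      using err[of "z + \<xi> *\<^sub>R v"] small[of \<xi>] \<xi> hN by simp
    have "norm (h *\<^sub>R w + \<xi> *\<^sub>R v) + norm (\<xi> *\<^sub>R v) \<le> h * N"
      using small[of \<xi>] \<xi> elim by (simp add: N_def algebra_simps)
    then have "e / N * norm (h *\<^sub>R w + \<xi> *\<^sub>R v) + e / N * norm (\<xi> *\<^sub>R v) \<le> e / N * (h * N)"
      using \<open>e > 0\<close> N unfolding distrib_left[symmetric] by (intro mult_left_mono) auto
    also have "\<dots> = e * h" using N by simp
    moreover have "A (h *\<^sub>R w + \<xi> *\<^sub>R v) - A (\<xi> *\<^sub>R v) = h * A w"
      using linA by (simp add: linear_add linear_cmul)
    ultimately have "\<bar>(u' (z + h *\<^sub>R w + \<xi> *\<^sub>R v) v - u' (z + \<xi> *\<^sub>R v) v) - h * A w\<bar> \<le> e * h"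
      using e1 e2 by linarith
    then have "h * \<bar>(u' (z + h *\<^sub>R w + \<xi> *\<^sub>R v) v - u' (z + \<xi> *\<^sub>R v) v) - h * A w\<bar> \<le> h * (e * h)"
      using elim by (intro mult_left_mono) auto
    moreover have "h * \<bar>(u' (z + h *\<^sub>R w + \<xi> *\<^sub>R v) v - u' (z + \<xi> *\<^sub>R v) v) - h * A w\<bar>
      = \<bar>\<phi> h - \<phi> 0 - h\<^sup>2 * A w\<bar>"
      using elim eq by (simp add: abs_mult_pos' power2_eq_square right_diff_distrib mult.assoc)
    moreover have "\<phi> h - \<phi> 0 = u (z + h *\<^sub>R v + h *\<^sub>R w) - u (z + h *\<^sub>R v) - u (z + h *\<^sub>R w) + u z"
      by (simp add: \<phi>_def algebra_simps)
    ultimately show ?case by (simp add: power2_eq_square mult.left_commute mult.commute)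
  qed
qed

lemma second_derivative_symmetric:
  fixes u :: "'v::real_normed_vector \<Rightarrow> real"
  assumes "open S" "z \<in> S" and d: "\<And>x. x \<in> S \<Longrightarrow> (u has_derivative u' x) (at x)"
    and A: "((\<lambda>x. u' x v) has_derivative A) (at z)" and B: "((\<lambda>x. u' x w) has_derivative B) (at z)"
  shows "A w = B v"
proof (rule ccontr)
  assume ne: "A w \<noteq> B v"
  \<comment> \<open>The same second difference lies within \<open>e\<close> h^2 of both h^2
    \<open>A w\<close> and h^2 \<open>B v\<close>. This gives a distance of at most 2
    \<open>e\<close> between the two derivatives, less than the assumed 3 \<open>e\<close>.\<close>
  define e where "e = \<bar>A w - B v\<bar> / 3"
  have e: "e > 0" using ne by (simp add: e_def)
  obtain r where r: "r > 0" "ball z r \<subseteq> S" using assms(1,2) open_contains_ball by blast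
  have 1: "\<forall>\<^sub>F h in at_right 0. \<bar>u (z + h *\<^sub>R v + h *\<^sub>R w) - u (z + h *\<^sub>R v) - u (z + h *\<^sub>R w) + u z - h\<^sup>2 * A w\<bar> \<le> e * h\<^sup>2"
    using r by (intro second_difference_bound[OF d _ A e]) auto
  have 2: "\<forall>\<^sub>F h in at_right 0. \<bar>u (z + h *\<^sub>R w + h *\<^sub>R v) - u (z + h *\<^sub>R w) - u (z + h *\<^sub>R v) + u z - h\<^sup>2 * B v\<bar> \<le> e * h\<^sup>2"
    using r by (intro second_difference_bound[OF d _ B e]) auto
  have "\<forall>\<^sub>F h in at_right (0::real). False"
    using 1 2 eventually_at_right_less[of 0]
  proof eventually_elim
    case (elim h)
    have "z + h *\<^sub>R w + h *\<^sub>R v = z + h *\<^sub>R v + h *\<^sub>R w" by simp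
    with elim(1,2) have "\<bar>h\<^sup>2 * A w - h\<^sup>2 * B v\<bar> \<le> 2 * (e * h\<^sup>2)" by simp
    then have "h\<^sup>2 * \<bar>A w - B v\<bar> \<le> h\<^sup>2 * (2 * e)"
      by (simp add: abs_mult flip: right_diff_distrib) (simp add: algebra_simps)
    then have "\<bar>A w - B v\<bar> \<le> 2 * e" using elim(3) by simp
    then show ?case using e unfolding e_def by simp
  qed
  then show False by simp
qed

lemma smooth_second_derivative_symmetric:
  fixes u :: "'v::euclidean_space \<Rightarrow> real"
  assumes "open S" "z \<in> S" "smooth_on u S"
  shows "frechet_derivative (\<lambda>x. frechet_derivative u (at x) v) (at z) w
       = frechet_derivative (\<lambda>x. frechet_derivative u (at x) w) (at z) v"
  by (rule second_derivative_symmetric[OF assms(1,2)])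
    (use assms in \<open>auto intro!: smooth_on_has_derivative[of _ S] smooth_on_frechet_derivative\<close>)

section \<open>Functions of time and space, and integrals over time\<close>

lemma smooth_on_partial:
  fixes F :: "real \<times> 'v::euclidean_space \<Rightarrow> 'w::real_normed_vector"
  assumes F: "smooth_on F (I \<times> V)" and V: "open V"
  shows smooth_on_slice: "t \<in> I \<Longrightarrow> smooth_on (\<lambda>y. F (t, y)) V"
    and "smooth_on (\<lambda>(t, z). frechet_derivative (\<lambda>y. F (t, y)) (at z) w) (I \<times> V)"
proof -
  have slice: "smooth_on (\<lambda>y. F (t, y)) V" if "t \<in> I" for t
    using smooth_on_compose[OF F smooth_on_Pair[OF smooth_on_const smooth_on_id], of t V] that by auto
  then show "t \<in> I \<Longrightarrow> smooth_on (\<lambda>y. F (t, y)) V" by blast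
  show "smooth_on (\<lambda>(t, z). frechet_derivative (\<lambda>y. F (t, y)) (at z) w) (I \<times> V)"
  proof (rule smooth_onI)
    fix k
    obtain F' where F': "\<And>x. x \<in> I \<times> V \<Longrightarrow> (F has_derivative F' x) (at x within I \<times> V)"
      "\<And>v. Ck_on k (\<lambda>x. F' x v) (I \<times> V)" using smooth_onE[OF F] by metis
    \<comment> \<open>\<open>I\<close> need not be open, so a derivative of \<open>F\<close> within
      the product is used; only its spatial part matters, and that part is unique because
      \<open>V\<close> is open.\<close>
    have "F' x (0, w) = (case x of (t, z) \<Rightarrow> frechet_derivative (\<lambda>y. F (t, y)) (at z) w)"
      if x: "x \<in> I \<times> V" for x
    proof -
      obtain t z where tz: "x = (t, z)" "t \<in> I" "z \<in> V" using x by auto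
      have "((\<lambda>y. F (t, y)) has_derivative (\<lambda>v. F' (t, z) (0, v))) (at z within V)"
        by (rule has_derivative_in_compose2[where t="I \<times> V" and g=F and g'=F'])
          (use F'(1) tz in \<open>auto intro!: derivative_eq_intros\<close>)
      then have "((\<lambda>y. F (t, y)) has_derivative (\<lambda>v. F' (t, z) (0, v))) (at z)"
        using at_within_open[OF tz(3) V] by simp
      from frechet_derivative_at[OF this] tz show ?thesis by (metis case_prod_conv)
    qed
    then show "Ck_on k (\<lambda>(t, z). frechet_derivative (\<lambda>y. F (t, y)) (at z) w) (I \<times> V)"
      using Ck_on_cong_imp[OF _ F'(2)[of "(0, w)"]] by blast
  qed
qed

text \<open>The Leibniz rule for parameter integrals wants the derivative as a continuous map into
  the bounded linear maps; in finite dimension it suffices to test the basis vectors.\<close>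

lemma blinfun_frechet_continuous_on:
  fixes F :: "real \<times> 'v::euclidean_space \<Rightarrow> 'w::real_normed_vector"
  assumes F: "smooth_on F (I \<times> V)" and V: "open V"
  shows "continuous_on (V \<times> I) (\<lambda>(z, t). Blinfun (frechet_derivative (\<lambda>y. F (t, y)) (at z)))"
proof (rule continuous_on_blinfun_componentwise)
  fix i :: 'v
  have c: "continuous_on (V \<times> I) (\<lambda>x. (\<lambda>(t, z). frechet_derivative (\<lambda>y. F (t, y)) (at z) i) (snd x, fst x))"
    by (rule continuous_on_compose2[OF smooth_on_continuous[OF smooth_on_partial(2)[OF F V]]])
      (auto intro!: continuous_intros)
  have "blinfun_apply (Blinfun (frechet_derivative (\<lambda>y. F (t, y)) (at z))) i
      = frechet_derivative (\<lambda>y. F (t, y)) (at z) i" if "t \<in> I" "z \<in> V" for t z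
    using smooth_on_has_derivative[OF smooth_on_slice[OF F V that(1)] V that(2)]
    by (metis bounded_linear_Blinfun_apply has_derivative_bounded_linear)
  note eq = this
  show "continuous_on (V \<times> I) (\<lambda>x. blinfun_apply (case x of (z, t) \<Rightarrow>
      Blinfun (frechet_derivative (\<lambda>y. F (t, y)) (at z))) i)"
    by (rule continuous_on_eq[OF c]) (auto simp: eq)
qed

lemma has_derivative_integral_param:
  fixes F :: "real \<times> 'v::euclidean_space \<Rightarrow> 'w::euclidean_space"
  assumes F: "smooth_on F ({a..b} \<times> V)" and V: "open V" and z: "z \<in> V"
  shows "((\<lambda>y. integral {a..b} (\<lambda>t. F (t, y))) has_derivative
      (\<lambda>w. integral {a..b} (\<lambda>t. frechet_derivative (\<lambda>y. F (t, y)) (at z) w))) (at z)"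
proof -
  obtain r where r: "r > 0" "ball z r \<subseteq> V" using V z open_contains_ball by blast
  let ?F' = "\<lambda>y t. Blinfun (frechet_derivative (\<lambda>y. F (t, y)) (at y))"
  have bl: "bounded_linear (frechet_derivative (\<lambda>y. F (t, y)) (at y))"
      "((\<lambda>y. F (t, y)) has_derivative frechet_derivative (\<lambda>y. F (t, y)) (at y)) (at y)"
    if "t \<in> {a..b}" "y \<in> V" for t y
    using smooth_on_has_derivative[OF smooth_on_slice[OF F V that(1)] V that(2)] has_derivative_bounded_linear
    by blast+
  have cb: "continuous_on (V \<times> {a..b}) (\<lambda>(y, t). ?F' y t)"
    by (rule blinfun_frechet_continuous_on[OF F V])
  have int: "(\<lambda>t. F (t, y)) integrable_on cbox a b" if "y \<in> V" for y
  proof (rule integrable_continuous)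
    have "continuous_on {a..b} (\<lambda>t. (t, y))" by (intro continuous_intros)
    then show "continuous_on (cbox a b) (\<lambda>t. F (t, y))"
      using continuous_on_compose2[OF smooth_on_continuous[OF F], of "{a..b}" "\<lambda>t. (t, y)"] that by auto
  qed
  have "((\<lambda>y. integral (cbox a b) (\<lambda>t. F (t, y))) has_derivative integral (cbox a b) (?F' z)) (at z within ball z r)"
  proof (rule leibniz_rule)
    show "((\<lambda>y. F (t, y)) has_derivative blinfun_apply (?F' y t)) (at y within ball z r)"
      if "y \<in> ball z r" "t \<in> cbox a b" for y t
    proof -
      have "t \<in> {a..b}" "y \<in> V" using that r by auto
      from bl[OF this] show ?thesis by (simp add: bounded_linear_Blinfun_apply has_derivative_at_withinI)
    qed
    show "continuous_on (ball z r \<times> cbox a b) (\<lambda>(y, t). ?F' y t)"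
      using r by (intro continuous_on_subset[OF cb]) auto
  qed (use r int in auto)
  then have d: "((\<lambda>y. integral {a..b} (\<lambda>t. F (t, y))) has_derivative blinfun_apply (integral {a..b} (?F' z))) (at z)"
    using r by (simp add: at_within_open[of z "ball z r"])
  have "blinfun_apply (integral {a..b} (?F' z)) w
      = integral {a..b} (\<lambda>t. frechet_derivative (\<lambda>y. F (t, y)) (at z) w)" for w
  proof -
    have "continuous_on {a..b} (\<lambda>t. ?F' z t)"
    proof -
      have 1: "continuous_on {a..b} (\<lambda>t. (z, t))" by (intro continuous_intros)
      have 2: "(\<lambda>t. (z, t)) ` {a..b} \<subseteq> V \<times> {a..b}" using z by auto
      show ?thesis using continuous_on_compose2[OF cb 1 2] by simp
    qed
    then have "?F' z integrable_on {a..b}" by (simp add: integrable_continuous_real)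
    then have "blinfun_apply (integral {a..b} (?F' z)) w = integral {a..b} (\<lambda>t. blinfun_apply (?F' z t) w)"
      using blinfun_apply_integral by blast
    also have "\<dots> = integral {a..b} (\<lambda>t. frechet_derivative (\<lambda>y. F (t, y)) (at z) w)"
      by (rule integral_cong) (use bl z in \<open>simp add: bounded_linear_Blinfun_apply\<close>)
    finally show ?thesis .
  qed
  then have "blinfun_apply (integral {a..b} (?F' z))
      = (\<lambda>w. integral {a..b} (\<lambda>t. frechet_derivative (\<lambda>y. F (t, y)) (at z) w))" by blast
  with d show ?thesis by simp
qed

text \<open>The directional derivative of such an integral is an integral of the same kind, with
  \<open>F\<close> replaced by its spatial derivative, so the induction runs over all
  \<open>F\<close>.\<close>

lemma smooth_on_integral_param:
  fixes F :: "real \<times> 'v::euclidean_space \<Rightarrow> 'w::euclidean_space"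
  assumes "smooth_on F ({a..b} \<times> V)" and V: "open V"
  shows "smooth_on (\<lambda>z. integral {a..b} (\<lambda>t. F (t, z))) V"
proof (rule smooth_onI)
  fix k show "Ck_on k (\<lambda>z. integral {a..b} (\<lambda>t. F (t, z))) V"
    using assms(1)
  proof (induction k arbitrary: F)
    case 0
    have "((\<lambda>y. integral {a..b} (\<lambda>t. F (t, y))) has_derivative
      (\<lambda>w. integral {a..b} (\<lambda>t. frechet_derivative (\<lambda>y. F (t, y)) (at z) w))) (at z)" if "z \<in> V" for z
      using has_derivative_integral_param[OF 0 V that] .
    then show ?case by (auto intro!: continuous_at_imp_continuous_on has_derivative_continuous)
  next
    case (Suc k)
    show ?case
    proof (rule Ck_on_SucI)
      show "((\<lambda>z. integral {a..b} (\<lambda>t. F (t, z))) has_derivative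
         (\<lambda>w. integral {a..b} (\<lambda>t. frechet_derivative (\<lambda>y. F (t, y)) (at z) w))) (at z within V)" if "z \<in> V" for z
        using has_derivative_integral_param[OF Suc.prems V that] has_derivative_at_withinI by blast
      show "Ck_on k (\<lambda>z. integral {a..b} (\<lambda>t. frechet_derivative (\<lambda>y. F (t, y)) (at z) v)) V" for v
        using Suc.IH[OF smooth_on_partial(2)[OF Suc.prems V]] by (simp add: case_prod_unfold)
    qed
  qed
qed

section \<open>Holomorphic maps of several variables\<close>

lemma bounded_bilinear_smult:
  "bounded_bilinear (\<lambda>(c::complex) (x::complex^'n). c *s x)"
  by (rule bilinear_conv_bounded_bilinear[THEN iffD1])
    (auto simp: bilinear_def vec_eq_iff algebra_simps intro!: linearI)

lemma i_smult_smult: "\<i> *s (\<i> *s (v::complex^'n)) = - v"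
  by (simp add: vec_eq_iff mult.assoc[symmetric])

lemma scaleR_smult: "r *\<^sub>R (v::complex^'n) = complex_of_real r *s v"
  unfolding vec_eq_iff vector_scaleR_component vector_smult_component
  by (simp add: scaleR_conv_of_real)

lemma scaleR_smult_commute: "r *\<^sub>R (c *s (v::complex^'n)) = c *s (r *\<^sub>R v)"
  by (simp add: vec_eq_iff)

definition cderiv :: "(complex^'n \<Rightarrow> complex^'m) \<Rightarrow> complex^'n \<Rightarrow> complex^'n \<Rightarrow> complex^'m" where
  "cderiv f z = frechet_derivative f (at z)"

lemma holomorphic_map_onD:
  assumes "holomorphic_map_on f S" "z \<in> S"
  shows "(f has_derivative cderiv f z) (at z)" "cderiv f z (c *s v) = c *s cderiv f z v"
proof -
  obtain f' where f': "(f has_derivative f') (at z)" "\<And>c v. f' (c *s v) = c *s f' v"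
    using assms unfolding holomorphic_map_on_def by blast
  with frechet_derivative_at[OF f'(1)] show "(f has_derivative cderiv f z) (at z)" "cderiv f z (c *s v) = c *s cderiv f z v"
    by (simp_all add: cderiv_def)
qed

definition unit_exp :: "real \<Rightarrow> complex" where
  "unit_exp s = exp (2 * of_real pi * \<i> * of_real s)"

lemma continuous_on_unit_exp: "continuous_on A g \<Longrightarrow> continuous_on A (\<lambda>x. unit_exp (g x))"
  unfolding unit_exp_def by (intro continuous_intros)

lemma norm_unit_exp: "norm (unit_exp s) = 1"
  by (simp add: unit_exp_def norm_exp_eq_Re)

text \<open>Cauchy's formula for the derivative along the complex line through \<open>z\<close> in direction \<open>v\<close>.\<close>

definition cauchy_mean :: "(complex^'n \<Rightarrow> complex^'n) \<Rightarrow> complex^'n \<Rightarrow> complex^'n \<Rightarrow> complex^'n" where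
  "cauchy_mean f v z = integral {0..1} (\<lambda>s. unit_exp (- s) *s f (z + unit_exp s *s v))"

lemma norm_smult: "norm (c *s (v::complex^'n)) = norm c * norm v"
  by (simp add: norm_vec_def norm_mult L2_set_right_distrib)

lemma unit_exp_shift_in_ball:
  assumes "z \<in> ball z0 r" "norm v < r"
  shows "z + unit_exp s *s v \<in> ball z0 (2 * r)"
proof -
  have "dist z0 (z + unit_exp s *s v) \<le> dist z0 z + norm (unit_exp s *s v)"
    using dist_triangle[of z0 "z + unit_exp s *s v" z] by (simp add: dist_norm)
  then show ?thesis using assms by (simp add: norm_smult norm_unit_exp)
qed

lemma cauchy_mean_eq:
  fixes f :: "complex^'n \<Rightarrow> complex^'n"
  assumes f: "holomorphic_map_on f S" and sub: "cball z r \<subseteq> S" and v: "norm v < r"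
  shows "cderiv f z v = cauchy_mean f v z"
proof -
  have inS: "z + \<zeta> *s v \<in> S" if "norm \<zeta> \<le> 1" for \<zeta>
  proof -
    have "norm (\<zeta> *s v) \<le> 1 * norm v" unfolding norm_smult by (intro mult_right_mono that) auto
    then have "z + \<zeta> *s v \<in> cball z r" using v by (simp add: dist_norm)
    then show ?thesis using sub by blast
  qed
  have der: "((\<lambda>\<zeta>. f (z + \<zeta> *s v) $ i) has_field_derivative cderiv f (z + \<zeta> *s v) v $ i) (at \<zeta>)"
    if "norm \<zeta> \<le> 1" for \<zeta> i
  proof -
    note d = holomorphic_map_onD[OF f inS[OF that]]
    have "((\<lambda>\<zeta>. z + \<zeta> *s v) has_derivative (\<lambda>h. h *s v)) (at \<zeta>)"
      by (auto intro!: derivative_eq_intros bounded_linear_imp_has_derivative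
        bounded_bilinear.bounded_linear_left[OF bounded_bilinear_smult])
    from has_derivative_compose[OF this d(1)]
    have "((\<lambda>\<zeta>. f (z + \<zeta> *s v)) has_derivative (\<lambda>h. h *s cderiv f (z + \<zeta> *s v) v)) (at \<zeta>)"
      by (simp add: d(2))
    from bounded_linear.has_derivative[OF bounded_linear_vec_nth this, of i]
    show ?thesis by (simp add: has_field_derivative_def mult.commute[of _ "cderiv f _ _ $ _"])
  qed
  have comp: "cderiv f z v $ i = integral {0..1} (\<lambda>s. unit_exp (- s) * f (z + unit_exp s *s v) $ i)" for i
  proof -
    let ?u = "\<lambda>\<zeta>. f (z + \<zeta> *s v) $ i"
    have hol: "?u holomorphic_on ball 0 1"
      using der[of _ i] unfolding holomorphic_on_def field_differentiable_def
      by (metis DERIV_subset has_field_derivative_at_within less_eq_real_def mem_ball_0)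
    have cont: "continuous_on (cball 0 1) ?u"
      using der[of _ i] by (intro continuous_at_imp_continuous_on ballI DERIV_isCont) auto
    have "(?u has_field_derivative (1 / (2 * of_real pi * \<i>) *
        contour_integral (circlepath 0 1) (\<lambda>u. ?u u / (u - 0)\<^sup>2))) (at 0)"
      by (rule Cauchy_derivative_integral_circlepath(2)[OF cont hol]) simp
    moreover have "(?u has_field_derivative cderiv f (z + 0 *s v) v $ i) (at 0)" using der[of 0 i] by simp
    ultimately have "cderiv f z v $ i = 1 / (2 * of_real pi * \<i>) * contour_integral (circlepath 0 1) (\<lambda>u. ?u u / (u - 0)\<^sup>2)"
      using DERIV_unique by fastforce
    also have "contour_integral (circlepath 0 1) (\<lambda>u. ?u u / (u - 0)\<^sup>2)
      = integral {0..1} (\<lambda>s. ?u (circlepath 0 1 s) / (circlepath 0 1 s - 0)\<^sup>2 * vector_derivative (circlepath 0 1) (at s))"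
      by (rule contour_integral_integral)
    also have "\<dots> = integral {0..1} (\<lambda>s. 2 * of_real pi * \<i> * (unit_exp (-s) * ?u (unit_exp s)))"
    proof (rule integral_cong)
      fix s
      have 1: "vector_derivative (circlepath 0 1) (at s) = 2 * of_real pi * \<i> * unit_exp s"
        by (simp add: vector_derivative_circlepath unit_exp_def)
      have 2: "circlepath 0 1 s = unit_exp s" by (simp add: circlepath unit_exp_def)
      have 3: "unit_exp (- s) = inverse (unit_exp s)" "unit_exp s \<noteq> 0" by (simp_all add: unit_exp_def exp_minus)
      show "?u (circlepath 0 1 s) / (circlepath 0 1 s - 0)\<^sup>2 * vector_derivative (circlepath 0 1) (at s)
          = 2 * of_real pi * \<i> * (unit_exp (-s) * ?u (unit_exp s))"
        unfolding 1 2 3(1) using 3(2) by (simp add: power2_eq_square field_simps)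
    qed
    also have "\<dots> = 2 * of_real pi * \<i> * integral {0..1} (\<lambda>s. unit_exp (-s) * ?u (unit_exp s))"
      by (rule integral_mult_right)
    finally show ?thesis by simp
  qed
  have fc: "continuous_on S f"
    using holomorphic_map_onD(1)[OF f] by (auto intro!: continuous_at_imp_continuous_on has_derivative_continuous)
  have "continuous_on {0..1} (\<lambda>s. unit_exp (-s) *s f (z + unit_exp s *s v))"
    by (intro bounded_bilinear.continuous_on[OF bounded_bilinear_smult] continuous_on_compose2[OF fc] continuous_intros
        continuous_on_unit_exp)
      (auto intro!: inS simp: norm_unit_exp)
  then have int: "(\<lambda>s. unit_exp (-s) *s f (z + unit_exp s *s v)) integrable_on {0..1}"
    by (rule integrable_continuous_real)
  have "cauchy_mean f v z $ i = cderiv f z v $ i" for i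
    using integral_linear[OF int bounded_linear_vec_nth, of i] comp[of i]
    by (simp add: cauchy_mean_def o_def)
  then show ?thesis by (simp add: vec_eq_iff)
qed

lemma holomorphic_map_on_continuous: "holomorphic_map_on f S \<Longrightarrow> continuous_on S f"
  using holomorphic_map_onD(1)[of f S] by (auto intro!: continuous_at_imp_continuous_on has_derivative_continuous)

text \<open>Cauchy's formula needs the whole disc spanned by \<open>v\<close> about \<open>z\<close>
  to lie inside \<open>S\<close>. Real homogeneity of the derivative permits shrinking
  \<open>v\<close>, and one factor \<open>c\<close> then serves for all \<open>z\<close> near
  \<open>z0\<close>.\<close>

lemma holomorphic_cderiv_scale:
  assumes f: "holomorphic_map_on f S" and "open S" "z0 \<in> S"
  obtains r c :: real where "r > 0" "c > 0" "ball z0 (2 * r) \<subseteq> S" "norm (c *\<^sub>R v) < r"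
    and "\<And>z. z \<in> ball z0 r \<Longrightarrow> cderiv f z v = (1 / c) *\<^sub>R cauchy_mean f (c *\<^sub>R v) z"
proof -
  obtain r0 where r0: "r0 > 0" "ball z0 r0 \<subseteq> S" using assms open_contains_ball by blast
  define r where "r = r0 / 3"
  define N where "N = norm v + 1"
  define c where "c = r / (2 * N)"
  have r: "r > 0" using r0 by (simp add: r_def)
  have v1: "N > 0" unfolding N_def by (intro add_nonneg_pos) auto
  have c: "c > 0" using r v1 by (simp add: c_def)
  have "c * norm v \<le> c * N" using c by (simp add: N_def)
  also have "\<dots> = r / 2" using v1 by (simp add: c_def)
  finally have cv: "norm (c *\<^sub>R v) < r" using r c by simp
  have "cderiv f z v = (1 / c) *\<^sub>R cauchy_mean f (c *\<^sub>R v) z" if z: "z \<in> ball z0 r" for z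
  proof -
    have sub: "cball z r \<subseteq> S"
    proof
      fix y assume "y \<in> cball z r"
      then have "dist z0 y < r0" using z r dist_triangle[of z0 y z] by (simp add: r_def)
      then show "y \<in> S" using r0 by auto
    qed
    then have "z \<in> S" using r by auto
    have "cderiv f z (c *\<^sub>R v) = c *\<^sub>R cderiv f z v"
      unfolding scaleR_smult by (rule holomorphic_map_onD(2)[OF f \<open>z \<in> S\<close>])
    then have "(1 / c) *\<^sub>R cauchy_mean f (c *\<^sub>R v) z = (1 / c) *\<^sub>R (c *\<^sub>R cderiv f z v)"
      by (simp only: cauchy_mean_eq[OF f sub cv])
    with c show ?thesis by simp
  qed
  moreover have "ball z0 (2 * r) \<subseteq> S" using r0 subset_ball[of "2*r" r0 z0] by (auto simp: r_def)
  ultimately show ?thesis using that r c cv by blast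
qed

text \<open>By Cauchy's formula the derivative is an integral of values of \<open>f\<close>, and
  these depend continuously on \<open>z\<close>.\<close>

lemma holomorphic_cderiv_continuous:
  assumes f: "holomorphic_map_on f S" and S: "open S"
  shows "continuous_on S (\<lambda>z. cderiv f z v)"
proof -
  have "isCont (\<lambda>z. cderiv f z v) z0" if z0S: "z0 \<in> S" for z0
  proof -
    obtain r c :: real where rc: "r > 0" "c > 0" "ball z0 (2 * r) \<subseteq> S" "norm (c *\<^sub>R v) < r"
      and eq: "\<And>z. z \<in> ball z0 r \<Longrightarrow> cderiv f z v = (1 / c) *\<^sub>R cauchy_mean f (c *\<^sub>R v) z"
      using holomorphic_cderiv_scale[OF f S z0S, of v] by blast
    have inS: "z + unit_exp s *s (c *\<^sub>R v) \<in> S" if "z \<in> ball z0 r" for z s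
      using unit_exp_shift_in_ball[OF that rc(4)] rc(3) by blast
    have "continuous_on (ball z0 r \<times> cbox 0 1)
        (\<lambda>(z, s). unit_exp (- s) *s f (z + unit_exp s *s (c *\<^sub>R v)))"
      unfolding case_prod_unfold
      by (intro bounded_bilinear.continuous_on[OF bounded_bilinear_smult]
          continuous_on_compose2[OF holomorphic_map_on_continuous[OF f]] continuous_intros continuous_on_unit_exp)
        (auto intro!: inS)
    from integral_continuous_on_param[OF this]
    have "continuous_on (ball z0 r) (cauchy_mean f (c *\<^sub>R v))" by (simp add: cauchy_mean_def[abs_def])
    then have "continuous_on (ball z0 r) (\<lambda>z. (1 / c) *\<^sub>R cauchy_mean f (c *\<^sub>R v) z)" by (intro continuous_intros)
    then have "continuous_on (ball z0 r) (\<lambda>z. cderiv f z v)" by (rule continuous_on_eq) (simp add: eq)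
    then show ?thesis using rc(1) by (simp add: continuous_on_eq_continuous_at)
  qed
  then show ?thesis by (simp add: continuous_at_imp_continuous_on)
qed

text \<open>Differentiation under the integral in Cauchy's formula: the integrand is
  \<open>f\<close> at translated points, whose derivative is complex linear and, by the continuity
  just shown, depends continuously on the parameters.\<close>

lemma holomorphic_cderiv_holomorphic:
  assumes f: "holomorphic_map_on f S" and S: "open S"
  shows "holomorphic_map_on (\<lambda>z. cderiv f z v) S"
  unfolding holomorphic_map_on_def
proof
  fix z0 assume "z0 \<in> S"
  obtain r c :: real where rc: "r > 0" "c > 0" "ball z0 (2 * r) \<subseteq> S" "norm (c *\<^sub>R v) < r"
    and eq: "\<And>z. z \<in> ball z0 r \<Longrightarrow> cderiv f z v = (1 / c) *\<^sub>R cauchy_mean f (c *\<^sub>R v) z"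
    using holomorphic_cderiv_scale[OF f S \<open>z0 \<in> S\<close>, of v] by blast
  let ?p = "\<lambda>z s. z + unit_exp s *s (c *\<^sub>R v)"
  let ?D = "\<lambda>z s w. unit_exp (- s) *s cderiv f (?p z s) w"
  have inS: "?p z s \<in> S" if "z \<in> ball z0 r" for z s
    using unit_exp_shift_in_ball[OF that rc(4)] rc(3) by blast
  have d: "((\<lambda>z. unit_exp (- s) *s f (?p z s)) has_derivative ?D z s) (at z)" if "z \<in> ball z0 r" for z s
  proof -
    have "((\<lambda>z. ?p z s) has_derivative (\<lambda>h. h)) (at z)" by (auto intro!: derivative_eq_intros)
    from has_derivative_compose[OF this holomorphic_map_onD(1)[OF f inS[OF that]]]
    have "((\<lambda>z. f (?p z s)) has_derivative cderiv f (?p z s)) (at z)" by simp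
    from bounded_linear.has_derivative[OF bounded_bilinear.bounded_linear_right[OF bounded_bilinear_smult] this]
    show ?thesis .
  qed
  have bl: "blinfun_apply (Blinfun (?D z s)) = ?D z s" if "z \<in> ball z0 r" for z s
    using d[OF that] has_derivative_bounded_linear bounded_linear_Blinfun_apply by blast
  have cc: "continuous_on (ball z0 r \<times> cbox 0 1) (\<lambda>x. ?D (fst x) (snd x) i)" for i
    by (intro bounded_bilinear.continuous_on[OF bounded_bilinear_smult]
        continuous_on_compose2[OF holomorphic_cderiv_continuous[OF f S]] continuous_intros continuous_on_unit_exp)
      (auto intro!: inS)
  have cb: "continuous_on (ball z0 r \<times> cbox 0 1) (\<lambda>(z, s). Blinfun (?D z s))"
    by (rule continuous_on_blinfun_componentwise, rule continuous_on_eq[OF cc]) (auto simp: bl)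
  have cf: "continuous_on {0..1} (\<lambda>s. unit_exp (- s) *s f (?p z s))" if "z \<in> ball z0 r" for z
    by (intro bounded_bilinear.continuous_on[OF bounded_bilinear_smult]
        continuous_on_compose2[OF holomorphic_map_on_continuous[OF f]] continuous_intros continuous_on_unit_exp)
      (auto intro!: inS that)
  have z0: "z0 \<in> ball z0 r" using rc by simp
  have "((\<lambda>z. integral (cbox 0 1) (\<lambda>s. unit_exp (- s) *s f (?p z s))) has_derivative
      integral (cbox 0 1) (\<lambda>s. Blinfun (?D z0 s))) (at z0 within ball z0 r)"
  proof (rule leibniz_rule)
    show "((\<lambda>z. unit_exp (- s) *s f (?p z s)) has_derivative blinfun_apply (Blinfun (?D z s))) (at z within ball z0 r)"
      if "z \<in> ball z0 r" for z s using d[OF that] bl[OF that] by (simp add: has_derivative_at_withinI)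
    show "(\<lambda>s. unit_exp (- s) *s f (?p z s)) integrable_on cbox 0 1" if "z \<in> ball z0 r" for z
      using cf[OF that] by (simp add: integrable_continuous_real)
  qed (use cb z0 in auto)
  then have dm: "(cauchy_mean f (c *\<^sub>R v) has_derivative blinfun_apply (integral {0..1} (\<lambda>s. Blinfun (?D z0 s)))) (at z0)"
    using z0 by (simp add: cauchy_mean_def[abs_def] at_within_open[of z0 "ball z0 r"])
  have ap: "blinfun_apply (integral {0..1} (\<lambda>s. Blinfun (?D z0 s))) w = integral {0..1} (\<lambda>s. ?D z0 s w)" for w
  proof -
    have "continuous_on {0..1} (\<lambda>s. Blinfun (?D z0 s))"
    proof -
      have 1: "continuous_on {0..1} (\<lambda>s::real. (z0, s))" by (intro continuous_intros)
      have 2: "(\<lambda>s::real. (z0, s)) ` {0..1} \<subseteq> ball z0 r \<times> cbox 0 1" using z0 by auto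
      show ?thesis using continuous_on_compose2[OF cb 1 2] by simp
    qed
    then have "(\<lambda>s. Blinfun (?D z0 s)) integrable_on {0..1}" by (rule integrable_continuous_real)
    then have "blinfun_apply (integral {0..1} (\<lambda>s. Blinfun (?D z0 s))) w = integral {0..1} (\<lambda>s. blinfun_apply (Blinfun (?D z0 s)) w)"
      using blinfun_apply_integral by blast
    then show ?thesis by (simp add: bl[OF z0])
  qed
  have clin: "integral {0..1} (\<lambda>s. ?D z0 s (a *s w)) = a *s integral {0..1} (\<lambda>s. ?D z0 s w)" for a w
  proof -
    have eq: "?D z0 s (a *s w) = a *s ?D z0 s w" for s
      using holomorphic_map_onD(2)[OF f inS[OF z0]] by (simp add: vec_eq_iff mult.left_commute)
    have "continuous_on {0..1} (\<lambda>s. ?D z0 s w)"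
      by (intro bounded_bilinear.continuous_on[OF bounded_bilinear_smult]
          continuous_on_compose2[OF holomorphic_cderiv_continuous[OF f S]] continuous_intros continuous_on_unit_exp)
        (auto intro!: inS[OF z0])
    then have "(\<lambda>s. ?D z0 s w) integrable_on {0..1}" by (rule integrable_continuous_real)
    from integral_linear[OF this bounded_bilinear.bounded_linear_right[OF bounded_bilinear_smult], of a]
    show ?thesis by (simp add: eq o_def)
  qed
  have "((\<lambda>z. (1 / c) *\<^sub>R cauchy_mean f (c *\<^sub>R v) z) has_derivative
      (\<lambda>w. (1 / c) *\<^sub>R blinfun_apply (integral {0..1} (\<lambda>s. Blinfun (?D z0 s))) w)) (at z0)"
    using dm by (rule has_derivative_scaleR_right)
  then have "((\<lambda>z. cderiv f z v) has_derivative
      (\<lambda>w. (1 / c) *\<^sub>R blinfun_apply (integral {0..1} (\<lambda>s. Blinfun (?D z0 s))) w)) (at z0)"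
    by (rule has_derivative_transform_within_open[of _ _ _ _ "ball z0 r"]) (use z0 eq in auto)
  moreover have "(1 / c) *\<^sub>R blinfun_apply (integral {0..1} (\<lambda>s. Blinfun (?D z0 s))) (a *s w)
      = a *s ((1 / c) *\<^sub>R blinfun_apply (integral {0..1} (\<lambda>s. Blinfun (?D z0 s))) w)" for a w
    by (simp only: ap clin scaleR_smult_commute)
  ultimately show "\<exists>f'. ((\<lambda>z. cderiv f z v) has_derivative f') (at z0) \<and> (\<forall>c v. f' (c *s v) = c *s f' v)" by blast
qed

text \<open>\<open>holomorphic_map_on\<close> asks for a single complex linear derivative. Each
  directional derivative is holomorphic again, so the induction over the order closes.\<close>

lemma holomorphic_imp_smooth:
  assumes "holomorphic_map_on f S" and S: "open S"
  shows "smooth_on f S"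
proof (rule smooth_onI)
  fix k show "Ck_on k f S"
    using assms(1)
  proof (induction k arbitrary: f)
    case 0
    then show ?case using holomorphic_map_on_continuous by simp
  next
    case (Suc k)
    show ?case
      by (rule Ck_on_SucI[of S f "cderiv f"])
        (use holomorphic_map_onD(1)[OF Suc.prems] Suc.IH[OF holomorphic_cderiv_holomorphic[OF Suc.prems S]]
          in \<open>auto intro: has_derivative_at_withinI\<close>)
  qed
qed

section \<open>Determinants and alternating sums\<close>

text \<open>One device for two purposes: for a bijection \<open>f\<close> it moves a determinant to
  another index type, and for an injection it completes a block by the identity, so that a block
  diagonal matrix is a product of two such matrices.\<close>

definition ext_matrix :: "('a \<Rightarrow> 'b) \<Rightarrow> 'r::comm_ring_1^'a^'a \<Rightarrow> 'r^'b^'b" where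
  "ext_matrix f C = (\<chi> p q. if p \<in> range f \<and> q \<in> range f then C $ (inv f p) $ (inv f q) else if p = q then 1 else 0)"

lemma det_ext_matrix:
  fixes f :: "'a::finite \<Rightarrow> 'b::finite" and C :: "'r::comm_ring_1^'a^'a"
  assumes f: "inj f"
  shows "det (ext_matrix f C) = det C"
proof -
  let ?R = "range f" and ?E = "ext_matrix f C"
  let ?t = "\<lambda>\<sigma>. of_int (sign \<sigma>) * (\<Prod>p\<in>UNIV. ?E $ p $ \<sigma> p)"
  have bij: "bij_betw f UNIV ?R" using f by (simp add: bij_betw_def)
  have bij': "bij_betw (inv f) ?R UNIV"
    using bij_betw_inv_into[OF bij] .
  \<comment> \<open>A permutation that moves an index outside the block meets a zero entry of the
    completed matrix.\<close>
  have z: "?t \<sigma> = 0" if \<sigma>: "\<sigma> permutes UNIV" "\<not> \<sigma> permutes ?R" for \<sigma>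
  proof -
    obtain k where k: "k \<notin> ?R" "\<sigma> k \<noteq> k" using \<sigma> permutes_superset[OF \<sigma>(1)] by blast
    then have "?E $ k $ \<sigma> k = 0" by (auto simp: ext_matrix_def)
    then have "(\<Prod>p\<in>UNIV. ?E $ p $ \<sigma> p) = 0" by (meson UNIV_I finite prod_zero)
    then show ?thesis by simp
  qed
  have "det ?E = sum ?t {\<sigma>. \<sigma> permutes UNIV}" by (simp add: det_def)
  also have "\<dots> = sum ?t {\<sigma>. \<sigma> permutes ?R}"
    by (rule sum.mono_neutral_right) (use z in \<open>auto intro: permutes_subset simp: finite_permutations\<close>)
  also have "\<dots> = (\<Sum>\<tau> | \<tau> permutes UNIV. of_int (sign \<tau>) * (\<Prod>a\<in>UNIV. C $ a $ \<tau> a))"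
  proof (rule sum.reindex_bij_witness[of _ "map_permutation UNIV f" "map_permutation ?R (inv f)"])
    fix \<tau> :: "'a \<Rightarrow> 'a" assume t: "\<tau> \<in> {\<tau>. \<tau> permutes UNIV}"
    then show "map_permutation ?R (inv f) (map_permutation UNIV f \<tau>) = \<tau>"
      by (intro map_permutation_compose_inv[OF bij]) (auto simp: f)
    show "map_permutation UNIV f \<tau> \<in> {\<sigma>. \<sigma> permutes ?R}"
      using t map_permutation_permutes[OF bij] by auto
  next
    fix \<sigma> :: "'b \<Rightarrow> 'b" assume s: "\<sigma> \<in> {\<sigma>. \<sigma> permutes ?R}"
    then show inv: "map_permutation UNIV f (map_permutation ?R (inv f) \<sigma>) = \<sigma>"
      by (intro map_permutation_compose_inv[OF bij']) (auto simp: f f_inv_into_f)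
    define \<tau> where "\<tau> = map_permutation ?R (inv f) \<sigma>"
    show "map_permutation ?R (inv f) \<sigma> \<in> {\<tau>. \<tau> permutes UNIV}"
      using s map_permutation_permutes[OF bij'] by auto
    have t: "\<tau> permutes UNIV" using s map_permutation_permutes[OF bij'] by (auto simp: \<tau>_def)
    have st: "\<sigma> = map_permutation UNIV f \<tau>" using inv by (simp add: \<tau>_def)
    have ap: "\<sigma> (f a) = f (\<tau> a)" for a unfolding st by (simp add: map_permutation_apply f)
    have fx: "\<sigma> p = p" if "p \<notin> ?R" for p using s that by (auto simp: permutes_def)
    have "(\<Prod>p\<in>UNIV. ?E $ p $ \<sigma> p) = (\<Prod>p\<in>?R. ?E $ p $ \<sigma> p)"
      by (rule prod.mono_neutral_right) (auto simp: ext_matrix_def fx)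
    also have "\<dots> = (\<Prod>a\<in>UNIV. ?E $ f a $ \<sigma> (f a))" using prod.reindex[OF f] by simp
    also have "\<dots> = (\<Prod>a\<in>UNIV. C $ a $ \<tau> a)" by (simp add: ap ext_matrix_def f)
    finally show "of_int (sign (map_permutation ?R (inv f) \<sigma>)) * (\<Prod>a\<in>UNIV. C $ a $ map_permutation ?R (inv f) \<sigma> a) = ?t \<sigma>"
      using s by (simp add: \<tau>_def sign_map_permutation f inj_on_inv_into)
  qed
  finally show ?thesis by (simp add: det_def)
qed

text \<open>Up to the factor 2^n, the value on the real basis of the mixed product of n two-forms,
  one for each index \<open>j\<close>. Allowing different factors makes polarisation and Stokes'
  theorem expressible.\<close>

definition alt_sum :: "('n::finite \<Rightarrow> 'n \<times> bool \<Rightarrow> 'n \<times> bool \<Rightarrow> 'r::comm_ring_1) \<Rightarrow> 'r" where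
  "alt_sum M = (\<Sum>\<sigma> | \<sigma> permutes (UNIV :: ('n \<times> bool) set).
     of_int (sign \<sigma>) * (\<Prod>j\<in>UNIV. M j (\<sigma> (j, False)) (\<sigma> (j, True))))"

lemma prod_UNIV_times_bool:
  fixes g :: "'n::finite \<times> bool \<Rightarrow> 'r::comm_monoid_mult"
  shows "(\<Prod>k\<in>UNIV. g k) = (\<Prod>j\<in>UNIV. g (j, False) * g (j, True))"
proof -
  have "(\<Prod>k\<in>UNIV. g k) = (\<Prod>j\<in>UNIV. \<Prod>b\<in>UNIV. g (j, b))"
    by (subst prod.cartesian_product) simp
  then show ?thesis by (simp add: UNIV_bool)
qed

lemma sum_UNIV_times_bool:
  fixes g :: "'n::finite \<times> bool \<Rightarrow> 'r::comm_monoid_add"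
  shows "(\<Sum>k\<in>UNIV. g k) = (\<Sum>j\<in>UNIV. g (j, False) + g (j, True))"
proof -
  have "(\<Sum>k\<in>UNIV. g k) = (\<Sum>j\<in>UNIV. \<Sum>b\<in>UNIV. g (j, b))"
    by (subst sum.cartesian_product) simp
  then show ?thesis by (simp add: UNIV_bool)
qed

lemma det_select_rows:
  fixes B :: "'r::comm_ring_1^'k^'k"
  shows "det (\<chi> k. B $ f k) = (if f permutes UNIV then of_int (sign f) * det B else 0)"
proof (cases "f permutes UNIV")
  case True
  then show ?thesis using det_permute_rows[of f B] by simp
next
  case False
  then have "\<not> inj f" using finite_UNIV_inj_surj[of f] bij_imp_permutes[of f UNIV] by (auto simp: bij_def)
  then obtain i j where "i \<noteq> j" "f i = f j" by (auto simp: inj_def)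
  then have "det (\<chi> k. B $ f k) = 0" by (intro det_identical_rows[of i j]) (auto simp: row_def)
  then show ?thesis using False by simp
qed

text \<open>Expand the product over \<open>j\<close> into a sum over all self-maps \<open>f\<close>
  of the 2n indices. The alternating sum over \<open>\<sigma>\<close> then is the determinant of the
  rows of \<open>B\<close> selected by \<open>f\<close>, which vanishes unless \<open>f\<close> is a
  permutation and otherwise is the sign of \<open>f\<close> times \<open>det B\<close>.\<close>

lemma alt_sum_transform:
  fixes B :: "'r::comm_ring_1^('n::finite \<times> bool)^('n \<times> bool)"
  assumes M: "\<And>j a b. M j a b = (\<Sum>p\<in>UNIV. \<Sum>q\<in>UNIV. B $ p $ a * B $ q $ b * N j p q)"
  shows "alt_sum M = det B * alt_sum N"
proof -
  let ?P = "{\<sigma>. \<sigma> permutes (UNIV :: ('n \<times> bool) set)}"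
  let ?F = "\<lambda>f. \<Prod>j\<in>UNIV. N j (f (j, False)) (f (j, True))"
  \<comment> \<open>A choice of two indices for every \<open>j\<close> is the same as a self-map of
    the 2n indices.\<close>
  define enc :: "('n \<Rightarrow> ('n \<times> bool) \<times> ('n \<times> bool)) \<Rightarrow> 'n \<times> bool \<Rightarrow> 'n \<times> bool"
    where "enc g = (\<lambda>(j, b). if b then snd (g j) else fst (g j))" for g
  have bij: "bij_betw enc UNIV UNIV"
    by (rule bij_betw_byWitness[of _ "\<lambda>f j. (f (j, False), f (j, True))"]) (auto simp: enc_def fun_eq_iff)
  have 1: "(\<Prod>j\<in>UNIV. M j (\<sigma> (j, False)) (\<sigma> (j, True))) = (\<Sum>f\<in>UNIV. (\<Prod>k\<in>UNIV. B $ f k $ \<sigma> k) * ?F f)" for \<sigma>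
  proof -
    have "(\<Prod>j\<in>UNIV. M j (\<sigma> (j, False)) (\<sigma> (j, True)))
      = (\<Prod>j\<in>UNIV. \<Sum>x\<in>UNIV. B $ fst x $ \<sigma> (j, False) * B $ snd x $ \<sigma> (j, True) * N j (fst x) (snd x))"
      unfolding M sum.cartesian_product by (simp add: case_prod_unfold)
    also have "\<dots> = (\<Sum>g\<in>UNIV. \<Prod>j\<in>UNIV. B $ fst (g j) $ \<sigma> (j, False) * B $ snd (g j) $ \<sigma> (j, True) * N j (fst (g j)) (snd (g j)))"
      by (subst prod_sum_PiE) auto
    also have "\<dots> = (\<Sum>g\<in>UNIV. (\<Prod>k\<in>UNIV. B $ enc g k $ \<sigma> k) * ?F (enc g))"
      unfolding prod_UNIV_times_bool by (simp add: enc_def prod.distrib)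
    also have "\<dots> = (\<Sum>f\<in>UNIV. (\<Prod>k\<in>UNIV. B $ f k $ \<sigma> k) * ?F f)"
      by (rule sum.reindex_bij_betw[OF bij])
    finally show ?thesis .
  qed
  have "alt_sum M = (\<Sum>f\<in>UNIV. (\<Sum>\<sigma>\<in>?P. of_int (sign \<sigma>) * (\<Prod>k\<in>UNIV. B $ f k $ \<sigma> k)) * ?F f)"
    unfolding alt_sum_def 1 sum_distrib_left sum_distrib_right
    by (subst sum.swap) (simp add: mult.assoc)
  also have "\<dots> = (\<Sum>f\<in>UNIV. det (\<chi> k. B $ f k) * ?F f)" by (simp add: det_def)
  also have "\<dots> = (\<Sum>f\<in>?P. det (\<chi> k. B $ f k) * ?F f)"
    by (rule sum.mono_neutral_right) (auto simp: det_select_rows)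
  also have "\<dots> = (\<Sum>f\<in>?P. det B * (of_int (sign f) * ?F f))"
    by (rule sum.cong) (auto simp: det_select_rows mult_ac)
  finally show ?thesis by (simp add: alt_sum_def sum_distrib_left)
qed

section \<open>Real bases and complex linear maps\<close>

definition rcoord :: "'n::finite \<times> bool \<Rightarrow> complex^'n \<Rightarrow> real" where
  "rcoord p v = (if snd p then Im (v $ fst p) else Re (v $ fst p))"

lemma rcoord_expansion: "v = (\<Sum>p\<in>UNIV. rcoord p v *\<^sub>R real_basis p)"
proof -
  have "(\<Sum>p\<in>UNIV. rcoord p v *\<^sub>R real_basis p) $ i = v $ i" for i
  proof -
    have "(\<Sum>p\<in>UNIV. rcoord p v *\<^sub>R real_basis p) $ i
      = (\<Sum>j\<in>UNIV. if j = i then complex_of_real (Re (v $ j)) + complex_of_real (Im (v $ j)) * \<i> else 0)"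
      unfolding sum_UNIV_times_bool sum_component
      by (rule sum.cong) (auto simp: rcoord_def real_basis_def axis_def scaleR_conv_of_real[where 'a=complex])
    then show ?thesis by (simp add: complex_eq_iff)
  qed
  then show ?thesis by (simp add: vec_eq_iff)
qed

lemma real_basis_component:
  "real_basis p $ i = (if fst p = i then (if snd p then \<i> else 1) else 0)"
  by (auto simp: real_basis_def axis_def)

definition realmat :: "(complex^'n::finite \<Rightarrow> complex^'n) \<Rightarrow> real^('n \<times> bool)^('n \<times> bool)" where
  "realmat L = (\<chi> p a. rcoord p (L (real_basis a)))"

text \<open>This is the transformation law of a top-degree form, and the source of the determinant
  in \<open>top_density\<close>.\<close>

lemma alt_sum_pullback:
  fixes \<gamma> :: "'n::finite \<Rightarrow> complex^'n \<Rightarrow> complex^'n \<Rightarrow> real"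
  assumes lin: "\<And>j v. linear (\<gamma> j v)" "\<And>j w. linear (\<lambda>v. \<gamma> j v w)"
  shows "alt_sum (\<lambda>j a b. \<gamma> j (L (real_basis a)) (L (real_basis b)))
     = det (realmat L) * alt_sum (\<lambda>j a b. \<gamma> j (real_basis a) (real_basis b))"
proof (rule alt_sum_transform)
  fix j a b
  have "\<gamma> j (L (real_basis a)) (L (real_basis b))
    = \<gamma> j (\<Sum>p\<in>UNIV. rcoord p (L (real_basis a)) *\<^sub>R real_basis p) (\<Sum>q\<in>UNIV. rcoord q (L (real_basis b)) *\<^sub>R real_basis q)"
    by (simp flip: rcoord_expansion)
  also have "\<dots> = (\<Sum>p\<in>UNIV. \<Sum>q\<in>UNIV. rcoord p (L (real_basis a)) * (rcoord q (L (real_basis b)) * \<gamma> j (real_basis p) (real_basis q)))"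
    by (simp add: linear_sum[OF lin(2)] linear_sum[OF lin(1)] linear_cmul[OF lin(1)] linear_cmul[OF lin(2)] sum_distrib_left)
      (subst sum.swap, simp add: mult.left_commute)
  finally show "\<gamma> j (L (real_basis a)) (L (real_basis b)) = (\<Sum>p\<in>UNIV. \<Sum>q\<in>UNIV. realmat L $ p $ a * realmat L $ q $ b * \<gamma> j (real_basis p) (real_basis q))"
    by (simp add: realmat_def mult.assoc)
qed

text \<open>The rows are the complex coordinates z_i (second component \<open>False\<close>) and
  their conjugates (second component \<open>True\<close>), evaluated on the real basis.\<close>

definition zcoord :: "complex^('n::finite \<times> bool)^('n \<times> bool)" where
  "zcoord = (\<chi> p a. if snd p then cnj (real_basis a $ fst p) else real_basis a $ fst p)"

definition cnj_matrix :: "complex^'n^'m \<Rightarrow> complex^'n^'m" where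
  "cnj_matrix C = (\<chi> i j. cnj (C $ i $ j))"

lemma det_cnj_matrix: "det (cnj_matrix C) = cnj (det C)"
  by (simp add: det_def cnj_matrix_def)

lemma det_of_real_matrix: "det (\<chi> i j. complex_of_real (A $ i $ j)) = complex_of_real (det A)"
  by (simp add: det_def)

lemma det_zcoord: "det (zcoord :: complex^('n::finite \<times> bool)^('n \<times> bool)) \<noteq> 0"
proof -
  \<comment> \<open>The inverse change of coordinates, x = (z + zbar) / 2 and y = (z - zbar) / (2
    i).\<close>
  define B' :: "complex^('n \<times> bool)^('n \<times> bool)" where
    "B' = (\<chi> p q. if fst p = fst q then (if snd p then (if snd q then \<i>/2 else -\<i>/2) else 1/2) else 0)"
  have "(B' ** zcoord) $ p $ a = mat 1 $ p $ a" for p a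
  proof -
    have "(B' ** zcoord) $ p $ a = (\<Sum>i\<in>UNIV. if i = fst p then
        (if snd p then -\<i>/2 * (real_basis a $ i) + \<i>/2 * cnj (real_basis a $ i) else real_basis a $ i/2 + cnj (real_basis a $ i)/2) else 0)"
      unfolding matrix_matrix_mult_def vec_lambda_beta sum_UNIV_times_bool
      by (rule sum.cong) (auto simp: B'_def zcoord_def)
    also have "\<dots> = mat 1 $ p $ a"
      by (auto simp: real_basis_component mat_def prod_eq_iff)
    finally show ?thesis .
  qed
  then have "B' ** zcoord = mat 1" by (simp add: vec_eq_iff)
  then have "det B' * det (zcoord :: complex^('n::finite \<times> bool)^('n \<times> bool)) = 1" by (metis det_I det_mul)
  then show ?thesis by auto
qed

lemma smult_linear_expansion:
  fixes L :: "complex^'n \<Rightarrow> complex^'n"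
  assumes "linear L" "\<And>c v. L (c *s v) = c *s L v"
  shows "L v $ i = (\<Sum>j\<in>UNIV. L (axis j 1) $ i * v $ j)"
proof -
  have "v = (\<Sum>j\<in>UNIV. v $ j *s axis j 1)"
    by (simp add: vec_eq_iff axis_def if_distrib cong: if_cong)
  then have "L v = L (\<Sum>j\<in>UNIV. v $ j *s axis j 1)" by (rule arg_cong)
  also have "\<dots> = (\<Sum>j\<in>UNIV. v $ j *s L (axis j 1))" by (simp only: linear_sum[OF assms(1)] assms(2))
  finally show ?thesis by (simp add: mult.commute)
qed

text \<open>In the coordinates \<open>z\<close>, \<open>zbar\<close> a complex linear map is block diagonal, with blocks its complex
  matrix and the conjugate of that.\<close>

lemma det_realmat:
  fixes L :: "complex^'n::finite \<Rightarrow> complex^'n"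
  assumes L: "linear L" "\<And>c v. L (c *s v) = c *s L v"
  shows "det (realmat L) = (cmod (det (matrix L)))\<^sup>2"
proof -
  define D :: "complex^('n \<times> bool)^('n \<times> bool)" where
    "D = (\<chi> p q. if snd p = snd q then (if snd p then cnj (L (axis (fst q) 1) $ fst p) else L (axis (fst q) 1) $ fst p) else 0)"
  define D1 where "D1 = ext_matrix (\<lambda>i::'n. (i, False)) (matrix L)"
  define D2 where "D2 = ext_matrix (\<lambda>i::'n. (i, True)) (cnj_matrix (matrix L))"
  define R where "R = (\<chi> p a. complex_of_real (realmat L $ p $ a))"
  have inj: "inj (\<lambda>i::'n. (i, b::bool))" for b by (simp add: inj_def)
  have inv: "inv (\<lambda>i::'n. (i, b::bool)) (i, b) = i" for b i by (rule inv_f_f[OF inj])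
  have rng: "x \<in> range (\<lambda>i::'n. (i, b::bool)) \<longleftrightarrow> snd x = b" for x b by (cases x) auto
  \<comment> \<open>Each factor is one diagonal block completed by the identity, so
    \<open>det_ext_matrix\<close> gives both determinants.\<close>
  have D: "D = D1 ** D2"
  proof -
    have "D $ (i,b) $ (j,b') = (D1 ** D2) $ (i,b) $ (j,b')" for i j b b'
    proof -
      have "(D1 ** D2) $ (i,b) $ (j,b') = (\<Sum>k\<in>UNIV. D1 $ (i,b) $ (k, False) * D2 $ (k, False) $ (j, b')
          + D1 $ (i,b) $ (k, True) * D2 $ (k, True) $ (j, b'))"
        unfolding matrix_matrix_mult_def by (simp add: sum_UNIV_times_bool)
      also have "\<dots> = (\<Sum>k\<in>UNIV. if b then (if k = i then (if b' then cnj (L (axis j 1) $ k) else 0) else 0)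
           else (if k = j then (if b' then 0 else L (axis k 1) $ i) else 0))"
        by (rule sum.cong) (auto simp: D1_def D2_def ext_matrix_def rng inv matrix_def cnj_matrix_def)
      also have "\<dots> = D $ (i,b) $ (j,b')" by (cases b) (auto simp: D_def)
      finally show ?thesis by simp
    qed
    then show ?thesis by (metis vec_eq_iff surj_pair)
  qed
  have "(zcoord ** R) $ p $ a = (D ** zcoord) $ p $ a" for p a
  proof -
    let ?v = "L (real_basis a)"
    have comp: "(\<Sum>q\<in>UNIV. real_basis q $ i * complex_of_real (rcoord q ?v)) = ?v $ i" for i
    proof -
      have "?v $ i = (\<Sum>q\<in>UNIV. rcoord q ?v *\<^sub>R real_basis q) $ i"
        by (rule arg_cong[OF rcoord_expansion])
      then show ?thesis by (simp add: scaleR_conv_of_real[where 'a=complex] mult.commute)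
    qed
    have cc: "(\<Sum>q\<in>UNIV. cnj (real_basis q $ i) * complex_of_real (rcoord q ?v)) = cnj (?v $ i)" for i
      using arg_cong[OF comp[of i], of cnj] by simp
    have 1: "(zcoord ** R) $ p $ a = (if snd p then cnj (?v $ fst p) else ?v $ fst p)"
      unfolding matrix_matrix_mult_def zcoord_def R_def realmat_def
      by (simp add: comp cc)
    have 2: "(D ** zcoord) $ p $ a = (if snd p then cnj (?v $ fst p) else ?v $ fst p)"
      unfolding matrix_matrix_mult_def vec_lambda_beta sum_UNIV_times_bool smult_linear_expansion[OF L, of "real_basis a"]
      by (cases "snd p") (simp_all add: zcoord_def D_def)
    show ?thesis unfolding 1 2 ..
  qed
  then have "zcoord ** R = D ** zcoord" by (simp add: vec_eq_iff)
  then have "det (zcoord :: complex^('n \<times> bool)^('n \<times> bool)) * det R = det D * det (zcoord :: complex^('n \<times> bool)^('n \<times> bool))"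
    by (metis det_mul)
  then have "det R = det D" using det_zcoord[where 'n='n] by simp
  also have "det D = det (matrix L) * cnj (det (matrix L))"
    unfolding D det_mul by (simp add: D1_def D2_def det_ext_matrix inj det_cnj_matrix)
  also have "\<dots> = complex_of_real ((cmod (det (matrix L)))\<^sup>2)" by (simp only: complex_norm_square)
  finally have "complex_of_real (det (realmat L)) = complex_of_real ((cmod (det (matrix L)))\<^sup>2)"
    unfolding R_def det_of_real_matrix .
  then show ?thesis by (simp only: of_real_eq_iff)
qed

section \<open>Hermitian matrices of (1,1)-forms\<close>

definition herm_mat :: "complex^'n^'n \<Rightarrow> bool" where
  "herm_mat h \<longleftrightarrow> (\<forall>i j. h $ j $ i = cnj (h $ i $ j))"

definition sesq :: "complex^'n^'n \<Rightarrow> complex^'n \<Rightarrow> complex^'n \<Rightarrow> complex" where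
  "sesq h v w = (\<Sum>i\<in>UNIV. \<Sum>j\<in>UNIV. h $ i $ j * v $ i * cnj (w $ j))"

lemma sesq_add_left: "sesq h (u + v) w = sesq h u w + sesq h v w"
  and sesq_add_right: "sesq h v (u + w) = sesq h v u + sesq h v w"
  and sesq_smult_left: "sesq h (c *s v) w = c * sesq h v w"
  and sesq_smult_right: "sesq h v (c *s w) = cnj c * sesq h v w"
  by (simp_all add: sesq_def algebra_simps sum.distrib sum_distrib_left)

lemma sesq_cnj: "herm_mat h \<Longrightarrow> sesq h w v = cnj (sesq h v w)"
proof -
  assume "herm_mat h"
  then have "cnj (h $ i $ j) = h $ j $ i" for i j unfolding herm_mat_def by metis
  then show ?thesis unfolding sesq_def by (subst sum.swap) (simp add: mult_ac)
qed

lemma form_of_coeff_sesq: "form_of_coeff h v w = - Im (sesq h v w - sesq h w v)"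
proof -
  have "(\<Sum>i\<in>UNIV. \<Sum>j\<in>UNIV. h $ i $ j * (v $ i * cnj (w $ j) - w $ i * cnj (v $ j))) = sesq h v w - sesq h w v"
    by (simp add: sesq_def algebra_simps sum_subtractf)
  then show ?thesis by (simp add: form_of_coeff_def)
qed

text \<open>Two changes of basis. Passing to z and zbar turns the form into the pairing
  \<open>N h\<close> between the two kinds of indices; acting by the transpose of \<open>h\<close>
  on the z-indices alone produces \<open>N h\<close> from \<open>N (mat 1)\<close>. The second
  change contributes \<open>det h\<close>, and the first one is common to \<open>h\<close> and the
  identity.\<close>

lemma alt_sum_form_of_coeff:
  fixes h :: "complex^'n::finite^'n"
  assumes h: "herm_mat h"
  shows "alt_sum (\<lambda>j a b. form_of_coeff h (real_basis a) (real_basis b))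
     = Re (det h) * alt_sum (\<lambda>j::'n. \<lambda>a b. form_of_coeff (mat 1) (real_basis a) (real_basis b))"
proof -
  define N :: "complex^'n^'n \<Rightarrow> 'n \<Rightarrow> 'n \<times> bool \<Rightarrow> 'n \<times> bool \<Rightarrow> complex" where
    "N h j p q = (if snd p then (if snd q then 0 else - \<i> * h $ fst q $ fst p)
      else (if snd q then \<i> * h $ fst p $ fst q else 0))" for h j p q
  have of_real_alt: "complex_of_real (alt_sum M) = alt_sum (\<lambda>j a b. complex_of_real (M j a b))"
    for M :: "'n \<Rightarrow> _" by (simp add: alt_sum_def)
  have z: "complex_of_real (alt_sum (\<lambda>j::'n. \<lambda>a b. form_of_coeff h (real_basis a) (real_basis b)))
      = det (zcoord :: complex^('n \<times> bool)^('n \<times> bool)) * alt_sum (N h)" if h: "herm_mat h" for h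
    unfolding of_real_alt
  proof (rule alt_sum_transform)
    fix j :: 'n and a b :: "'n \<times> bool"
    let ?v = "real_basis a" and ?w = "real_basis b"
    have "complex_of_real (form_of_coeff h ?v ?w) = \<i> * (sesq h ?v ?w - sesq h ?w ?v)"
      unfolding form_of_coeff_sesq sesq_cnj[OF h, of ?w ?v] by (simp add: complex_eq_iff)
    also have "\<dots> = (\<Sum>i\<in>UNIV. \<Sum>j\<in>UNIV. \<i> * h $ i $ j * ?v $ i * cnj (?w $ j)) - (\<Sum>j\<in>UNIV. \<Sum>i\<in>UNIV. \<i> * h $ i $ j * ?w $ i * cnj (?v $ j))"
      unfolding sesq_def right_diff_distrib sum_distrib_left
      by (subst (2) sum.swap) (simp add: mult.assoc)
    also have "\<dots> = (\<Sum>p\<in>UNIV. \<Sum>q\<in>UNIV. zcoord $ p $ a * zcoord $ q $ b * N h j p q)"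
      unfolding sum_UNIV_times_bool
      by (simp add: zcoord_def N_def sum_subtractf[symmetric] sum.distrib[symmetric] algebra_simps)
    finally show "complex_of_real (form_of_coeff h ?v ?w) = (\<Sum>p\<in>UNIV. \<Sum>q\<in>UNIV. zcoord $ p $ a * zcoord $ q $ b * N h j p q)" .
  qed
  have inj: "inj (\<lambda>i::'n. (i, False))" by (simp add: inj_def)
  have inv: "inv (\<lambda>i::'n. (i, False)) (i, False) = i" for i by (rule inv_f_f[OF inj])
  have rng: "x \<in> range (\<lambda>i::'n. (i, False)) \<longleftrightarrow> snd x = False" for x by (cases x) auto
  have "alt_sum (N h) = det (ext_matrix (\<lambda>i::'n. (i, False)) (transpose h)) * alt_sum (N (mat 1))"
  proof (rule alt_sum_transform)
    fix j :: 'n and a b :: "'n \<times> bool"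
    let ?E = "ext_matrix (\<lambda>i::'n. (i, False)) (transpose h)"
    have E: "?E $ (k, False) $ (l, False) = h $ l $ k" "?E $ (k, True) $ (l, c) = (if c \<and> k = l then 1 else 0)"
      "?E $ (k, False) $ (l, True) = 0" for k l c
      by (auto simp: ext_matrix_def rng inv transpose_def)
    obtain k c where a: "a = (k, c)" by (cases a)
    obtain l d where b: "b = (l, d)" by (cases b)
    have FT: "(\<Sum>i\<in>UNIV. \<Sum>m\<in>UNIV. h $ k $ i * (if m = l then 1 else 0) * (\<i> * (mat 1 :: complex^'n^'n) $ i $ m)) = \<i> * h $ k $ l"
    proof -
      have "(\<Sum>i\<in>UNIV. \<Sum>m\<in>UNIV. h $ k $ i * (if m = l then 1 else 0) * (\<i> * (mat 1 :: complex^'n^'n) $ i $ m))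
        = (\<Sum>i\<in>UNIV. \<Sum>m\<in>UNIV. if m = l then (if i = l then \<i> * h $ k $ i else 0) else 0)"
        by (intro sum.cong refl) (auto simp: mat_def)
      then show ?thesis by simp
    qed
    have TF: "(\<Sum>i\<in>UNIV. \<Sum>m\<in>UNIV. (if i = k then 1 else 0) * h $ l $ m * (- \<i> * (mat 1 :: complex^'n^'n) $ m $ i)) = - \<i> * h $ l $ k"
    proof -
      have "(\<Sum>i\<in>UNIV. \<Sum>m\<in>UNIV. (if i = k then 1 else 0) * h $ l $ m * (- \<i> * (mat 1 :: complex^'n^'n) $ m $ i))
        = (\<Sum>i\<in>UNIV. \<Sum>m\<in>UNIV. if m = i then (if i = k then - \<i> * h $ l $ m else 0) else 0)"
        by (intro sum.cong refl) (auto simp: mat_def)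
      then show ?thesis by simp
    qed
    show "N h j a b = (\<Sum>p\<in>UNIV. \<Sum>q\<in>UNIV. ?E $ p $ a * ?E $ q $ b * N (mat 1) j p q)"
      unfolding sum_UNIV_times_bool a b
      using FT TF by (cases c; cases d) (simp_all add: N_def E del: sum.delta sum.delta')
  qed
  then have "alt_sum (N h) = det h * alt_sum (N (mat 1))" by (simp add: det_ext_matrix inj)
  moreover have "herm_mat (mat 1 :: complex^'n^'n)" by (auto simp: herm_mat_def mat_def)
  ultimately have "complex_of_real (alt_sum (\<lambda>j::'n. \<lambda>a b. form_of_coeff h (real_basis a) (real_basis b)))
     = det h * complex_of_real (alt_sum (\<lambda>j::'n. \<lambda>a b. form_of_coeff (mat 1) (real_basis a) (real_basis b)))"
    using z[OF h] z by simp
  from arg_cong[OF this, of Re] show ?thesis by simp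
qed

lemma herm_mat_det_real: "herm_mat h \<Longrightarrow> Im (det h) = 0"
proof -
  assume h: "herm_mat h"
  then have "cnj (h $ i $ j) = h $ j $ i" for i j unfolding herm_mat_def by metis
  then have "cnj_matrix h = transpose h" by (simp add: cnj_matrix_def transpose_def vec_eq_iff)
  then have "cnj (det h) = det h" by (metis det_cnj_matrix det_transpose)
  then show ?thesis by (simp add: complex_eq_iff)
qed

section \<open>Positive definite Hermitian matrices\<close>

definition posdef :: "complex^'n^'n \<Rightarrow> bool" where
  "posdef h \<longleftrightarrow> herm_mat h \<and> (\<forall>v. v \<noteq> 0 \<longrightarrow> 0 < Re (sesq h v v))"

lemma sesq_eq_0_imp_det_0:
  fixes h :: "complex^'n^'n"
  assumes "\<And>w. sesq h v w = 0" "v \<noteq> 0"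
  shows "det h = 0"
proof -
  have "(transpose h *v v) $ j = 0" for j
  proof -
    have "sesq h v (axis j 1) = (\<Sum>i\<in>UNIV. h $ i $ j * v $ i)"
      by (simp add: sesq_def axis_def if_distrib cong: if_cong)
    then show ?thesis using assms(1)[of "axis j 1"] by (simp add: matrix_vector_mult_def transpose_def)
  qed
  then have "transpose h *v v = 0" by (simp add: vec_eq_iff)
  then have "\<not> invertible (transpose h)"
    using assms(2) by (metis invertible_def matrix_vector_mul_assoc matrix_vector_mul_lid matrix_vector_mult_0_right)
  then show ?thesis by (metis invertible_det_nz det_transpose)
qed

lemma sesq_mat_1: "sesq (mat 1) v v = complex_of_real ((norm v)\<^sup>2)"
proof -
  have "sesq (mat 1) v v = (\<Sum>i\<in>UNIV. v $ i * cnj (v $ i))"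
    by (simp add: sesq_def mat_def if_distrib if_distribR cong: if_cong)
  also have "\<dots> = complex_of_real (\<Sum>i\<in>UNIV. (cmod (v $ i))\<^sup>2)" by (simp only: of_real_sum complex_norm_square)
  also have "(\<Sum>i\<in>UNIV. (cmod (v $ i))\<^sup>2) = (norm v)\<^sup>2" by (simp add: norm_vec_def L2_set_def sum_nonneg)
  finally show ?thesis .
qed

text \<open>Join \<open>h\<close> to the identity by a segment. The determinant is real and
  continuous along it, and a zero would give a null vector of a positive definite matrix.\<close>

lemma posdef_det_pos:
  assumes h: "posdef h"
  shows "0 < Re (det h)"
proof (rule ccontr)
  assume neg: "\<not> 0 < Re (det h)"
  define hs where "hs s = (\<chi> i j. complex_of_real s * mat 1 $ i $ j + complex_of_real (1 - s) * h $ i $ j)" for s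
  have herm: "herm_mat (hs s)" for s
  proof -
    have e: "h $ j $ i = cnj (h $ i $ j)" for i j using h unfolding posdef_def herm_mat_def by metis
    show ?thesis unfolding herm_mat_def
    proof (intro allI)
      fix i j show "hs s $ j $ i = cnj (hs s $ i $ j)" by (simp add: hs_def mat_def e[of i j])
    qed
  qed
  have "continuous_on {0..1} (\<lambda>s. Re (det (hs s)))"
    by (simp add: det_def hs_def) (intro continuous_intros)
  moreover have "hs 0 = h" "hs 1 = mat 1" by (simp_all add: hs_def vec_eq_iff)
  ultimately obtain s where s: "0 \<le> s" "s \<le> 1" "Re (det (hs s)) = 0"
    using IVT'[of "\<lambda>s. Re (det (hs s))" 0 0 1] neg by auto
  then have "det (hs s) = 0" using herm_mat_det_real[OF herm] by (simp add: complex_eq_iff)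
  then have "det (transpose (hs s)) = 0" by simp
  then have "\<not> invertible (transpose (hs s))" by (simp add: invertible_det_nz)
  then obtain v where v: "v \<noteq> 0" "transpose (hs s) *v v = 0"
    by (metis invertible_left_inverse matrix_left_invertible_ker)
  have "sesq (hs s) v v = (\<Sum>j\<in>UNIV. (transpose (hs s) *v v) $ j * cnj (v $ j))"
    unfolding sesq_def by (subst sum.swap) (simp add: matrix_vector_mult_def transpose_def sum_distrib_right)
  then have "sesq (hs s) v v = 0" using v by simp
  moreover have "sesq (hs s) v v = complex_of_real s * sesq (mat 1) v v + complex_of_real (1 - s) * sesq h v v"
    by (simp add: hs_def sesq_def algebra_simps sum.distrib sum_subtractf sum_distrib_left)
  ultimately have "s * (norm v)\<^sup>2 + (1 - s) * Re (sesq h v v) = 0" by (simp add: sesq_mat_1 complex_eq_iff)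
  moreover have "0 < s * (norm v)\<^sup>2 + (1 - s) * Re (sesq h v v)"
  proof (cases "s = 0")
    case True then show ?thesis using h v by (simp add: posdef_def)
  next
    case False
    then have "0 < s * (norm v)\<^sup>2" using s v by simp
    moreover have "0 \<le> Re (sesq h v v)" using h v by (auto simp: posdef_def intro: less_imp_le)
    then have "0 \<le> (1 - s) * Re (sesq h v v)" using s by (intro mult_nonneg_nonneg) auto
    ultimately show ?thesis by linarith
  qed
  ultimately show False by simp
qed

text \<open>The discriminant argument of the Cauchy-Schwarz inequality: a null vector of a
  semidefinite form lies in its radical.\<close>

lemma psd_sesq_0:
  assumes h: "herm_mat h" and psd: "\<And>w. 0 \<le> Re (sesq h w w)" and v: "Re (sesq h v v) = 0"
  shows "sesq h v w = 0"
proof -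
  have re: "Re (sesq h v w) = 0" for w
  proof (rule ccontr)
    assume ne: "Re (sesq h v w) \<noteq> 0"
    define b where "b = Re (sesq h v w)"
    \<comment> \<open>The summand 1 allows division by \<open>q\<close>; the \<open>t\<close> below
      minimises 2 t \<open>b\<close> + t^2 \<open>q\<close>, with the value - \<open>b\<close>^2 /
      \<open>q\<close>.\<close>
    define q where "q = Re (sesq h w w) + 1"
    have q: "q > 0" using psd[of w] by (simp add: q_def)
    define t where "t = - b / q"
    have "0 \<le> Re (sesq h (v + of_real t *s w) (v + of_real t *s w))" by (rule psd)
    also have "\<dots> = 2 * t * b + t\<^sup>2 * Re (sesq h w w)"
      using v by (simp add: sesq_add_left sesq_add_right sesq_smult_left sesq_smult_right sesq_cnj[OF h, of w v] b_def
          power2_eq_square algebra_simps)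
    also have "\<dots> \<le> 2 * t * b + t\<^sup>2 * q" by (simp add: q_def mult_left_mono)
    also have "\<dots> = - (b\<^sup>2 / q)" using q by (simp add: t_def power2_eq_square field_simps)
    also have "\<dots> < 0" using ne q by (simp add: b_def)
    finally show False by simp
  qed
  have "Re (sesq h v (\<i> *s w)) = Im (sesq h v w)" by (simp add: sesq_smult_right)
  then show ?thesis using re[of w] re[of "\<i> *s w"] by (simp add: complex_eq_iff)
qed

text \<open>A positive matrix that is bounded above and has determinant bounded below is bounded below;
  by compactness, since the limits of such matrices are positive.\<close>

lemma posdef_lower_bound:
  assumes "c0 > 0"
  obtains c where "c > 0" and "\<And>h::complex^'n^'n. \<And>v. posdef h \<Longrightarrow> norm h \<le> C \<Longrightarrow> c0 \<le> Re (det h) \<Longrightarrow>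
     c * (norm v)\<^sup>2 \<le> Re (sesq h v v)"
proof -
  define H where "H = {h::complex^'n^'n. herm_mat h \<and> (\<forall>w. 0 \<le> Re (sesq h w w)) \<and> norm h \<le> C \<and> c0 \<le> Re (det h)}"
  have Heq: "H = (\<Inter>i. \<Inter>j. {h. h $ j $ i = cnj (h $ i $ j)}) \<inter> (\<Inter>w. {h. 0 \<le> Re (sesq h w w)}) \<inter> {h. norm h \<le> C} \<inter> {h. c0 \<le> Re (det h)}"
    by (auto simp: H_def herm_mat_def)
  have "closed H"
    unfolding Heq
  proof (intro closed_Int closed_INT ballI)
    show "closed {h :: complex^'n^'n. h $ j $ i = cnj (h $ i $ j)}" for i j
      by (intro closed_Collect_eq continuous_intros)
    show "closed {h :: complex^'n^'n. 0 \<le> Re (sesq h w w)}" for w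
      unfolding sesq_def by (intro closed_Collect_le continuous_intros)
    show "closed {h :: complex^'n^'n. norm h \<le> C}" by (intro closed_Collect_le continuous_intros)
    show "closed {h :: complex^'n^'n. c0 \<le> Re (det h)}"
      unfolding det_def by (intro closed_Collect_le continuous_intros)
  qed
  moreover have "bounded H" by (auto simp: H_def bounded_iff)
  ultimately have "compact H" by (simp add: compact_eq_bounded_closed)
  then have comp: "compact (H \<times> sphere (0::complex^'n) 1)" by (intro compact_Times) auto
  have cont: "continuous_on (H \<times> sphere (0::complex^'n) 1) (\<lambda>x. Re (sesq (fst x) (snd x) (snd x)))"
    unfolding sesq_def by (intro continuous_intros)
  \<comment> \<open>A null vector of a semidefinite matrix would make it singular, against the lower
    bound on the determinant, which is part of the closed set \<open>H\<close>.\<close>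
  have pos: "0 < Re (sesq h v v)" if "h \<in> H" "v \<noteq> 0" for h v
  proof (rule ccontr)
    assume "\<not> 0 < Re (sesq h v v)"
    then have "Re (sesq h v v) = 0" using that by (auto simp: H_def intro: antisym)
    then have "det h = 0" using psd_sesq_0[of h v] sesq_eq_0_imp_det_0[of h v] that by (auto simp: H_def)
    then show False using that assms by (auto simp: H_def)
  qed
  obtain c where c: "c > 0" "\<And>h v. h \<in> H \<Longrightarrow> norm v = 1 \<Longrightarrow> c \<le> Re (sesq h v v)"
  proof (cases "H \<times> sphere (0::complex^'n) 1 = {}")
    case True
    then show ?thesis using that[of 1] by auto
  next
    case False
    from continuous_attains_inf[OF comp False cont] obtain x where x: "x \<in> H \<times> sphere (0::complex^'n) 1"
      "\<And>y. y \<in> H \<times> sphere (0::complex^'n) 1 \<Longrightarrow> Re (sesq (fst x) (snd x) (snd x)) \<le> Re (sesq (fst y) (snd y) (snd y))" by blast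
    have ne: "snd x \<noteq> 0" using x(1) by auto
    show ?thesis
    proof (rule that[OF pos[OF _ ne]])
      show "fst x \<in> H" using x(1) by auto
      show "Re (sesq (fst x) (snd x) (snd x)) \<le> Re (sesq h v v)" if "h \<in> H" "norm v = 1" for h v
        using x(2)[of "(h, v)"] that by auto
    qed
  qed
  show ?thesis
  proof (rule that[OF c(1)])
    fix h :: "complex^'n^'n" and v assume h: "posdef h" "norm h \<le> C" "c0 \<le> Re (det h)"
    have psd: "0 \<le> Re (sesq h w w)" for w
      using h(1) by (cases "w = 0") (auto simp: posdef_def sesq_def intro: less_imp_le)
    then have hH: "h \<in> H" using h by (auto simp: H_def posdef_def)
    show "c * (norm v)\<^sup>2 \<le> Re (sesq h v v)"
    proof (cases "v = 0")
      case False
      define u where "u = of_real (1 / norm v) *s v"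
      have "norm u = 1" using False by (simp add: u_def norm_smult norm_divide)
      then have "c \<le> Re (sesq h u u)" using c(2)[OF hH] by blast
      also have "\<dots> = Re (sesq h v v) / (norm v)\<^sup>2"
        by (simp add: u_def sesq_smult_left sesq_smult_right power2_eq_square)
      finally show ?thesis using False by (simp add: field_simps)
    qed (use psd in simp)
  qed
qed

lemma norm_matrix_le:
  fixes h :: "complex^'n^'n"
  assumes "\<And>i j. norm (h $ i $ j) \<le> B"
  shows "norm h \<le> real (CARD('n)) * real (CARD('n)) * B"
proof -
  have "norm (h $ i) \<le> real (CARD('n)) * B" for i
  proof -
    have "norm (h $ i) \<le> (\<Sum>j\<in>UNIV. norm (h $ i $ j))" by (simp add: norm_vec_def L2_set_le_sum)
    also have "\<dots> \<le> (\<Sum>j\<in>(UNIV::'n set). B)" by (intro sum_mono assms)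
    finally show ?thesis by simp
  qed
  moreover have "norm h \<le> (\<Sum>i\<in>UNIV. norm (h $ i))" by (simp add: norm_vec_def L2_set_le_sum)
  ultimately have "norm h \<le> (\<Sum>i\<in>(UNIV::'n set). real (CARD('n)) * B)" by (meson order_trans sum_mono)
  then show ?thesis by (simp add: mult.assoc)
qed

lemma norm_det_le:
  fixes h :: "complex^'n^'n"
  assumes "\<And>i j. norm (h $ i $ j) \<le> B"
  shows "norm (det h) \<le> real (card {p. p permutes (UNIV::'n set)}) * B ^ CARD('n)"
proof -
  have "norm (of_int (sign p) * (\<Prod>i\<in>UNIV. h $ i $ p i)) \<le> B ^ CARD('n)" for p :: "'n \<Rightarrow> 'n"
  proof -
    have "norm (of_int (sign p) * (\<Prod>i\<in>UNIV. h $ i $ p i)) = (\<Prod>i\<in>UNIV. norm (h $ i $ p i))"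
      by (simp add: norm_mult prod_norm sign_def)
    also have "\<dots> \<le> (\<Prod>i\<in>(UNIV::'n set). B)" by (intro prod_mono) (auto simp: assms)
    finally show ?thesis by simp
  qed
  then have "norm (det h) \<le> (\<Sum>p\<in>{p. p permutes (UNIV::'n set)}. B ^ CARD('n))"
    unfolding det_def by (intro order_trans[OF norm_sum] sum_mono)
  then show ?thesis by simp
qed

section \<open>Real (1,1)-forms at a point\<close>

definition real11 :: "(complex^'n \<Rightarrow> complex^'n \<Rightarrow> real) \<Rightarrow> bool" where
  "real11 a \<longleftrightarrow> (\<forall>v. linear (a v)) \<and> (\<forall>v w. a w v = - a v w) \<and> (\<forall>v w. a (\<i> *s v) (\<i> *s w) = a v w)"

lemma real11D:
  assumes "real11 a"
  shows "linear (a v)" "a w v = - a v w" "a (\<i> *s v) (\<i> *s w) = a v w"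
  using assms unfolding real11_def by blast+

text \<open>The right side is conjugate linear in \<open>w\<close> by its form; antisymmetry and
  invariance under multiplication by i make it Hermitian, hence complex linear in \<open>v\<close>.
  It is therefore determined by its values on the complex basis, which are the entries of
  \<open>hermitian_coeff a\<close>.\<close>

lemma real11_sesq:
  assumes a: "real11 a"
  shows "sesq (hermitian_coeff a) v w = (complex_of_real (a v (\<i> *s w)) - \<i> * complex_of_real (a v w)) / 2"
proof -
  note lr = real11D(1)[OF a] and anti = real11D(2)[OF a] and t11 = real11D(3)[OF a]
  define H where "H v w = (complex_of_real (a v (\<i> *s w)) - \<i> * complex_of_real (a v w)) / 2" for v w
  have Hadd: "H v (x + y) = H v x + H v y" for v x y
    by (simp add: H_def vector_add_ldistrib linear_add[OF lr] add_divide_distrib diff_divide_distrib algebra_simps)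
  have Hi: "H v (\<i> *s w) = - \<i> * H v w" for v w
    by (simp add: H_def i_smult_smult linear_neg[OF lr] algebra_simps diff_divide_distrib)
  have Hr: "H v (r *\<^sub>R w) = of_real r * H v w" for v w r
    by (simp add: H_def flip: scaleR_smult_commute)
      (simp add: linear_cmul[OF lr] algebra_simps diff_divide_distrib)
  have Hc: "H v (c *s w) = cnj c * H v w" for v w c
  proof -
    have "c *s w = Re c *\<^sub>R w + Im c *\<^sub>R (\<i> *s w)"
      by (simp add: scaleR_smult vec_eq_iff) (metis complex_eq distrib_right mult.assoc mult.commute)
    then have "H v (c *s w) = of_real (Re c) * H v w + of_real (Im c) * (- \<i> * H v w)" by (simp add: Hadd Hr Hi)
    also have "\<dots> = cnj c * H v w" by (simp add: complex_eq_iff algebra_simps)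
    finally show ?thesis .
  qed
  have i_anti: "a v (\<i> *s w) = a w (\<i> *s v)" for v w
    using t11[of v "\<i> *s w"] anti[of "\<i> *s v" w] linear_neg[OF lr, of "\<i> *s v" w] by (simp add: i_smult_smult)
  have Hsym: "H w v = cnj (H v w)" for v w
    by (simp add: H_def i_anti[of w v] anti[of v w])
  have Hsum: "H v (\<Sum>j\<in>J. f j) = (\<Sum>j\<in>J. H v (f j))" if "finite J" for v J and f :: "'a \<Rightarrow> complex^'a"
    using that
  proof (induction J)
    case empty
    show ?case by (simp add: H_def linear_0[OF lr] vector_smult_rzero)
  qed (simp add: Hadd)
  have ex: "x = (\<Sum>j\<in>UNIV. x $ j *s axis j 1)" for x :: "complex^'a"
    by (simp add: vec_eq_iff axis_def if_distrib cong: if_cong)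
  have R: "H v w = (\<Sum>j\<in>UNIV. cnj (w $ j) * H v (axis j 1))" for v w
    using Hsum[of UNIV v "\<lambda>j. w $ j *s axis j 1"] ex[of w] by (simp add: Hc)
  have Lft: "H v w = (\<Sum>i\<in>UNIV. v $ i * H (axis i 1) w)" for v w
    using arg_cong[OF R[of w v], of cnj] by (simp flip: Hsym)
  have ax: "\<i> *s axis j 1 = axis j \<i>" for j :: 'a by (simp add: vec_eq_iff axis_def)
  have "H v w = (\<Sum>i\<in>UNIV. v $ i * (\<Sum>j\<in>UNIV. cnj (w $ j) * H (axis i 1) (axis j 1)))"
    using Lft[of v w] R[of _ w] by simp
  also have "\<dots> = sesq (hermitian_coeff a) v w"
    by (simp add: sesq_def hermitian_coeff_def H_def sum_distrib_left ax mult_ac)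
  finally show ?thesis by (simp add: H_def)
qed

lemma real11_i_sym:
  assumes a: "real11 a"
  shows "a v (\<i> *s w) = a w (\<i> *s v)"
proof -
  have "a (\<i> *s v) (\<i> *s (\<i> *s w)) = a v (\<i> *s w)" "a (\<i> *s v) w = - a w (\<i> *s v)" "linear (a (\<i> *s v))"
    by (rule real11D[OF a])+
  then show ?thesis by (simp add: i_smult_smult linear_neg)
qed

lemma real11_form_of_coeff:
  assumes a: "real11 a"
  shows "form_of_coeff (hermitian_coeff a) = a"
proof (intro ext)
  fix v w
  have "a w v = - a v w" by (rule real11D(2)[OF a])
  then show "form_of_coeff (hermitian_coeff a) v w = a v w"
    unfolding form_of_coeff_sesq real11_sesq[OF a] by simp
qed

lemma sesq_axis: "sesq h (axis i 1) (axis j 1) = h $ i $ j"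
proof -
  have "sesq h (axis i 1) (axis j 1) = (\<Sum>k\<in>UNIV. \<Sum>l\<in>UNIV. if l = j then (if k = i then h $ k $ l else 0) else 0)"
    unfolding sesq_def by (intro sum.cong refl) (auto simp: axis_def)
  then show ?thesis by simp
qed

lemma real11_herm:
  assumes a: "real11 a"
  shows "herm_mat (hermitian_coeff a)"
  unfolding herm_mat_def
proof (intro allI)
  fix i j
  have "sesq (hermitian_coeff a) w v = cnj (sesq (hermitian_coeff a) v w)" for v w
    unfolding real11_sesq[OF a] real11D(2)[OF a, of v w] real11_i_sym[OF a, of w v] by simp
  from this[of "axis j 1" "axis i 1"] show "hermitian_coeff a $ j $ i = cnj (hermitian_coeff a $ i $ j)"
    by (simp add: sesq_axis)
qed

lemma real11_re_sesq: "real11 a \<Longrightarrow> Re (sesq (hermitian_coeff a) v v) = a v (\<i> *s v) / 2"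
  by (simp add: real11_sesq)

lemma real11_posdef:
  "real11 a \<Longrightarrow> (\<And>v. v \<noteq> 0 \<Longrightarrow> 0 < a v (\<i> *s v)) \<Longrightarrow> posdef (hermitian_coeff a)"
  by (simp add: posdef_def real11_herm real11_re_sesq)

lemma wedge_power_top_alt_sum:
  "wedge_power_top a = alt_sum (\<lambda>j::'n. \<lambda>p q. a (real_basis p) (real_basis q)) / 2 ^ CARD('n)"
  for a :: "complex^'n::finite \<Rightarrow> complex^'n \<Rightarrow> real"
  unfolding wedge_power_top_def alt_sum_def ..

text \<open>The top power of the standard form, with identity coefficient matrix, on the real basis.
  It stays a symbol: the volume estimates only need that the factor is the same for all
  forms.\<close>

definition wedge_const :: "'n::finite itself \<Rightarrow> real" where
  "wedge_const _ = wedge_power_top (form_of_coeff (mat 1 :: complex^'n^'n))"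

lemma wedge_power_top_det:
  fixes a :: "complex^'n::finite \<Rightarrow> complex^'n \<Rightarrow> real"
  assumes a: "real11 a"
  shows "wedge_power_top a = wedge_const TYPE('n) * Re (det (hermitian_coeff a))"
  using alt_sum_form_of_coeff[OF real11_herm[OF a]]
  by (simp add: wedge_power_top_alt_sum wedge_const_def real11_form_of_coeff[OF a])

text \<open>With M the complex matrix of \<open>L\<close> and h the coefficient matrix of
  \<open>a\<close>, the coefficient matrix of the pullback is M^T h conj(M).\<close>

lemma det_hermitian_pullback:
  fixes a :: "complex^'n::finite \<Rightarrow> complex^'n \<Rightarrow> real"
  assumes a: "real11 a" and L: "linear L" "\<And>c v. L (c *s v) = c *s L v"
  shows "Re (det (hermitian_coeff (\<lambda>v w. a (L v) (L w)))) = (cmod (det (matrix L)))\<^sup>2 * Re (det (hermitian_coeff a))"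
proof -
  have b: "real11 (\<lambda>v w. a (L v) (L w))"
    unfolding real11_def
  proof (intro conjI allI)
    show "linear (\<lambda>w. a (L v) (L w))" for v
      using linear_compose[OF L(1) real11D(1)[OF a]] by (simp add: o_def)
    show "a (L w) (L v) = - a (L v) (L w)" for v w by (rule real11D(2)[OF a])
    show "a (L (\<i> *s v)) (L (\<i> *s w)) = a (L v) (L w)" for v w
      unfolding L(2) by (rule real11D(3)[OF a])
  qed
  let ?h = "hermitian_coeff a" and ?h' = "hermitian_coeff (\<lambda>v w. a (L v) (L w))"
  have "?h' $ i $ j = (transpose (matrix L) ** ?h ** cnj_matrix (matrix L)) $ i $ j" for i j
  proof -
    have "?h' $ i $ j = sesq ?h (L (axis i 1)) (L (axis j 1))"
      unfolding sesq_axis[of ?h', symmetric] real11_sesq[OF a] real11_sesq[OF b] by (simp add: L(2))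
    also have "\<dots> = (\<Sum>l\<in>UNIV. (\<Sum>k\<in>UNIV. L (axis i 1) $ k * ?h $ k $ l) * cnj (L (axis j 1) $ l))"
      unfolding sesq_def by (subst sum.swap) (simp add: sum_distrib_left sum_distrib_right mult_ac)
    also have "\<dots> = (transpose (matrix L) ** ?h ** cnj_matrix (matrix L)) $ i $ j"
      by (simp add: matrix_matrix_mult_def transpose_def matrix_def cnj_matrix_def)
    finally show ?thesis .
  qed
  then have "?h' = transpose (matrix L) ** ?h ** cnj_matrix (matrix L)" by (simp add: vec_eq_iff)
  then have "det ?h' = (det (matrix L) * cnj (det (matrix L))) * det ?h" by (simp add: det_mul det_cnj_matrix mult_ac)
  also have "\<dots> = complex_of_real ((cmod (det (matrix L)))\<^sup>2) * det ?h" by (simp only: complex_norm_square)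
  finally show ?thesis by simp
qed

text \<open>A diagonal entry is half the form on a basis vector. For an off-diagonal one, positivity
  on e_i - u e_j, with a phase \<open>u\<close> that makes the mixed term real, bounds its modulus
  by diagonal terms.\<close>

lemma real11_entry_bound:
  assumes a: "real11 a" and pos: "\<And>v. 0 \<le> a v (\<i> *s v)" and B: "\<And>v. a v (\<i> *s v) \<le> B * (norm v)\<^sup>2"
  shows "norm (hermitian_coeff a $ i $ j) \<le> B"
proof -
  let ?h = "hermitian_coeff a"
  have herm: "herm_mat ?h" by (rule real11_herm[OF a])
  have psd: "0 \<le> Re (sesq ?h v v)" for v using pos[of v] by (simp add: real11_re_sesq[OF a])
  have le: "Re (sesq ?h v v) \<le> B / 2 * (norm v)\<^sup>2" for v using B[of v] by (simp add: real11_re_sesq[OF a])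
  define z where "z = ?h $ i $ j"
  show ?thesis
  proof (cases "z = 0")
    case True
    have "0 \<le> B * (norm (axis i 1 :: complex^'a))\<^sup>2" using pos B order_trans by blast
    then show ?thesis using True by (simp add: z_def)
  next
    case False
    define u where "u = z / of_real (cmod z)"
    have u: "cmod u = 1" "cnj u * z = of_real (cmod z)"
      using False by (simp_all add: u_def norm_divide)
        (metis complex_norm_square mult.commute power2_eq_square nonzero_mult_div_cancel_left of_real_eq_0_iff norm_eq_zero of_real_power)
    let ?x = "axis i (1::complex) :: complex^'a" and ?y = "u *s (axis j (1::complex) :: complex^'a)"
    have s: "sesq ?h ?x ?y = of_real (cmod z)" by (simp add: sesq_smult_right sesq_axis u flip: z_def)
    have "sesq ?h ?y ?x = of_real (cmod z)" using sesq_cnj[OF herm, of ?y ?x] s by simp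
    then have "0 \<le> Re (sesq ?h (?x + (-1) *s ?y) (?x + (-1) *s ?y))
        \<longleftrightarrow> 2 * cmod z \<le> Re (sesq ?h ?x ?x) + Re (sesq ?h ?y ?y)"
      using s by (simp only: sesq_add_left sesq_add_right sesq_smult_left[of _ "-1"] sesq_smult_right[of _ _ "-1"]) simp
    then have "2 * cmod z \<le> Re (sesq ?h ?x ?x) + Re (sesq ?h ?y ?y)" using psd by blast
    also have "\<dots> \<le> B / 2 * (norm ?x)\<^sup>2 + B / 2 * (norm ?y)\<^sup>2" by (intro add_mono le)
    also have "\<dots> = B" by (simp add: norm_smult u)
    finally show ?thesis using norm_ge_zero[of z] unfolding z_def by linarith
  qed
qed

section \<open>Integrals of compactly supported functions\<close>

definition zext :: "'v set \<Rightarrow> ('v \<Rightarrow> real) \<Rightarrow> 'v \<Rightarrow> real" where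
  "zext S f x = (if x \<in> S then f x else 0)"

lemma integral_zext: "integral UNIV (zext S f) = integral S f" for S :: "'v::euclidean_space set"
  unfolding zext_def by (rule Henstock_Kurzweil_Integration.integral_restrict_UNIV)

lemma zext_continuous:
  fixes f :: "'v::topological_space \<Rightarrow> real"
  assumes "open S" "closed C" "C \<subseteq> S" and f: "continuous_on S f" and z: "\<And>x. x \<in> S - C \<Longrightarrow> f x = 0"
  shows "continuous_on UNIV (zext S f)"
proof -
  have 1: "continuous_on S (zext S f)" by (rule continuous_on_eq[OF f]) (simp add: zext_def)
  have 2: "continuous_on (- C) (zext S f)"
    by (rule continuous_on_eq[OF continuous_on_const[of _ 0]]) (use z in \<open>auto simp: zext_def\<close>)
  have "continuous_on (S \<union> - C) (zext S f)"
    using 1 2 assms by (intro continuous_on_open_Un) auto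
  moreover have "S \<union> - C = UNIV" using assms by auto
  ultimately show ?thesis by simp
qed

text \<open>For such functions the gauge integral over \<open>S\<close>, the integral over any box
  containing \<open>C\<close> and the Lebesgue integral agree. \<open>C\<close> may be larger than
  the support.\<close>

locale compact_support =
  fixes S C :: "'v::euclidean_space set" and f :: "'v \<Rightarrow> real"
  assumes S: "open S" and C: "compact C" and CS: "C \<subseteq> S" and f: "continuous_on S f"
    and z: "\<And>x. x \<in> S - C \<Longrightarrow> f x = 0"
begin

lemma continuous: "continuous_on UNIV (zext S f)"
  by (rule zext_continuous[OF S compact_imp_closed[OF C] CS f z])

lemma zero: "x \<notin> C \<Longrightarrow> zext S f x = 0" using z by (auto simp: zext_def)

lemma integral_eq_cbox:
  assumes "C \<subseteq> cbox a b"
  shows "integral (cbox a b) (zext S f) = integral S f"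
proof -
  have "(zext S f has_integral integral (cbox a b) (zext S f)) (cbox a b)"
    by (intro integrable_integral integrable_continuous continuous_on_subset[OF continuous]) auto
  then have "(zext S f has_integral integral (cbox a b) (zext S f)) UNIV"
    by (rule has_integral_on_superset) (use assms zero in auto)
  then show ?thesis using integral_zext[of S f] by (simp add: integral_unique)
qed

lemma absolutely_integrable: "f absolutely_integrable_on S"
proof -
  obtain a b where ab: "C \<subseteq> cbox a b" using C bounded_subset_cbox_symmetric compact_imp_bounded by metis
  have "zext S f absolutely_integrable_on cbox a b"
    by (intro absolutely_integrable_continuous continuous_on_subset[OF continuous]) auto
  then have "(\<lambda>x. if x \<in> cbox a b then zext S f x else 0) absolutely_integrable_on UNIV"
    by (simp add: absolutely_integrable_restrict_UNIV)
  moreover have "(\<lambda>x. if x \<in> cbox a b then zext S f x else 0) = (\<lambda>x. if x \<in> S then f x else 0)"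
    using ab z by (auto simp: zext_def fun_eq_iff)
  ultimately show ?thesis by (simp add: absolutely_integrable_restrict_UNIV)
qed

lemma integrable: "f integrable_on S"
  using absolutely_integrable set_lebesgue_integral_eq_integral(1) by blast

lemma integral_eq_lborel: "integral S f = (\<integral>x. zext S f x \<partial>lborel)"
proof -
  have "integrable lborel (\<lambda>x. indicator C x *\<^sub>R zext S f x)"
    by (rule borel_integrable_compact[OF C]) (rule continuous_on_subset[OF continuous], simp)
  moreover have "(\<lambda>x. indicator C x *\<^sub>R zext S f x) = zext S f" using zero by (auto simp: indicator_def fun_eq_iff)
  ultimately have "integrable lborel (zext S f)" by simp
  from integral_lborel[OF this] show ?thesis by (simp add: integral_zext)
qed

end

text \<open>The integral of the translate x -> f (x + s e) over a large fixed box does not depend on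
  s for |s| at most 1, since each translate keeps its support in the box. Its derivative at s = 0 is
  the integral in question.\<close>

lemma integral_derivative_eq_0:
  fixes f :: "'v::euclidean_space \<Rightarrow> real"
  assumes S: "open S" and C: "compact C" "C \<subseteq> S"
    and d: "\<And>x. x \<in> S \<Longrightarrow> (f has_derivative f' x) (at x)"
    and c: "continuous_on S (\<lambda>x. f' x e)" and z: "\<And>x. x \<in> S - C \<Longrightarrow> f x = 0"
  shows "integral S (\<lambda>x. f' x e) = 0" and integrable_derivative: "(\<lambda>x. f' x e) integrable_on S"
proof -
  have op: "open (S - C)" using S C(1) compact_imp_closed open_Diff by blast
  have f'0: "f' x = (\<lambda>_. 0)" if "x \<in> S - C" for x
  proof -
    have "((\<lambda>_. 0) has_derivative (\<lambda>_. 0)) (at x)" by simp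
    then have "(f has_derivative (\<lambda>_. 0)) (at x)"
      by (rule has_derivative_transform_within_open[OF _ op that]) (simp add: z)
    moreover have "(f has_derivative f' x) (at x)" using d that by blast
    ultimately show ?thesis using has_derivative_unique by blast
  qed
  have cf: "continuous_on S f" using d by (auto intro!: continuous_at_imp_continuous_on has_derivative_continuous)
  interpret F: compact_support S C f by unfold_locales (use S C cf z in auto)
  interpret F': compact_support S C "\<lambda>x. f' x e" by unfold_locales (use S C c f'0 in auto)
  have dz: "(zext S f has_derivative (\<lambda>h. if x \<in> S then f' x h else 0)) (at x)" for x
  proof (cases "x \<in> S")
    case True
    then show ?thesis
      by (auto intro: has_derivative_transform_within_open[OF d S] simp: zext_def)
  next
    case False
    have "((\<lambda>_. 0) has_derivative (\<lambda>_. 0)) (at x)" by simp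
    then have "(zext S f has_derivative (\<lambda>_. 0)) (at x)"
      by (rule has_derivative_transform_within_open[OF _ open_Compl[OF compact_imp_closed[OF C(1)]]])
        (use False C F.zero in auto)
    then show ?thesis using False by simp
  qed
  obtain K where K: "\<And>x. x \<in> C \<Longrightarrow> norm x \<le> K" "K > 0" using C(1) compact_imp_bounded bounded_pos by metis
  \<comment> \<open>The margin \<open>norm e\<close> leaves room for all shifts by s e with |s| at
    most 1.\<close>
  obtain a :: 'v where a: "cball (0::'v) (K + norm e) \<subseteq> cbox (-a) a"
    using bounded_subset_cbox_symmetric[OF bounded_cball[of "0::'v" "K + norm e"]] by blast
  let ?U = "{-1..1::real}"
  have C1: "C \<subseteq> cbox (-a + s *\<^sub>R e) (a + s *\<^sub>R e)" if "s \<in> ?U" for s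
  proof
    fix x assume "x \<in> C"
    have "\<bar>s\<bar> * norm e \<le> 1 * norm e" using that by (intro mult_right_mono) auto
    then have "x - s *\<^sub>R e \<in> cball 0 (K + norm e)"
      using K(1)[OF \<open>x \<in> C\<close>] norm_triangle_ineq4[of x "s *\<^sub>R e"] by simp
    then have "x - s *\<^sub>R e \<in> cbox (-a) a" using a by blast
    then show "x \<in> cbox (-a + s *\<^sub>R e) (a + s *\<^sub>R e)" by (simp add: mem_box inner_diff_left inner_add_left algebra_simps)
  qed
  have const: "integral (cbox (-a) a) (\<lambda>x. zext S f (x + s *\<^sub>R e)) = integral S f" if "s \<in> ?U" for s
    using integral_shift_cbox_plus[of "-a" a "zext S f" "s *\<^sub>R e"] F.integral_eq_cbox[OF C1[OF that]]
    by (simp add: o_def add.commute)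
  have cz: "continuous_on UNIV (zext S (\<lambda>x. f' x e))" by (rule F'.continuous)
  have "((\<lambda>s. integral (cbox (-a) a) (\<lambda>x. zext S f (x + s *\<^sub>R e))) has_vector_derivative
      integral (cbox (-a) a) (\<lambda>x. zext S (\<lambda>x. f' x e) (x + 0 *\<^sub>R e))) (at 0 within ?U)"
  proof (rule leibniz_rule_vector_derivative[where fx="\<lambda>s x. zext S (\<lambda>x. f' x e) (x + s *\<^sub>R e)"])
    fix s x assume "s \<in> ?U" "x \<in> cbox (-a) a"
    let ?y = "x + s *\<^sub>R e"
    have lin: "linear (\<lambda>h. if ?y \<in> S then f' ?y h else 0)"
      using dz has_derivative_linear by blast
    have "((\<lambda>s. x + s *\<^sub>R e) has_derivative (\<lambda>h. h *\<^sub>R e)) (at s)" by (auto intro!: derivative_eq_intros)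
    from has_derivative_compose[OF this dz]
    have "((\<lambda>s. zext S f (x + s *\<^sub>R e)) has_derivative (\<lambda>h. if ?y \<in> S then f' ?y (h *\<^sub>R e) else 0)) (at s)" .
    moreover have "(\<lambda>h. if ?y \<in> S then f' ?y (h *\<^sub>R e) else 0) = (\<lambda>h. h *\<^sub>R zext S (\<lambda>x. f' x e) ?y)"
      using linear_cmul[OF lin, of _ e] by (auto simp: zext_def fun_eq_iff)
    ultimately show "((\<lambda>s. zext S f (x + s *\<^sub>R e)) has_vector_derivative zext S (\<lambda>x. f' x e) ?y) (at s within ?U)"
      by (simp add: has_vector_derivative_def has_derivative_at_withinI)
  next
    show "(\<lambda>x. zext S f (x + s *\<^sub>R e)) integrable_on cbox (-a) a" for s
      by (intro integrable_continuous continuous_on_compose2[OF F.continuous] continuous_intros) auto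
    show "continuous_on (?U \<times> cbox (-a) a) (\<lambda>(s, x). zext S (\<lambda>x. f' x e) (x + s *\<^sub>R e))"
      unfolding case_prod_unfold
      by (intro continuous_on_compose2[OF cz] continuous_intros) auto
  qed auto
  then have "((\<lambda>s. integral (cbox (-a) a) (\<lambda>x. zext S f (x + s *\<^sub>R e))) has_vector_derivative
      integral (cbox (-a) a) (zext S (\<lambda>x. f' x e))) (at 0 within ?U)" by simp
  then have "((\<lambda>s. integral S f) has_vector_derivative integral (cbox (-a) a) (zext S (\<lambda>x. f' x e))) (at 0 within ?U)"
    by (rule has_vector_derivative_transform[rotated 2]) (simp_all add: const)
  then have "((\<lambda>s::real. integral S f) has_vector_derivative integral (cbox (-a) a) (zext S (\<lambda>x. f' x e))) (at 0)"
    by (simp add: at_within_interior[of 0 ?U])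
  moreover have "((\<lambda>s::real. integral S f) has_vector_derivative 0) (at 0)" by simp
  ultimately have "integral (cbox (-a) a) (zext S (\<lambda>x. f' x e)) = 0" using vector_derivative_unique_at by blast
  moreover have "C \<subseteq> cbox (-a) a" using C1[of 0] by simp
  ultimately show "integral S (\<lambda>x. f' x e) = 0" using F'.integral_eq_cbox by simp
  show "(\<lambda>x. f' x e) integrable_on S" by (rule F'.integrable)
qed

section \<open>Change of variables for holomorphic maps\<close>

text \<open>The change of variables theorem of the library is for \<open>real ^ 'm\<close> with well-ordered index type
  \<open>'m\<close>; the type below is \<open>'n \<times> bool\<close> with an arbitrary well-order.\<close>

typedef 'n::finite cidx = "UNIV :: ('n \<times> bool) set" by simp

instance cidx :: (finite) finite
proof
  have e: "(UNIV :: 'a cidx set) = range Abs_cidx" by (rule UNIV_eq_I) (metis Rep_cidx_inverse rangeI)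
  show "finite (UNIV :: 'a cidx set)" unfolding e by (rule finite_imageI) (rule finite)
qed

instantiation cidx :: (finite) wellorder
begin

definition less_eq_cidx :: "'a cidx \<Rightarrow> 'a cidx \<Rightarrow> bool" where
  "less_eq_cidx x y \<longleftrightarrow> to_nat_on (UNIV :: 'a cidx set) x \<le> to_nat_on (UNIV :: 'a cidx set) y"

definition less_cidx :: "'a cidx \<Rightarrow> 'a cidx \<Rightarrow> bool" where
  "less_cidx x y \<longleftrightarrow> to_nat_on (UNIV :: 'a cidx set) x < to_nat_on (UNIV :: 'a cidx set) y"

instance
proof
  fix x y z :: "'a cidx"
  show "x \<le> y \<Longrightarrow> y \<le> x \<Longrightarrow> x = y"
    using inj_on_to_nat_on[of "UNIV :: 'a cidx set"] by (auto simp: less_eq_cidx_def inj_on_def countable_finite)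
  show "(\<And>x. (\<And>y. y < x \<Longrightarrow> P y) \<Longrightarrow> P x) \<Longrightarrow> P a" for P and a :: "'a cidx"
    unfolding less_cidx_def using measure_induct_rule[of "to_nat_on (UNIV :: 'a cidx set)" P a] by blast
qed (auto simp: less_eq_cidx_def less_cidx_def)

end

definition from_coords :: "real^'n::finite cidx \<Rightarrow> complex^'n" where
  "from_coords x = (\<Sum>p\<in>UNIV. (x $ Abs_cidx p) *\<^sub>R real_basis p)"

definition to_coords :: "complex^'n::finite \<Rightarrow> real^'n cidx" where
  "to_coords v = (\<chi> k. rcoord (Rep_cidx k) v)"

lemma rcoord_linear: "linear (rcoord p)"
  by (rule linearI) (auto simp: rcoord_def)

lemma rcoord_real_basis: "rcoord p (real_basis q) = (if p = q then 1 else 0)"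
  by (auto simp: rcoord_def real_basis_component prod_eq_iff)

lemma to_coords_linear: "linear to_coords"
  by (rule linearI) (auto simp: to_coords_def vec_eq_iff linear_add[OF rcoord_linear] linear_cmul[OF rcoord_linear])

lemma from_coords_linear: "linear from_coords"
  by (rule linearI) (auto simp: from_coords_def scaleR_add_left sum.distrib scaleR_sum_right)

lemma to_from_coords [simp]: "to_coords (from_coords x) = x"
proof -
  have "rcoord (Rep_cidx k) (from_coords x) = x $ k" for k
  proof -
    have "rcoord (Rep_cidx k) (from_coords x) = (\<Sum>p\<in>UNIV. if p = Rep_cidx k then x $ Abs_cidx p else 0)"
      unfolding from_coords_def linear_sum[OF rcoord_linear] linear_cmul[OF rcoord_linear] rcoord_real_basis
      by (intro sum.cong) auto
    then show ?thesis by (simp add: Rep_cidx_inverse)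
  qed
  then show ?thesis by (simp add: to_coords_def vec_eq_iff)
qed

lemma from_to_coords [simp]: "from_coords (to_coords v) = v"
  unfolding from_coords_def to_coords_def by (simp add: Abs_cidx_inverse flip: rcoord_expansion)

lemma continuous_on_to_coords: "continuous_on A to_coords"
  by (simp add: linear_continuous_on to_coords_linear linear_conv_bounded_linear[symmetric])

lemma continuous_on_from_coords: "continuous_on A from_coords"
  by (simp add: linear_continuous_on from_coords_linear linear_conv_bounded_linear[symmetric])

lemma Basis_complex_vec: "(Basis :: (complex^'n) set) = range real_basis"
proof -
  have "v \<in> Basis \<longleftrightarrow> (\<exists>i. v = axis i 1 \<or> v = axis i \<i>)" for v :: "complex^'n"
    by (auto simp: Basis_vec_def Basis_complex_def)
  moreover have "v \<in> range real_basis \<longleftrightarrow> (\<exists>i. v = axis i 1 \<or> v = axis i \<i>)" for v :: "complex^'n"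
    by (simp add: image_iff real_basis_def split_paired_Ex ex_bool_eq) (metis (full_types))
  ultimately show ?thesis by blast
qed

lemma inj_real_basis: "inj real_basis"
  by (rule injI) (metis rcoord_real_basis zero_neq_one)

lemma inner_real_basis: "v \<bullet> real_basis p = rcoord p v"
  by (auto simp: real_basis_def rcoord_def inner_axis inner_complex_def)

lemma rcoord_from_coords: "rcoord p (from_coords x) = x $ Abs_cidx p"
  using arg_cong[OF to_from_coords[of x], of "\<lambda>y. y $ Abs_cidx p"] by (simp add: to_coords_def Abs_cidx_inverse)

lemma all_cidx: "(\<forall>k::'n::finite cidx. P k) \<longleftrightarrow> (\<forall>p. P (Abs_cidx p))"
  by (metis Rep_cidx_inverse)

lemma prod_Basis_cart:
  fixes X :: "real^'k"
  shows "(\<Prod>b\<in>Basis. X \<bullet> b) = (\<Prod>k\<in>UNIV. X $ k)"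
proof -
  have B: "(Basis :: (real^'k) set) = range (\<lambda>k. axis k 1)" by (auto simp: Basis_vec_def)
  have inj: "inj (\<lambda>k::'k. axis k (1::real))" by (simp add: inj_def axis_eq_axis)
  show ?thesis unfolding B prod.reindex[OF inj] by (simp add: inner_axis)
qed

text \<open>The coordinate map sends boxes to boxes with the same side lengths, and a measure with
  the right values on boxes is Lebesgue measure.\<close>

lemma lborel_from_coords: "distr lborel borel from_coords = (lborel :: (complex^'n::finite) measure)"
proof (rule lborel_eqI[symmetric])
  fix l u :: "complex^'n"
  assume le: "\<And>b. b \<in> Basis \<Longrightarrow> l \<bullet> b \<le> u \<bullet> b"
  have le': "rcoord p l \<le> rcoord p u" for p
    using le[of "real_basis p"] by (simp add: Basis_complex_vec inner_real_basis)
  have pre: "from_coords -` box l u = box (to_coords l) (to_coords u)"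
  proof (rule set_eqI)
    fix x
    have "x \<in> from_coords -` box l u \<longleftrightarrow> (\<forall>p. rcoord p l < x $ Abs_cidx p \<and> x $ Abs_cidx p < rcoord p u)"
      by (simp add: mem_box Basis_complex_vec inner_real_basis rcoord_from_coords)
    also have "\<dots> \<longleftrightarrow> (\<forall>k. rcoord (Rep_cidx k) l < x $ k \<and> x $ k < rcoord (Rep_cidx k) u)"
      unfolding all_cidx by (simp add: Abs_cidx_inverse)
    also have "\<dots> \<longleftrightarrow> x \<in> box (to_coords l) (to_coords u)"
      by (simp add: mem_box_cart to_coords_def)
    finally show "x \<in> from_coords -` box l u \<longleftrightarrow> x \<in> box (to_coords l) (to_coords u)" .
  qed
  have "emeasure (distr lborel borel from_coords) (box l u) = emeasure lborel (box (to_coords l) (to_coords u))"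
    using pre by (subst emeasure_distr) (auto intro!: borel_measurable_continuous_onI continuous_on_from_coords)
  also have "\<dots> = (\<Prod>b\<in>Basis. (to_coords u - to_coords l) \<bullet> b)"
    by (rule emeasure_lborel_box) (auto simp: Basis_vec_def inner_axis to_coords_def le')
  also have "(\<Prod>b\<in>Basis. (to_coords u - to_coords l) \<bullet> b) = (\<Prod>k\<in>UNIV. (to_coords u - to_coords l) $ k)"
    by (rule prod_Basis_cart)
  also have "\<dots> = (\<Prod>p\<in>UNIV. rcoord p (u - l))"
    by (rule prod.reindex_bij_witness[of _ Abs_cidx Rep_cidx])
      (auto simp: Rep_cidx_inverse Abs_cidx_inverse to_coords_def linear_diff[OF rcoord_linear])
  also have "\<dots> = (\<Prod>b\<in>Basis. (u - l) \<bullet> b)"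
    unfolding Basis_complex_vec by (simp add: prod.reindex[OF inj_real_basis] inner_real_basis)
  finally show "emeasure (distr lborel borel from_coords) (box l u) = (\<Prod>b\<in>Basis. (u - l) \<bullet> b)" .
qed simp

lemma integral_from_coords:
  assumes "compact_support S C f"
  shows "compact_support (from_coords -` S) (to_coords ` C) (\<lambda>x. f (from_coords x))"
    and "integral S f = integral (from_coords -` S) (\<lambda>x. f (from_coords x))"
proof -
  interpret compact_support S C f by fact
  have 1: "open (from_coords -` S)" by (rule open_vimage[OF S continuous_on_from_coords])
  have 2: "compact (to_coords ` C)" by (rule compact_continuous_image[OF continuous_on_to_coords C])
  have 3: "continuous_on (from_coords -` S) (\<lambda>x. f (from_coords x))"
    by (rule continuous_on_compose2[OF f continuous_on_from_coords]) auto
  show cs: "compact_support (from_coords -` S) (to_coords ` C) (\<lambda>x. f (from_coords x))"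
  proof
    show "f (from_coords x) = 0" if "x \<in> from_coords -` S - to_coords ` C" for x
      using that z[of "from_coords x"] by (metis Diff_iff image_eqI to_from_coords vimage_eq)
  qed (use 1 2 3 CS in auto)
  interpret G: compact_support "from_coords -` S" "to_coords ` C" "\<lambda>x. f (from_coords x)" by fact
  have "integral S f = (\<integral>x. zext S f x \<partial>distr lborel borel from_coords)"
    by (simp add: integral_eq_lborel lborel_from_coords)
  also have "\<dots> = (\<integral>x. zext S f (from_coords x) \<partial>lborel)"
    by (rule integral_distr) (auto intro!: borel_measurable_continuous_onI continuous continuous_on_from_coords)
  also have "(\<lambda>x. zext S f (from_coords x)) = zext (from_coords -` S) (\<lambda>x. f (from_coords x))"
    by (auto simp: zext_def fun_eq_iff)
  finally show "integral S f = integral (from_coords -` S) (\<lambda>x. f (from_coords x))"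
    using G.integral_eq_lborel by simp
qed

lemma det_matrix_coords:
  assumes "linear L"
  shows "det (matrix (\<lambda>x. to_coords (L (from_coords x)))) = det (realmat L)"
proof -
  have inj: "inj (Abs_cidx :: 'a \<times> bool \<Rightarrow> 'a cidx)" by (metis Abs_cidx_inverse UNIV_I injI)
  have inv: "inv (Abs_cidx :: 'a \<times> bool \<Rightarrow> 'a cidx) = Rep_cidx"
    by (rule inv_equality) (auto simp: Abs_cidx_inverse Rep_cidx_inverse)
  have rng: "k \<in> range Abs_cidx" for k :: "'a cidx" by (metis Rep_cidx_inverse rangeI)
  have fa: "from_coords (axis l 1) = real_basis (Rep_cidx l)" for l :: "'a cidx"
  proof -
    have "to_coords (real_basis (Rep_cidx l)) = axis l 1"
      by (auto simp: to_coords_def rcoord_real_basis vec_eq_iff axis_def Rep_cidx_inject)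
    then show ?thesis by (metis from_to_coords)
  qed
  have "matrix (\<lambda>x. to_coords (L (from_coords x))) = ext_matrix Abs_cidx (realmat L)"
    by (simp add: vec_eq_iff matrix_def ext_matrix_def rng inv fa realmat_def to_coords_def)
  then show ?thesis by (simp add: det_ext_matrix[OF inj])
qed

text \<open>The real Jacobian determinant of a holomorphic map is a squared modulus, so the absolute
  value in the change of variables formula disappears; this is how the complex structure orients the
  manifold.\<close>

lemma integral_change_holomorphic:
  fixes \<tau> \<theta> :: "complex^'n::finite \<Rightarrow> complex^'n"
  assumes f: "compact_support S2 C2 f" and S: "open S"
    and \<tau>: "holomorphic_map_on \<tau> S" "\<tau> ` S = S2" and \<theta>: "continuous_on S2 \<theta>" "\<And>z. z \<in> S \<Longrightarrow> \<theta> (\<tau> z) = z"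
  shows "integral S2 f = integral S (\<lambda>z. det (realmat (cderiv \<tau> z)) * f (\<tau> z))"
proof -
  interpret f: compact_support S2 C2 f by fact
  have lin: "linear (cderiv \<tau> z)" if "z \<in> S" for z
    using holomorphic_map_onD(1)[OF \<tau>(1) that] has_derivative_linear by blast
  have det_eq: "det (realmat (cderiv \<tau> z)) = (cmod (det (matrix (cderiv \<tau> z))))\<^sup>2" if "z \<in> S" for z
    by (rule det_realmat[OF lin[OF that] holomorphic_map_onD(2)[OF \<tau>(1) that]])
  have "continuous_on S (\<lambda>z. realmat (cderiv \<tau> z) $ p $ q)" for p q
    by (cases "snd p")
      (auto simp: realmat_def rcoord_def intro!: continuous_intros holomorphic_cderiv_continuous[OF \<tau>(1) S])
  then have cdet: "continuous_on S (\<lambda>z. det (realmat (cderiv \<tau> z)))"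
    unfolding det_def by (intro continuous_on_sum continuous_on_mult continuous_on_const continuous_on_prod)
  have h: "compact_support S (\<theta> ` C2) (\<lambda>z. det (realmat (cderiv \<tau> z)) * f (\<tau> z))"
  proof
    show "compact (\<theta> ` C2)" by (rule compact_continuous_image[OF continuous_on_subset[OF \<theta>(1) f.CS] f.C])
    show "\<theta> ` C2 \<subseteq> S" using f.CS \<tau>(2) \<theta>(2) by force
    show "continuous_on S (\<lambda>z. det (realmat (cderiv \<tau> z)) * f (\<tau> z))"
      by (intro continuous_on_mult cdet continuous_on_compose2[OF f.f holomorphic_map_on_continuous[OF \<tau>(1)]]) (use \<tau>(2) in auto)
    show "det (realmat (cderiv \<tau> z)) * f (\<tau> z) = 0" if "z \<in> S - \<theta> ` C2" for z
    proof -
      have "\<tau> z \<in> S2 - C2" using that \<theta>(2) \<tau>(2) by (metis Diff_iff image_eqI)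
      then show ?thesis using f.z by simp
    qed
  qed (rule S)
  define g where "g x = to_coords (\<tau> (from_coords x))" for x :: "real^'n cidx"
  define g' where "g' x h = to_coords (cderiv \<tau> (from_coords x) (from_coords h))" for x h :: "real^'n cidx"
  \<comment> \<open>The change of variables formula is stated for vector-valued functions, hence the
    factor in the one-dimensional vector space.\<close>
  define F where "F x = f (from_coords x) *\<^sub>R (1 :: real^1)" for x :: "real^'n cidx"
  let ?S = "from_coords -` S" and ?S2 = "from_coords -` S2"
  note f2 = integral_from_coords[OF f] and h2 = integral_from_coords[OF h]
  have oS: "open ?S" using h2(1) compact_support.S by blast
  have gS: "g ` ?S = ?S2"
  proof -
    have "g ` ?S = to_coords ` \<tau> ` from_coords ` ?S" by (auto simp: g_def image_image)
    also have "from_coords ` ?S = S" by (metis from_to_coords surj_def surj_image_vimage_eq)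
    also have "to_coords ` \<tau> ` S = ?S2" unfolding \<tau>(2)
      by (auto simp: image_iff) (metis to_from_coords)
    finally show ?thesis .
  qed
  have bl1: "bounded_linear to_coords" "bounded_linear from_coords"
    by (simp_all add: to_coords_linear from_coords_linear linear_conv_bounded_linear[symmetric])
  have der: "(g has_derivative g' x) (at x within ?S)" if "x \<in> ?S" for x
  proof -
    have "((\<lambda>x. \<tau> (from_coords x)) has_derivative (\<lambda>h. cderiv \<tau> (from_coords x) (from_coords h))) (at x)"
      by (rule has_derivative_compose[OF bounded_linear_imp_has_derivative[OF bl1(2)]])
        (use that holomorphic_map_onD(1)[OF \<tau>(1)] in auto)
    from bounded_linear.has_derivative[OF bl1(1) this]
    show ?thesis unfolding g_def[abs_def] g'_def[abs_def] by (rule has_derivative_at_withinI)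
  qed
  have inj: "inj_on g ?S"
  proof (rule inj_onI)
    fix x y assume "x \<in> ?S" "y \<in> ?S" "g x = g y"
    then have "\<tau> (from_coords x) = \<tau> (from_coords y)" by (metis from_to_coords g_def)
    then have "from_coords x = from_coords y" using \<theta>(2) \<open>x \<in> ?S\<close> \<open>y \<in> ?S\<close> by (metis vimage_eq)
    then show "x = y" by (metis to_from_coords)
  qed
  have bl: "bounded_linear (\<lambda>r::real. r *\<^sub>R (1 :: real^1))" by (rule bounded_linear_scaleR_left)
  have F: "F absolutely_integrable_on ?S2"
    using absolutely_integrable_linear[OF compact_support.absolutely_integrable[OF f2(1)] bl] by (simp add: F_def[abs_def] o_def)
  have i1: "integral ?S2 F = integral ?S2 (\<lambda>x. f (from_coords x)) *\<^sub>R 1"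
    using integral_linear[OF compact_support.integrable[OF f2(1)] bl] by (simp add: F_def[abs_def] o_def)
  have "integral (g ` ?S) F = integral ?S (\<lambda>x. \<bar>det (matrix (g' x))\<bar> *\<^sub>R F (g x))"
    by (rule integral_change_of_variables[OF _ der inj]) (use oS F gS in auto)
  also have "\<dots> = integral ?S (\<lambda>x. (det (realmat (cderiv \<tau> (from_coords x))) * f (\<tau> (from_coords x))) *\<^sub>R 1)"
  proof (rule integral_cong)
    fix x assume x: "x \<in> ?S"
    have "det (matrix (g' x)) = det (realmat (cderiv \<tau> (from_coords x)))"
      unfolding g'_def[abs_def] by (rule det_matrix_coords) (use x lin in auto)
    then show "\<bar>det (matrix (g' x))\<bar> *\<^sub>R F (g x) = (det (realmat (cderiv \<tau> (from_coords x))) * f (\<tau> (from_coords x))) *\<^sub>R 1"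
      using det_eq[of "from_coords x"] x by (simp add: F_def g_def)
  qed
  also have "\<dots> = integral ?S (\<lambda>x. det (realmat (cderiv \<tau> (from_coords x))) * f (\<tau> (from_coords x))) *\<^sub>R 1"
    using integral_linear[OF compact_support.integrable[OF h2(1)] bl] by (simp add: o_def)
  finally have "integral ?S2 (\<lambda>x. f (from_coords x)) *\<^sub>R (1::real^1) = integral S (\<lambda>z. det (realmat (cderiv \<tau> z)) * f (\<tau> z)) *\<^sub>R 1"
    unfolding gS i1 h2(2) .
  then have "integral ?S2 (\<lambda>x. f (from_coords x)) = integral S (\<lambda>z. det (realmat (cderiv \<tau> z)) * f (\<tau> z))"
    by (simp add: scaleR_cancel_right)
  then show ?thesis using f2(2) by simp
qed

section \<open>A weak Harnack inequality\<close>

text \<open>Balls of the maximum norm, so that integrals over them are integrals over boxes.\<close>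

definition cube :: "'v::euclidean_space \<Rightarrow> real \<Rightarrow> 'v set" where
  "cube x r = cbox (x - r *\<^sub>R One) (x + r *\<^sub>R One)"

lemma mem_cube: "y \<in> cube x r \<longleftrightarrow> (\<forall>b\<in>Basis. \<bar>(y - x) \<bullet> b\<bar> \<le> r)"
  by (auto simp: cube_def mem_box inner_diff_left inner_add_left abs_le_iff algebra_simps) 

lemma cube_norm: "y \<in> cube x r \<Longrightarrow> norm (y - x) \<le> r * DIM('v)" for x :: "'v::euclidean_space"
proof -
  assume "y \<in> cube x r"
  then have "(\<Sum>b\<in>Basis. \<bar>(y - x) \<bullet> b\<bar>) \<le> (\<Sum>b\<in>(Basis::'v set). r)" by (intro sum_mono) (auto simp: mem_cube)
  with norm_le_l1[of "y - x"] show ?thesis by (simp add: mult.commute)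
qed

lemma cball_subset_cube: "cball x r \<subseteq> cube x r"
proof
  fix y assume "y \<in> cball x r"
  then show "y \<in> cube x r" using Basis_le_norm[of _ "y - x"] by (fastforce simp: mem_cube dist_norm norm_minus_commute)
qed

definition laplacian :: "('v::euclidean_space \<Rightarrow> real) \<Rightarrow> 'v \<Rightarrow> real" where
  "laplacian w x = (\<Sum>b\<in>Basis. frechet_derivative (\<lambda>y. frechet_derivative w (at y) b) (at x) b)"

text \<open>The powers 2 and 3 belong together: the gradient of the weight with exponent 3 is - 6
  \<xi> times the weight with exponent 2, which is what the integration by parts below needs. Both
  vanish outside the ball of radius \<open>R\<close>.\<close>

definition bump_pow :: "nat \<Rightarrow> real \<Rightarrow> 'v::euclidean_space \<Rightarrow> real" where
  "bump_pow m R \<xi> = max 0 (R\<^sup>2 - \<xi> \<bullet> \<xi>) ^ m"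

lemma bump_pow_has_derivative:
  "(bump_pow 3 R has_derivative (\<lambda>h. - 6 * bump_pow 2 R \<xi> * (\<xi> \<bullet> h))) (at \<xi>)"
proof -
  have r: "((\<lambda>t::real. max 0 t ^ 3) has_real_derivative 3 * (max 0 t)\<^sup>2) (at t)" for t
  proof -
    consider "t < 0" | "t = 0" | "t > 0" by linarith
    then show ?thesis
    proof cases
      case 1
      have "((\<lambda>_. 0::real) has_real_derivative 0) (at t)" by simp
      then have "((\<lambda>t::real. max 0 t ^ 3) has_real_derivative 0) (at t)"
        by (rule has_field_derivative_transform_within_open[of _ _ _ "{..<0}"]) (use 1 in auto)
      then show ?thesis using 1 by simp
    next
      case 2
      have "((\<lambda>h::real. (max 0 h)^3 / h) \<longlongrightarrow> 0) (at 0)"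
      proof (rule Lim_null_comparison)
        show "\<forall>\<^sub>F h in at (0::real). norm ((max 0 h)^3 / h) \<le> h\<^sup>2"
          by (auto simp: eventually_at_filter max_def power3_eq_cube power2_eq_square)
        show "((\<lambda>h::real. h\<^sup>2) \<longlongrightarrow> 0) (at 0)" by (auto intro!: tendsto_eq_intros)
      qed
      then show ?thesis using 2 by (simp add: DERIV_def)
    next
      case 3
      have "((\<lambda>t::real. t ^ 3) has_real_derivative 3 * t\<^sup>2) (at t)" by (auto intro!: derivative_eq_intros)
      then have "((\<lambda>t::real. max 0 t ^ 3) has_real_derivative 3 * t\<^sup>2) (at t)"
        by (rule has_field_derivative_transform_within_open[of _ _ _ "{0<..}"]) (use 3 in auto)
      then show ?thesis using 3 by simp
    qed
  qed
  have "((\<lambda>\<xi>::'a. R\<^sup>2 - \<xi> \<bullet> \<xi>) has_derivative (\<lambda>h. - (\<xi> \<bullet> h + h \<bullet> \<xi>))) (at \<xi>)"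
    by (auto intro!: derivative_eq_intros)
  from has_derivative_compose[OF this r[unfolded has_field_derivative_def]]
  show ?thesis by (simp add: bump_pow_def[abs_def] inner_commute algebra_simps)
qed

lemma bump_pow_continuous: "continuous_on A (bump_pow m R)"
  unfolding bump_pow_def[abs_def] by (intro continuous_intros)

lemma bump_pow_nonneg: "0 \<le> bump_pow m R \<xi>" by (simp add: bump_pow_def)

lemma bump_pow_zero: "0 < m \<Longrightarrow> R \<ge> 0 \<Longrightarrow> \<xi> \<notin> cball 0 R \<Longrightarrow> bump_pow m R \<xi> = 0"
proof -
  assume a: "0 < m" "R \<ge> 0" "\<xi> \<notin> cball 0 R"
  then have "R\<^sup>2 \<le> (norm \<xi>)\<^sup>2" by (intro power_mono) auto
  then show ?thesis using a by (simp add: bump_pow_def power2_norm_eq_inner)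
qed

text \<open>The derivative in \<open>s\<close> of the weighted mean \<open>\<integral> w(y+s\<xi>) (R\<^sup>2-\<xi>\<^sup>2)\<^sup>2 d\<xi>\<close> is, after an integration by
  parts, an integral of the Laplacian of \<open>w\<close> against a positive weight.\<close>

lemma weighted_mean_le:
  fixes w :: "'v::euclidean_space \<Rightarrow> real"
  assumes V: "open V" and w: "smooth_on w V" and R: "R > 0"
    and sub: "\<And>s \<xi>. s \<in> {0..1} \<Longrightarrow> \<xi> \<in> cube 0 R \<Longrightarrow> y + s *\<^sub>R \<xi> \<in> N" and NV: "N \<subseteq> V"
    and lap: "\<And>x. x \<in> N \<Longrightarrow> laplacian w x \<le> K" and K: "K \<ge> 0"
  shows "integral (cube 0 R) (\<lambda>\<xi>. w (y + \<xi>) * bump_pow 2 R \<xi>)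
    \<le> w y * integral (cube (0::'v) R) (bump_pow 2 R) + K / 6 * integral (cube (0::'v) R) (bump_pow 3 R)"
proof -
  let ?Q = "cube (0::'v) R"
  let ?D = "\<lambda>x. frechet_derivative w (at x)"
  let ?DD = "\<lambda>x b. frechet_derivative (\<lambda>y. ?D y b) (at x)"
  have inV: "y + s *\<^sub>R \<xi> \<in> V" if "s \<in> {0..1}" "\<xi> \<in> ?Q" for s \<xi> using sub[OF that] NV by blast
  have Q: "?Q = cbox (- R *\<^sub>R One) (R *\<^sub>R (One::'v))" by (simp add: cube_def)
  have wd: "(w has_derivative ?D x) (at x)" if "x \<in> V" for x using smooth_on_has_derivative[OF w V that] .
  have wdd: "((\<lambda>y. ?D y b) has_derivative ?DD x b) (at x)" if "x \<in> V" for x b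
    using smooth_on_has_derivative[OF smooth_on_frechet_derivative[OF w V] V that] .
  have cD: "continuous_on V (\<lambda>x. ?D x b)" for b using smooth_on_continuous[OF smooth_on_frechet_derivative[OF w V]] .
  have cDD: "continuous_on V (\<lambda>x. ?DD x b c)" for b c
    using smooth_on_continuous[OF smooth_on_frechet_derivative[OF smooth_on_frechet_derivative[OF w V] V]] .
  have cw: "continuous_on V w" by (rule smooth_on_continuous[OF w])
  have Dexp: "?D x \<xi> = (\<Sum>b\<in>Basis. (\<xi> \<bullet> b) * ?D x b)" if "x \<in> V" for x \<xi>
  proof -
    have "linear (?D x)" using wd[OF that] has_derivative_linear by blast
    then have "?D x (\<Sum>b\<in>Basis. (\<xi> \<bullet> b) *\<^sub>R b) = (\<Sum>b\<in>Basis. (\<xi> \<bullet> b) * ?D x b)"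
      by (simp add: linear_sum linear_cmul)
    then show ?thesis by (simp add: euclidean_representation)
  qed
  let ?f = "\<lambda>s \<xi>. w (y + s *\<^sub>R \<xi>) * bump_pow 2 R \<xi>"
  let ?f' = "\<lambda>s \<xi>. (\<Sum>b\<in>Basis. (\<xi> \<bullet> b) * ?D (y + s *\<^sub>R \<xi>) b) * bump_pow 2 R \<xi>"
  have der: "((\<lambda>s. integral (cbox (- R *\<^sub>R One) (R *\<^sub>R (One::'v))) (?f s)) has_vector_derivative integral (cbox (- R *\<^sub>R One) (R *\<^sub>R (One::'v))) (?f' s)) (at s within {0..1})"
    if s: "s \<in> {0..1}" for s
  proof (rule leibniz_rule_vector_derivative[where f="?f" and fx="?f'"])
    fix t \<xi> assume t: "t \<in> {0..1::real}" and x: "\<xi> \<in> cbox (- R *\<^sub>R One) (R *\<^sub>R (One::'v))"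
    have iv: "y + t *\<^sub>R \<xi> \<in> V" using inV[OF t] x Q by simp
    have lin: "linear (?D (y + t *\<^sub>R \<xi>))" using wd[OF iv] has_derivative_linear by blast
    have "((\<lambda>s. y + s *\<^sub>R \<xi>) has_derivative (\<lambda>h. h *\<^sub>R \<xi>)) (at t within {0..1})" by (auto intro!: derivative_eq_intros)
    from has_derivative_compose[OF this wd[OF iv]]
    have "((\<lambda>s. w (y + s *\<^sub>R \<xi>)) has_derivative (\<lambda>h. h *\<^sub>R ?D (y + t *\<^sub>R \<xi>) \<xi>)) (at t within {0..1})"
      by (simp add: linear_cmul[OF lin])
    then have "((\<lambda>s. w (y + s *\<^sub>R \<xi>)) has_real_derivative ?D (y + t *\<^sub>R \<xi>) \<xi>) (at t within {0..1})"
      by (simp add: has_field_derivative_def mult_commute_abs)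
    from DERIV_cmult_right[OF this, of "bump_pow 2 R \<xi>"]
    show "((\<lambda>s. ?f s \<xi>) has_vector_derivative ?f' t \<xi>) (at t within {0..1})"
      by (simp add: has_real_derivative_iff_has_vector_derivative Dexp[OF iv, of \<xi>])
  next
    show "?f t integrable_on cbox (- R *\<^sub>R One) (R *\<^sub>R (One::'v))" if "t \<in> {0..1}" for t
      by (intro integrable_continuous continuous_on_mult continuous_on_compose2[OF cw] continuous_intros bump_pow_continuous)
        (use inV[OF that] Q in auto)
    show "continuous_on ({0..1} \<times> cbox (- R *\<^sub>R One) (R *\<^sub>R (One::'v))) (\<lambda>(s, \<xi>). ?f' s \<xi>)"
      unfolding case_prod_unfold
      by (intro continuous_on_mult continuous_on_sum continuous_on_compose2[OF cD] continuous_intros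
          continuous_on_compose2[OF bump_pow_continuous[of UNIV]])
        (use inV Q in auto)
  qed (use s in auto)
  \<comment> \<open>The divergence in \<xi> of \<open>bump_pow 3 R \<xi>\<close> times the gradient
    of \<open>w\<close> at y + s \<xi> integrates to zero. It consists of - 6 times the integrand
    \<open>?f' s\<close> and of s times the Laplacian with the weight of exponent 3.\<close>
  have key: "6 * integral ?Q (?f' s) \<le> K * integral ?Q (bump_pow 3 R)" if s: "s \<in> {0..1}" for s
  proof -
    define W where "W = {\<xi>. y + s *\<^sub>R \<xi> \<in> V}"
    have oW: "open W" unfolding W_def
      by (rule open_vimage[OF V, unfolded vimage_def]) (intro continuous_intros)
    have QW: "?Q \<subseteq> W" using inV[OF s] by (auto simp: W_def)
    have CW: "cball 0 R \<subseteq> W" using cball_subset_cube QW by blast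
    have cont: "continuous_on W (\<lambda>\<xi>. g (y + s *\<^sub>R \<xi>))" if "continuous_on V g" for g :: "'v \<Rightarrow> real"
      by (intro continuous_on_compose2[OF that] continuous_intros) (auto simp: W_def)
    let ?P = "\<lambda>b \<xi> h. ?D (y + s *\<^sub>R \<xi>) b * (- 6 * bump_pow 2 R \<xi> * (\<xi> \<bullet> h)) + ?DD (y + s *\<^sub>R \<xi>) b (s *\<^sub>R h) * bump_pow 3 R \<xi>"
    have scale: "?DD (y + s *\<^sub>R \<xi>) b (s *\<^sub>R b) = s * ?DD (y + s *\<^sub>R \<xi>) b b" if "\<xi> \<in> W" for b \<xi>
      using linear_cmul[OF has_derivative_linear[OF wdd[of "y + s *\<^sub>R \<xi>" b]], of s b] that by (simp add: W_def)
    have z: "?P b \<xi> b = 0" if "\<xi> \<notin> cball 0 R" for b \<xi>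
      using bump_pow_zero[OF _ _ that, of 2] bump_pow_zero[OF _ _ that, of 3] R by simp
    have cP: "continuous_on W (\<lambda>\<xi>. ?P b \<xi> b)" for b
    proof (rule continuous_on_eq)
      show "continuous_on W (\<lambda>\<xi>. ?D (y + s *\<^sub>R \<xi>) b * (- 6 * bump_pow 2 R \<xi> * (\<xi> \<bullet> b)) + s * ?DD (y + s *\<^sub>R \<xi>) b b * bump_pow 3 R \<xi>)"
        by (intro continuous_intros cont[OF cD] cont[OF cDD] bump_pow_continuous)
    qed (simp add: scale)
    have "integral W (\<lambda>\<xi>. ?P b \<xi> b) = 0" for b
    proof (rule integral_derivative_eq_0[where f'="?P b" and e=b and f="\<lambda>\<xi>. ?D (y + s *\<^sub>R \<xi>) b * bump_pow 3 R \<xi>", OF oW compact_cball CW])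
      fix \<xi> assume "\<xi> \<in> W"
      then have iv: "y + s *\<^sub>R \<xi> \<in> V" by (simp add: W_def)
      have "((\<lambda>\<xi>. y + s *\<^sub>R \<xi>) has_derivative (\<lambda>h. s *\<^sub>R h)) (at \<xi>)" by (auto intro!: derivative_eq_intros)
      from has_derivative_mult[OF has_derivative_compose[OF this wdd[OF iv, of b]] bump_pow_has_derivative[of R]]
      show "((\<lambda>\<xi>. ?D (y + s *\<^sub>R \<xi>) b * bump_pow 3 R \<xi>) has_derivative ?P b \<xi>) (at \<xi>)" .
    next
      show "?D (y + s *\<^sub>R \<xi>) b * bump_pow 3 R \<xi> = 0" if "\<xi> \<in> W - cball 0 R" for \<xi>
        using bump_pow_zero[of 3 R \<xi>] that R by simp
    qed (rule cP)
    moreover have "compact_support W (cball 0 R) (\<lambda>\<xi>. ?P b \<xi> b)" for b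
      by unfold_locales (use oW CW cP z in auto)
    then have "integral W (\<lambda>\<xi>. ?P b \<xi> b) = integral ?Q (zext W (\<lambda>\<xi>. ?P b \<xi> b))" for b
      unfolding Q
      by (rule compact_support.integral_eq_cbox[symmetric]) (use cball_subset_cube[of "0::'v" R] Q in simp)
    moreover have "integral ?Q (zext W (\<lambda>\<xi>. ?P b \<xi> b)) = integral ?Q (\<lambda>\<xi>. ?P b \<xi> b)" for b
      by (rule integral_cong) (use QW in \<open>auto simp: zext_def\<close>)
    ultimately have 0: "integral ?Q (\<lambda>\<xi>. ?P b \<xi> b) = 0" for b by simp
    have iP: "(\<lambda>\<xi>. ?P b \<xi> b) integrable_on ?Q" for b
      unfolding Q by (rule integrable_continuous) (use continuous_on_subset[OF cP QW] Q in auto)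
    have if': "?f' s integrable_on ?Q"
      unfolding Q by (intro integrable_continuous continuous_on_mult continuous_on_sum continuous_intros
          continuous_on_subset[OF cont[OF cD]] bump_pow_continuous) (use QW Q in auto)
    have iL: "(\<lambda>\<xi>. s * laplacian w (y + s *\<^sub>R \<xi>) * bump_pow 3 R \<xi>) integrable_on ?Q"
      unfolding Q laplacian_def by (intro integrable_continuous continuous_on_mult continuous_on_sum continuous_intros
          continuous_on_subset[OF cont[OF cDD]] bump_pow_continuous) (use QW Q in auto)
    have "0 = (\<Sum>b\<in>Basis. integral ?Q (\<lambda>\<xi>. ?P b \<xi> b))" by (simp only: 0 sum.neutral_const)
    also have "\<dots> = integral ?Q (\<lambda>\<xi>. \<Sum>b\<in>Basis. ?P b \<xi> b)" by (rule integral_sum[symmetric]) (use iP in auto)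
    also have "\<dots> = integral ?Q (\<lambda>\<xi>. s * laplacian w (y + s *\<^sub>R \<xi>) * bump_pow 3 R \<xi> - 6 * ?f' s \<xi>)"
    proof (rule integral_cong)
      fix \<xi> assume "\<xi> \<in> ?Q"
      then have "\<xi> \<in> W" using QW by blast
      then show "(\<Sum>b\<in>Basis. ?P b \<xi> b) = s * laplacian w (y + s *\<^sub>R \<xi>) * bump_pow 3 R \<xi> - 6 * ?f' s \<xi>"
        by (simp add: scale laplacian_def sum_distrib_left sum_distrib_right sum.distrib sum_negf sum_subtractf algebra_simps)
    qed
    also have "\<dots> = integral ?Q (\<lambda>\<xi>. s * laplacian w (y + s *\<^sub>R \<xi>) * bump_pow 3 R \<xi>) - integral ?Q (\<lambda>\<xi>. 6 * ?f' s \<xi>)"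
      by (rule integral_diff[OF iL]) (rule integrable_on_mult_right[OF if'])
    finally have "6 * integral ?Q (?f' s) = integral ?Q (\<lambda>\<xi>. s * laplacian w (y + s *\<^sub>R \<xi>) * bump_pow 3 R \<xi>)"
      by simp
    also have "\<dots> \<le> integral ?Q (\<lambda>\<xi>. K * bump_pow 3 R \<xi>)"
    proof (rule integral_le[OF iL])
      show "(\<lambda>\<xi>. K * bump_pow 3 R \<xi>) integrable_on ?Q"
        unfolding Q by (intro integrable_continuous continuous_intros bump_pow_continuous)
      fix \<xi> assume x: "\<xi> \<in> ?Q"
      have "s * laplacian w (y + s *\<^sub>R \<xi>) \<le> s * K" using lap[OF sub[OF s x]] s by (intro mult_left_mono) auto
      also have "s * K \<le> K" using s K by (simp add: mult_left_le_one_le)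
      finally show "s * laplacian w (y + s *\<^sub>R \<xi>) * bump_pow 3 R \<xi> \<le> K * bump_pow 3 R \<xi>"
        by (intro mult_right_mono bump_pow_nonneg)
    qed
    finally show ?thesis by simp
  qed
  \<comment> \<open>At s = 1 the integral is the weighted mean about \<open>y\<close>, at s = 0 it
    is the value at \<open>y\<close> times the total weight; the mean value theorem turns the bound
    on the derivative into the claim.\<close>
  have "\<exists>x\<in>{0<..<1}. integral ?Q (?f 1) - integral ?Q (?f 0) = (1 - 0) *\<^sub>R integral ?Q (?f' x)"
    by (rule mvt_simple) (use der in \<open>auto simp: Q has_vector_derivative_def\<close>)
  then obtain s where "s \<in> {0<..<1}" "integral ?Q (?f 1) - integral ?Q (?f 0) = integral ?Q (?f' s)" by auto
  with key[of s] have "integral ?Q (?f 1) - integral ?Q (?f 0) \<le> K / 6 * integral ?Q (bump_pow 3 R)" by simp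
  then show ?thesis by simp
qed

text \<open>The mean about \<open>y\<close> with the weight of exponent 2 is controlled by the value
  at \<open>y\<close>, while for every \<open>y\<close> in the small cube the weight is at least a
  fixed \<open>B\<close> on all of that cube. As \<open>w\<close> is nonnegative, the integral over
  the cube is at most the mean divided by \<open>B\<close>. Only an upper bound of the Laplacian
  enters, as for supersolutions.\<close>

lemma weak_harnack:
  fixes x0 :: "'v::euclidean_space"
  assumes V: "open V" and r: "r > 0" and sub: "cball x0 (4 * r * real DIM('v) * real DIM('v)) \<subseteq> V"
  obtains C where "C > 0" and
    "\<And>w K y. smooth_on w V \<Longrightarrow> (\<And>x. x \<in> V \<Longrightarrow> 0 \<le> w x) \<Longrightarrow>
      (\<And>x. x \<in> cball x0 (4 * r * real DIM('v) * real DIM('v)) \<Longrightarrow> laplacian w x \<le> K) \<Longrightarrow> 0 \<le> K \<Longrightarrow> y \<in> cube x0 r \<Longrightarrow>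
      integral (cube x0 r) w \<le> C * (w y + K)"
proof -
  let ?d = "real DIM('v)" and ?N = "cball x0 (4 * r * real DIM('v) * real DIM('v))"
  \<comment> \<open>With d the dimension, points of the cube are at distance at most 2 r d from
    \<open>y\<close>, so this radius covers them with room to spare. The points y + s \<xi> then
    stay within r d + 3 r d^2, hence within 4 r d^2, of \<open>x0\<close>; this explains the radius
    in the hypothesis.\<close>
  define R where "R = 3 * r * ?d"
  have d: "?d \<ge> 1" by (simp add: DIM_positive Suc_leI)
  have R: "R > 0" using r d by (simp add: R_def)
  \<comment> \<open>The base of the weight is at least R^2 - (2 r d)^2 = 5 r^2 d^2 on the small
    cube.\<close>
  define B where "B = (5 * r\<^sup>2 * ?d\<^sup>2)\<^sup>2"
  have B: "B > 0" using r d by (simp add: B_def)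
  define I2 where "I2 = integral (cube (0::'v) R) (bump_pow 2 R)"
  define I3 where "I3 = integral (cube (0::'v) R) (bump_pow 3 R)"
  have I: "I2 \<ge> 0" "I3 \<ge> 0" unfolding I2_def I3_def cube_def
    by (intro integral_nonneg integrable_continuous bump_pow_continuous; simp add: bump_pow_nonneg)+
  define C where "C = (I2 + I3 + 1) / B"
  have rd: "r * ?d \<le> r * ?d * ?d" using d r by simp
  show ?thesis
  proof (rule that)
    show "C > 0" using I B by (simp add: C_def)
    fix w :: "'v \<Rightarrow> real" and K y
    assume w: "smooth_on w V" "\<And>x. x \<in> V \<Longrightarrow> 0 \<le> w x" "\<And>x. x \<in> ?N \<Longrightarrow> laplacian w x \<le> K" and K: "0 \<le> K" and y: "y \<in> cube x0 r"
    have yx: "norm (y - x0) \<le> r * ?d" by (rule cube_norm[OF y])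
    have inN: "y + s *\<^sub>R \<xi> \<in> ?N" if "s \<in> {0..1}" "\<xi> \<in> cube 0 R" for s \<xi>
    proof -
      have "s * norm \<xi> \<le> 1 * norm \<xi>" using that by (intro mult_right_mono) auto
      also have "1 * norm \<xi> \<le> R * ?d" using cube_norm[OF that(2)] by simp
      finally have "norm (s *\<^sub>R \<xi>) \<le> 3 * r * ?d * ?d" using that by (simp add: R_def)
      moreover have "norm (y + s *\<^sub>R \<xi> - x0) \<le> norm (y - x0) + norm (s *\<^sub>R \<xi>)"
        using norm_triangle_ineq[of "y - x0" "s *\<^sub>R \<xi>"] by (simp add: algebra_simps)
      ultimately have "norm (y + s *\<^sub>R \<xi> - x0) \<le> 4 * r * ?d * ?d" using yx rd by linarith
      then show ?thesis by (simp add: dist_norm norm_minus_commute)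
    qed
    have le: "integral (cube 0 R) (\<lambda>\<xi>. w (y + \<xi>) * bump_pow 2 R \<xi>) \<le> w y * I2 + K / 6 * I3"
      unfolding I2_def I3_def by (rule weighted_mean_le[OF V w(1) R inN sub w(3) K])
    have cw: "continuous_on V w" by (rule smooth_on_continuous[OF w(1)])
    have Qy: "cube y R \<subseteq> V"
    proof
      fix x assume "x \<in> cube y R"
      then have "x - y \<in> cube 0 R" by (simp add: mem_cube)
      from inN[of 1, OF _ this] show "x \<in> V" using sub by auto
    qed
    have sub2: "cube x0 r \<subseteq> cube y R"
    proof
      fix x assume x: "x \<in> cube x0 r"
      have "\<bar>(x - y) \<bullet> b\<bar> \<le> R" if b: "b \<in> Basis" for b
      proof -
        have "\<bar>(x - x0) \<bullet> b\<bar> \<le> r" "\<bar>(y - x0) \<bullet> b\<bar> \<le> r" using x y b by (auto simp: mem_cube)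
        then have "\<bar>(x - y) \<bullet> b\<bar> \<le> 2 * r" by (simp add: inner_diff_left)
        also have "\<dots> \<le> 3 * (r * 1)" using r by simp
        also have "\<dots> \<le> 3 * (r * ?d)" using d r by (intro mult_left_mono) auto
        finally show ?thesis by (simp add: R_def)
      qed
      then show "x \<in> cube y R" by (simp add: mem_cube)
    qed
    have eq: "integral (cube 0 R) (\<lambda>\<xi>. w (y + \<xi>) * bump_pow 2 R \<xi>) = integral (cube y R) (\<lambda>x. w x * bump_pow 2 R (x - y))"
      using integral_shift_cbox_plus[of "- R *\<^sub>R One" "R *\<^sub>R One" "\<lambda>x. w x * bump_pow 2 R (x - y)" y]
      by (simp add: cube_def o_def algebra_simps)
    have cg: "continuous_on A (\<lambda>x. bump_pow 2 R (x - y))" for A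
      by (rule continuous_on_compose2[OF bump_pow_continuous[of UNIV]]) (auto intro: continuous_intros)
    have int: "(\<lambda>x. w x * bump_pow 2 R (x - y)) integrable_on cube x r'" if "cube x r' \<subseteq> V" for x r'
      unfolding cube_def by (intro integrable_continuous continuous_on_mult cg continuous_on_subset[OF cw]) (use that in \<open>simp add: cube_def\<close>)
    have "B * integral (cube x0 r) w = integral (cube x0 r) (\<lambda>x. B * w x)" by simp
    also have "\<dots> \<le> integral (cube x0 r) (\<lambda>x. w x * bump_pow 2 R (x - y))"
    proof (rule integral_le)
      show "(\<lambda>x. B * w x) integrable_on cube x0 r"
        unfolding cube_def by (intro integrable_continuous continuous_intros continuous_on_subset[OF cw]) (use sub2 Qy in \<open>simp add: cube_def\<close>)
      show "(\<lambda>x. w x * bump_pow 2 R (x - y)) integrable_on cube x0 r" using int sub2 Qy by blast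
      fix x assume x: "x \<in> cube x0 r"
      have "norm (x - y) \<le> norm (x - x0) + norm (y - x0)" using norm_triangle_ineq4[of "x - x0" "y - x0"] by simp
      also have "\<dots> \<le> 2 * (r * ?d)" using yx cube_norm[OF x] by linarith
      finally have "(norm (x - y))\<^sup>2 \<le> (2 * (r * ?d))\<^sup>2" by (intro power_mono) auto
      then have "5 * r\<^sup>2 * ?d\<^sup>2 \<le> R\<^sup>2 - (x - y) \<bullet> (x - y)"
        by (simp add: R_def power2_norm_eq_inner power_mult_distrib)
      then have "B \<le> bump_pow 2 R (x - y)" unfolding B_def bump_pow_def by (intro power_mono) auto
      moreover have "0 \<le> w x" using w(2) x sub2 Qy by blast
      ultimately show "B * w x \<le> w x * bump_pow 2 R (x - y)" by (metis mult.commute mult_left_mono)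
    qed
    also have "\<dots> \<le> integral (cube y R) (\<lambda>x. w x * bump_pow 2 R (x - y))"
      by (rule integral_subset_le[OF sub2]) (use int sub2 Qy w(2) in \<open>auto intro!: mult_nonneg_nonneg bump_pow_nonneg\<close>)
    also have "\<dots> \<le> w y * I2 + K / 6 * I3" using le eq by simp
    also have "\<dots> \<le> (I2 + I3 + 1) * (w y + K)"
    proof -
      have "y \<in> V" using sub2 Qy y by blast
      then have "0 \<le> w y" by (rule w(2))
      then have "0 \<le> w y * (I3 + 1)" "0 \<le> K * (I2 + 1)" "0 \<le> K * I3" using I K by auto
      then show ?thesis by (simp add: algebra_simps)
    qed
    finally show "integral (cube x0 r) w \<le> C * (w y + K)" using B by (simp add: C_def field_simps)
  qed
qed

section \<open>The operator \<open>dd\<^sup>c\<close> in coordinates\<close>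

abbreviation fderiv :: "('v::real_normed_vector \<Rightarrow> 'w::real_normed_vector) \<Rightarrow> 'v \<Rightarrow> 'v \<Rightarrow> 'w" where
  "fderiv f z \<equiv> frechet_derivative f (at z)"

text \<open>The operator d^c, normalised by -1/2 so that its exterior derivative \<open>ddcl\<close>
  is i times del delbar; the coefficient matrix of \<open>ddcl u z\<close> consists of the mixed
  derivatives of \<open>u\<close> in z_i and zbar_j.\<close>

definition dcl :: "(complex^'n \<Rightarrow> real) \<Rightarrow> complex^'n \<Rightarrow> complex^'n \<Rightarrow> real" where
  "dcl u z w = - (1/2) * fderiv u z (\<i> *s w)"

definition ddcl :: "(complex^'n::finite \<Rightarrow> real) \<Rightarrow> complex^'n \<Rightarrow> complex^'n \<Rightarrow> complex^'n \<Rightarrow> real" where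
  "ddcl u z v w = fderiv (\<lambda>y. dcl u y w) z v - fderiv (\<lambda>y. dcl u y v) z w"

abbreviation hess :: "('v::real_normed_vector \<Rightarrow> real) \<Rightarrow> 'v \<Rightarrow> 'v \<Rightarrow> 'v \<Rightarrow> real" where
  "hess u z a b \<equiv> fderiv (\<lambda>y. fderiv u y a) z b"

lemma fderiv_eqI: "(f has_derivative f') (at z) \<Longrightarrow> fderiv f z = f'"
  by (rule frechet_derivative_at[symmetric])

lemma fderiv_cong_open:
  assumes "open V" "z \<in> V" "\<And>y. y \<in> V \<Longrightarrow> f y = g y"
  shows "fderiv f z = fderiv g z"
proof -
  have "(f has_derivative f') (at z) \<longleftrightarrow> (g has_derivative f') (at z)" for f'
    using has_derivative_transform_within_open[of f f' z UNIV V g] has_derivative_transform_within_open[of g f' z UNIV V f] assms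
    by auto
  then show ?thesis by (simp add: frechet_derivative_def)
qed

locale smooth_at =
  fixes V :: "(complex^'n::finite) set" and u :: "complex^'n \<Rightarrow> real"
  assumes V: "open V" and u: "smooth_on u V"
begin

lemma d1: "z \<in> V \<Longrightarrow> (u has_derivative fderiv u z) (at z)"
  by (rule smooth_on_has_derivative[OF u V])

lemma d2: "z \<in> V \<Longrightarrow> ((\<lambda>y. fderiv u y a) has_derivative hess u z a) (at z)"
  by (rule smooth_on_has_derivative[OF smooth_on_frechet_derivative[OF u V] V])

lemma hess_linear: "z \<in> V \<Longrightarrow> linear (hess u z a)"
  using d2 has_derivative_linear by blast

lemma hess_sym: "z \<in> V \<Longrightarrow> hess u z a b = hess u z b a"
  by (rule smooth_second_derivative_symmetric[OF V _ u])

lemma hess_linear2: "z \<in> V \<Longrightarrow> linear (\<lambda>a. hess u z a b)"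
  using hess_linear[of z b] by (simp add: hess_sym[of z _ b])

lemma smooth_dcl: "smooth_on (\<lambda>z. dcl u z w) V"
  unfolding dcl_def by (intro smooth_on_mult smooth_on_const smooth_on_frechet_derivative u V)

lemma dcl_linear: "z \<in> V \<Longrightarrow> linear (dcl u z)"
proof -
  assume z: "z \<in> V"
  have l: "linear (fderiv u z)" using d1[OF z] has_derivative_linear by blast
  show ?thesis
    unfolding dcl_def
    by (rule linearI)
      (simp_all add: vector_add_ldistrib linear_add[OF l] linear_cmul[OF l] scaleR_smult_commute[symmetric] algebra_simps)
qed

lemma ddcl_hess: "z \<in> V \<Longrightarrow> ddcl u z v w = - (1/2) * (hess u z (\<i> *s w) v - hess u z (\<i> *s v) w)"
proof -
  assume z: "z \<in> V"
  have "fderiv (\<lambda>y. dcl u y w) z = (\<lambda>v. - (1/2) * hess u z (\<i> *s w) v)" for w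
    unfolding dcl_def by (intro fderiv_eqI has_derivative_mult_right d2 z)
  then show ?thesis by (simp add: ddcl_def algebra_simps)
qed

text \<open>Up to the factor 1/2 this is the Laplacian of \<open>u\<close> in the complex direction
  \<open>v\<close>, the bridge from (1,1)-forms to the flat Laplacian.\<close>

lemma ddcl_i: "z \<in> V \<Longrightarrow> ddcl u z v (\<i> *s v) = (1/2) * (hess u z v v + hess u z (\<i> *s v) (\<i> *s v))"
proof -
  assume z: "z \<in> V"
  show ?thesis unfolding ddcl_hess[OF z] i_smult_smult linear_neg[OF hess_linear2[OF z]] by (simp add: field_simps)
qed

lemma ddcl_real11:
  assumes z: "z \<in> V"
  shows "real11 (ddcl u z)"
  unfolding real11_def
proof (intro conjI allI)
  show "linear (ddcl u z v)" for v
    unfolding ddcl_hess[OF z]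
    by (rule linearI)
      (simp_all add: vector_add_ldistrib linear_add[OF hess_linear[OF z]] linear_add[OF hess_linear2[OF z]]
        linear_cmul[OF hess_linear[OF z]] linear_cmul[OF hess_linear2[OF z]] scaleR_smult_commute[symmetric] algebra_simps)
  show "ddcl u z w v = - ddcl u z v w" for v w by (simp add: ddcl_def)
  show "ddcl u z (\<i> *s v) (\<i> *s w) = ddcl u z v w" for v w
    unfolding ddcl_hess[OF z] i_smult_smult linear_neg[OF hess_linear2[OF z]]
    using hess_sym[OF z, of w "\<i> *s v"] hess_sym[OF z, of v "\<i> *s w"] by simp
qed

text \<open>Connects the coordinate formula in the definition of \<open>Ric\<close> with the
  operator \<open>ddcl\<close>, which behaves well under changes of charts.\<close>

lemma d_z_d_zbar:
  assumes z: "z \<in> V"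
  shows "d_z i (d_zbar j (\<lambda>y. complex_of_real (u y))) z = hermitian_coeff (ddcl u z) $ i $ j"
proof -
  let ?e = "\<lambda>i. axis i 1 :: complex^'n" and ?f = "\<lambda>i. axis i \<i> :: complex^'n"
  have zb: "d_zbar j (\<lambda>y. complex_of_real (u y)) y = (of_real (fderiv u y (?e j)) + \<i> * of_real (fderiv u y (?f j))) / 2"
    if "y \<in> V" for y
  proof -
    have "((\<lambda>y. complex_of_real (u y)) has_derivative (\<lambda>h. of_real (fderiv u y h))) (at y)"
      by (rule has_derivative_of_real[OF d1[OF that]])
    then have "fderiv (\<lambda>y. complex_of_real (u y)) y = (\<lambda>h. of_real (fderiv u y h))" by (rule fderiv_eqI)
    then show ?thesis by (simp add: d_zbar_def)
  qed
  have "((\<lambda>y. (of_real (fderiv u y (?e j)) + \<i> * of_real (fderiv u y (?f j))) / 2 :: complex) has_derivative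
     (\<lambda>h. (of_real (hess u z (?e j) h) + \<i> * of_real (hess u z (?f j) h)) / 2)) (at z)"
    unfolding divide_inverse
    by (intro has_derivative_mult_left has_derivative_add has_derivative_mult_right has_derivative_of_real d2 z)
  from has_derivative_transform_within_open[OF this V z, of "d_zbar j (\<lambda>y. complex_of_real (u y))"]
  have "fderiv (d_zbar j (\<lambda>y. complex_of_real (u y))) z = (\<lambda>h. (of_real (hess u z (?e j) h) + \<i> * of_real (hess u z (?f j) h)) / 2)"
    by (intro fderiv_eqI) (simp add: zb)
  then have L: "d_z i (d_zbar j (\<lambda>y. complex_of_real (u y))) z
     = ((of_real (hess u z (?e j) (?e i)) + \<i> * of_real (hess u z (?f j) (?e i))) / 2
       - \<i> * ((of_real (hess u z (?e j) (?f i)) + \<i> * of_real (hess u z (?f j) (?f i))) / 2)) / 2"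
    by (simp add: d_z_def)
  have ie: "\<i> *s ?e i = ?f i" for i by (simp add: vec_eq_iff axis_def)
  have iff: "\<i> *s ?f i = - ?e i" for i by (simp add: vec_eq_iff axis_def)
  have R: "hermitian_coeff (ddcl u z) $ i $ j = (complex_of_real (- (1/2) * (- hess u z (?e j) (?e i) - hess u z (?f i) (?f j)))
      - \<i> * complex_of_real (- (1/2) * (hess u z (?f j) (?e i) - hess u z (?f i) (?e j)))) / 2"
    unfolding hermitian_coeff_def ddcl_hess[OF z] vec_lambda_beta ie iff linear_neg[OF hess_linear2[OF z]] ..
  show ?thesis unfolding L R hess_sym[OF z, of "?f i" "?f j"] hess_sym[OF z, of "?f i" "?e j"]
    by (simp add: complex_eq_iff field_simps)
qed

end

lemma form_of_coeff_uminus: "form_of_coeff (- h) v w = - form_of_coeff h v w"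
  by (simp add: form_of_coeff_def sum_negf)

abbreviation ricpot :: "('a, 'n::finite) form2 \<Rightarrow> ('a, 'n) chart \<Rightarrow> complex^'n \<Rightarrow> real" where
  "ricpot \<omega> c y \<equiv> ln (Re (det (hermitian_coeff (\<omega> c y))))"

lemma Ric_ddcl:
  assumes "open V" "smooth_on (ricpot \<omega> c) V" "z \<in> V"
  shows "Ric \<omega> c z v w = - ddcl (ricpot \<omega> c) z v w"
proof -
  interpret smooth_at V "ricpot \<omega> c" by unfold_locales (use assms in auto)
  have "(\<chi> i j. - d_z i (d_zbar j (\<lambda>y. complex_of_real (ricpot \<omega> c y))) z) = - hermitian_coeff (ddcl (ricpot \<omega> c) z)"
    by (simp add: vec_eq_iff d_z_d_zbar[OF assms(3)])
  then show ?thesis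
    by (simp add: Ric_def form_of_coeff_uminus real11_form_of_coeff[OF ddcl_real11[OF assms(3)]])
qed

lemma ddcl_cong_open:
  assumes "open V" "z \<in> V" "\<And>y. y \<in> V \<Longrightarrow> f y = g y"
  shows "ddcl f z = ddcl g z"
proof -
  have 1: "dcl f y w = dcl g y w" if "y \<in> V" for y w
    unfolding dcl_def using fderiv_cong_open[OF assms(1) that assms(3)] by simp
  have "fderiv (\<lambda>y. dcl f y w) z = fderiv (\<lambda>y. dcl g y w) z" for w
    by (rule fderiv_cong_open[OF assms(1,2) 1])
  then show ?thesis by (simp add: ddcl_def fun_eq_iff)
qed

lemma ddcl_add:
  assumes "open V" "smooth_on f V" "smooth_on g V" "z \<in> V"
  shows "ddcl (\<lambda>y. a * f y + b * g y) z v w = a * ddcl f z v w + b * ddcl g z v w"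
proof -
  interpret f: smooth_at V f by unfold_locales (use assms in auto)
  interpret g: smooth_at V g by unfold_locales (use assms in auto)
  interpret fg: smooth_at V "\<lambda>y. a * f y + b * g y"
    by unfold_locales (auto intro!: smooth_on_add smooth_on_mult assms)
  have 1: "fderiv (\<lambda>y. a * f y + b * g y) y = (\<lambda>h. a * fderiv f y h + b * fderiv g y h)" if "y \<in> V" for y
    by (intro fderiv_eqI has_derivative_add has_derivative_mult_right f.d1 g.d1 that)
  have "hess (\<lambda>y. a * f y + b * g y) z p q = a * hess f z p q + b * hess g z p q" for p q
  proof -
    have "((\<lambda>y. a * fderiv f y p + b * fderiv g y p) has_derivative (\<lambda>h. a * hess f z p h + b * hess g z p h)) (at z)"
      by (intro has_derivative_add has_derivative_mult_right f.d2 g.d2 assms)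
    then have "fderiv (\<lambda>y. a * fderiv f y p + b * fderiv g y p) z = (\<lambda>h. a * hess f z p h + b * hess g z p h)" by (rule fderiv_eqI)
    moreover have "fderiv (\<lambda>y. fderiv (\<lambda>y. a * f y + b * g y) y p) z = fderiv (\<lambda>y. a * fderiv f y p + b * fderiv g y p) z"
      by (rule fderiv_cong_open[OF assms(1,4)]) (simp add: 1)
    ultimately show ?thesis by simp
  qed
  then show ?thesis unfolding f.ddcl_hess[OF assms(4)] g.ddcl_hess[OF assms(4)] fg.ddcl_hess[OF assms(4)] by (simp add: algebra_simps)
qed

lemma linear_inner_expansion:
  fixes L :: "'v::euclidean_space \<Rightarrow> real"
  assumes "linear L"
  shows "L x = (\<Sum>b\<in>Basis. (x \<bullet> b) * L b)"
proof -
  have "L (\<Sum>b\<in>Basis. (x \<bullet> b) *\<^sub>R b) = (\<Sum>b\<in>Basis. (x \<bullet> b) * L b)"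
    using assms by (simp add: linear_sum linear_cmul)
  then show ?thesis by (simp add: euclidean_representation)
qed

text \<open>The second derivatives of \<open>\<tau>\<close> cancel because they are symmetric.\<close>

lemma ddcl_compose:
  fixes \<tau> :: "complex^'n::finite \<Rightarrow> complex^'n"
  assumes S: "open S" and S2: "open S2" and \<tau>: "holomorphic_map_on \<tau> S" and im: "\<tau> ` S \<subseteq> S2"
    and u: "smooth_on u S2" and z: "z \<in> S"
  shows "ddcl (\<lambda>y. u (\<tau> y)) z v w = ddcl u (\<tau> z) (cderiv \<tau> z v) (cderiv \<tau> z w)"
proof -
  interpret u: smooth_at S2 u by unfold_locales (use S2 u in auto)
  note hol = holomorphic_map_onD[OF \<tau>]
  have \<tau>s: "smooth_on \<tau> S" by (rule holomorphic_imp_smooth[OF \<tau> S])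
  have inS2: "\<tau> y \<in> S2" if "y \<in> S" for y using im that by blast
  have d1: "fderiv (\<lambda>y. u (\<tau> y)) y = (\<lambda>h. fderiv u (\<tau> y) (cderiv \<tau> y h))" if "y \<in> S" for y
    by (rule fderiv_eqI[OF has_derivative_compose[OF hol(1)[OF that] u.d1[OF inS2[OF that]]]])
  \<comment> \<open>The expansion separates the moving vector \<open>cderiv \<tau> y w\<close> from
    the moving base point, so that the product rule applies.\<close>
  have dc: "dcl (\<lambda>y. u (\<tau> y)) y w = (\<Sum>b\<in>Basis. (cderiv \<tau> y w \<bullet> b) * dcl u (\<tau> y) b)" if "y \<in> S" for y w
  proof -
    have "dcl (\<lambda>y. u (\<tau> y)) y w = dcl u (\<tau> y) (cderiv \<tau> y w)"
      unfolding dcl_def d1[OF that] hol(2)[OF that] ..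
    also have "\<dots> = (\<Sum>b\<in>Basis. (cderiv \<tau> y w \<bullet> b) * dcl u (\<tau> y) b)"
      by (rule linear_inner_expansion[OF u.dcl_linear[OF inS2[OF that]]])
    finally show ?thesis .
  qed
  define \<tau>2 where "\<tau>2 w = fderiv (\<lambda>y. cderiv \<tau> y w) z" for w
  have d\<tau>: "((\<lambda>y. cderiv \<tau> y w) has_derivative \<tau>2 w) (at z)" for w
    unfolding \<tau>2_def cderiv_def by (rule smooth_on_has_derivative[OF smooth_on_frechet_derivative[OF \<tau>s S] S z])
  have sym: "\<tau>2 w v = \<tau>2 v w" for v w
  proof -
    have "\<tau>2 w v \<bullet> b = \<tau>2 v w \<bullet> b" for b
      by (rule second_derivative_symmetric[OF S z, of "\<lambda>x. \<tau> x \<bullet> b" "\<lambda>x v. cderiv \<tau> x v \<bullet> b"])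
        (auto intro!: has_derivative_inner_left hol(1) d\<tau>)
    then show ?thesis by (simp add: euclidean_eq_iff[of "\<tau>2 w v"])
  qed
  define E where "E b = fderiv (\<lambda>x. dcl u x b) (\<tau> z)" for b
  have dE: "((\<lambda>x. dcl u x b) has_derivative E b) (at (\<tau> z))" for b
    unfolding E_def by (rule smooth_on_has_derivative[OF u.smooth_dcl S2 inS2[OF z]])
  have E_lin: "linear (\<lambda>b. E b h)" for h
  proof -
    have "E b h = - (1/2) * hess u (\<tau> z) (\<i> *s b) h" for b
      unfolding E_def dcl_def
      by (subst fderiv_eqI[OF has_derivative_mult_right[OF u.d2[OF inS2[OF z]]]]) simp
    then show ?thesis
      by (intro linearI) (simp_all add: vector_add_ldistrib linear_add[OF u.hess_linear2[OF inS2[OF z]]]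
          linear_cmul[OF u.hess_linear2[OF inS2[OF z]]] scaleR_smult_commute[symmetric] algebra_simps)
  qed
  have main: "fderiv (\<lambda>y. dcl (\<lambda>y. u (\<tau> y)) y w) z v = E (cderiv \<tau> z w) (cderiv \<tau> z v) + dcl u (\<tau> z) (\<tau>2 w v)" for v w
  proof -
    have "((\<lambda>y. \<Sum>b\<in>Basis. (cderiv \<tau> y w \<bullet> b) * dcl u (\<tau> y) b) has_derivative
       (\<lambda>h. \<Sum>b\<in>Basis. (cderiv \<tau> z w \<bullet> b) * E b (cderiv \<tau> z h) + (\<tau>2 w h \<bullet> b) * dcl u (\<tau> z) b)) (at z)"
      by (intro has_derivative_sum has_derivative_mult has_derivative_inner_left d\<tau> has_derivative_compose[OF hol(1)[OF z] dE])
    from has_derivative_transform_within_open[OF this S z, of "\<lambda>y. dcl (\<lambda>y. u (\<tau> y)) y w"] dc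
    have "fderiv (\<lambda>y. dcl (\<lambda>y. u (\<tau> y)) y w) z = (\<lambda>h. \<Sum>b\<in>Basis. (cderiv \<tau> z w \<bullet> b) * E b (cderiv \<tau> z h) + (\<tau>2 w h \<bullet> b) * dcl u (\<tau> z) b)"
      by (intro fderiv_eqI) simp
    then show ?thesis
      using linear_inner_expansion[OF u.dcl_linear[OF inS2[OF z]], of "\<tau>2 w v"] linear_inner_expansion[OF E_lin, of "cderiv \<tau> z w" "cderiv \<tau> z v"]
      by (simp add: sum.distrib)
  qed
  show ?thesis unfolding ddcl_def main sym[of w v] by (simp add: E_def)
qed

lemma smooth_on_Re: "smooth_on J S \<Longrightarrow> smooth_on (\<lambda>x. Re (J x)) S"
  and smooth_on_Im: "smooth_on J S \<Longrightarrow> smooth_on (\<lambda>x. Im (J x)) S"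
  by (rule smooth_on_linear_comp, rule bounded_linear_Re bounded_linear_Im, assumption)+

lemma smooth_on_ln_norm_square:
  assumes "smooth_on J S" "\<And>z. z \<in> S \<Longrightarrow> J z \<noteq> (0::complex)"
  shows "smooth_on (\<lambda>z. ln ((cmod (J z))\<^sup>2)) S"
proof (rule smooth_on_compose[OF smooth_on_ln])
  have "smooth_on (\<lambda>z. Re (J z) * Re (J z) + Im (J z) * Im (J z)) S"
    using assms(1) by (intro smooth_on_add smooth_on_mult smooth_on_Re smooth_on_Im)
  then show "smooth_on (\<lambda>z. (cmod (J z))\<^sup>2) S" unfolding cmod_power2 unfolding power2_eq_square .
qed (use assms in auto)

text \<open>Locally the function is twice the real part of log J. Its d^c is the imaginary part of
  dJ / J, and this one-form is closed because the second derivatives of \<open>J\<close> are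
  symmetric.\<close>

lemma ddcl_ln_norm_square:
  fixes J :: "complex^'n::finite \<Rightarrow> complex"
  assumes S: "open S" and J: "smooth_on J S" and nz: "\<And>z. z \<in> S \<Longrightarrow> J z \<noteq> 0"
    and clin: "\<And>z v. z \<in> S \<Longrightarrow> fderiv J z (\<i> *s v) = \<i> * fderiv J z v" and z: "z \<in> S"
  shows "ddcl (\<lambda>z. ln ((cmod (J z))\<^sup>2)) z v w = 0"
proof -
  let ?D = "fderiv J"
  have d1: "(J has_derivative ?D y) (at y)" if "y \<in> S" for y by (rule smooth_on_has_derivative[OF J S that])
  have d2: "((\<lambda>y. ?D y w) has_derivative fderiv (\<lambda>y. ?D y w) y) (at y)" if "y \<in> S" for y w
    by (rule smooth_on_has_derivative[OF smooth_on_frechet_derivative[OF J S] S that])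
  have ln': "fderiv (\<lambda>z. ln ((cmod (J z))\<^sup>2)) y h = 2 * Re (?D y h / J y)" if y: "y \<in> S" for y h
  proof -
    have pos: "0 < (Re (J y))\<^sup>2 + (Im (J y))\<^sup>2" using nz[OF y] by (simp add: cmod_power2[symmetric])
    have "((\<lambda>y. (Re (J y))\<^sup>2 + (Im (J y))\<^sup>2) has_derivative (\<lambda>h. 2 * Re (J y) * Re (?D y h) + 2 * Im (J y) * Im (?D y h))) (at y)"
      by (auto intro!: derivative_eq_intros d1[OF y] simp: algebra_simps)
    from has_derivative_ln[OF pos this]
    have "((\<lambda>y. ln ((cmod (J y))\<^sup>2)) has_derivative
        (\<lambda>h. (2 * Re (J y) * Re (?D y h) + 2 * Im (J y) * Im (?D y h)) / ((Re (J y))\<^sup>2 + (Im (J y))\<^sup>2))) (at y)"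
      unfolding cmod_power2 by (simp add: divide_inverse mult.commute)
    from fderiv_eqI[OF this] show ?thesis by (simp add: Re_divide field_simps)
  qed
  have dc: "dcl (\<lambda>z. ln ((cmod (J z))\<^sup>2)) y w = Im (?D y w / J y)" if y: "y \<in> S" for y w
  proof -
    have "Re (\<i> * ?D y w / J y) = - Im (?D y w / J y)" by (metis Re_i_times times_divide_eq_right)
    then show ?thesis unfolding dcl_def ln'[OF y] clin[OF y] by simp
  qed
  have sym: "fderiv (\<lambda>y. ?D y w) z v = fderiv (\<lambda>y. ?D y v) z w" for v w
  proof (rule complex_eqI)
    show "Re (fderiv (\<lambda>y. ?D y w) z v) = Re (fderiv (\<lambda>y. ?D y v) z w)"
      by (rule second_derivative_symmetric[OF S z, of "\<lambda>x. Re (J x)" "\<lambda>x v. Re (?D x v)"])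
        (auto intro!: bounded_linear.has_derivative[OF bounded_linear_Re] d1 d2 z)
    show "Im (fderiv (\<lambda>y. ?D y w) z v) = Im (fderiv (\<lambda>y. ?D y v) z w)"
      by (rule second_derivative_symmetric[OF S z, of "\<lambda>x. Im (J x)" "\<lambda>x v. Im (?D x v)"])
        (auto intro!: bounded_linear.has_derivative[OF bounded_linear_Im] d1 d2 z)
  qed
  have main: "fderiv (\<lambda>y. dcl (\<lambda>z. ln ((cmod (J z))\<^sup>2)) y w) z v
      = Im ((fderiv (\<lambda>y. ?D y w) z v * J z - ?D z w * ?D z v) / (J z * J z))" for v w
  proof -
    have "((\<lambda>y. Im (?D y w / J y)) has_derivative (\<lambda>v. Im ((fderiv (\<lambda>y. ?D y w) z v * J z - ?D z w * ?D z v) / (J z * J z)))) (at z)"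
      by (intro bounded_linear.has_derivative[OF bounded_linear_Im] has_derivative_divide' d1 d2 z nz)
    from has_derivative_transform_within_open[OF this S z, of "\<lambda>y. dcl (\<lambda>z. ln ((cmod (J z))\<^sup>2)) y w"] dc
    have "fderiv (\<lambda>y. dcl (\<lambda>z. ln ((cmod (J z))\<^sup>2)) y w) z = (\<lambda>v. Im ((fderiv (\<lambda>y. ?D y w) z v * J z - ?D z w * ?D z v) / (J z * J z)))"
      by (intro fderiv_eqI) simp
    then show ?thesis by simp
  qed
  show ?thesis unfolding ddcl_def main sym[of w v] by (simp add: mult.commute)
qed

lemma smooth_on_vec_nth: "smooth_on f S \<Longrightarrow> smooth_on (\<lambda>z. f z $ i) S"
  by (rule smooth_on_linear_comp[OF bounded_linear_vec_nth])

text \<open>Directional derivatives of a holomorphic map are holomorphic, and complex linearity of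
  the derivative is preserved by sums and products, hence by the determinant.\<close>

lemma holomorphic_jacobian:
  fixes \<tau> :: "complex^'n::finite \<Rightarrow> complex^'n"
  assumes S: "open S" and \<tau>: "holomorphic_map_on \<tau> S"
  shows "smooth_on (\<lambda>z. det (matrix (cderiv \<tau> z))) S"
    and "z \<in> S \<Longrightarrow> fderiv (\<lambda>z. det (matrix (cderiv \<tau> z))) z (\<i> *s v) = \<i> * fderiv (\<lambda>z. det (matrix (cderiv \<tau> z))) z v"
proof -
  define good where "good f \<longleftrightarrow> smooth_on f S \<and> (\<forall>z\<in>S. \<forall>v. fderiv f z (\<i> *s v) = \<i> * fderiv f z v)" for f :: "complex^'n \<Rightarrow> complex"
  have d: "(f has_derivative fderiv f z) (at z)" if "good f" "z \<in> S" for f z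
    using smooth_on_has_derivative[of f S z] S that unfolding good_def by blast
  have const: "good (\<lambda>z. c)" for c by (simp add: good_def)
  have mult: "good (\<lambda>z. f z * g z)" if f: "good f" and g: "good g" for f g
  proof -
    have "fderiv (\<lambda>z. f z * g z) z = (\<lambda>h. f z * fderiv g z h + fderiv f z h * g z)" if "z \<in> S" for z
      by (rule fderiv_eqI) (rule has_derivative_mult[OF d[OF f that] d[OF g that]])
    then show ?thesis using f g unfolding good_def by (auto simp: algebra_simps)
  qed
  have add: "good (\<lambda>z. f z + g z)" if f: "good f" and g: "good g" for f g
  proof -
    have "fderiv (\<lambda>z. f z + g z) z = (\<lambda>h. fderiv f z h + fderiv g z h)" if "z \<in> S" for z
      by (rule fderiv_eqI) (rule has_derivative_add[OF d[OF f that] d[OF g that]])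
    then show ?thesis using f g unfolding good_def by (auto simp: algebra_simps)
  qed
  have sum: "good (\<lambda>z. \<Sum>i\<in>I. f i z)" if "\<And>i. i \<in> I \<Longrightarrow> good (f i)" for I :: "('n \<Rightarrow> 'n) set" and f
    using that by (induction I rule: infinite_finite_induct) (auto intro: add const)
  have prod: "good (\<lambda>z. \<Prod>i\<in>I. f i z)" if "\<And>i. i \<in> I \<Longrightarrow> good (f i)" for I :: "'n set" and f
    using that by (induction I rule: infinite_finite_induct) (auto intro: mult const)
  have entry: "good (\<lambda>z. matrix (cderiv \<tau> z) $ i $ j)" for i j
  proof -
    let ?g = "\<lambda>z. cderiv \<tau> z (axis j 1)"
    have h: "holomorphic_map_on ?g S" by (rule holomorphic_cderiv_holomorphic[OF \<tau> S])
    have "fderiv (\<lambda>z. ?g z $ i) z = (\<lambda>h. cderiv ?g z h $ i)" if "z \<in> S" for z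
      by (rule fderiv_eqI) (rule bounded_linear.has_derivative[OF bounded_linear_vec_nth holomorphic_map_onD(1)[OF h that]])
    then show ?thesis
      using holomorphic_imp_smooth[OF h S] holomorphic_map_onD(2)[OF h]
      by (auto simp: good_def matrix_def intro: smooth_on_vec_nth)
  qed
  have "good (\<lambda>z. det (matrix (cderiv \<tau> z)))"
    unfolding det_def by (intro sum mult prod const entry)
  then show "smooth_on (\<lambda>z. det (matrix (cderiv \<tau> z))) S"
    "z \<in> S \<Longrightarrow> fderiv (\<lambda>z. det (matrix (cderiv \<tau> z))) z (\<i> *s v) = \<i> * fderiv (\<lambda>z. det (matrix (cderiv \<tau> z))) z v"
    by (simp_all add: good_def)
qed

section \<open>Charts and forms\<close>

abbreviation overlap :: "('a::topological_space, 'n::finite) chart \<Rightarrow> ('a, 'n) chart \<Rightarrow> (complex^'n) set" where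
  "overlap c c' \<equiv> chart_map c ` (chart_dom c \<inter> chart_dom c')"

locale ccm =
  fixes A :: "('a::t2_space, 'n::finite) chart set"
  assumes man: "closed_complex_manifold A"
begin

lemma compact_UNIV: "compact (UNIV :: 'a set)" and connected_UNIV: "connected (UNIV :: 'a set)"
  using man by (auto simp: closed_complex_manifold_def)

lemma charts_cover: "\<exists>c\<in>A. p \<in> chart_dom c"
proof -
  have "p \<in> (\<Union>c\<in>A. chart_dom c)" using man by (simp add: closed_complex_manifold_def)
  then show ?thesis by blast
qed

lemma chart_homeo: "c \<in> A \<Longrightarrow> homeomorphism (chart_dom c) (chart_img c) (chart_map c) (chart_inv c)"
  and open_dom: "c \<in> A \<Longrightarrow> open (chart_dom c)"
  and open_img: "c \<in> A \<Longrightarrow> open (chart_img c)"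
  using man by (auto simp: closed_complex_manifold_def is_chart_def)

lemma chart_inv_map: "c \<in> A \<Longrightarrow> p \<in> chart_dom c \<Longrightarrow> chart_inv c (chart_map c p) = p"
  and chart_map_inv: "c \<in> A \<Longrightarrow> z \<in> chart_img c \<Longrightarrow> chart_map c (chart_inv c z) = z"
  and chart_inv_dom: "c \<in> A \<Longrightarrow> z \<in> chart_img c \<Longrightarrow> chart_inv c z \<in> chart_dom c"
  and chart_map_img: "c \<in> A \<Longrightarrow> p \<in> chart_dom c \<Longrightarrow> chart_map c p \<in> chart_img c"
  and cont_chart_inv: "c \<in> A \<Longrightarrow> continuous_on (chart_img c) (chart_inv c)"
  and cont_chart_map: "c \<in> A \<Longrightarrow> continuous_on (chart_dom c) (chart_map c)"
  using chart_homeo[of c] by (auto simp: homeomorphism_def)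

lemma overlap_eq: "c \<in> A \<Longrightarrow> overlap c c' = {z \<in> chart_img c. chart_inv c z \<in> chart_dom c'}"
proof (intro set_eqI iffI)
  fix z assume c: "c \<in> A" and "z \<in> overlap c c'"
  then obtain p where p: "p \<in> chart_dom c" "p \<in> chart_dom c'" "z = chart_map c p" by blast
  then show "z \<in> {z \<in> chart_img c. chart_inv c z \<in> chart_dom c'}"
    using chart_inv_map[OF c p(1)] chart_map_img[OF c p(1)] by simp
next
  fix z assume c: "c \<in> A" and z: "z \<in> {z \<in> chart_img c. chart_inv c z \<in> chart_dom c'}"
  show "z \<in> overlap c c'"
    using z chart_map_inv[OF c, of z] chart_inv_dom[OF c, of z] by (intro image_eqI[of _ _ "chart_inv c z"]) auto
qed

lemma overlap_subset: "c \<in> A \<Longrightarrow> overlap c c' \<subseteq> chart_img c"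
  using overlap_eq by blast

lemma open_chart_vimage: "c \<in> A \<Longrightarrow> open U \<Longrightarrow> open {z \<in> chart_img c. chart_inv c z \<in> U}"
  using continuous_open_preimage[OF cont_chart_inv open_img, of c U] by (simp add: vimage_def Int_def)

lemma open_chart_image: "c \<in> A \<Longrightarrow> open W \<Longrightarrow> W \<subseteq> chart_img c \<Longrightarrow> open (chart_inv c ` W)"
proof -
  assume c: "c \<in> A" and W: "open W" "W \<subseteq> chart_img c"
  have "open (chart_dom c \<inter> chart_map c -` W)"
    by (rule continuous_open_preimage[OF cont_chart_map[OF c] open_dom[OF c] W(1)])
  moreover have "chart_inv c ` W = chart_dom c \<inter> chart_map c -` W"
    using W(2) chart_inv_map[OF c] chart_map_inv[OF c] chart_inv_dom[OF c] by (force simp: image_iff)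
  ultimately show ?thesis by simp
qed

lemma open_overlap: "c \<in> A \<Longrightarrow> c' \<in> A \<Longrightarrow> open (overlap c c')"
  using overlap_eq open_chart_vimage[of c "chart_dom c'"] open_dom by simp

lemma transition_holomorphic: "c \<in> A \<Longrightarrow> c' \<in> A \<Longrightarrow> holomorphic_map_on (transition c c') (overlap c c')"
  using man by (auto simp: closed_complex_manifold_def)

lemma transition_in: "c \<in> A \<Longrightarrow> c' \<in> A \<Longrightarrow> z \<in> overlap c c' \<Longrightarrow> transition c c' z \<in> overlap c' c"
  and transition_inverse: "c \<in> A \<Longrightarrow> c' \<in> A \<Longrightarrow> z \<in> overlap c c' \<Longrightarrow> transition c' c (transition c c' z) = z"
  and chart_inv_transition: "c \<in> A \<Longrightarrow> c' \<in> A \<Longrightarrow> z \<in> overlap c c' \<Longrightarrow> chart_inv c' (transition c c' z) = chart_inv c z"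
  by (auto simp: transition_def chart_inv_map)

lemma transition_image: "c \<in> A \<Longrightarrow> c' \<in> A \<Longrightarrow> transition c c' ` overlap c c' = overlap c' c"
proof
  assume c: "c \<in> A" "c' \<in> A"
  then show "transition c c' ` overlap c c' \<subseteq> overlap c' c" using transition_in by blast
  show "overlap c' c \<subseteq> transition c c' ` overlap c c'"
  proof
    fix z assume z: "z \<in> overlap c' c"
    have "z = transition c c' (transition c' c z)" using transition_inverse[OF c(2,1) z] by simp
    then show "z \<in> transition c c' ` overlap c c'" using transition_in[OF c(2,1) z] by blast
  qed
qed

abbreviation dtrans :: "('a, 'n) chart \<Rightarrow> ('a, 'n) chart \<Rightarrow> complex^'n \<Rightarrow> complex^'n \<Rightarrow> complex^'n" where
  "dtrans c c' z \<equiv> cderiv (transition c c') z"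

lemma dtrans_linear: "c \<in> A \<Longrightarrow> c' \<in> A \<Longrightarrow> z \<in> overlap c c' \<Longrightarrow> linear (dtrans c c' z)"
  and dtrans_smult: "c \<in> A \<Longrightarrow> c' \<in> A \<Longrightarrow> z \<in> overlap c c' \<Longrightarrow> dtrans c c' z (a *s v) = a *s dtrans c c' z v"
  and dtrans_has_derivative: "c \<in> A \<Longrightarrow> c' \<in> A \<Longrightarrow> z \<in> overlap c c' \<Longrightarrow> (transition c c' has_derivative dtrans c c' z) (at z)"
  using holomorphic_map_onD[OF transition_holomorphic, of c c' z] has_derivative_linear by blast+

lemma dtrans_inverse:
  assumes c: "c \<in> A" "c' \<in> A" "z \<in> overlap c c'"
  shows "dtrans c' c (transition c c' z) (dtrans c c' z v) = v"
proof -
  have 1: "((\<lambda>y. transition c' c (transition c c' y)) has_derivative (\<lambda>v. dtrans c' c (transition c c' z) (dtrans c c' z v))) (at z)"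
    by (rule has_derivative_compose[OF dtrans_has_derivative[OF c] dtrans_has_derivative[OF c(2,1) transition_in[OF c]]])
  have "((\<lambda>y. y) has_derivative (\<lambda>v. v)) (at z)" by simp
  then have 2: "((\<lambda>y. transition c' c (transition c c' y)) has_derivative (\<lambda>v. v)) (at z)"
    by (rule has_derivative_transform_within_open[OF _ open_overlap[OF c(1,2)] c(3)])
      (use transition_inverse[OF c(1,2)] in simp)
  show ?thesis using fun_cong[OF has_derivative_unique[OF 1 2], of v] .
qed

lemma dtrans_nonzero: "c \<in> A \<Longrightarrow> c' \<in> A \<Longrightarrow> z \<in> overlap c c' \<Longrightarrow> v \<noteq> 0 \<Longrightarrow> dtrans c c' z v \<noteq> 0"
  by (metis dtrans_inverse linear_0 dtrans_linear transition_in)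

lemma dtrans_det_nonzero: "c \<in> A \<Longrightarrow> c' \<in> A \<Longrightarrow> z \<in> overlap c c' \<Longrightarrow> det (matrix (dtrans c c' z)) \<noteq> 0"
proof -
  assume c: "c \<in> A" "c' \<in> A" "z \<in> overlap c c'"
  have mv: "matrix (dtrans c c' z) *v v = dtrans c c' z v" for v
    unfolding vec_eq_iff matrix_vector_mult_def matrix_def vec_lambda_beta
    by (intro allI smult_linear_expansion[symmetric] dtrans_linear[OF c] dtrans_smult[OF c])
  then have "\<forall>v. matrix (dtrans c c' z) *v v = 0 \<longrightarrow> v = 0" using dtrans_nonzero[OF c] by metis
  then have "invertible (matrix (dtrans c c' z))" by (metis invertible_left_inverse matrix_left_invertible_ker)
  then show ?thesis by (simp add: invertible_det_nz)
qed

lemma tensor2_iff: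
  "(\<forall>c\<in>A. \<forall>c'\<in>A. \<forall>p\<in>chart_dom c \<inter> chart_dom c'. \<forall>v w.
        let \<tau>' = frechet_derivative (transition c c') (at (chart_map c p))
        in \<alpha> c (chart_map c p) v w = \<alpha> c' (chart_map c' p) (\<tau>' v) (\<tau>' w)) \<longleftrightarrow>
   (\<forall>c\<in>A. \<forall>c'\<in>A. \<forall>z\<in>overlap c c'. \<forall>v w. \<alpha> c z v w = \<alpha> c' (transition c c' z) (dtrans c c' z v) (dtrans c c' z w))"
  by (simp add: Let_def cderiv_def transition_def chart_inv_map)

lemma tensor1_iff:
  "(\<forall>c\<in>A. \<forall>c'\<in>A. \<forall>p\<in>chart_dom c \<inter> chart_dom c'. \<forall>v.
        let \<tau>' = frechet_derivative (transition c c') (at (chart_map c p))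
        in \<eta> c (chart_map c p) v = \<eta> c' (chart_map c' p) (\<tau>' v)) \<longleftrightarrow>
   (\<forall>c\<in>A. \<forall>c'\<in>A. \<forall>z\<in>overlap c c'. \<forall>v. \<eta> c z v = \<eta> c' (transition c c' z) (dtrans c c' z v))"
  by (simp add: Let_def cderiv_def transition_def chart_inv_map)

lemma smooth_form2D:
  assumes "smooth_form2 A \<alpha>" "c \<in> A"
  shows "z \<in> chart_img c \<Longrightarrow> linear (\<alpha> c z v)" "z \<in> chart_img c \<Longrightarrow> \<alpha> c z w v = - \<alpha> c z v w"
    "smooth_on (\<lambda>z. \<alpha> c z v w) (chart_img c)"
    "c' \<in> A \<Longrightarrow> z \<in> overlap c c' \<Longrightarrow> \<alpha> c z v w = \<alpha> c' (transition c c' z) (dtrans c c' z v) (dtrans c c' z w)"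
  using assms unfolding smooth_form2_def tensor2_iff by blast+

lemma smooth_form2I:
  assumes "\<And>c z v. c \<in> A \<Longrightarrow> z \<in> chart_img c \<Longrightarrow> linear (\<alpha> c z v)"
    and "\<And>c z v w. c \<in> A \<Longrightarrow> z \<in> chart_img c \<Longrightarrow> \<alpha> c z w v = - \<alpha> c z v w"
    and "\<And>c v w. c \<in> A \<Longrightarrow> smooth_on (\<lambda>z. \<alpha> c z v w) (chart_img c)"
    and "\<And>c c' z v w. c \<in> A \<Longrightarrow> c' \<in> A \<Longrightarrow> z \<in> overlap c c' \<Longrightarrow> \<alpha> c z v w = \<alpha> c' (transition c c' z) (dtrans c c' z v) (dtrans c c' z w)"
  shows "smooth_form2 A \<alpha>"
  using assms unfolding smooth_form2_def tensor2_iff by blast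

lemma smooth_form2_linear_left:
  assumes "smooth_form2 A \<alpha>" "c \<in> A" "z \<in> chart_img c"
  shows "linear (\<lambda>v. \<alpha> c z v w)"
  using smooth_form2D(1,2)[OF assms(1,2,3)]
  by (intro linearI) (metis linear_add minus_add_distrib, metis linear_cmul scaleR_minus_right)

lemma smooth_form1D:
  assumes "smooth_form1 A \<eta>" "c \<in> A"
  shows "z \<in> chart_img c \<Longrightarrow> linear (\<eta> c z)" "smooth_on (\<lambda>z. \<eta> c z v) (chart_img c)"
    "c' \<in> A \<Longrightarrow> z \<in> overlap c c' \<Longrightarrow> \<eta> c z v = \<eta> c' (transition c c' z) (dtrans c c' z v)"
  using assms unfolding smooth_form1_def tensor1_iff by blast+

lemma smooth_form1I:
  assumes "\<And>c z. c \<in> A \<Longrightarrow> z \<in> chart_img c \<Longrightarrow> linear (\<eta> c z)"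
    and "\<And>c v. c \<in> A \<Longrightarrow> smooth_on (\<lambda>z. \<eta> c z v) (chart_img c)"
    and "\<And>c c' z v. c \<in> A \<Longrightarrow> c' \<in> A \<Longrightarrow> z \<in> overlap c c' \<Longrightarrow> \<eta> c z v = \<eta> c' (transition c c' z) (dtrans c c' z v)"
  shows "smooth_form1 A \<eta>"
  using assms unfolding smooth_form1_def tensor1_iff by blast

section \<open>Smooth functions on the manifold\<close>

definition smooth_fun :: "('a \<Rightarrow> real) \<Rightarrow> bool" where
  "smooth_fun g \<longleftrightarrow> (\<forall>c\<in>A. smooth_on (\<lambda>z. g (chart_inv c z)) (chart_img c))"

lemma smooth_fun_continuous: "smooth_fun g \<Longrightarrow> continuous_on UNIV g"
proof -
  assume g: "smooth_fun g"
  have "isCont g p" for p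
  proof -
    obtain c where c: "c \<in> A" "p \<in> chart_dom c" using charts_cover by blast
    have "continuous_on (chart_dom c) (\<lambda>p. g (chart_inv c (chart_map c p)))"
      by (rule continuous_on_compose2[OF smooth_on_continuous cont_chart_map[OF c(1)]])
        (use g c(1) chart_map_img[OF c(1)] in \<open>auto simp: smooth_fun_def\<close>)
    then have "continuous_on (chart_dom c) g"
      by (rule continuous_on_eq) (simp add: chart_inv_map c)
    then show ?thesis using c open_dom continuous_on_eq_continuous_at by blast
  qed
  then show ?thesis by (simp add: continuous_at_imp_continuous_on)
qed

definition dc_form :: "('a \<Rightarrow> real) \<Rightarrow> ('a, 'n) form1" where
  "dc_form g c z w = dcl (\<lambda>y. g (chart_inv c y)) z w"

lemma ext_deriv1_dc_form: "ext_deriv1 (dc_form g) c z v w = ddcl (\<lambda>y. g (chart_inv c y)) z v w"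
  unfolding ext_deriv1_def ddcl_def dc_form_def ..

lemma smooth_at_fun: "smooth_fun g \<Longrightarrow> c \<in> A \<Longrightarrow> smooth_at (chart_img c) (\<lambda>y. g (chart_inv c y))"
  by unfold_locales (auto simp: smooth_fun_def open_img)

lemma smooth_fun_deriv:
  assumes g: "smooth_fun g" and c: "c \<in> A" "c' \<in> A" "z \<in> overlap c c'"
  shows "fderiv (\<lambda>y. g (chart_inv c y)) z v = fderiv (\<lambda>y. g (chart_inv c' y)) (transition c c' z) (dtrans c c' z v)"
proof -
  have z': "transition c c' z \<in> chart_img c'" using transition_in[OF c] overlap_subset[OF c(2)] by blast
  have "((\<lambda>y. g (chart_inv c' (transition c c' y))) has_derivative (\<lambda>v. fderiv (\<lambda>y. g (chart_inv c' y)) (transition c c' z) (dtrans c c' z v))) (at z)"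
    by (rule has_derivative_compose[OF dtrans_has_derivative[OF c] smooth_at.d1[OF smooth_at_fun[OF g c(2)] z']])
  then have "((\<lambda>y. g (chart_inv c y)) has_derivative (\<lambda>v. fderiv (\<lambda>y. g (chart_inv c' y)) (transition c c' z) (dtrans c c' z v))) (at z)"
    by (rule has_derivative_transform_within_open[OF _ open_overlap[OF c(1,2)] c(3)])
      (use chart_inv_transition[OF c(1,2)] in simp)
  from fderiv_eqI[OF this] show ?thesis by simp
qed

lemma smooth_form1_dc_form:
  assumes g: "smooth_fun g"
  shows "smooth_form1 A (dc_form g)"
proof (rule smooth_form1I)
  fix c z assume c: "c \<in> A" "z \<in> chart_img c"
  show "linear (dc_form g c z)"
    using smooth_at.dcl_linear[OF smooth_at_fun[OF g c(1)] c(2)] by (simp add: dc_form_def[abs_def])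
next
  fix c v assume c: "c \<in> A"
  show "smooth_on (\<lambda>z. dc_form g c z v) (chart_img c)"
    using smooth_at.smooth_dcl[OF smooth_at_fun[OF g c(1)]] by (simp add: dc_form_def[abs_def])
next
  fix c c' z v assume c: "c \<in> A" "c' \<in> A" "z \<in> overlap c c'"
  show "dc_form g c z v = dc_form g c' (transition c c' z) (dtrans c c' z v)"
    unfolding dc_form_def dcl_def smooth_fun_deriv[OF g c] dtrans_smult[OF c] ..
qed

section \<open>The Ricci form\<close>

lemma kaehler_real11:
  assumes "kaehler_form A \<omega>" "c \<in> A" "z \<in> chart_img c"
  shows "real11 (\<omega> c z)"
  unfolding real11_def
proof (intro conjI allI)
  have s: "smooth_form2 A \<omega>" using assms by (simp add: kaehler_form_def closed_form2_def)
  show "linear (\<omega> c z v)" "\<omega> c z w v = - \<omega> c z v w" for v w using smooth_form2D(1,2)[OF s assms(2,3)] by blast+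
  show "\<omega> c z (\<i> *s v) (\<i> *s w) = \<omega> c z v w" for v w
    using assms by (simp add: kaehler_form_def type11_def)
qed

lemma kaehler_posdef:
  assumes "kaehler_form A \<omega>" "c \<in> A" "z \<in> chart_img c"
  shows "posdef (hermitian_coeff (\<omega> c z))"
  by (rule real11_posdef[OF kaehler_real11[OF assms]]) (use assms in \<open>auto simp: kaehler_form_def\<close>)

abbreviation hdet :: "('a, 'n) form2 \<Rightarrow> ('a, 'n) chart \<Rightarrow> complex^'n \<Rightarrow> real" where
  "hdet \<omega> c z \<equiv> Re (det (hermitian_coeff (\<omega> c z)))"

lemma hdet_pos: "kaehler_form A \<omega> \<Longrightarrow> c \<in> A \<Longrightarrow> z \<in> chart_img c \<Longrightarrow> 0 < hdet \<omega> c z"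
  by (rule posdef_det_pos[OF kaehler_posdef])

lemma smooth_on_of_real: "smooth_on f S \<Longrightarrow> smooth_on (\<lambda>x. complex_of_real (f x)) S"
  by (rule smooth_on_linear_comp[OF bounded_linear_of_real])

lemma smooth_on_hdet:
  fixes F :: "'x::euclidean_space \<Rightarrow> complex^'n \<Rightarrow> complex^'n \<Rightarrow> real"
  assumes "\<And>v w. smooth_on (\<lambda>x. F x v w) S"
  shows "smooth_on (\<lambda>x. Re (det (hermitian_coeff (F x)))) S"
  unfolding det_def hermitian_coeff_def vec_lambda_beta divide_inverse
  by (intro smooth_on_Re smooth_on_sum smooth_on_mult smooth_on_prod smooth_on_const smooth_on_diff smooth_on_of_real assms)

lemma smooth_hdet: "kaehler_form A \<omega> \<Longrightarrow> c \<in> A \<Longrightarrow> smooth_on (hdet \<omega> c) (chart_img c)"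
  by (rule smooth_on_hdet) (simp add: kaehler_form_def closed_form2_def smooth_form2D(3))

lemma smooth_ricpot: "kaehler_form A \<omega> \<Longrightarrow> c \<in> A \<Longrightarrow> smooth_on (ricpot \<omega> c) (chart_img c)"
  using hdet_pos[of \<omega> c] by (auto intro!: smooth_on_compose[OF smooth_on_ln smooth_hdet])

lemma Ric_eq: "kaehler_form A \<omega> \<Longrightarrow> c \<in> A \<Longrightarrow> z \<in> chart_img c \<Longrightarrow> Ric \<omega> c z v w = - ddcl (ricpot \<omega> c) z v w"
  by (rule Ric_ddcl[OF open_img smooth_ricpot])

lemma smooth_at_ricpot: "kaehler_form A \<omega> \<Longrightarrow> c \<in> A \<Longrightarrow> smooth_at (chart_img c) (ricpot \<omega> c)"
  by unfold_locales (auto simp: smooth_ricpot open_img)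

lemma hdet_transform:
  assumes k: "kaehler_form A \<omega>" and c: "c \<in> A" "c' \<in> A" "z \<in> overlap c c'"
  shows "hdet \<omega> c z = (cmod (det (matrix (dtrans c c' z))))\<^sup>2 * hdet \<omega> c' (transition c c' z)"
proof -
  have s: "smooth_form2 A \<omega>" using k by (simp add: kaehler_form_def closed_form2_def)
  have z': "transition c c' z \<in> chart_img c'" using transition_in[OF c] overlap_subset[OF c(2)] by blast
  have "\<omega> c z = (\<lambda>v w. \<omega> c' (transition c c' z) (dtrans c c' z v) (dtrans c c' z w))"
    using smooth_form2D(4)[OF s c] by blast
  then show ?thesis
    using det_hermitian_pullback[OF kaehler_real11[OF k c(2) z'] dtrans_linear[OF c] dtrans_smult[OF c]] by simp
qed

text \<open>The potentials log det in two charts differ by log |J|^2 with J the Jacobian of the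
  transition map, and dd^c annihilates this term. So the local formula for \<open>Ric\<close>
  defines a global form.\<close>

lemma Ric_transform:
  assumes k: "kaehler_form A \<omega>" and c: "c \<in> A" "c' \<in> A" "z \<in> overlap c c'"
  shows "Ric \<omega> c z v w = Ric \<omega> c' (transition c c' z) (dtrans c c' z v) (dtrans c c' z w)"
proof -
  let ?\<tau> = "transition c c'" and ?O = "overlap c c'"
  let ?J = "\<lambda>y. det (matrix (cderiv ?\<tau> y))" and ?u' = "\<lambda>y. ricpot \<omega> c' (?\<tau> y)"
  have zc: "z \<in> chart_img c" using c overlap_subset by blast
  have z': "?\<tau> y \<in> chart_img c'" if "y \<in> ?O" for y using transition_in[OF c(1,2) that] overlap_subset[OF c(2)] by blast
  have nz: "?J y \<noteq> 0" if "y \<in> ?O" for y by (rule dtrans_det_nonzero[OF c(1,2) that])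
  have eq: "ricpot \<omega> c y = 1 * ?u' y + 1 * ln ((cmod (?J y))\<^sup>2)" if "y \<in> ?O" for y
    unfolding hdet_transform[OF k c(1,2) that]
    using hdet_pos[OF k c(2) z'[OF that]] nz[OF that] by (simp add: ln_mult)
  have s1: "smooth_on ?u' ?O"
    by (rule smooth_on_compose[OF smooth_ricpot[OF k c(2)] holomorphic_imp_smooth[OF transition_holomorphic[OF c(1,2)] open_overlap[OF c(1,2)]]])
      (use z' in blast)
  have s2: "smooth_on (\<lambda>y. ln ((cmod (?J y))\<^sup>2)) ?O"
    by (rule smooth_on_ln_norm_square[OF holomorphic_jacobian(1)[OF open_overlap[OF c(1,2)] transition_holomorphic[OF c(1,2)]] nz])
  have "ddcl (ricpot \<omega> c) z v w = ddcl (\<lambda>y. 1 * ?u' y + 1 * ln ((cmod (?J y))\<^sup>2)) z v w"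
    using ddcl_cong_open[OF open_overlap[OF c(1,2)] c(3) eq] by simp
  also have "\<dots> = 1 * ddcl ?u' z v w + 1 * ddcl (\<lambda>y. ln ((cmod (?J y))\<^sup>2)) z v w"
    by (rule ddcl_add[OF open_overlap[OF c(1,2)] s1 s2 c(3)])
  also have "ddcl (\<lambda>y. ln ((cmod (?J y))\<^sup>2)) z v w = 0"
    using holomorphic_jacobian[OF open_overlap[OF c(1,2)] transition_holomorphic[OF c(1,2)]] nz
    by (intro ddcl_ln_norm_square[OF open_overlap[OF c(1,2)] _ _ _ c(3)]) auto
  also have "ddcl ?u' z v w = ddcl (ricpot \<omega> c') (?\<tau> z) (dtrans c c' z v) (dtrans c c' z w)"
    by (rule ddcl_compose[OF open_overlap[OF c(1,2)] open_img[OF c(2)] transition_holomorphic[OF c(1,2)] _ smooth_ricpot[OF k c(2)] c(3)])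
      (use z' in blast)
  finally show ?thesis unfolding Ric_eq[OF k c(1) zc] Ric_eq[OF k c(2) z'[OF c(3)]] by simp
qed

text \<open>In each chart the form is exact, with primitive minus \<open>dcl\<close> of the
  potential; closedness is the symmetry of second derivatives, and type (1,1) is inherited from
  \<open>ddcl\<close>.\<close>

lemma closed_Ric:
  assumes k: "kaehler_form A \<omega>"
  shows "closed_form2 A (Ric \<omega>)" "type11 A (Ric \<omega>)"
proof -
  have r11: "real11 (ddcl (ricpot \<omega> c) z)" if "c \<in> A" "z \<in> chart_img c" for c z
    by (rule smooth_at.ddcl_real11[OF smooth_at_ricpot[OF k that(1)] that(2)])
  have sm: "smooth_on (\<lambda>z. ddcl (ricpot \<omega> c) z v w) (chart_img c)" if "c \<in> A" for c v w
    unfolding ddcl_def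
    by (intro smooth_on_diff smooth_on_frechet_derivative smooth_at.smooth_dcl[OF smooth_at_ricpot[OF k that]] open_img that)
  have s: "smooth_form2 A (Ric \<omega>)"
  proof (rule smooth_form2I)
    fix c z v w assume c: "c \<in> A" "z \<in> chart_img c"
    show "linear (Ric \<omega> c z v)"
      using real11D(1)[OF r11[OF c]] linear_compose_neg by (fastforce simp: Ric_eq[OF k c, abs_def])
    show "Ric \<omega> c z w v = - Ric \<omega> c z v w"
      unfolding Ric_eq[OF k c] using real11D(2)[OF r11[OF c], of v w] by simp
  next
    fix c v w assume c: "c \<in> A"
    show "smooth_on (\<lambda>z. Ric \<omega> c z v w) (chart_img c)"
    proof -
      have "smooth_on (\<lambda>z. Ric \<omega> c z v w) (chart_img c) \<longleftrightarrow> smooth_on (\<lambda>z. - ddcl (ricpot \<omega> c) z v w) (chart_img c)"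
        by (rule smooth_on_cong) (rule Ric_eq[OF k c])
      then show ?thesis using smooth_on_minus[OF sm[OF c, of v w]] by blast
    qed
  qed (rule Ric_transform[OF k])
  have "ext_deriv2 (Ric \<omega>) c z x y w = 0" if c: "c \<in> A" "z \<in> chart_img c" for c z x y w
  proof -
    let ?u = "ricpot \<omega> c" and ?V = "chart_img c"
    let ?\<eta> = "dcl ?u"
    have \<eta>: "smooth_on (\<lambda>z. ?\<eta> z w) ?V" for w by (rule smooth_at.smooth_dcl[OF smooth_at_ricpot[OF k c(1)]])
    have d: "fderiv (\<lambda>y. Ric \<omega> c y a b) z h = - (hess (\<lambda>z. ?\<eta> z b) z a h - hess (\<lambda>z. ?\<eta> z a) z b h)" for a b h
    proof -
      have "((\<lambda>y. - (fderiv (\<lambda>z. ?\<eta> z b) y a - fderiv (\<lambda>z. ?\<eta> z a) y b)) has_derivative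
          (\<lambda>h. - (hess (\<lambda>z. ?\<eta> z b) z a h - hess (\<lambda>z. ?\<eta> z a) z b h))) (at z)"
        by (intro has_derivative_minus has_derivative_diff smooth_on_has_derivative[OF smooth_on_frechet_derivative[OF \<eta> open_img[OF c(1)]] open_img[OF c(1)] c(2)])
      from has_derivative_transform_within_open[OF this open_img[OF c(1)] c(2), of "\<lambda>y. Ric \<omega> c y a b"]
      have "((\<lambda>y. Ric \<omega> c y a b) has_derivative (\<lambda>h. - (hess (\<lambda>z. ?\<eta> z b) z a h - hess (\<lambda>z. ?\<eta> z a) z b h))) (at z)"
        using Ric_eq[OF k c(1)] by (simp add: ddcl_def)
      from fderiv_eqI[OF this] show ?thesis by simp
    qed
    have sym: "hess (\<lambda>z. ?\<eta> z a) z b h = hess (\<lambda>z. ?\<eta> z a) z h b" for a b h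
      by (rule smooth_second_derivative_symmetric[OF open_img[OF c(1)] c(2) \<eta>])
    show ?thesis unfolding ext_deriv2_def d using sym[of w y x] sym[of y w x] sym[of x w y] by simp
  qed
  with s show "closed_form2 A (Ric \<omega>)" by (simp add: closed_form2_def)
  show "type11 A (Ric \<omega>)" unfolding type11_def
  proof (intro ballI allI)
    fix c z v w assume c: "c \<in> A" "z \<in> chart_img c"
    show "Ric \<omega> c z (\<i> *s v) (\<i> *s w) = Ric \<omega> c z v w" unfolding Ric_eq[OF k c] real11D(3)[OF r11[OF c]] ..
  qed
qed

text \<open>The logarithm of the ratio of the volume forms. The Jacobians of the coordinate changes cancel in
  the ratio, so the choice of the chart does not matter.\<close>

definition vol_ratio :: "('a, 'n) form2 \<Rightarrow> ('a, 'n) form2 \<Rightarrow> 'a \<Rightarrow> real" where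
  "vol_ratio \<omega> \<omega>' p = (let c = SOME c. c \<in> A \<and> p \<in> chart_dom c in
     ricpot \<omega> c (chart_map c p) - ricpot \<omega>' c (chart_map c p))"

lemma vol_ratio_eq:
  assumes k: "kaehler_form A \<omega>" "kaehler_form A \<omega>'" and c: "c \<in> A" "z \<in> chart_img c"
  shows "vol_ratio \<omega> \<omega>' (chart_inv c z) = ricpot \<omega> c z - ricpot \<omega>' c z"
proof -
  define p where "p = chart_inv c z"
  define c' where "c' = (SOME c. c \<in> A \<and> p \<in> chart_dom c)"
  have "\<exists>c. c \<in> A \<and> p \<in> chart_dom c" using charts_cover by blast
  from someI_ex[OF this] have c': "c' \<in> A" "p \<in> chart_dom c'" by (auto simp: c'_def)
  have z: "z \<in> overlap c c'" unfolding overlap_eq[OF c(1)] using c c'(2) by (simp add: p_def)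
  have z': "transition c c' z \<in> chart_img c'" using transition_in[OF c(1) c'(1) z] overlap_subset[OF c'(1)] by blast
  have t: "chart_map c' p = transition c c' z" by (simp add: p_def transition_def)
  have pos: "0 < (cmod (det (matrix (dtrans c c' z))))\<^sup>2" using dtrans_det_nonzero[OF c(1) c'(1) z] by simp
  have "ricpot \<omega> c z - ricpot \<omega>' c z = ricpot \<omega> c' (transition c c' z) - ricpot \<omega>' c' (transition c c' z)"
    unfolding hdet_transform[OF k(1) c(1) c'(1) z] hdet_transform[OF k(2) c(1) c'(1) z]
    using pos hdet_pos[OF k(1) c'(1) z'] hdet_pos[OF k(2) c'(1) z'] by (simp add: ln_mult)
  then show ?thesis by (simp add: vol_ratio_def Let_def t flip: p_def c'_def)
qed

lemma smooth_vol_ratio: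
  assumes k: "kaehler_form A \<omega>" "kaehler_form A \<omega>'"
  shows "smooth_fun (vol_ratio \<omega> \<omega>')"
  unfolding smooth_fun_def
proof
  fix c assume c: "c \<in> A"
  have "smooth_on (\<lambda>z. ricpot \<omega> c z - ricpot \<omega>' c z) (chart_img c)"
    by (intro smooth_on_diff smooth_ricpot k c)
  moreover have "smooth_on (\<lambda>z. vol_ratio \<omega> \<omega>' (chart_inv c z)) (chart_img c)
      \<longleftrightarrow> smooth_on (\<lambda>z. ricpot \<omega> c z - ricpot \<omega>' c z) (chart_img c)"
    by (rule smooth_on_cong) (rule vol_ratio_eq[OF k c])
  ultimately show "smooth_on (\<lambda>z. vol_ratio \<omega> \<omega>' (chart_inv c z)) (chart_img c)" by blast
qed

text \<open>Used twice: it makes the first Chern class independent of the metric, and it expresses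
  dd^c of the logarithm of the volume ratio through Ricci forms, from which the bound on its
  Laplacian comes.\<close>

lemma Ric_diff:
  assumes k: "kaehler_form A \<omega>" "kaehler_form A \<omega>'" and c: "c \<in> A" "z \<in> chart_img c"
  shows "Ric \<omega>' c z v w - Ric \<omega> c z v w = ext_deriv1 (dc_form (vol_ratio \<omega> \<omega>')) c z v w"
proof -
  have "ddcl (\<lambda>y. vol_ratio \<omega> \<omega>' (chart_inv c y)) z v w = ddcl (\<lambda>y. 1 * ricpot \<omega> c y + (-1) * ricpot \<omega>' c y) z v w"
    using ddcl_cong_open[OF open_img[OF c(1)] c(2), of "\<lambda>y. vol_ratio \<omega> \<omega>' (chart_inv c y)"] vol_ratio_eq[OF k c(1)] by simp
  also have "\<dots> = 1 * ddcl (ricpot \<omega> c) z v w + (-1) * ddcl (ricpot \<omega>' c) z v w"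
    by (rule ddcl_add[OF open_img[OF c(1)] smooth_ricpot[OF k(1) c(1)] smooth_ricpot[OF k(2) c(1)] c(2)])
  finally show ?thesis unfolding ext_deriv1_dc_form Ric_eq[OF k(1) c] Ric_eq[OF k(2) c] by simp
qed

end

section \<open>Integration by parts for alternating sums\<close>

lemma alt_sum_reindex:
  fixes h :: "('n::finite \<times> bool \<Rightarrow> 'n \<times> bool) \<Rightarrow> real"
  assumes "\<pi> permutes UNIV"
  shows "(\<Sum>\<sigma> | \<sigma> permutes UNIV. of_int (sign \<sigma>) * h \<sigma>)
    = of_int (sign \<pi>) * (\<Sum>\<sigma> | \<sigma> permutes UNIV. of_int (sign \<sigma>) * h (\<sigma> \<circ> \<pi>))"
proof -
  have "(\<Sum>\<sigma> | \<sigma> permutes UNIV. of_int (sign \<sigma>) * h \<sigma>) = (\<Sum>\<sigma> | \<sigma> permutes UNIV. of_int (sign (\<sigma> \<circ> \<pi>)) * h (\<sigma> \<circ> \<pi>))"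
    by (rule sum_permutations_compose_right[OF assms])
  also have "\<dots> = (\<Sum>\<sigma> | \<sigma> permutes UNIV. of_int (sign \<pi>) * (of_int (sign \<sigma>) * h (\<sigma> \<circ> \<pi>)))"
  proof (intro sum.cong refl)
    fix \<sigma> :: "'n \<times> bool \<Rightarrow> 'n \<times> bool" assume "\<sigma> \<in> {\<sigma>. \<sigma> permutes UNIV}"
    then have "sign (\<sigma> \<circ> \<pi>) = sign \<sigma> * sign \<pi>"
      using assms by (intro sign_compose permutes_imp_permutation[OF finite]) auto
    then show "of_int (sign (\<sigma> \<circ> \<pi>)) * h (\<sigma> \<circ> \<pi>) = of_int (sign \<pi>) * (of_int (sign \<sigma>) * h (\<sigma> \<circ> \<pi>))" by simp
  qed
  finally show ?thesis by (simp add: sum_distrib_left)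
qed

text \<open>An exact factor of a product of closed forms: the integrand is a sum of derivatives, because
  the terms in which a factor \<open>g k\<close> is differentiated cancel by closedness after averaging over the
  cyclic permutations of three indices.\<close>

lemma stokes_local:
  fixes V :: "(complex^'n::finite) set" and f :: "'n \<times> bool \<Rightarrow> complex^'n \<Rightarrow> real"
    and g :: "'n \<Rightarrow> 'n \<times> bool \<Rightarrow> 'n \<times> bool \<Rightarrow> complex^'n \<Rightarrow> real"
  assumes V: "open V" and C: "compact C" "C \<subseteq> V"
    and f: "\<And>b. smooth_on (f b) V" and f0: "\<And>b z. z \<in> V - C \<Longrightarrow> f b z = 0"
    and g: "\<And>j a b. smooth_on (g j a b) V"
    and cyc: "\<And>j a b c z. j \<noteq> j0 \<Longrightarrow> z \<in> V \<Longrightarrow>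
       fderiv (g j b c) z (real_basis a) + fderiv (g j c a) z (real_basis b) + fderiv (g j a b) z (real_basis c) = 0"
  shows "integral V (\<lambda>z. alt_sum (\<lambda>j a b. if j = j0 then fderiv (f b) z (real_basis a) - fderiv (f a) z (real_basis b) else g j a b z)) = 0"
proof -
  let ?P = "{\<sigma>. \<sigma> permutes (UNIV :: ('n \<times> bool) set)}"
  let ?J = "UNIV - {j0}"
  let ?E = "real_basis :: 'n \<times> bool \<Rightarrow> complex^'n"
  let ?a = "\<lambda>\<sigma>::'n \<times> bool \<Rightarrow> 'n \<times> bool. \<sigma> (j0, False)" and ?b = "\<lambda>\<sigma>::'n \<times> bool \<Rightarrow> 'n \<times> bool. \<sigma> (j0, True)"
  let ?R = "\<lambda>J \<sigma> z. \<Prod>j\<in>J. g j (\<sigma> (j, False)) (\<sigma> (j, True)) z"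
  \<comment> \<open>The coefficient to be differentiated in the remaining direction
    \<open>?a \<sigma>\<close>; the product rule yields the derivative of \<open>f\<close> and the
    terms in which some \<open>g k\<close> is differentiated.\<close>
  define \<phi> where "\<phi> \<sigma> z = f (?b \<sigma>) z * ?R ?J \<sigma> z" for \<sigma> z
  have \<phi>s: "smooth_on (\<phi> \<sigma>) V" for \<sigma> unfolding \<phi>_def by (intro smooth_on_mult smooth_on_prod f g)
  have \<phi>0: "\<phi> \<sigma> z = 0" if "z \<in> V - C" for \<sigma> z using f0[OF that] by (simp add: \<phi>_def)
  have fd: "(f b has_derivative fderiv (f b) z) (at z)" if "z \<in> V" for b z by (rule smooth_on_has_derivative[OF f V that])
  have gd: "(g j a b has_derivative fderiv (g j a b) z) (at z)" if "z \<in> V" for j a b z by (rule smooth_on_has_derivative[OF g V that])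
  have int: "integral V (\<lambda>z. fderiv (\<phi> \<sigma>) z (?E (?a \<sigma>))) = 0" "(\<lambda>z. fderiv (\<phi> \<sigma>) z (?E (?a \<sigma>))) integrable_on V" for \<sigma>
    by (rule integral_derivative_eq_0[where f="\<phi> \<sigma>" and f'="fderiv (\<phi> \<sigma>)", OF V C smooth_on_has_derivative[OF \<phi>s V]]
        integrable_derivative[where f="\<phi> \<sigma>" and f'="fderiv (\<phi> \<sigma>)", OF V C smooth_on_has_derivative[OF \<phi>s V]];
      use \<phi>0 smooth_on_continuous[OF smooth_on_frechet_derivative[OF \<phi>s V]] in blast)+
  have D\<phi>: "fderiv (\<phi> \<sigma>) z h = fderiv (f (?b \<sigma>)) z h * ?R ?J \<sigma> z
      + (\<Sum>k\<in>?J. f (?b \<sigma>) z * fderiv (g k (\<sigma> (k, False)) (\<sigma> (k, True))) z h * ?R (?J - {k}) \<sigma> z)" if z: "z \<in> V" for \<sigma> z h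
  proof -
    have "(\<phi> \<sigma> has_derivative (\<lambda>h. f (?b \<sigma>) z * (\<Sum>k\<in>?J. fderiv (g k (\<sigma> (k, False)) (\<sigma> (k, True))) z h * ?R (?J - {k}) \<sigma> z)
        + fderiv (f (?b \<sigma>)) z h * ?R ?J \<sigma> z)) (at z)"
      unfolding \<phi>_def by (intro has_derivative_mult has_derivative_prod fd gd z)
    from fderiv_eqI[OF this] show ?thesis by (simp add: sum_distrib_left mult.assoc)
  qed
  have vanish: "(\<Sum>\<sigma>\<in>?P. of_int (sign \<sigma>) * (f (?b \<sigma>) z * fderiv (g k (\<sigma> (k, False)) (\<sigma> (k, True))) z (?E (?a \<sigma>)) * ?R (?J - {k}) \<sigma> z)) = 0"
    if z: "z \<in> V" and k: "k \<noteq> j0" for z k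
  proof -
    define X where "X \<sigma> x y w = f (?b \<sigma>) z * fderiv (g k (\<sigma> y) (\<sigma> w)) z (?E (\<sigma> x)) * ?R (?J - {k}) \<sigma> z" for \<sigma> x y w
    \<comment> \<open>The cycle (j0, False) -> (k, False) -> (k, True) -> (j0, False), which is even
      and fixes all other slots.\<close>
    define \<pi> where "\<pi> = Transposition.transpose (j0, False) (k, False) \<circ> Transposition.transpose (k, False) (k, True)"
    have \<pi>p: "\<pi> permutes UNIV" unfolding \<pi>_def by (intro permutes_compose permutes_swap_id) auto
    have "sign \<pi> = 1"
      unfolding \<pi>_def using k by (subst sign_compose) (auto simp: sign_swap_id permutation_swap_id)
    then have re: "(\<Sum>\<sigma>\<in>?P. of_int (sign \<sigma>) * h \<sigma>) = (\<Sum>\<sigma>\<in>?P. of_int (sign \<sigma>) * h (\<sigma> \<circ> \<pi>))" for h :: "_ \<Rightarrow> real"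
      using alt_sum_reindex[OF \<pi>p, of h] by simp
    have \<pi>: "\<pi> (j0, False) = (k, False)" "\<pi> (k, False) = (k, True)" "\<pi> (k, True) = (j0, False)" "\<pi> (j0, True) = (j0, True)"
      "\<And>j b. j \<noteq> k \<Longrightarrow> j \<noteq> j0 \<Longrightarrow> \<pi> (j, b) = (j, b)"
      using k by (auto simp: \<pi>_def Transposition.transpose_def)
    have R\<pi>: "?R (?J - {k}) (\<sigma> \<circ> \<pi>) z = ?R (?J - {k}) \<sigma> z" for \<sigma>
      by (rule prod.cong) (auto simp: \<pi>(5))
    have X\<pi>: "X (\<sigma> \<circ> \<pi>) x y w = X \<sigma> (\<pi> x) (\<pi> y) (\<pi> w)" for \<sigma> x y w
      unfolding X_def R\<pi> by (simp add: \<pi>(4))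
    let ?S = "\<lambda>x y w. \<Sum>\<sigma>\<in>?P. of_int (sign \<sigma>) * X \<sigma> x y w"
    have e1: "?S (j0, False) (k, False) (k, True) = ?S (k, False) (k, True) (j0, False)"
      using re[of "\<lambda>\<sigma>. X \<sigma> (j0, False) (k, False) (k, True)"] unfolding X\<pi> \<pi> .
    have e2: "?S (k, False) (k, True) (j0, False) = ?S (k, True) (j0, False) (k, False)"
      using re[of "\<lambda>\<sigma>. X \<sigma> (k, False) (k, True) (j0, False)"] unfolding X\<pi> \<pi> .
    have "X \<sigma> (j0, False) (k, False) (k, True) + X \<sigma> (k, False) (k, True) (j0, False) + X \<sigma> (k, True) (j0, False) (k, False) = 0" for \<sigma>
    proof -
      have "X \<sigma> (j0, False) (k, False) (k, True) + X \<sigma> (k, False) (k, True) (j0, False) + X \<sigma> (k, True) (j0, False) (k, False)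
        = f (?b \<sigma>) z * (fderiv (g k (\<sigma> (k, False)) (\<sigma> (k, True))) z (?E (\<sigma> (j0, False))) +
            fderiv (g k (\<sigma> (k, True)) (\<sigma> (j0, False))) z (?E (\<sigma> (k, False))) +
            fderiv (g k (\<sigma> (j0, False)) (\<sigma> (k, False))) z (?E (\<sigma> (k, True)))) * ?R (?J - {k}) \<sigma> z"
        unfolding X_def by (simp add: algebra_simps)
      then show ?thesis unfolding cyc[OF k z] by simp
    qed
    then have "(\<Sum>\<sigma>\<in>?P. of_int (sign \<sigma>) * (X \<sigma> (j0, False) (k, False) (k, True) + X \<sigma> (k, False) (k, True) (j0, False) + X \<sigma> (k, True) (j0, False) (k, False))) = 0"
      by simp
    then have "?S (j0, False) (k, False) (k, True) + ?S (k, False) (k, True) (j0, False) + ?S (k, True) (j0, False) (k, False) = 0"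
      by (simp add: distrib_left sum.distrib)
    then have "?S (j0, False) (k, False) (k, True) = 0" using e1 e2 by simp
    then show ?thesis unfolding X_def .
  qed
  have pw: "alt_sum (\<lambda>j a b. if j = j0 then fderiv (f b) z (?E a) - fderiv (f a) z (?E b) else g j a b z)
     = (\<Sum>\<sigma>\<in>?P. 2 * of_int (sign \<sigma>) * fderiv (\<phi> \<sigma>) z (?E (?a \<sigma>)))" if z: "z \<in> V" for z
  proof -
    let ?Df = "\<lambda>b a. fderiv (f b) z (?E a)"
    have split: "(\<Prod>j\<in>UNIV. M j) = M j0 * (\<Prod>j\<in>?J. M j)" for M :: "'n \<Rightarrow> real"
      by (rule prod.remove) auto
    have "alt_sum (\<lambda>j a b. if j = j0 then ?Df b a - ?Df a b else g j a b z)
      = (\<Sum>\<sigma>\<in>?P. of_int (sign \<sigma>) * ((?Df (?b \<sigma>) (?a \<sigma>) - ?Df (?a \<sigma>) (?b \<sigma>)) * ?R ?J \<sigma> z))"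
      unfolding alt_sum_def split by (intro sum.cong refl arg_cong2[where f="(*)"] prod.cong) auto
    also have "\<dots> = (\<Sum>\<sigma>\<in>?P. of_int (sign \<sigma>) * (?Df (?b \<sigma>) (?a \<sigma>) * ?R ?J \<sigma> z)) - (\<Sum>\<sigma>\<in>?P. of_int (sign \<sigma>) * (?Df (?a \<sigma>) (?b \<sigma>) * ?R ?J \<sigma> z))"
      by (simp add: algebra_simps sum_subtractf)
    also have "(\<Sum>\<sigma>\<in>?P. of_int (sign \<sigma>) * (?Df (?a \<sigma>) (?b \<sigma>) * ?R ?J \<sigma> z)) = - (\<Sum>\<sigma>\<in>?P. of_int (sign \<sigma>) * (?Df (?b \<sigma>) (?a \<sigma>) * ?R ?J \<sigma> z))"
    proof -
      \<comment> \<open>Exchanging the two slots of \<open>j0\<close> changes the sign, so the two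
        halves of the exterior derivative contribute equally; this is the factor 2.\<close>
      let ?t = "Transposition.transpose (j0, False) (j0, True)"
      have R: "?R ?J (\<sigma> \<circ> ?t) z = ?R ?J \<sigma> z" for \<sigma>
        by (rule prod.cong) (auto simp: Transposition.transpose_def)
      have s: "sign ?t = - 1" by (simp add: sign_swap_id)
      have t: "?t permutes UNIV" by (rule permutes_swap_id) auto
      show ?thesis
        using alt_sum_reindex[OF t, of "\<lambda>\<sigma>. ?Df (?a \<sigma>) (?b \<sigma>) * ?R ?J \<sigma> z"] unfolding R s by simp
    qed
    also have "(\<Sum>\<sigma>\<in>?P. of_int (sign \<sigma>) * (?Df (?b \<sigma>) (?a \<sigma>) * ?R ?J \<sigma> z)) = (\<Sum>\<sigma>\<in>?P. of_int (sign \<sigma>) * fderiv (\<phi> \<sigma>) z (?E (?a \<sigma>)))"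
    proof -
      have "(\<Sum>\<sigma>\<in>?P. of_int (sign \<sigma>) * fderiv (\<phi> \<sigma>) z (?E (?a \<sigma>))) = (\<Sum>\<sigma>\<in>?P. of_int (sign \<sigma>) * (?Df (?b \<sigma>) (?a \<sigma>) * ?R ?J \<sigma> z))
        + (\<Sum>k\<in>?J. \<Sum>\<sigma>\<in>?P. of_int (sign \<sigma>) * (f (?b \<sigma>) z * fderiv (g k (\<sigma> (k, False)) (\<sigma> (k, True))) z (?E (?a \<sigma>)) * ?R (?J - {k}) \<sigma> z))"
        unfolding D\<phi>[OF z] distrib_left sum.distrib sum_distrib_left by (subst (2) sum.swap) simp
      also have "(\<Sum>k\<in>?J. \<Sum>\<sigma>\<in>?P. of_int (sign \<sigma>) * (f (?b \<sigma>) z * fderiv (g k (\<sigma> (k, False)) (\<sigma> (k, True))) z (?E (?a \<sigma>)) * ?R (?J - {k}) \<sigma> z)) = 0"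
        by (rule sum.neutral) (use vanish[OF z] in blast)
      finally show ?thesis by simp
    qed
    finally show ?thesis by (simp add: mult.assoc flip: sum_distrib_left)
  qed
  have "integral V (\<lambda>z. alt_sum (\<lambda>j a b. if j = j0 then fderiv (f b) z (?E a) - fderiv (f a) z (?E b) else g j a b z))
     = integral V (\<lambda>z. \<Sum>\<sigma>\<in>?P. 2 * of_int (sign \<sigma>) * fderiv (\<phi> \<sigma>) z (?E (?a \<sigma>)))"
    by (rule integral_cong) (rule pw)
  also have "\<dots> = (\<Sum>\<sigma>\<in>?P. integral V (\<lambda>z. 2 * of_int (sign \<sigma>) * fderiv (\<phi> \<sigma>) z (?E (?a \<sigma>))))"
    by (rule integral_sum) (auto intro!: integrable_on_mult_right int(2) finite_permutations)
  also have "\<dots> = 0" by (simp add: int(1))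
  finally show ?thesis .
qed

text \<open>Each slot of the product takes either \<open>M\<close> or \<open>N\<close>, and
  \<open>S\<close> collects those that take \<open>M\<close>. The expansion serves both the
  invariance of the intersection number under exact forms and its dependence on time.\<close>

lemma alt_sum_binomial:
  fixes M N :: "'n::finite \<times> bool \<Rightarrow> 'n \<times> bool \<Rightarrow> real"
  shows "alt_sum (\<lambda>j::'n. \<lambda>p q. a * M p q + b * N p q)
    = (\<Sum>S\<in>Pow UNIV. a ^ card S * b ^ card (- S) * alt_sum (\<lambda>j p q. if j \<in> S then M p q else N p q))"
proof -
  let ?P = "{\<sigma>. \<sigma> permutes (UNIV :: ('n \<times> bool) set)}"
  have "(\<Prod>j\<in>UNIV. a * M (\<sigma> (j, False)) (\<sigma> (j, True)) + b * N (\<sigma> (j, False)) (\<sigma> (j, True)))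
    = (\<Sum>S\<in>Pow UNIV. a ^ card S * b ^ card (- S) * (\<Prod>j\<in>UNIV. if j \<in> S then M (\<sigma> (j, False)) (\<sigma> (j, True)) else N (\<sigma> (j, False)) (\<sigma> (j, True))))"
    for \<sigma> :: "'n \<times> bool \<Rightarrow> 'n \<times> bool"
  proof -
    have "(\<Prod>j\<in>UNIV. if j \<in> S then m j else n j) = (\<Prod>j\<in>S. m j) * (\<Prod>j\<in>-S. n j)" for S and m n :: "'n \<Rightarrow> real"
      using prod.If_cases[of UNIV "\<lambda>j. j \<in> S" m n] by (simp add: Compl_eq)
    then show ?thesis
      by (subst prod_add) (simp_all add: prod.distrib Compl_eq_Diff_UNIV mult_ac)
  qed
  then show ?thesis
    unfolding alt_sum_def sum_distrib_left by (subst sum.swap) (simp add: sum_distrib_left mult_ac)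
qed

lemma alt_sum_slot_sum:
  fixes M :: "'i \<Rightarrow> 'n::finite \<times> bool \<Rightarrow> 'n \<times> bool \<Rightarrow> real"
  shows "(\<Sum>i\<in>I. alt_sum (\<lambda>j p q. if j = j0 then M i p q else N j p q)) = alt_sum (\<lambda>j p q. if j = j0 then \<Sum>i\<in>I. M i p q else N j p q)"
proof -
  have split: "(\<Prod>j\<in>UNIV. if j = j0 then m j else n j) = m j0 * (\<Prod>j\<in>UNIV - {j0}. n j)" for m n :: "'n \<Rightarrow> real"
    by (subst prod.remove[of _ j0]) (auto intro!: prod.cong)
  show ?thesis
    unfolding alt_sum_def split sum_distrib_left sum_distrib_right by (rule sum.swap)
qed

section \<open>Integration on the manifold\<close>

context ccm
begin

text \<open>The determinant occurs without absolute value, as for forms of top degree; for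
  transition maps of a complex atlas it is a squared modulus.\<close>

definition top_density :: "(('a, 'n) chart \<Rightarrow> complex^'n \<Rightarrow> real) \<Rightarrow> bool" where
  "top_density \<theta> \<longleftrightarrow> (\<forall>c\<in>A. continuous_on (chart_img c) (\<theta> c)) \<and>
     (\<forall>c\<in>A. \<forall>c'\<in>A. \<forall>z\<in>overlap c c'. \<theta> c z = det (realmat (dtrans c c' z)) * \<theta> c' (transition c c' z))"

lemma top_densityD:
  assumes "top_density \<theta>"
  shows "c \<in> A \<Longrightarrow> continuous_on (chart_img c) (\<theta> c)"
    "c \<in> A \<Longrightarrow> c' \<in> A \<Longrightarrow> z \<in> overlap c c' \<Longrightarrow> \<theta> c z = det (realmat (dtrans c c' z)) * \<theta> c' (transition c c' z)"
  using assms unfolding top_density_def by blast+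

lemma chart_compact_support:
  assumes c: "c \<in> A" and K: "closed K" "K \<subseteq> chart_dom c" and f: "continuous_on (chart_img c) f"
    and z: "\<And>z. z \<in> chart_img c \<Longrightarrow> chart_inv c z \<notin> K \<Longrightarrow> f z = 0"
  shows "compact_support (chart_img c) (chart_map c ` K) f"
proof
  have "compact K" using closed_Int_compact[OF K(1) compact_UNIV] by simp
  then show "compact (chart_map c ` K)"
    by (rule compact_continuous_image[OF continuous_on_subset[OF cont_chart_map[OF c] K(2)]])
  show "chart_map c ` K \<subseteq> chart_img c" using K(2) chart_map_img[OF c] by blast
  show "f y = 0" if "y \<in> chart_img c - chart_map c ` K" for y
    using that z[of y] chart_map_inv[OF c, of y] by force
qed (use f open_img c in auto)

text \<open>A density supported in a closed set inside both chart domains can be integrated over the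
  overlap in either chart, and there the transition map changes the variables.\<close>

lemma integral_change_chart:
  assumes T: "top_density T" and c: "c \<in> A" "c' \<in> A" and K: "closed K" "K \<subseteq> chart_dom c \<inter> chart_dom c'"
    and z: "\<And>d z. d \<in> A \<Longrightarrow> z \<in> chart_img d \<Longrightarrow> chart_inv d z \<notin> K \<Longrightarrow> T d z = 0"
  shows "integral (chart_img c) (T c) = integral (chart_img c') (T c')"
proof -
  have restrict: "integral (chart_img d) (T d) = integral (overlap d d') (T d)" if d: "d \<in> A" "K \<subseteq> chart_dom d'" for d d'
  proof -
    have "zext (chart_img d) (T d) = zext (overlap d d') (T d)"
      using overlap_subset[OF d(1), of d'] z[OF d(1)] d(2) by (auto simp: zext_def fun_eq_iff overlap_eq[OF d(1)])
    then show ?thesis by (metis integral_zext)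
  qed
  have "compact K" using closed_Int_compact[OF K(1) compact_UNIV] by simp
  then have cK: "compact (chart_map c' ` K)"
    using compact_continuous_image[OF continuous_on_subset[OF cont_chart_map[OF c(2)]]] K by blast
  have cs: "compact_support (overlap c' c) (chart_map c' ` K) (T c')"
  proof
    show "continuous_on (overlap c' c) (T c')"
      using T c overlap_subset[OF c(2)] by (meson continuous_on_subset top_density_def)
    show "T c' y = 0" if "y \<in> overlap c' c - chart_map c' ` K" for y
    proof -
      have y: "y \<in> chart_img c'" using that overlap_subset[OF c(2)] by blast
      have "chart_inv c' y \<notin> K"
        using that chart_map_inv[OF c(2) y] image_eqI[of y "chart_map c'" "chart_inv c' y" K] by auto
      then show ?thesis using z[OF c(2) y] by blast
    qed
  qed (use open_overlap[OF c(2,1)] cK K in auto)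
  have "integral (overlap c' c) (T c') = integral (overlap c c') (\<lambda>z. det (realmat (dtrans c c' z)) * T c' (transition c c' z))"
    by (rule integral_change_holomorphic[OF cs open_overlap[OF c] transition_holomorphic[OF c] transition_image[OF c]
          holomorphic_map_on_continuous[OF transition_holomorphic[OF c(2,1)]] transition_inverse[OF c]])
  also have "\<dots> = integral (overlap c c') (T c)"
    by (rule integral_cong) (simp only: top_densityD(2)[OF T c])
  finally show ?thesis using restrict[OF c(1), of c'] restrict[OF c(2), of c] K(2) by simp
qed

text \<open>\<open>top_integral\<close> with the partition held fixed; computations use this form,
  and \<open>top_integral_eq\<close> transfers the result.\<close>

definition pou_integral :: "('a, 'n) chart set \<Rightarrow> (('a, 'n) chart \<Rightarrow> 'a \<Rightarrow> real) \<Rightarrow> (('a, 'n) chart \<Rightarrow> complex^'n \<Rightarrow> real) \<Rightarrow> real" where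
  "pou_integral F \<rho> \<theta> = (\<Sum>c\<in>F. integral (chart_img c) (\<lambda>z. \<rho> c (chart_inv c z) * \<theta> c z))"

context
  fixes F \<rho> assumes pou: "partition_of_unity A F \<rho>"
begin

abbreviation rsupp :: "('a, 'n) chart \<Rightarrow> 'a set" where "rsupp c \<equiv> closure {p. \<rho> c p \<noteq> 0}"

lemma pouD: "finite F" "c \<in> F \<Longrightarrow> c \<in> A" "c \<in> F \<Longrightarrow> 0 \<le> \<rho> c p" "c \<in> F \<Longrightarrow> rsupp c \<subseteq> chart_dom c"
  "c \<in> F \<Longrightarrow> smooth_fun (\<rho> c)" "(\<Sum>c\<in>F. \<rho> c p) = 1" "p \<notin> rsupp c \<Longrightarrow> \<rho> c p = 0"
  using pou closure_subset[of "{p. \<rho> c p \<noteq> 0}"] by (auto simp: partition_of_unity_def smooth_fun_def o_def)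

lemma pou_cont: "c \<in> F \<Longrightarrow> d \<in> A \<Longrightarrow> continuous_on (chart_img d) (\<lambda>z. \<rho> c (chart_inv d z))"
  using pouD(5)[of c] smooth_on_continuous unfolding smooth_fun_def by blast

lemma pou_compact_support:
  assumes "c \<in> F" "continuous_on (chart_img c) f"
  shows "compact_support (chart_img c) (chart_map c ` rsupp c) (\<lambda>z. \<rho> c (chart_inv c z) * f z)"
proof (rule chart_compact_support[OF pouD(2)[OF assms(1)] closed_closure pouD(4)[OF assms(1)]
      continuous_on_mult[OF pou_cont[OF assms(1) pouD(2)[OF assms(1)]] assms(2)]])
  show "\<rho> c (chart_inv c z) * f z = 0" if "chart_inv c z \<notin> rsupp c" for z
    using pouD(7)[OF that] by (simp only: mult_zero_left)
qed

lemma pou_integral_sum: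
  assumes "\<And>i c. i \<in> I \<Longrightarrow> c \<in> F \<Longrightarrow> continuous_on (chart_img c) (\<theta> i c)" "finite I"
  shows "pou_integral F \<rho> (\<lambda>c z. \<Sum>i\<in>I. a i * \<theta> i c z) = (\<Sum>i\<in>I. a i * pou_integral F \<rho> (\<theta> i))"
proof -
  have "integral (chart_img c) (\<lambda>z. \<rho> c (chart_inv c z) * (\<Sum>i\<in>I. a i * \<theta> i c z))
     = (\<Sum>i\<in>I. a i * integral (chart_img c) (\<lambda>z. \<rho> c (chart_inv c z) * \<theta> i c z))" if c: "c \<in> F" for c
  proof -
    have int: "(\<lambda>z. \<rho> c (chart_inv c z) * \<theta> i c z) integrable_on chart_img c" if "i \<in> I" for i
      by (rule compact_support.integrable[OF pou_compact_support[OF c assms(1)[OF that c]]])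
    have "integral (chart_img c) (\<lambda>z. \<rho> c (chart_inv c z) * (\<Sum>i\<in>I. a i * \<theta> i c z))
      = integral (chart_img c) (\<lambda>z. \<Sum>i\<in>I. a i * (\<rho> c (chart_inv c z) * \<theta> i c z))"
      by (simp add: sum_distrib_left mult_ac)
    also have "\<dots> = (\<Sum>i\<in>I. integral (chart_img c) (\<lambda>z. a i * (\<rho> c (chart_inv c z) * \<theta> i c z)))"
      by (rule integral_sum[OF assms(2)]) (intro integrable_on_mult_right int)
    finally show ?thesis by simp
  qed
  then show ?thesis unfolding pou_integral_def
    by (simp add: sum_distrib_left) (rule sum.swap)
qed

text \<open>Every piece cut out by the partition is moved to the chart \<open>c'\<close>, where the
  pieces add up again because the partition sums to 1.\<close>

lemma pou_integral_supported:
  assumes T: "top_density T" and c': "c' \<in> A" and K: "closed K" "K \<subseteq> chart_dom c'"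
    and z: "\<And>d z. d \<in> A \<Longrightarrow> z \<in> chart_img d \<Longrightarrow> chart_inv d z \<notin> K \<Longrightarrow> T d z = 0"
  shows "pou_integral F \<rho> T = integral (chart_img c') (T c')"
proof -
  have cT: "continuous_on (chart_img d) (T d)" if "d \<in> A" for d using T that by (simp add: top_density_def)
  have 1: "integral (chart_img c) (\<lambda>z. \<rho> c (chart_inv c z) * T c z) = integral (chart_img c') (\<lambda>z. \<rho> c (chart_inv c' z) * T c' z)"
    if c: "c \<in> F" for c
  proof (rule integral_change_chart[of "\<lambda>d z. \<rho> c (chart_inv d z) * T d z" c c' "rsupp c \<inter> K"])
    show "top_density (\<lambda>d z. \<rho> c (chart_inv d z) * T d z)"
      unfolding top_density_def
    proof (intro conjI ballI)
      show "continuous_on (chart_img d) (\<lambda>z. \<rho> c (chart_inv d z) * T d z)" if "d \<in> A" for d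
        by (intro continuous_on_mult pou_cont c that cT)
      show "\<rho> c (chart_inv d z) * T d z = det (realmat (dtrans d d' z)) * (\<rho> c (chart_inv d' (transition d d' z)) * T d' (transition d d' z))"
        if "d \<in> A" "d' \<in> A" "z \<in> overlap d d'" for d d' z
        unfolding chart_inv_transition[OF that] top_densityD(2)[OF T that] by simp
    qed
    show "c \<in> A" "c' \<in> A" "closed (rsupp c \<inter> K)" "rsupp c \<inter> K \<subseteq> chart_dom c \<inter> chart_dom c'"
      using pouD(2)[OF c] c' K pouD(4)[OF c] by auto
    show "\<rho> c (chart_inv d z) * T d z = 0" if "d \<in> A" "z \<in> chart_img d" "chart_inv d z \<notin> rsupp c \<inter> K" for d z
      using that z[of d z] pouD(7)[of "chart_inv d z" c] by (cases "chart_inv d z \<in> K") auto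
  qed
  have int: "(\<lambda>z. \<rho> c (chart_inv c' z) * T c' z) integrable_on chart_img c'" if c: "c \<in> F" for c
    by (rule compact_support.integrable[OF chart_compact_support[OF c' K continuous_on_mult[OF pou_cont[OF c c'] cT[OF c']]]])
      (simp add: z[OF c'])
  have "pou_integral F \<rho> T = integral (chart_img c') (\<lambda>z. \<Sum>c\<in>F. \<rho> c (chart_inv c' z) * T c' z)"
    unfolding pou_integral_def by (subst integral_sum[OF pouD(1) int]) (auto simp: 1)
  also have "\<dots> = integral (chart_img c') (T c')"
    by (simp add: pouD(6) flip: sum_distrib_right)
  finally show ?thesis .
qed

end

lemma top_density_mult:
  assumes \<theta>: "top_density \<theta>" and g: "smooth_fun g"
  shows "top_density (\<lambda>d z. g (chart_inv d z) * \<theta> d z)"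
  unfolding top_density_def
proof (intro conjI ballI)
  show "continuous_on (chart_img d) (\<lambda>z. g (chart_inv d z) * \<theta> d z)" if "d \<in> A" for d
    using continuous_on_mult[OF smooth_on_continuous top_densityD(1)[OF \<theta> that]] g that unfolding smooth_fun_def by blast
  show "g (chart_inv d z) * \<theta> d z = det (realmat (dtrans d d' z)) * (g (chart_inv d' (transition d d' z)) * \<theta> d' (transition d d' z))"
    if "d \<in> A" "d' \<in> A" "z \<in> overlap d d'" for d d' z
    unfolding chart_inv_transition[OF that] top_densityD(2)[OF \<theta> that] by simp
qed

text \<open>Cut \<theta> by the second partition. Each piece lives in a single chart, where its
  integral can be computed with the first partition, and summing restores \<theta>.\<close>

lemma pou_integral_unique:
  assumes p: "partition_of_unity A F \<rho>" and q: "partition_of_unity A G \<sigma>" and \<theta>: "top_density \<theta>"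
  shows "pou_integral F \<rho> \<theta> = pou_integral G \<sigma> \<theta>"
proof -
  have c\<theta>: "continuous_on (chart_img d) (\<theta> d)" if "d \<in> A" for d using \<theta> that by (simp add: top_density_def)
  have "pou_integral G \<sigma> \<theta> = (\<Sum>c'\<in>G. pou_integral F \<rho> (\<lambda>d z. \<sigma> c' (chart_inv d z) * \<theta> d z))"
    unfolding pou_integral_def[of G]
  proof (rule sum.cong[OF refl])
    fix c' assume c': "c' \<in> G"
    show "integral (chart_img c') (\<lambda>z. \<sigma> c' (chart_inv c' z) * \<theta> c' z) = pou_integral F \<rho> (\<lambda>d z. \<sigma> c' (chart_inv d z) * \<theta> d z)"
      by (rule pou_integral_supported[OF p top_density_mult[OF \<theta> pouD(5)[OF q c']] pouD(2)[OF q c'] closed_closure pouD(4)[OF q c'], symmetric])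
        (drule pouD(7)[OF q], simp)
  qed
  also have "\<dots> = (\<Sum>c'\<in>G. 1 * pou_integral F \<rho> (\<lambda>d z. \<sigma> c' (chart_inv d z) * \<theta> d z))" by simp
  also have "\<dots> = pou_integral F \<rho> (\<lambda>d z. \<Sum>c'\<in>G. 1 * (\<sigma> c' (chart_inv d z) * \<theta> d z))"
    by (rule pou_integral_sum[OF p _ pouD(1)[OF q], symmetric])
      (use pouD(2)[OF p] c\<theta> in \<open>auto intro!: continuous_on_mult pou_cont[OF q]\<close>)
  also have "\<dots> = pou_integral F \<rho> \<theta>"
    by (simp add: pouD(6)[OF q] flip: sum_distrib_right)
  finally show ?thesis ..
qed

lemma top_integral_eq:
  assumes p: "partition_of_unity A F \<rho>" and \<theta>: "top_density \<theta>"
  shows "top_integral A \<theta> = pou_integral F \<rho> \<theta>"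
  unfolding top_integral_def
proof (rule the_equality)
  show "\<exists>F' \<rho>'. partition_of_unity A F' \<rho>' \<and> pou_integral F \<rho> \<theta> = (\<Sum>c\<in>F'. integral (chart_img c) (\<lambda>z. \<rho>' c (chart_inv c z) * \<theta> c z))"
    using p unfolding pou_integral_def by blast
  fix I assume "\<exists>F' \<rho>'. partition_of_unity A F' \<rho>' \<and> I = (\<Sum>c\<in>F'. integral (chart_img c) (\<lambda>z. \<rho>' c (chart_inv c z) * \<theta> c z))"
  then obtain F' \<rho>' where p': "partition_of_unity A F' \<rho>'" and I: "I = pou_integral F' \<rho>' \<theta>"
    unfolding pou_integral_def by blast
  show "I = pou_integral F \<rho> \<theta>" unfolding I by (rule pou_integral_unique[OF p' p \<theta>])
qed

text \<open>The bump is a radial function in one chart. In any other chart it is smooth near points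
  of the first domain by composition with a transition map, and it vanishes off the compact set
  \<open>K\<close>, whose complement is open because the space is Hausdorff.\<close>

lemma smooth_bump_exists:
  assumes c: "c \<in> A" and U: "open U" "p \<in> U" "U \<subseteq> chart_dom c"
  obtains b K where "smooth_fun b" "\<And>q. 0 \<le> b q" "0 < b p" "closed K" "K \<subseteq> U" "\<And>q. q \<notin> K \<Longrightarrow> b q = 0"
proof -
  define z0 where "z0 = chart_map c p"
  have pc: "p \<in> chart_dom c" using U by blast
  have op: "open {z \<in> chart_img c. chart_inv c z \<in> U}" by (rule open_chart_vimage[OF c U(1)])
  have "z0 \<in> {z \<in> chart_img c. chart_inv c z \<in> U}" using chart_map_img[OF c pc] chart_inv_map[OF c pc] U(2) by (simp add: z0_def)
  then obtain r where r: "r > 0" "cball z0 r \<subseteq> {z \<in> chart_img c. chart_inv c z \<in> U}" using op open_contains_cball by blast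
  define K where "K = chart_inv c ` cball z0 r"
  define b where "b q = (if q \<in> chart_dom c then exp_bump 0 (r\<^sup>2 - (chart_map c q - z0) \<bullet> (chart_map c q - z0)) else 0)" for q
  have "compact K" unfolding K_def
    by (rule compact_continuous_image[OF continuous_on_subset[OF cont_chart_inv[OF c]]]) (use r in auto)
  then have K: "closed K" by (rule compact_imp_closed)
  have KU: "K \<subseteq> U" using r(2) by (auto simp: K_def)
  have b0: "b q = 0" if "q \<notin> K" for q
  proof (cases "q \<in> chart_dom c")
    case True
    have "chart_map c q \<notin> cball z0 r" using that chart_inv_map[OF c True] unfolding K_def by (metis image_eqI)
    then have "r < norm (chart_map c q - z0)" by (simp add: dist_norm norm_minus_commute)
    then have "r\<^sup>2 < (norm (chart_map c q - z0))\<^sup>2" using r(1) by (intro power_strict_mono) auto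
    then show ?thesis by (simp add: b_def exp_bump_def power2_norm_eq_inner)
  qed (simp add: b_def)
  have "smooth_on (\<lambda>z. b (chart_inv d z)) (chart_img d)" if d: "d \<in> A" for d
  proof (rule smooth_on_locally[OF open_img[OF d]])
    fix z assume z: "z \<in> chart_img d"
    show "\<exists>W. open W \<and> z \<in> W \<and> smooth_on (\<lambda>z. b (chart_inv d z)) (W \<inter> chart_img d)"
    proof (cases "chart_inv d z \<in> chart_dom c")
      case True
      let ?\<tau> = "transition d c"
      have s: "smooth_on ?\<tau> (overlap d c)" by (rule holomorphic_imp_smooth[OF transition_holomorphic[OF d c] open_overlap[OF d c]])
      have "smooth_on (\<lambda>z. exp_bump 0 (r\<^sup>2 - (?\<tau> z - z0) \<bullet> (?\<tau> z - z0))) (overlap d c)"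
        by (rule smooth_on_compose[OF smooth_on_exp_bump[of 0 UNIV]])
          (auto intro!: smooth_on_diff smooth_on_bilinear[OF bounded_bilinear_inner] s)
      moreover have "smooth_on (\<lambda>z. b (chart_inv d z)) (overlap d c) \<longleftrightarrow> smooth_on (\<lambda>z. exp_bump 0 (r\<^sup>2 - (?\<tau> z - z0) \<bullet> (?\<tau> z - z0))) (overlap d c)"
        by (rule smooth_on_cong) (simp add: overlap_eq[OF d] b_def transition_def)
      ultimately have "smooth_on (\<lambda>z. b (chart_inv d z)) (overlap d c)" by simp
      then have "smooth_on (\<lambda>z. b (chart_inv d z)) (overlap d c \<inter> chart_img d)" by (rule smooth_on_subset) (rule Int_lower1)
      then show ?thesis using open_overlap[OF d c] True z overlap_eq[OF d, of c] by blast
    next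
      case False
      let ?W = "{z \<in> chart_img d. chart_inv d z \<in> - K}"
      have "smooth_on (\<lambda>z. b (chart_inv d z)) ?W \<longleftrightarrow> smooth_on (\<lambda>z. 0::real) ?W"
        by (rule smooth_on_cong) (simp add: b0)
      then have "smooth_on (\<lambda>z. b (chart_inv d z)) ?W" by simp
      then have "smooth_on (\<lambda>z. b (chart_inv d z)) (?W \<inter> chart_img d)" by (rule smooth_on_subset) (rule Int_lower1)
      moreover have "z \<in> ?W" using False z KU U(3) by auto
      moreover have "open ?W" by (rule open_chart_vimage[OF d]) (use K in auto)
      ultimately show ?thesis by blast
    qed
  qed
  then have "smooth_fun b" by (simp add: smooth_fun_def)
  moreover have "0 < b p" using r(1) pc by (simp add: b_def exp_bump_pos_iff z0_def)
  moreover have "0 \<le> b q" for q by (simp add: b_def exp_bump_nonneg)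
  ultimately show ?thesis using that K KU b0 by blast
qed

text \<open>The functions are subordinate to the prescribed neighbourhoods \<open>U p\<close>, not
  merely to the chart domains; this later confines the volume to the cubes of the Harnack
  inequality.\<close>

lemma partition_of_unity_exists:
  assumes cp: "\<And>p. cp p \<in> A" and U: "\<And>p. open (U p)" "\<And>p. p \<in> U p" "\<And>p. U p \<subseteq> chart_dom (cp p)"
  obtains Q \<rho> where "finite Q" "partition_of_unity A (cp ` Q) \<rho>" "(\<Union>p\<in>Q. U p) = UNIV"
    "\<And>c q. \<rho> c q \<noteq> 0 \<Longrightarrow> \<exists>p\<in>Q. cp p = c \<and> q \<in> U p"
proof -
  have "\<exists>b K. smooth_fun b \<and> (\<forall>q. 0 \<le> b q) \<and> 0 < b p \<and> closed K \<and> K \<subseteq> U p \<and> (\<forall>q. q \<notin> K \<longrightarrow> b q = 0)" for p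
    using smooth_bump_exists[OF cp U(1) U(2) U(3)] by metis
  then obtain b K where b: "\<And>p. smooth_fun (b p)" "\<And>p q. 0 \<le> b p q" "\<And>p. 0 < b p p"
    and K: "\<And>p. closed (K p)" "\<And>p. K p \<subseteq> U p" "\<And>p q. q \<notin> K p \<Longrightarrow> b p q = 0" by metis
  have op: "open {q. 0 < b p q}" for p
    by (rule open_Collect_less[OF continuous_on_const smooth_fun_continuous[OF b(1)]])
  have cov: "UNIV \<subseteq> (\<Union>p\<in>UNIV. {q. 0 < b p q})" using b(3) by blast
  obtain Q where Q: "finite Q" "UNIV \<subseteq> (\<Union>p\<in>Q. {q. 0 < b p q})"
    using compactE_image[OF compact_UNIV, of UNIV "\<lambda>p. {q. 0 < b p q}"] op cov by metis
  define B where "B q = (\<Sum>p\<in>Q. b p q)" for q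
  have B: "B q > 0" for q
  proof -
    obtain p where "p \<in> Q" "0 < b p q" using Q(2) by blast
    then show ?thesis unfolding B_def using b(2) Q(1) by (intro sum_pos2[of Q p]) auto
  qed
  \<comment> \<open>A partition of unity is indexed by charts, and several points of
    \<open>Q\<close> may share one, so the bumps belonging to one chart are added up.\<close>
  define \<rho> where "\<rho> c q = (\<Sum>p\<in>{p\<in>Q. cp p = c}. b p q) / B q" for c q
  have pos: "0 \<le> \<rho> c q" for c q unfolding \<rho>_def using B[of q] b(2) by (intro divide_nonneg_pos sum_nonneg) auto
  have nz: "\<exists>p\<in>Q. cp p = c \<and> q \<in> K p" if "\<rho> c q \<noteq> 0" for c q
  proof (rule ccontr)
    assume "\<not> ?thesis"
    then have "(\<Sum>p\<in>{p\<in>Q. cp p = c}. b p q) = 0" by (intro sum.neutral) (use K(3) in auto)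
    then show False using that by (simp add: \<rho>_def)
  qed
  have "partition_of_unity A (cp ` Q) \<rho>"
    unfolding partition_of_unity_def
  proof (intro conjI ballI allI)
    show "finite (cp ` Q)" "cp ` Q \<subseteq> A" using Q(1) cp by auto
    show "0 \<le> \<rho> c q" for c q by (rule pos)
    show "closure {q. \<rho> c q \<noteq> 0} \<subseteq> chart_dom c" for c
    proof -
      have "closed (\<Union>p\<in>{p\<in>Q. cp p = c}. K p)" using Q(1) K(1) by (intro closed_UN) auto
      moreover have "{q. \<rho> c q \<noteq> 0} \<subseteq> (\<Union>p\<in>{p\<in>Q. cp p = c}. K p)" using nz by blast
      ultimately have "closure {q. \<rho> c q \<noteq> 0} \<subseteq> (\<Union>p\<in>{p\<in>Q. cp p = c}. K p)" by (rule closure_minimal[rotated])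
      also have "\<dots> \<subseteq> chart_dom c" using K(2) U(3) by blast
      finally show ?thesis .
    qed
    show "smooth_on (\<rho> c \<circ> chart_inv d) (chart_img d)" if "d \<in> A" for c d
      unfolding \<rho>_def B_def o_def
      by (intro smooth_on_divide smooth_on_sum) (use b(1) that B in \<open>auto simp: smooth_fun_def B_def less_imp_neq[THEN not_sym]\<close>)
    show "(\<Sum>c\<in>cp ` Q. \<rho> c q) = 1" for q
    proof -
      have "(\<Sum>c\<in>cp ` Q. \<rho> c q) = (\<Sum>c\<in>cp ` Q. \<Sum>p\<in>{p\<in>Q. cp p = c}. b p q) / B q"
        by (simp add: \<rho>_def sum_divide_distrib)
      also have "(\<Sum>c\<in>cp ` Q. \<Sum>p\<in>{p\<in>Q. cp p = c}. b p q) = B q"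
        unfolding B_def by (rule sum.image_gen[OF Q(1), symmetric])
      finally show ?thesis using B[of q] by simp
    qed
  qed
  moreover have "(\<Union>p\<in>Q. U p) = UNIV"
  proof -
    have "q \<in> (\<Union>p\<in>Q. U p)" for q
    proof -
      obtain p where p: "p \<in> Q" "0 < b p q" using Q(2) by blast
      then have "q \<in> K p" using K(3)[of q p] by fastforce
      then show ?thesis using p K(2) by blast
    qed
    then show ?thesis by blast
  qed
  moreover have "\<exists>p\<in>Q. cp p = c \<and> q \<in> U p" if "\<rho> c q \<noteq> 0" for c q using nz[OF that] K(2) by blast
  ultimately show ?thesis using that Q(1) by blast
qed

section \<open>Top intersection numbers\<close>

text \<open>Mixed products are needed because expanding the power of a sum of two forms produces
  factors of different kinds.\<close>

definition wedge_family :: "('n \<Rightarrow> ('a, 'n) form2) \<Rightarrow> ('a, 'n) chart \<Rightarrow> complex^'n \<Rightarrow> real" where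
  "wedge_family \<gamma> c z = alt_sum (\<lambda>j a b. \<gamma> j c z (real_basis a) (real_basis b))"

lemma top_density_wedge_family:
  assumes \<gamma>: "\<And>j. smooth_form2 A (\<gamma> j)"
  shows "top_density (wedge_family \<gamma>)"
  unfolding top_density_def
proof (intro conjI ballI)
  fix c assume c: "c \<in> A"
  show "continuous_on (chart_img c) (wedge_family \<gamma> c)"
    unfolding wedge_family_def[abs_def] alt_sum_def
    by (intro continuous_on_sum continuous_on_mult continuous_on_const continuous_on_prod
        smooth_on_continuous smooth_form2D(3)[OF \<gamma> c])
next
  fix c c' z assume c: "c \<in> A" "c' \<in> A" "z \<in> overlap c c'"
  have z': "transition c c' z \<in> chart_img c'" using transition_in[OF c] overlap_subset[OF c(2)] by blast
  show "wedge_family \<gamma> c z = det (realmat (dtrans c c' z)) * wedge_family \<gamma> c' (transition c c' z)"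
    unfolding wedge_family_def smooth_form2D(4)[OF \<gamma> c]
    by (rule alt_sum_pullback) (use smooth_form2D(1)[OF \<gamma> c(2) z'] smooth_form2_linear_left[OF \<gamma> c(2) z'] in auto)
qed

lemma wedge_power_top_family: "wedge_power_top (\<alpha> c z) = wedge_family (\<lambda>_. \<alpha>) c z / 2 ^ CARD('n)"
  by (simp add: wedge_power_top_alt_sum wedge_family_def)

lemma top_density_divide: "top_density \<theta> \<Longrightarrow> top_density (\<lambda>c z. \<theta> c z / k)"
  unfolding top_density_def divide_inverse by (auto intro!: continuous_on_mult continuous_on_const simp: mult.assoc)

text \<open>The product of dg and \<eta>, the error term that arises when \<eta> is multiplied by a
  cut-off function.\<close>

definition wedge1 :: "('a \<Rightarrow> real) \<Rightarrow> ('a, 'n) form1 \<Rightarrow> ('a, 'n) form2" where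
  "wedge1 g \<eta> c z v w = fderiv (\<lambda>y. g (chart_inv c y)) z v * \<eta> c z w - fderiv (\<lambda>y. g (chart_inv c y)) z w * \<eta> c z v"

lemma smooth_form2_wedge1:
  assumes g: "smooth_fun g" and \<eta>: "smooth_form1 A \<eta>"
  shows "smooth_form2 A (wedge1 g \<eta>)"
proof (rule smooth_form2I)
  fix c z v w assume c: "c \<in> A" "z \<in> chart_img c"
  have l1: "linear (fderiv (\<lambda>y. g (chart_inv c y)) z)"
    using smooth_at.d1[OF smooth_at_fun[OF g c(1)] c(2)] has_derivative_linear by blast
  have l2: "linear (\<eta> c z)" by (rule smooth_form1D(1)[OF \<eta> c])
  show "linear (wedge1 g \<eta> c z v)"
    unfolding wedge1_def by (rule linearI) (simp_all add: linear_add[OF l1] linear_add[OF l2] linear_cmul[OF l1] linear_cmul[OF l2] algebra_simps)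
  show "wedge1 g \<eta> c z w v = - wedge1 g \<eta> c z v w" by (simp add: wedge1_def)
next
  fix c v w assume c: "c \<in> A"
  show "smooth_on (\<lambda>z. wedge1 g \<eta> c z v w) (chart_img c)"
    unfolding wedge1_def
    by (intro smooth_on_diff smooth_on_mult smooth_on_frechet_derivative smooth_at.u[OF smooth_at_fun[OF g c]] open_img c smooth_form1D(2)[OF \<eta> c])
next
  fix c c' z v w assume c: "c \<in> A" "c' \<in> A" "z \<in> overlap c c'"
  show "wedge1 g \<eta> c z v w = wedge1 g \<eta> c' (transition c c' z) (dtrans c c' z v) (dtrans c c' z w)"
    unfolding wedge1_def smooth_fun_deriv[OF g c] smooth_form1D(3)[OF \<eta> c] ..
qed

lemma closed_form2_cyclic:
  assumes \<gamma>: "closed_form2 A \<gamma>" and c: "c \<in> A" "z \<in> chart_img c"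
  shows "fderiv (\<lambda>y. \<gamma> c y v w) z u + fderiv (\<lambda>y. \<gamma> c y w u) z v + fderiv (\<lambda>y. \<gamma> c y u v) z w = 0"
proof -
  have s: "smooth_form2 A \<gamma>" using \<gamma> by (simp add: closed_form2_def)
  have "((\<lambda>y. - \<gamma> c y u w) has_derivative (\<lambda>h. - fderiv (\<lambda>y. \<gamma> c y u w) z h)) (at z)"
    by (intro has_derivative_minus smooth_on_has_derivative[OF smooth_form2D(3)[OF s c(1)] open_img[OF c(1)] c(2)])
  from has_derivative_transform_within_open[OF this open_img[OF c(1)] c(2), of "\<lambda>y. \<gamma> c y w u"]
  have "((\<lambda>y. \<gamma> c y w u) has_derivative (\<lambda>h. - fderiv (\<lambda>y. \<gamma> c y u w) z h)) (at z)"
    using smooth_form2D(2)[OF s c(1)] by metis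
  from fderiv_eqI[OF this] have "fderiv (\<lambda>y. \<gamma> c y w u) z v = - fderiv (\<lambda>y. \<gamma> c y u w) z v" by simp
  moreover have "ext_deriv2 \<gamma> c z u v w = 0" using \<gamma> c by (simp add: closed_form2_def)
  ultimately show ?thesis by (simp add: ext_deriv2_def)
qed

text \<open>Write \<rho> d\<eta> = d(\<rho> \<eta>) - d\<rho> wedge \<eta> for each member of the
  partition. The first term integrates to zero in its chart, and the second terms cancel in the sum
  because the differentials of the partition add up to zero.\<close>

lemma stokes:
  assumes p: "partition_of_unity A F \<rho>" and \<eta>: "smooth_form1 A \<eta>"
    and \<delta>: "smooth_form2 A \<delta>" "\<And>c z v w. c \<in> A \<Longrightarrow> z \<in> chart_img c \<Longrightarrow> \<delta> c z v w = ext_deriv1 \<eta> c z v w"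
    and \<gamma>: "\<And>j. closed_form2 A (\<gamma> j)"
  shows "pou_integral F \<rho> (wedge_family (\<lambda>j. if j = j0 then \<delta> else \<gamma> j)) = 0"
proof -
  note pD = pouD[OF p]
  have \<gamma>s: "smooth_form2 A (\<gamma> j)" for j using \<gamma> by (simp add: closed_form2_def)
  let ?W = "\<lambda>\<alpha>. wedge_family (\<lambda>j. if j = j0 then \<alpha> else \<gamma> j)"
  have td: "top_density (?W \<alpha>)" if "smooth_form2 A \<alpha>" for \<alpha>
    by (rule top_density_wedge_family) (use that \<gamma>s in auto)
  have W_eq: "?W \<alpha> c z = alt_sum (\<lambda>j a b. if j = j0 then \<alpha> c z (real_basis a) (real_basis b) else \<gamma> j c z (real_basis a) (real_basis b))" for \<alpha> c z
    unfolding wedge_family_def by (rule arg_cong[of _ _ alt_sum]) (auto simp: fun_eq_iff)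
  have s1: "smooth_form2 A (wedge1 (\<rho> c) \<eta>)" if "c \<in> F" for c by (rule smooth_form2_wedge1[OF pD(5)[OF that] \<eta>])
  \<comment> \<open>Off its closed support the cut-off vanishes on an open set, so its differential
    vanishes there too.\<close>
  have w0: "?W (wedge1 (\<rho> c) \<eta>) d z = 0" if c: "c \<in> F" and d: "d \<in> A" "z \<in> chart_img d" "chart_inv d z \<notin> rsupp \<rho> c" for c d z
  proof -
    let ?O = "{z \<in> chart_img d. chart_inv d z \<in> - rsupp \<rho> c}"
    have "open ?O" by (rule open_chart_vimage[OF d(1)]) auto
    moreover have "z \<in> ?O" using d by simp
    ultimately have "fderiv (\<lambda>y. \<rho> c (chart_inv d y)) z = fderiv (\<lambda>y. 0::real) z"
    proof (rule fderiv_cong_open)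
      show "\<rho> c (chart_inv d y) = 0" if "y \<in> ?O" for y
        by (rule pD(7)) (use that in blast)
    qed
    then have "wedge1 (\<rho> c) \<eta> d z v w = 0" for v w by (simp add: wedge1_def)
    then show ?thesis unfolding W_eq by (simp add: alt_sum_def prod.remove[of UNIV j0])
  qed
  have local0: "integral (chart_img c) (\<lambda>z. \<rho> c (chart_inv c z) * ?W \<delta> c z) = - integral (chart_img c) (?W (wedge1 (\<rho> c) \<eta>) c)"
    if c: "c \<in> F" for c
  proof -
    have cA: "c \<in> A" using pD(2) c by blast
    let ?r = "\<lambda>z. \<rho> c (chart_inv c z)" and ?V = "chart_img c"
    interpret r: smooth_at ?V ?r by (rule smooth_at_fun[OF pD(5)[OF c] cA])
    let ?f = "\<lambda>b z. ?r z * \<eta> c z (real_basis b)"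
    let ?g = "\<lambda>j a b z. \<gamma> j c z (real_basis a) (real_basis b)"
    have "compact (rsupp \<rho> c)" using closed_Int_compact[OF closed_closure compact_UNIV] by simp
    then have C: "compact (chart_map c ` rsupp \<rho> c)"
      by (rule compact_continuous_image[OF continuous_on_subset[OF cont_chart_map[OF cA] pD(4)[OF c]]])
    have \<eta>s: "smooth_on (\<lambda>z. \<eta> c z v) ?V" for v by (rule smooth_form1D(2)[OF \<eta> cA])
    have df: "fderiv (?f b) z h = ?r z * fderiv (\<lambda>y. \<eta> c y (real_basis b)) z h + fderiv ?r z h * \<eta> c z (real_basis b)" if "z \<in> ?V" for b z h
      by (subst fderiv_eqI[OF has_derivative_mult[OF r.d1[OF that] smooth_on_has_derivative[OF \<eta>s open_img[OF cA] that]]]) simp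
    have "integral ?V (\<lambda>z. alt_sum (\<lambda>j a b. if j = j0 then fderiv (?f b) z (real_basis a) - fderiv (?f a) z (real_basis b) else ?g j a b z)) = 0"
    proof (rule stokes_local[OF open_img[OF cA] C])
      show "chart_map c ` rsupp \<rho> c \<subseteq> ?V" using chart_map_img[OF cA] pD(4)[OF c] by blast
      show "smooth_on (?f b) ?V" for b by (intro smooth_on_mult r.u \<eta>s)
      show "smooth_on (?g j a b) ?V" for j a b by (rule smooth_form2D(3)[OF \<gamma>s cA])
      show "?f b z = 0" if "z \<in> ?V - chart_map c ` rsupp \<rho> c" for b z
      proof -
        have "chart_inv c z \<notin> rsupp \<rho> c"
          using that chart_map_inv[OF cA, of z] image_eqI[of z "chart_map c" "chart_inv c z" "rsupp \<rho> c"] by auto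
        from pD(7)[OF this] show ?thesis by (simp only: mult_zero_left)
      qed
      show "fderiv (?g j b d) z (real_basis a) + fderiv (?g j d a) z (real_basis b) + fderiv (?g j a b) z (real_basis d) = 0"
        if "z \<in> ?V" for j a b d z by (rule closed_form2_cyclic[OF \<gamma> cA that])
    qed
    also have "integral ?V (\<lambda>z. alt_sum (\<lambda>j a b. if j = j0 then fderiv (?f b) z (real_basis a) - fderiv (?f a) z (real_basis b) else ?g j a b z))
      = integral ?V (\<lambda>z. ?r z * ?W \<delta> c z + ?W (wedge1 (\<rho> c) \<eta>) c z)"
    proof (rule integral_cong)
      fix z assume z: "z \<in> ?V"
      define m where "m a b = ?r z * \<delta> c z (real_basis a) (real_basis b)" for a b
      define n where "n a b = wedge1 (\<rho> c) \<eta> c z (real_basis a) (real_basis b)" for a b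
      \<comment> \<open>The product rule; writing it as a sum over two indices brings it into the
        shape of \<open>alt_sum_slot_sum\<close>.\<close>
      have e: "fderiv (?f b) z (real_basis a) - fderiv (?f a) z (real_basis b) = (\<Sum>i\<in>{True, False}. if i then m a b else n a b)" for a b
        unfolding m_def n_def df[OF z] \<delta>(2)[OF cA z] ext_deriv1_def wedge1_def by (simp add: algebra_simps)
      have "alt_sum (\<lambda>j a b. if j = j0 then fderiv (?f b) z (real_basis a) - fderiv (?f a) z (real_basis b) else ?g j a b z)
        = alt_sum (\<lambda>j a b. if j = j0 then \<Sum>i\<in>{True, False}. (if i then m a b else n a b) else ?g j a b z)"
        by (simp only: e)
      also have "\<dots> = alt_sum (\<lambda>j a b. if j = j0 then m a b else ?g j a b z) + alt_sum (\<lambda>j a b. if j = j0 then n a b else ?g j a b z)"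
        using alt_sum_slot_sum[of j0 "\<lambda>i a b. if i then m a b else n a b" "\<lambda>j a b. ?g j a b z" "{True, False}"] by (simp cong: if_cong)
      also have "alt_sum (\<lambda>j a b. if j = j0 then m a b else ?g j a b z) = ?r z * ?W \<delta> c z"
        unfolding W_eq m_def alt_sum_def sum_distrib_left
        by (rule sum.cong) (simp_all add: prod.remove[of UNIV j0])
      finally show "alt_sum (\<lambda>j a b. if j = j0 then fderiv (?f b) z (real_basis a) - fderiv (?f a) z (real_basis b) else ?g j a b z)
         = ?r z * ?W \<delta> c z + ?W (wedge1 (\<rho> c) \<eta>) c z" unfolding W_eq n_def by simp
    qed
    also have "\<dots> = integral ?V (\<lambda>z. ?r z * ?W \<delta> c z) + integral ?V (?W (wedge1 (\<rho> c) \<eta>) c)"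
    proof (rule integral_add)
      show "(\<lambda>z. ?r z * ?W \<delta> c z) integrable_on ?V"
        by (rule compact_support.integrable[OF pou_compact_support[OF p c]]) (use td[OF \<delta>(1)] cA in \<open>simp add: top_density_def\<close>)
      show "?W (wedge1 (\<rho> c) \<eta>) c integrable_on ?V"
        by (rule compact_support.integrable[OF chart_compact_support[OF cA closed_closure pD(4)[OF c]]])
          (use td[OF s1[OF c]] cA w0[OF c cA] in \<open>auto simp: top_density_def\<close>)
    qed
    finally show ?thesis by simp
  qed
  have "pou_integral F \<rho> (?W \<delta>) = - (\<Sum>c\<in>F. integral (chart_img c) (?W (wedge1 (\<rho> c) \<eta>) c))"
    unfolding pou_integral_def by (simp add: local0 sum_negf)
  \<comment> \<open>Each error term is supported in one chart, so its integral there is the global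
    one, and the terms of different charts can be added under a single integral.\<close>
  also have "(\<Sum>c\<in>F. integral (chart_img c) (?W (wedge1 (\<rho> c) \<eta>) c)) = (\<Sum>c\<in>F. 1 * pou_integral F \<rho> (?W (wedge1 (\<rho> c) \<eta>)))"
  proof (rule sum.cong[OF refl])
    fix c assume c: "c \<in> F"
    show "integral (chart_img c) (?W (wedge1 (\<rho> c) \<eta>) c) = 1 * pou_integral F \<rho> (?W (wedge1 (\<rho> c) \<eta>))"
      using pou_integral_supported[OF p td[OF s1[OF c]] pD(2)[OF c] closed_closure pD(4)[OF c] w0[OF c]] by simp
  qed
  also have "\<dots> = pou_integral F \<rho> (\<lambda>d z. \<Sum>c\<in>F. 1 * ?W (wedge1 (\<rho> c) \<eta>) d z)"
    by (rule pou_integral_sum[OF p _ pD(1), symmetric]) (use td[OF s1] pD(2) in \<open>auto simp: top_density_def\<close>)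
  also have "\<dots> = pou_integral F \<rho> (\<lambda>d z. 0)"
    unfolding pou_integral_def
  proof (intro sum.cong refl integral_cong)
    fix d z assume d: "d \<in> F" "z \<in> chart_img d"
    have dA: "d \<in> A" using d pD(2) by blast
    have "((\<lambda>y. \<Sum>c\<in>F. \<rho> c (chart_inv d y)) has_derivative (\<lambda>h. \<Sum>c\<in>F. fderiv (\<lambda>y. \<rho> c (chart_inv d y)) z h)) (at z)"
      by (intro has_derivative_sum smooth_at.d1[OF smooth_at_fun[OF pD(5) dA] d(2)])
    then have "((\<lambda>y. 1::real) has_derivative (\<lambda>h. \<Sum>c\<in>F. fderiv (\<lambda>y. \<rho> c (chart_inv d y)) z h)) (at z)"
      by (simp add: pD(6))
    moreover have "((\<lambda>y. 1::real) has_derivative (\<lambda>h. 0)) (at z)" by simp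
    ultimately have "(\<lambda>h. \<Sum>c\<in>F. fderiv (\<lambda>y. \<rho> c (chart_inv d y)) z h) = (\<lambda>h. 0)" by (rule has_derivative_unique)
    then have s0: "(\<Sum>c\<in>F. fderiv (\<lambda>y. \<rho> c (chart_inv d y)) z h) = 0" for h by (rule fun_cong)
    have "(\<Sum>c\<in>F. wedge1 (\<rho> c) \<eta> d z v w) = 0" for v w
      unfolding wedge1_def sum_subtractf sum_distrib_right[symmetric] s0 by simp
    then have "(\<Sum>c\<in>F. ?W (wedge1 (\<rho> c) \<eta>) d z) = 0"
      unfolding W_eq alt_sum_slot_sum by (simp add: alt_sum_def prod.remove[of UNIV j0])
    then show "\<rho> d (chart_inv d z) * (\<Sum>c\<in>F. 1 * ?W (wedge1 (\<rho> c) \<eta>) d z) = \<rho> d (chart_inv d z) * 0" by simp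
  qed
  finally show ?thesis by (simp add: pou_integral_def)
qed

lemma closed_form2_combination:
  assumes "closed_form2 A \<alpha>" "closed_form2 A \<beta>"
  shows "closed_form2 A (\<lambda>c z v w. a * \<alpha> c z v w + b * \<beta> c z v w)"
proof -
  have s: "smooth_form2 A \<alpha>" "smooth_form2 A \<beta>" using assms by (auto simp: closed_form2_def)
  have "smooth_form2 A (\<lambda>c z v w. a * \<alpha> c z v w + b * \<beta> c z v w)"
  proof (rule smooth_form2I)
    fix c z v w assume c: "c \<in> A" "z \<in> chart_img c"
    note l = smooth_form2D(1)[OF s(1) c] smooth_form2D(1)[OF s(2) c]
    show "linear (\<lambda>w. a * \<alpha> c z v w + b * \<beta> c z v w)"
      by (rule linearI) (simp_all add: linear_add[OF l(1)] linear_add[OF l(2)] linear_cmul[OF l(1)] linear_cmul[OF l(2)] algebra_simps)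
    show "a * \<alpha> c z w v + b * \<beta> c z w v = - (a * \<alpha> c z v w + b * \<beta> c z v w)"
      unfolding smooth_form2D(2)[OF s(1) c, of v w] smooth_form2D(2)[OF s(2) c, of v w] by simp
  next
    fix c v w assume c: "c \<in> A"
    show "smooth_on (\<lambda>z. a * \<alpha> c z v w + b * \<beta> c z v w) (chart_img c)"
      by (intro smooth_on_add smooth_on_mult smooth_on_const smooth_form2D(3)[OF s(1) c] smooth_form2D(3)[OF s(2) c])
  next
    fix c c' z v w assume c: "c \<in> A" "c' \<in> A" "z \<in> overlap c c'"
    show "a * \<alpha> c z v w + b * \<beta> c z v w = a * \<alpha> c' (transition c c' z) (dtrans c c' z v) (dtrans c c' z w)
        + b * \<beta> c' (transition c c' z) (dtrans c c' z v) (dtrans c c' z w)"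
      unfolding smooth_form2D(4)[OF s(1) c] smooth_form2D(4)[OF s(2) c] ..
  qed
  moreover have "ext_deriv2 (\<lambda>c z v w. a * \<alpha> c z v w + b * \<beta> c z v w) c z u v w = 0" if c: "c \<in> A" "z \<in> chart_img c" for c z u v w
  proof -
    have "fderiv (\<lambda>y. a * \<alpha> c y p q + b * \<beta> c y p q) z h = a * fderiv (\<lambda>y. \<alpha> c y p q) z h + b * fderiv (\<lambda>y. \<beta> c y p q) z h" for p q h
      by (subst fderiv_eqI[OF has_derivative_add[OF has_derivative_mult_right has_derivative_mult_right]])
        (auto intro!: smooth_on_has_derivative[OF smooth_form2D(3)[OF s(1) c(1)] open_img[OF c(1)] c(2)]
          smooth_on_has_derivative[OF smooth_form2D(3)[OF s(2) c(1)] open_img[OF c(1)] c(2)])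
    then have "ext_deriv2 (\<lambda>c z v w. a * \<alpha> c z v w + b * \<beta> c z v w) c z u v w = a * ext_deriv2 \<alpha> c z u v w + b * ext_deriv2 \<beta> c z u v w"
      by (simp add: ext_deriv2_def algebra_simps)
    then show ?thesis using assms c by (simp add: closed_form2_def)
  qed
  ultimately show ?thesis by (simp add: closed_form2_def)
qed

lemma pou_integral_cong:
  "(\<And>c z. c \<in> F \<Longrightarrow> z \<in> chart_img c \<Longrightarrow> \<theta> c z = \<theta>' c z) \<Longrightarrow> pou_integral F \<rho> \<theta> = pou_integral F \<rho> \<theta>'"
  unfolding pou_integral_def by (intro sum.cong refl integral_cong) auto

lemma pou_integral_binomial:
  assumes p: "partition_of_unity A F \<rho>" and "closed_form2 A \<alpha>" "closed_form2 A \<beta>"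
  shows "pou_integral F \<rho> (wedge_family (\<lambda>_ c z v w. a * \<alpha> c z v w + b * \<beta> c z v w))
    = (\<Sum>S\<in>Pow UNIV. (a ^ card S * b ^ card (- S)) * pou_integral F \<rho> (wedge_family (\<lambda>j. if j \<in> S then \<alpha> else \<beta>)))"
proof -
  have s: "smooth_form2 A \<alpha>" "smooth_form2 A \<beta>" using assms by (auto simp: closed_form2_def)
  have E: "wedge_family (\<lambda>_ c z v w. a * \<alpha> c z v w + b * \<beta> c z v w)
     = (\<lambda>c z. \<Sum>S\<in>Pow UNIV. (a ^ card S * b ^ card (- S)) * wedge_family (\<lambda>j. if j \<in> S then \<alpha> else \<beta>) c z)"
    unfolding wedge_family_def alt_sum_binomial
    by (intro ext sum.cong refl arg_cong2[where f="(*)"] arg_cong[where f=alt_sum]) auto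
  have t: "top_density (wedge_family (\<lambda>j. if j \<in> S then \<alpha> else \<beta>))" for S
    by (rule top_density_wedge_family) (simp add: s)
  show ?thesis
    unfolding E by (rule pou_integral_sum[OF p top_densityD(1)[OF t pouD(2)[OF p]]]) auto
qed

text \<open>With \<alpha> = \<beta> + d\<eta>, the expansion of the n-th power leaves the power of
  \<beta> and products containing an exact factor, which integrate to zero.\<close>

lemma pou_integral_cohomologous:
  assumes p: "partition_of_unity A F \<rho>" and \<alpha>: "closed_form2 A \<alpha>" and \<beta>: "closed_form2 A \<beta>" and co: "cohomologous A \<alpha> \<beta>"
  shows "pou_integral F \<rho> (wedge_family (\<lambda>_. \<alpha>)) = pou_integral F \<rho> (wedge_family (\<lambda>_. \<beta>))"
proof -
  obtain \<eta> where \<eta>: "smooth_form1 A \<eta>" "\<And>c z v w. c \<in> A \<Longrightarrow> z \<in> chart_img c \<Longrightarrow> \<alpha> c z v w - \<beta> c z v w = ext_deriv1 \<eta> c z v w"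
    using co unfolding cohomologous_def by blast
  define \<delta> where "\<delta> = (\<lambda>c z v w. 1 * \<alpha> c z v w + (- 1) * \<beta> c z v w)"
  have \<delta>: "closed_form2 A \<delta>" unfolding \<delta>_def by (rule closed_form2_combination[OF \<alpha> \<beta>])
  have \<delta>\<eta>: "\<delta> c z v w = ext_deriv1 \<eta> c z v w" if "c \<in> A" "z \<in> chart_img c" for c z v w
    using \<eta>(2)[OF that] by (simp add: \<delta>_def)
  have z: "pou_integral F \<rho> (wedge_family (\<lambda>j. if j \<in> S then \<delta> else \<beta>)) = 0" if ne: "S \<noteq> {}" for S
  proof -
    obtain j0 where j0: "j0 \<in> S" using ne by blast
    have "(\<lambda>j. if j \<in> S then \<delta> else \<beta>) = (\<lambda>j. if j = j0 then \<delta> else (if j \<in> S then \<delta> else \<beta>))" using j0 by auto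
    moreover have "pou_integral F \<rho> (wedge_family (\<lambda>j. if j = j0 then \<delta> else (if j \<in> S then \<delta> else \<beta>))) = 0"
      by (rule stokes[OF p \<eta>(1) _ \<delta>\<eta>]) (use \<delta> \<beta> in \<open>auto simp: closed_form2_def\<close>)
    ultimately show ?thesis by simp
  qed
  have "(\<lambda>_. \<alpha>) = (\<lambda>_::'n. \<lambda>c z v w. 1 * \<delta> c z v w + 1 * \<beta> c z v w)" by (simp add: \<delta>_def fun_eq_iff)
  then have "pou_integral F \<rho> (wedge_family (\<lambda>_. \<alpha>)) = (\<Sum>S\<in>Pow UNIV. (1 ^ card S * 1 ^ card (- S)) * pou_integral F \<rho> (wedge_family (\<lambda>j. if j \<in> S then \<delta> else \<beta>)))"
    using pou_integral_binomial[OF p \<delta> \<beta>, of 1 1] by simp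
  also have "\<dots> = (\<Sum>S\<in>{{}}. (1 ^ card S * 1 ^ card (- S)) * pou_integral F \<rho> (wedge_family (\<lambda>j. if j \<in> S then \<delta> else \<beta>)))"
    by (rule sum.mono_neutral_right) (use z in auto)
  finally show ?thesis by simp
qed

text \<open>The integral takes one value on the whole class and the class is nonempty, so
  \<open>the_elem\<close> is applied to a singleton.\<close>

lemma top_self_intersection_eq:
  assumes p: "partition_of_unity A F \<rho>" and \<alpha>: "closed_form2 A \<alpha>"
  shows "top_self_intersection A (dR_class A \<alpha>) = pou_integral F \<rho> (wedge_family (\<lambda>_. \<alpha>)) / 2 ^ CARD('n)"
proof -
  let ?I = "\<lambda>\<beta>. top_integral A (\<lambda>c z. wedge_power_top (\<beta> c z))"
  have I: "?I \<beta> = pou_integral F \<rho> (wedge_family (\<lambda>_. \<beta>)) / 2 ^ CARD('n)" if \<beta>: "closed_form2 A \<beta>" for \<beta>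
  proof -
    have td: "top_density (wedge_family (\<lambda>_. \<beta>))" by (rule top_density_wedge_family) (use \<beta> in \<open>simp add: closed_form2_def\<close>)
    have "?I \<beta> = pou_integral F \<rho> (\<lambda>c z. wedge_family (\<lambda>_. \<beta>) c z / 2 ^ CARD('n))"
      unfolding wedge_power_top_family by (rule top_integral_eq[OF p top_density_divide[OF td]])
    then show ?thesis by (simp add: pou_integral_def sum_divide_distrib)
  qed
  have refl: "\<alpha> \<in> dR_class A \<alpha>"
    unfolding dR_class_def cohomologous_def
  proof (intro CollectI conjI exI[of _ "\<lambda>c z v. 0"] ballI allI)
    show "smooth_form1 A (\<lambda>c z v. 0)" by (rule smooth_form1I) (auto intro: module_hom_zero[unfolded])
  qed (use \<alpha> in \<open>auto simp: ext_deriv1_def\<close>)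
  have "?I ` dR_class A \<alpha> = {pou_integral F \<rho> (wedge_family (\<lambda>_. \<alpha>)) / 2 ^ CARD('n)}"
  proof (intro equalityI subsetI)
    fix x assume "x \<in> ?I ` dR_class A \<alpha>"
    then obtain \<beta> where \<beta>: "closed_form2 A \<beta>" "cohomologous A \<beta> \<alpha>" "x = ?I \<beta>" by (auto simp: dR_class_def)
    then show "x \<in> {pou_integral F \<rho> (wedge_family (\<lambda>_. \<alpha>)) / 2 ^ CARD('n)}"
      using I[OF \<beta>(1)] pou_integral_cohomologous[OF p \<beta>(1) \<alpha> \<beta>(2)] by simp
  next
    fix x assume "x \<in> {pou_integral F \<rho> (wedge_family (\<lambda>_. \<alpha>)) / 2 ^ CARD('n)}"
    then show "x \<in> ?I ` dR_class A \<alpha>" using I[OF \<alpha>] refl by (metis imageI singletonD)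
  qed
  then show ?thesis by (simp add: top_self_intersection_def)
qed

end

section \<open>The exponential function, and dd^c of an integral over time\<close>

lemma smooth_on_exp: "smooth_on (exp :: real \<Rightarrow> real) S"
proof (rule smooth_onI)
  fix k show "Ck_on k (exp :: real \<Rightarrow> real) S"
  proof (induction k)
    case 0
    then show ?case by (auto intro: continuous_intros)
  next
    case (Suc k)
    show ?case
    proof (rule Ck_on_SucI[of S _ "\<lambda>x v. v * exp x"])
      show "(exp has_derivative (\<lambda>v. v * exp x)) (at x within S)" for x :: real
        by (auto intro!: derivative_eq_intros)
      show "Ck_on k (\<lambda>x. v * exp x) S" for v :: real
        by (rule Ck_on_bilinear[OF bounded_bilinear_mult Ck_on_const Suc])
    qed
  qed
qed

lemma hess_integral_param:
  fixes F :: "real \<times> (complex^'n::finite) \<Rightarrow> real"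
  assumes F: "smooth_on F ({a..b} \<times> V)" and V: "open V" and z: "z \<in> V"
  shows "hess (\<lambda>y. integral {a..b} (\<lambda>t. F (t, y))) z p q = integral {a..b} (\<lambda>t. hess (\<lambda>y. F (t, y)) z p q)"
    and "(\<lambda>t. hess (\<lambda>y. F (t, y)) z p q) integrable_on {a..b}"
proof -
  define G where "G = (\<lambda>(t, y). fderiv (\<lambda>y. F (t, y)) y p)"
  have G: "smooth_on G ({a..b} \<times> V)" unfolding G_def by (rule smooth_on_partial(2)[OF F V])
  have 1: "fderiv (\<lambda>y. integral {a..b} (\<lambda>t. F (t, y))) y p = integral {a..b} (\<lambda>t. G (t, y))" if "y \<in> V" for y
    using fderiv_eqI[OF has_derivative_integral_param[OF F V that]] by (simp add: G_def)
  have "hess (\<lambda>y. integral {a..b} (\<lambda>t. F (t, y))) z p = fderiv (\<lambda>y. integral {a..b} (\<lambda>t. G (t, y))) z"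
    by (rule fderiv_cong_open[OF V z 1])
  then show "hess (\<lambda>y. integral {a..b} (\<lambda>t. F (t, y))) z p q = integral {a..b} (\<lambda>t. hess (\<lambda>y. F (t, y)) z p q)"
    using fderiv_eqI[OF has_derivative_integral_param[OF G V z]] by (simp add: G_def)
  have c: "continuous_on ({a..b} \<times> V) (\<lambda>(t, y). fderiv (\<lambda>y. G (t, y)) y q)"
    by (rule smooth_on_continuous[OF smooth_on_partial(2)[OF G V]])
  have c1: "continuous_on {a..b} (\<lambda>t. (t, z))" by (intro continuous_intros)
  have c2: "(\<lambda>t. (t, z)) ` {a..b} \<subseteq> {a..b} \<times> V" using z by auto
  have "continuous_on {a..b} (\<lambda>t. hess (\<lambda>y. F (t, y)) z p q)"
    using continuous_on_compose2[OF c c1 c2] by (simp add: G_def)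
  then show "(\<lambda>t. hess (\<lambda>y. F (t, y)) z p q) integrable_on {a..b}" by (rule integrable_continuous_real)
qed

lemma ddcl_integral_param:
  fixes F :: "real \<times> (complex^'n::finite) \<Rightarrow> real"
  assumes F: "smooth_on F ({a..b} \<times> V)" and V: "open V" and z: "z \<in> V"
  shows "ddcl (\<lambda>y. integral {a..b} (\<lambda>t. F (t, y))) z v w = integral {a..b} (\<lambda>t. ddcl (\<lambda>y. F (t, y)) z v w)"
proof -
  interpret u: smooth_at V "\<lambda>y. integral {a..b} (\<lambda>t. F (t, y))"
    by unfold_locales (rule V, rule smooth_on_integral_param[OF F V])
  have sl: "smooth_at V (\<lambda>y. F (t, y))" if "t \<in> {a..b}" for t
    by unfold_locales (rule V, rule smooth_on_slice[OF F V that])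
  note H = hess_integral_param[OF F V z]
  have "integral {a..b} (\<lambda>t. ddcl (\<lambda>y. F (t, y)) z v w)
     = integral {a..b} (\<lambda>t. - (1/2) * (hess (\<lambda>y. F (t, y)) z (\<i> *s w) v - hess (\<lambda>y. F (t, y)) z (\<i> *s v) w))"
    by (rule integral_cong) (rule smooth_at.ddcl_hess[OF sl z])
  also have "\<dots> = - (1/2) * integral {a..b} (\<lambda>t. hess (\<lambda>y. F (t, y)) z (\<i> *s w) v - hess (\<lambda>y. F (t, y)) z (\<i> *s v) w)"
    by (rule integral_mult_right)
  also have "\<dots> = - (1/2) * (integral {a..b} (\<lambda>t. hess (\<lambda>y. F (t, y)) z (\<i> *s w) v) - integral {a..b} (\<lambda>t. hess (\<lambda>y. F (t, y)) z (\<i> *s v) w))"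
    by (subst integral_diff[OF H(2) H(2)]) simp
  finally show ?thesis unfolding u.ddcl_hess[OF z] H(1) ..
qed

section \<open>Classes along the flow\<close>

context ccm
begin

lemma ext_deriv1_combination:
  assumes \<eta>: "smooth_form1 A \<eta>" "smooth_form1 A \<xi>"
  shows "smooth_form1 A (\<lambda>c z v. a * \<eta> c z v + b * \<xi> c z v)"
    and "c \<in> A \<Longrightarrow> z \<in> chart_img c \<Longrightarrow>
      ext_deriv1 (\<lambda>c z v. a * \<eta> c z v + b * \<xi> c z v) c z v w = a * ext_deriv1 \<eta> c z v w + b * ext_deriv1 \<xi> c z v w"
proof -
  show "smooth_form1 A (\<lambda>c z v. a * \<eta> c z v + b * \<xi> c z v)"
  proof (rule smooth_form1I)
    fix c z assume c: "c \<in> A" "z \<in> chart_img c"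
    note l = smooth_form1D(1)[OF \<eta>(1) c] smooth_form1D(1)[OF \<eta>(2) c]
    show "linear (\<lambda>v. a * \<eta> c z v + b * \<xi> c z v)"
      by (rule linearI) (simp_all add: linear_add[OF l(1)] linear_add[OF l(2)] linear_cmul[OF l(1)] linear_cmul[OF l(2)] algebra_simps)
  next
    fix c v assume c: "c \<in> A"
    show "smooth_on (\<lambda>z. a * \<eta> c z v + b * \<xi> c z v) (chart_img c)"
      by (intro smooth_on_add smooth_on_mult smooth_on_const smooth_form1D(2)[OF \<eta>(1) c] smooth_form1D(2)[OF \<eta>(2) c])
  next
    fix c c' z v assume c: "c \<in> A" "c' \<in> A" "z \<in> overlap c c'"
    show "a * \<eta> c z v + b * \<xi> c z v = a * \<eta> c' (transition c c' z) (dtrans c c' z v) + b * \<xi> c' (transition c c' z) (dtrans c c' z v)"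
      unfolding smooth_form1D(3)[OF \<eta>(1) c] smooth_form1D(3)[OF \<eta>(2) c] ..
  qed
  assume c: "c \<in> A" "z \<in> chart_img c"
  have "((\<lambda>y. a * \<eta> c y p + b * \<xi> c y p) has_derivative (\<lambda>h. a * fderiv (\<lambda>y. \<eta> c y p) z h + b * fderiv (\<lambda>y. \<xi> c y p) z h)) (at z)" for p
    by (intro has_derivative_add has_derivative_mult_right
      smooth_on_has_derivative[OF smooth_form1D(2)[OF \<eta>(1) c(1)] open_img[OF c(1)] c(2)]
      smooth_on_has_derivative[OF smooth_form1D(2)[OF \<eta>(2) c(1)] open_img[OF c(1)] c(2)])
  note d = fderiv_eqI[OF this]
  show "ext_deriv1 (\<lambda>c z v. a * \<eta> c z v + b * \<xi> c z v) c z v w = a * ext_deriv1 \<eta> c z v w + b * ext_deriv1 \<xi> c z v w"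
    unfolding ext_deriv1_def d by (simp add: algebra_simps)
qed

lemma cohomologous_combination:
  assumes "cohomologous A \<alpha> \<alpha>'" "cohomologous A \<beta> \<beta>'"
  shows "cohomologous A (\<lambda>c z v w. a * \<alpha> c z v w + b * \<beta> c z v w) (\<lambda>c z v w. a * \<alpha>' c z v w + b * \<beta>' c z v w)"
proof -
  obtain \<eta> where \<eta>: "smooth_form1 A \<eta>" "\<And>c z v w. c \<in> A \<Longrightarrow> z \<in> chart_img c \<Longrightarrow> \<alpha> c z v w - \<alpha>' c z v w = ext_deriv1 \<eta> c z v w"
    using assms(1) unfolding cohomologous_def by blast
  obtain \<xi> where \<xi>: "smooth_form1 A \<xi>" "\<And>c z v w. c \<in> A \<Longrightarrow> z \<in> chart_img c \<Longrightarrow> \<beta> c z v w - \<beta>' c z v w = ext_deriv1 \<xi> c z v w"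
    using assms(2) unfolding cohomologous_def by blast
  show ?thesis
    unfolding cohomologous_def
  proof (intro exI[of _ "\<lambda>c z v. a * \<eta> c z v + b * \<xi> c z v"] conjI ballI allI)
    show "smooth_form1 A (\<lambda>c z v. a * \<eta> c z v + b * \<xi> c z v)" by (rule ext_deriv1_combination(1)[OF \<eta>(1) \<xi>(1)])
    show "a * \<alpha> c z v w + b * \<beta> c z v w - (a * \<alpha>' c z v w + b * \<beta>' c z v w) = ext_deriv1 (\<lambda>c z v. a * \<eta> c z v + b * \<xi> c z v) c z v w"
      if "c \<in> A" "z \<in> chart_img c" for c z v w
      unfolding ext_deriv1_combination(2)[OF \<eta>(1) \<xi>(1) that] \<eta>(2)[OF that, symmetric] \<xi>(2)[OF that, symmetric] by (simp add: algebra_simps)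
  qed
qed

lemma cohomologousI:
  assumes "smooth_form1 A \<eta>" "\<And>c z v w. c \<in> A \<Longrightarrow> z \<in> chart_img c \<Longrightarrow> \<alpha> c z v w - \<beta> c z v w = ext_deriv1 \<eta> c z v w"
  shows "cohomologous A \<alpha> \<beta>"
  using assms unfolding cohomologous_def by blast

lemma smooth_form1_0: "smooth_form1 A (\<lambda>c z v. 0)"
  by (rule smooth_form1I) (auto intro: linearI)

lemma cohomologous_refl: "(\<And>c z v w. c \<in> A \<Longrightarrow> z \<in> chart_img c \<Longrightarrow> \<alpha> c z v w = \<beta> c z v w) \<Longrightarrow> cohomologous A \<alpha> \<beta>"
  by (rule cohomologousI[OF smooth_form1_0]) (simp add: ext_deriv1_def)

lemma cohomologous_sym: "cohomologous A \<alpha> \<beta> \<Longrightarrow> cohomologous A \<beta> \<alpha>"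
proof -
  assume "cohomologous A \<alpha> \<beta>"
  then obtain \<eta> where \<eta>: "smooth_form1 A \<eta>" "\<And>c z v w. c \<in> A \<Longrightarrow> z \<in> chart_img c \<Longrightarrow> \<alpha> c z v w - \<beta> c z v w = ext_deriv1 \<eta> c z v w"
    unfolding cohomologous_def by blast
  show ?thesis
    by (rule cohomologousI[OF ext_deriv1_combination(1)[OF \<eta>(1) \<eta>(1), of "-1" 0]])
      (simp only: ext_deriv1_combination(2)[OF \<eta>(1) \<eta>(1)] \<eta>(2)[symmetric], simp)
qed

lemma cohomologous_trans: "cohomologous A \<alpha> \<beta> \<Longrightarrow> cohomologous A \<beta> \<gamma> \<Longrightarrow> cohomologous A \<alpha> \<gamma>"
proof -
  assume "cohomologous A \<alpha> \<beta>" "cohomologous A \<beta> \<gamma>"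
  then obtain \<eta> \<xi> where \<eta>: "smooth_form1 A \<eta>" "\<And>c z v w. c \<in> A \<Longrightarrow> z \<in> chart_img c \<Longrightarrow> \<alpha> c z v w - \<beta> c z v w = ext_deriv1 \<eta> c z v w"
    and \<xi>: "smooth_form1 A \<xi>" "\<And>c z v w. c \<in> A \<Longrightarrow> z \<in> chart_img c \<Longrightarrow> \<beta> c z v w - \<gamma> c z v w = ext_deriv1 \<xi> c z v w"
    unfolding cohomologous_def by metis
  show ?thesis
    by (rule cohomologousI[OF ext_deriv1_combination(1)[OF \<eta>(1) \<xi>(1), of 1 1]])
      (simp only: ext_deriv1_combination(2)[OF \<eta>(1) \<xi>(1)] \<eta>(2)[symmetric] \<xi>(2)[symmetric], simp)
qed

lemma dR_class_eq: "cohomologous A \<alpha> \<beta> \<Longrightarrow> dR_class A \<alpha> = dR_class A \<beta>"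
  unfolding dR_class_def using cohomologous_trans cohomologous_sym by blast

lemma dR_class_self: "closed_form2 A \<alpha> \<Longrightarrow> \<alpha> \<in> dR_class A \<alpha>"
  by (simp add: dR_class_def cohomologous_refl)

lemma class_add_dR:
  assumes "closed_form2 A \<alpha>" "closed_form2 A \<beta>"
  shows "class_add A (dR_class A \<alpha>) (dR_class A \<beta>) = dR_class A (\<lambda>c z v w. \<alpha> c z v w + \<beta> c z v w)"
proof -
  have "dR_class A (\<lambda>c z v w. \<alpha>' c z v w + \<beta>' c z v w) = dR_class A (\<lambda>c z v w. \<alpha> c z v w + \<beta> c z v w)"
    if "\<alpha>' \<in> dR_class A \<alpha>" "\<beta>' \<in> dR_class A \<beta>" for \<alpha>' \<beta>'
    using dR_class_eq[OF cohomologous_combination[of \<alpha>' \<alpha> \<beta>' \<beta> 1 1]] that by (simp add: dR_class_def)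
  then show ?thesis unfolding class_add_def using dR_class_self[OF assms(1)] dR_class_self[OF assms(2)] by blast
qed

lemma class_scale_dR:
  assumes "closed_form2 A \<alpha>"
  shows "class_scale A r (dR_class A \<alpha>) = dR_class A (\<lambda>c z v w. r * \<alpha> c z v w)"
proof -
  have "dR_class A (\<lambda>c z v w. r * \<alpha>' c z v w) = dR_class A (\<lambda>c z v w. r * \<alpha> c z v w)"
    if "\<alpha>' \<in> dR_class A \<alpha>" for \<alpha>'
    using dR_class_eq[OF cohomologous_combination[of \<alpha>' \<alpha> \<alpha>' \<alpha> r 0]] that by (simp add: dR_class_def)
  then show ?thesis unfolding class_scale_def using dR_class_self[OF assms] by blast
qed

lemma c1_eq:
  assumes k: "kaehler_form A \<omega>"
  shows "c1 A = dR_class A (Ric \<omega>)"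
proof -
  have "dR_class A (Ric \<omega>') = dR_class A (Ric \<omega>)" if k': "kaehler_form A \<omega>'" for \<omega>'
    by (rule dR_class_eq) (rule cohomologousI[OF smooth_form1_dc_form[OF smooth_vol_ratio[OF k k']] Ric_diff[OF k k']])
  then show ?thesis unfolding c1_def using k by blast
qed

text \<open>The representative of the flow class obtained by taking
  \<open>Ric \<omega>\<^sub>0\<close> for the first Chern class. It is explicit in \<open>t\<close>
  and makes sense for all times, in particular at and beyond \<open>T\<close>.\<close>

definition limit_form :: "('a, 'n) form2 \<Rightarrow> real \<Rightarrow> ('a, 'n) form2" where
  "limit_form \<omega>\<^sub>0 t = (\<lambda>c z v w. exp (- t) * \<omega>\<^sub>0 c z v w + (exp (- t) - 1) * Ric \<omega>\<^sub>0 c z v w)"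

lemma closed_limit_form:
  assumes k: "kaehler_form A \<omega>\<^sub>0"
  shows "closed_form2 A (limit_form \<omega>\<^sub>0 t)"
  unfolding limit_form_def
  by (rule closed_form2_combination) (use k closed_Ric[OF k] in \<open>auto simp: kaehler_form_def\<close>)

lemma flow_class_eq:
  assumes k: "kaehler_form A \<omega>\<^sub>0"
  shows "flow_class A \<omega>\<^sub>0 t = dR_class A (limit_form \<omega>\<^sub>0 t)"
proof -
  have c0: "closed_form2 A \<omega>\<^sub>0" using k by (simp add: kaehler_form_def)
  note cR = closed_Ric(1)[OF k]
  have c2: "closed_form2 A (\<lambda>c z v w. \<omega>\<^sub>0 c z v w + Ric \<omega>\<^sub>0 c z v w)"
    using closed_form2_combination[OF c0 cR, of 1 1] by simp
  have c3: "closed_form2 A (\<lambda>c z v w. - 1 * Ric \<omega>\<^sub>0 c z v w)"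
    using closed_form2_combination[OF cR cR, of "-1" 0] by simp
  have c4: "closed_form2 A (\<lambda>c z v w. exp (- t) * (\<omega>\<^sub>0 c z v w + Ric \<omega>\<^sub>0 c z v w))"
    using closed_form2_combination[OF c2 c2, of "exp (-t)" 0] by simp
  have "flow_class A \<omega>\<^sub>0 t = dR_class A (\<lambda>c z v w. - 1 * Ric \<omega>\<^sub>0 c z v w + exp (- t) * (\<omega>\<^sub>0 c z v w + Ric \<omega>\<^sub>0 c z v w))"
    unfolding flow_class_def c1_eq[OF k] class_add_dR[OF c0 cR] class_scale_dR[OF cR] class_scale_dR[OF c2] class_add_dR[OF c3 c4] ..
  also have "(\<lambda>c z v w. - 1 * Ric \<omega>\<^sub>0 c z v w + exp (- t) * (\<omega>\<^sub>0 c z v w + Ric \<omega>\<^sub>0 c z v w)) = limit_form \<omega>\<^sub>0 t"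
    by (simp add: limit_form_def fun_eq_iff algebra_simps)
  finally show ?thesis .
qed

text \<open>Joint smoothness in time and space, with one-sided derivatives at time 0; it permits
  differentiating the time integral of this function twice in space.\<close>

lemma smooth_flow_potential:
  assumes k: "kaehler_form A \<omega>\<^sub>0" and sol: "krf_solution A \<omega>\<^sub>0 T \<omega>" and c: "c \<in> A"
  shows "smooth_on (\<lambda>(s, z). exp s * (ricpot (\<omega> s) c z - ricpot \<omega>\<^sub>0 c z)) (time_interval T \<times> chart_img c)"
proof -
  let ?S = "time_interval T \<times> chart_img c"
  have kt: "kaehler_form A (\<omega> t)" if "t \<in> time_interval T" for t using sol that by (simp add: krf_solution_def)
  have "smooth_on (\<lambda>x. \<omega> (fst x) c (snd x) v w) ?S" for v w
    using sol c by (simp add: krf_solution_def case_prod_unfold)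
  then have "smooth_on (\<lambda>x. Re (det (hermitian_coeff (\<omega> (fst x) c (snd x))))) ?S" by (rule smooth_on_hdet)
  then have 1: "smooth_on (\<lambda>x. ricpot (\<omega> (fst x)) c (snd x)) ?S"
    by (rule smooth_on_compose[OF smooth_on_ln]) (use hdet_pos[OF kt c] in auto)
  have 2: "smooth_on (\<lambda>x. ricpot \<omega>\<^sub>0 c (snd x)) ?S"
    by (rule smooth_on_compose[OF smooth_ricpot[OF k c] smooth_on_bounded_linear[OF bounded_linear_snd]]) auto
  have 3: "smooth_on (\<lambda>x. exp (fst x)) ?S"
    by (rule smooth_on_compose[OF smooth_on_exp[of UNIV] smooth_on_bounded_linear[OF bounded_linear_fst]]) auto
  show ?thesis
    unfolding case_prod_unfold by (intro smooth_on_mult smooth_on_diff 1 2 3)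
qed

lemma time_interval_Icc: "t \<in> time_interval T \<Longrightarrow> {0..t} \<subseteq> time_interval T"
proof
  fix s assume "t \<in> time_interval T" "s \<in> {0..t}"
  then have "ereal s \<le> ereal t" "ereal t < T" "0 \<le> s" by (auto simp: time_interval_def)
  then show "s \<in> time_interval T" by (auto simp: time_interval_def intro: le_less_trans[of "ereal s" "ereal t"])
qed

text \<open>Integrating the flow equation in time, with \<open>Ric (\<omega> s) = Ric \<omega>\<^sub>0 - dd\<^sup>c v\<^sub>s\<close>.\<close>

lemma flow_cohomologous:
  assumes k: "kaehler_form A \<omega>\<^sub>0" and sol: "krf_solution A \<omega>\<^sub>0 T \<omega>" and t: "t \<in> time_interval T"
  shows "cohomologous A (\<omega> t) (limit_form \<omega>\<^sub>0 t)"
proof -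
  let ?I = "time_interval T"
  note sub = time_interval_Icc[OF t]
  have t0: "0 \<le> t" using t by (simp add: time_interval_def)
  have kt: "kaehler_form A (\<omega> s)" if "s \<in> {0..t}" for s using sol sub that by (auto simp: krf_solution_def)
  \<comment> \<open>The factor exp s absorbs the linear term of the flow: the time derivative of exp
    s times the metric at time s is - exp s times its Ricci form.\<close>
  define \<Phi> where "\<Phi> p = exp (- t) * integral {0..t} (\<lambda>s. exp s * vol_ratio (\<omega> s) \<omega>\<^sub>0 p)" for p
  define F where "F c = (\<lambda>(s, z). exp s * (ricpot (\<omega> s) c z - ricpot \<omega>\<^sub>0 c z))" for c
  have Fs: "smooth_on (F c) ({0..t} \<times> chart_img c)" if "c \<in> A" for c
    unfolding F_def by (rule smooth_on_subset[OF smooth_flow_potential[OF k sol that]]) (use sub in auto)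
  have \<Phi>: "\<Phi> (chart_inv c z) = exp (- t) * integral {0..t} (\<lambda>s. F c (s, z))" if c: "c \<in> A" "z \<in> chart_img c" for c z
    unfolding \<Phi>_def F_def using vol_ratio_eq[OF kt k c] by (auto intro!: integral_cong)
  have \<Phi>s: "smooth_fun \<Phi>"
    unfolding smooth_fun_def
  proof
    fix c assume c: "c \<in> A"
    have "smooth_on (\<lambda>z. exp (- t) * integral {0..t} (\<lambda>s. F c (s, z))) (chart_img c)"
      by (intro smooth_on_mult smooth_on_const smooth_on_integral_param[OF Fs[OF c] open_img[OF c]])
    moreover have "smooth_on (\<lambda>z. \<Phi> (chart_inv c z)) (chart_img c) \<longleftrightarrow> smooth_on (\<lambda>z. exp (- t) * integral {0..t} (\<lambda>s. F c (s, z))) (chart_img c)"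
      by (rule smooth_on_cong) (rule \<Phi>[OF c])
    ultimately show "smooth_on (\<lambda>z. \<Phi> (chart_inv c z)) (chart_img c)" by simp
  qed
  show ?thesis
  proof (rule cohomologousI[OF smooth_form1_dc_form[OF \<Phi>s]])
    fix c z v w assume c: "c \<in> A" "z \<in> chart_img c"
    have s1: "smooth_on (\<lambda>z. integral {0..t} (\<lambda>s. F c (s, z))) (chart_img c)"
      by (rule smooth_on_integral_param[OF Fs[OF c(1)] open_img[OF c(1)]])
    have "ext_deriv1 (dc_form \<Phi>) c z v w = ddcl (\<lambda>z. exp (- t) * integral {0..t} (\<lambda>s. F c (s, z)) + 0 * integral {0..t} (\<lambda>s. F c (s, z))) z v w"
      unfolding ext_deriv1_dc_form using ddcl_cong_open[OF open_img[OF c(1)] c(2) \<Phi>[OF c(1)]] by simp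
    also have "\<dots> = exp (- t) * integral {0..t} (\<lambda>s. ddcl (\<lambda>z. F c (s, z)) z v w)"
      unfolding ddcl_add[OF open_img[OF c(1)] s1 s1 c(2)] ddcl_integral_param[OF Fs[OF c(1)] open_img[OF c(1)] c(2)] by simp
    also have "integral {0..t} (\<lambda>s. ddcl (\<lambda>z. F c (s, z)) z v w) = exp t * \<omega> t c z v w - \<omega>\<^sub>0 c z v w + (exp t - 1) * Ric \<omega>\<^sub>0 c z v w"
    proof (rule integral_unique)
      have dd: "ddcl (\<lambda>z. F c (s, z)) z v w = exp s * Ric \<omega>\<^sub>0 c z v w - exp s * Ric (\<omega> s) c z v w" if s: "s \<in> {0..t}" for s
      proof -
        have "ddcl (\<lambda>z. F c (s, z)) z v w = ddcl (\<lambda>z. exp s * ricpot (\<omega> s) c z + (- exp s) * ricpot \<omega>\<^sub>0 c z) z v w"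
          by (simp add: F_def algebra_simps)
        also have "\<dots> = exp s * ddcl (ricpot (\<omega> s) c) z v w + (- exp s) * ddcl (ricpot \<omega>\<^sub>0 c) z v w"
          by (rule ddcl_add[OF open_img[OF c(1)] smooth_ricpot[OF kt[OF s] c(1)] smooth_ricpot[OF k c(1)] c(2)])
        finally show ?thesis unfolding Ric_eq[OF kt[OF s] c] Ric_eq[OF k c] by simp
      qed
      \<comment> \<open>So dd^c of the potential is the time derivative of an explicit form, and its
        time integral comes from the fundamental theorem of calculus.\<close>
      have "((\<lambda>s. exp s * \<omega> s c z v w + exp s * Ric \<omega>\<^sub>0 c z v w) has_vector_derivative ddcl (\<lambda>z. F c (s, z)) z v w) (at s within {0..t})"
        if s: "s \<in> {0..t}" for s
      proof -
        have "((\<lambda>s. \<omega> s c z v w) has_real_derivative (- Ric (\<omega> s) c z v w - \<omega> s c z v w)) (at s within ?I)"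
          using sol s sub c by (auto simp: krf_solution_def)
        then have "((\<lambda>s. \<omega> s c z v w) has_real_derivative (- Ric (\<omega> s) c z v w - \<omega> s c z v w)) (at s within {0..t})"
          by (rule DERIV_subset) (rule sub)
        then have "((\<lambda>s. exp s * \<omega> s c z v w + exp s * Ric \<omega>\<^sub>0 c z v w) has_real_derivative
            (exp s * (- Ric (\<omega> s) c z v w - \<omega> s c z v w) + exp s * \<omega> s c z v w + exp s * Ric \<omega>\<^sub>0 c z v w)) (at s within {0..t})"
          by (auto intro!: derivative_eq_intros)
        then show ?thesis unfolding dd[OF s] has_real_derivative_iff_has_vector_derivative by (simp add: algebra_simps)
      qed
      from fundamental_theorem_of_calculus[OF t0 this]
      have "((\<lambda>s. ddcl (\<lambda>z. F c (s, z)) z v w) has_integral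
         (exp t * \<omega> t c z v w + exp t * Ric \<omega>\<^sub>0 c z v w - (exp 0 * \<omega> 0 c z v w + exp 0 * Ric \<omega>\<^sub>0 c z v w))) {0..t}" .
      moreover have "\<omega> 0 c z = \<omega>\<^sub>0 c z" using sol c by (simp add: krf_solution_def)
      ultimately show "((\<lambda>s. ddcl (\<lambda>z. F c (s, z)) z v w) has_integral
         (exp t * \<omega> t c z v w - \<omega>\<^sub>0 c z v w + (exp t - 1) * Ric \<omega>\<^sub>0 c z v w)) {0..t}" by (simp add: algebra_simps)
    qed
    also have "exp (- t) * (exp t * \<omega> t c z v w - \<omega>\<^sub>0 c z v w + (exp t - 1) * Ric \<omega>\<^sub>0 c z v w) = \<omega> t c z v w - limit_form \<omega>\<^sub>0 t c z v w"
      by (simp add: limit_form_def exp_minus field_simps)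
    finally show "\<omega> t c z v w - limit_form \<omega>\<^sub>0 t c z v w = ext_deriv1 (dc_form \<Phi>) c z v w" by simp
  qed
qed

text \<open>The integral is a polynomial in \<open>exp (- t)\<close> whose coefficients are
  integrals of mixed products of \<open>\<omega>\<^sub>0\<close> and
  \<open>Ric \<omega>\<^sub>0\<close>, so the volumes converge at \<open>T\<close> although nothing
  is known about a limit of the metrics.\<close>

lemma flow_volume_tendsto:
  assumes k: "kaehler_form A \<omega>\<^sub>0" and p: "partition_of_unity A F \<rho>"
  shows "isCont (\<lambda>t. pou_integral F \<rho> (wedge_family (\<lambda>_. limit_form \<omega>\<^sub>0 t))) t"
proof -
  have "closed_form2 A \<omega>\<^sub>0" using k by (simp add: kaehler_form_def)
  note pou_integral_binomial[OF p this closed_Ric(1)[OF k], folded limit_form_def]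
  then have "pou_integral F \<rho> (wedge_family (\<lambda>_. limit_form \<omega>\<^sub>0 t))
    = (\<Sum>S\<in>Pow UNIV. (exp (- t) ^ card S * (exp (- t) - 1) ^ card (- S)) * pou_integral F \<rho> (wedge_family (\<lambda>j. if j \<in> S then \<omega>\<^sub>0 else Ric \<omega>\<^sub>0)))" for t
    unfolding limit_form_def by blast
  then show ?thesis by (simp only:) (intro continuous_intros)
qed

end

section \<open>Uniform estimates\<close>

lemma bilinear_real_basis_expansion:
  fixes a :: "complex^'n::finite \<Rightarrow> complex^'n \<Rightarrow> real"
  assumes lin: "\<And>v. linear (a v)" "\<And>w. linear (\<lambda>v. a v w)"
  shows "a v w = (\<Sum>p\<in>UNIV. \<Sum>q\<in>UNIV. rcoord p v * rcoord q w * a (real_basis p) (real_basis q))"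
proof -
  have "a v w = a (\<Sum>p\<in>UNIV. rcoord p v *\<^sub>R real_basis p) (\<Sum>q\<in>UNIV. rcoord q w *\<^sub>R real_basis q)"
    by (simp flip: rcoord_expansion)
  then show ?thesis
    by (simp add: linear_sum[OF lin(2)] linear_sum[OF lin(1)] linear_cmul[OF lin(1)] linear_cmul[OF lin(2)] sum_distrib_left)
      (subst sum.swap, simp add: mult_ac)
qed

lemma abs_rcoord_le: "\<bar>rcoord p v\<bar> \<le> norm v"
  using Basis_le_norm[of "real_basis p" v] by (simp add: Basis_complex_vec inner_real_basis)

text \<open>The real basis splits into pairs e_j, i e_j, and each pair contributes dd^c in one
  complex direction.\<close>

lemma laplacian_ddcl:
  assumes "smooth_at V u" "z \<in> V"
  shows "laplacian u z = (\<Sum>j\<in>UNIV. 2 * ddcl u z (real_basis (j, False)) (\<i> *s real_basis (j, False)))"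
proof -
  have "real_basis (j, True) = \<i> *s real_basis (j, False)" for j :: 'a
    by (simp add: real_basis_def vec_eq_iff axis_def)
  then show ?thesis
    unfolding laplacian_def Basis_complex_vec sum.reindex[OF inj_real_basis] o_def sum_UNIV_times_bool
    by (simp add: smooth_at.ddcl_i[OF assms] add_divide_distrib)
qed

lemma fderiv_diff_const: "fderiv (\<lambda>y. g y - m) z = fderiv g z"
proof -
  have "((\<lambda>y. g y - m) has_derivative f') (at z) \<longleftrightarrow> (g has_derivative f') (at z)" for f'
    using has_derivative_add_const[of "\<lambda>y. g y - m" f' "at z" m] has_derivative_add_const[of g f' "at z" "- m"]
    by auto
  then show ?thesis by (simp add: frechet_derivative_def)
qed

lemma ddcl_diff_const: "ddcl (\<lambda>y. g y - m) z v w = ddcl g z v w"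
  by (simp add: ddcl_def dcl_def fderiv_diff_const)

context ccm
begin

lemma form_bound:
  assumes \<alpha>: "smooth_form2 A \<alpha>" and c: "c \<in> A" and N: "compact N" "N \<subseteq> chart_img c"
  obtains B where "B > 0" "\<And>z v w. z \<in> N \<Longrightarrow> \<bar>\<alpha> c z v w\<bar> \<le> B * (norm v * norm w)"
proof -
  have "\<exists>m. \<forall>z\<in>N. \<bar>\<alpha> c z (real_basis p) (real_basis q)\<bar> \<le> m" for p q
  proof -
    have "continuous_on N (\<lambda>z. \<alpha> c z (real_basis p) (real_basis q))"
      using smooth_on_continuous[OF smooth_form2D(3)[OF \<alpha> c]] N(2) continuous_on_subset by blast
    then have "compact ((\<lambda>z. \<alpha> c z (real_basis p) (real_basis q)) ` N)" by (rule compact_continuous_image[OF _ N(1)])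
    then have "bounded ((\<lambda>z. \<alpha> c z (real_basis p) (real_basis q)) ` N)" by (rule compact_imp_bounded)
    then show ?thesis by (auto simp: bounded_iff)
  qed
  then obtain m where m: "\<And>p q z. z \<in> N \<Longrightarrow> \<bar>\<alpha> c z (real_basis p) (real_basis q)\<bar> \<le> m p q" by metis
  define B where "B = (\<Sum>p\<in>UNIV. \<Sum>q\<in>UNIV. \<bar>m p q\<bar>) + 1"
  have "B > 0" unfolding B_def by (intro add_nonneg_pos sum_nonneg) auto
  moreover have "\<bar>\<alpha> c z v w\<bar> \<le> B * (norm v * norm w)" if z: "z \<in> N" for z v w
  proof -
    have zc: "z \<in> chart_img c" using z N by blast
    have "\<alpha> c z v w = (\<Sum>p\<in>UNIV. \<Sum>q\<in>UNIV. rcoord p v * rcoord q w * \<alpha> c z (real_basis p) (real_basis q))"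
      by (rule bilinear_real_basis_expansion[OF smooth_form2D(1)[OF \<alpha> c zc] smooth_form2_linear_left[OF \<alpha> c zc]])
    also have "\<bar>\<dots>\<bar> \<le> (\<Sum>p\<in>UNIV. \<Sum>q\<in>UNIV. \<bar>rcoord p v * rcoord q w * \<alpha> c z (real_basis p) (real_basis q)\<bar>)"
      by (intro order_trans[OF sum_abs] sum_mono order.refl)
    also have "\<dots> \<le> (\<Sum>p\<in>UNIV. \<Sum>q\<in>UNIV. norm v * norm w * \<bar>m p q\<bar>)"
    proof (intro sum_mono)
      fix p q
      have "\<bar>\<alpha> c z (real_basis p) (real_basis q)\<bar> \<le> \<bar>m p q\<bar>" using m[OF z, of p q] by linarith
      then show "\<bar>rcoord p v * rcoord q w * \<alpha> c z (real_basis p) (real_basis q)\<bar> \<le> norm v * norm w * \<bar>m p q\<bar>"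
        unfolding abs_mult by (intro mult_mono abs_rcoord_le) auto
    qed
    also have "\<dots> = (\<Sum>p\<in>UNIV. \<Sum>q\<in>UNIV. \<bar>m p q\<bar>) * (norm v * norm w)"
      by (simp add: sum_distrib_left mult_ac)
    also have "\<dots> \<le> B * (norm v * norm w)" unfolding B_def by (intro mult_right_mono) auto
    finally show ?thesis .
  qed
  ultimately show ?thesis using that by blast
qed

lemma form_bound_i:
  assumes "smooth_form2 A \<alpha>" "c \<in> A" "compact N" "N \<subseteq> chart_img c"
  obtains B where "B > 0" "\<And>z v. z \<in> N \<Longrightarrow> \<bar>\<alpha> c z v (\<i> *s v)\<bar> \<le> B * (norm v)\<^sup>2"
proof -
  obtain B where B: "B > 0" "\<And>z v w. z \<in> N \<Longrightarrow> \<bar>\<alpha> c z v w\<bar> \<le> B * (norm v * norm w)" using form_bound[OF assms] by blast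
  have "\<bar>\<alpha> c z v (\<i> *s v)\<bar> \<le> B * (norm v)\<^sup>2" if "z \<in> N" for z v
    using B(2)[OF that, of v "\<i> *s v"] by (simp add: norm_smult power2_eq_square)
  then show ?thesis using that B(1) by blast
qed

lemma hdet_bounds:
  assumes k: "kaehler_form A \<omega>" and c: "c \<in> A" and N: "compact N" "N \<subseteq> chart_img c"
  obtains a b where "a > 0" "b > 0" "\<And>z. z \<in> N \<Longrightarrow> a \<le> hdet \<omega> c z" "\<And>z. z \<in> N \<Longrightarrow> hdet \<omega> c z \<le> b"
proof (cases "N = {}")
  case True
  then show ?thesis using that[of 1 1] by simp
next
  case False
  have ct: "continuous_on N (hdet \<omega> c)" using smooth_on_continuous[OF smooth_hdet[OF k c]] N(2) continuous_on_subset by blast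
  obtain x where x: "x \<in> N" "\<And>z. z \<in> N \<Longrightarrow> hdet \<omega> c x \<le> hdet \<omega> c z" using continuous_attains_inf[OF N(1) False ct] by blast
  obtain y where y: "y \<in> N" "\<And>z. z \<in> N \<Longrightarrow> hdet \<omega> c z \<le> hdet \<omega> c y" using continuous_attains_sup[OF N(1) False ct] by blast
  show ?thesis by (rule that[of "hdet \<omega> c x" "hdet \<omega> c y"]) (use x y N(2) hdet_pos[OF k c] in auto)
qed

text \<open>The constant depends on \<open>a\<close> and \<open>B\<close> alone, so it serves all
  forms, points and charts for which these two bounds hold.\<close>

lemma kaehler_lower_bound:
  assumes "a > 0"
  obtains l where "l > 0" "\<And>\<omega> c z v. kaehler_form A \<omega> \<Longrightarrow> c \<in> A \<Longrightarrow> z \<in> chart_img c \<Longrightarrow>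
    (\<And>v. \<omega> c z v (\<i> *s v) \<le> B * (norm v)\<^sup>2) \<Longrightarrow> a \<le> hdet \<omega> c z \<Longrightarrow> l * (norm v)\<^sup>2 \<le> \<omega> c z v (\<i> *s v)"
proof -
  obtain l where l: "l > 0" "\<And>h::complex^'n^'n. \<And>v. posdef h \<Longrightarrow> norm h \<le> real (CARD('n)) * real (CARD('n)) * B \<Longrightarrow> a \<le> Re (det h) \<Longrightarrow>
     l * (norm v)\<^sup>2 \<le> Re (sesq h v v)" using posdef_lower_bound[OF assms] by metis
  have "2 * l * (norm v)\<^sup>2 \<le> \<omega> c z v (\<i> *s v)"
    if k: "kaehler_form A \<omega>" and c: "c \<in> A" "z \<in> chart_img c" and B: "\<And>v. \<omega> c z v (\<i> *s v) \<le> B * (norm v)\<^sup>2" and h: "a \<le> hdet \<omega> c z"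
    for \<omega> c z v
  proof -
    note r = kaehler_real11[OF k c]
    have pos: "0 \<le> \<omega> c z v (\<i> *s v)" for v
    proof (cases "v = 0")
      case True then show ?thesis using linear_0[OF real11D(1)[OF r, of v]] by (simp add: vector_smult_rzero)
    next
      case False then show ?thesis using k c by (auto simp: kaehler_form_def intro: less_imp_le)
    qed
    have "norm (hermitian_coeff (\<omega> c z)) \<le> real (CARD('n)) * real (CARD('n)) * B"
      by (rule norm_matrix_le) (rule real11_entry_bound[OF r pos B])
    from l(2)[OF kaehler_posdef[OF k c] this h, of v] show ?thesis by (simp add: real11_re_sesq[OF r])
  qed
  then show ?thesis using that[of "2 * l"] l(1) by simp
qed

lemma hdet_upper_bound:
  assumes k: "kaehler_form A \<omega>" and c: "c \<in> A" "z \<in> chart_img c" and B: "\<And>v. \<omega> c z v (\<i> *s v) \<le> B * (norm v)\<^sup>2"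
  shows "hdet \<omega> c z \<le> real (card {p. p permutes (UNIV::'n set)}) * B ^ CARD('n)"
proof -
  note r = kaehler_real11[OF k c]
  have pos: "0 \<le> \<omega> c z v (\<i> *s v)" for v
  proof (cases "v = 0")
    case True then show ?thesis using linear_0[OF real11D(1)[OF r, of v]] by (simp add: vector_smult_rzero)
  next
    case False then show ?thesis using k c by (auto simp: kaehler_form_def intro: less_imp_le)
  qed
  have "hdet \<omega> c z \<le> norm (det (hermitian_coeff (\<omega> c z)))" by (rule complex_Re_le_cmod)
  also have "\<dots> \<le> real (card {p. p permutes (UNIV::'n set)}) * B ^ CARD('n)"
    by (rule norm_det_le) (rule real11_entry_bound[OF r pos B])
  finally show ?thesis .
qed

lemma exp_vol_ratio:
  assumes k: "kaehler_form A \<omega>" "kaehler_form A \<omega>'" and c: "c \<in> A" "z \<in> chart_img c"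
  shows "exp (vol_ratio \<omega> \<omega>' (chart_inv c z)) = hdet \<omega> c z / hdet \<omega>' c z"
  unfolding vol_ratio_eq[OF k c] using hdet_pos[OF k(1) c] hdet_pos[OF k(2) c] by (simp add: exp_diff)

text \<open>The curvature hypothesis says that exp (- (D - 1) s) times the metric at time s is
  nonincreasing on each vector. The final factor exp (D T) bounds exp ((D - 1) t) also when
  \<open>D\<close> is less than 1.\<close>

lemma flow_upper_bound:
  assumes k: "kaehler_form A \<omega>\<^sub>0" and sol: "krf_solution A \<omega>\<^sub>0 (ereal T) \<omega>" and D: "D > 0"
    and ric: "\<And>t c z v. t \<in> time_interval (ereal T) \<Longrightarrow> c \<in> A \<Longrightarrow> z \<in> chart_img c \<Longrightarrow> - D * \<omega> t c z v (\<i> *s v) \<le> Ric (\<omega> t) c z v (\<i> *s v)"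
    and t: "t \<in> time_interval (ereal T)" and c: "c \<in> A" "z \<in> chart_img c"
  shows "\<omega> t c z v (\<i> *s v) \<le> exp (D * T) * \<omega>\<^sub>0 c z v (\<i> *s v)"
proof -
  let ?w = "\<i> *s v"
  have tT: "0 \<le> t" "t < T" using t by (auto simp: time_interval_def)
  define f where "f s = exp (- (D - 1) * s) * \<omega> s c z v ?w" for s
  have f0: "f 0 = \<omega>\<^sub>0 c z v ?w" using sol c by (simp add: f_def krf_solution_def)
  have "f t \<le> f 0"
  proof (cases "t = 0")
    case False
    then have t0: "0 < t" using tT by simp
    let ?f' = "\<lambda>s. exp (- (D - 1) * s) * (- Ric (\<omega> s) c z v ?w - \<omega> s c z v ?w) + exp (- (D - 1) * s) * (- (D - 1)) * \<omega> s c z v ?w"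
    have d: "(f has_derivative (\<lambda>h. ?f' s * h)) (at s within {0..t})" if "0 \<le> s" "s \<le> t" for s
    proof -
      have s: "s \<in> time_interval (ereal T)" using time_interval_Icc[OF t] that by auto
      have "((\<lambda>s. \<omega> s c z v ?w) has_real_derivative (- Ric (\<omega> s) c z v ?w - \<omega> s c z v ?w)) (at s within time_interval (ereal T))"
        using sol s c by (auto simp: krf_solution_def)
      then have "((\<lambda>s. \<omega> s c z v ?w) has_real_derivative (- Ric (\<omega> s) c z v ?w - \<omega> s c z v ?w)) (at s within {0..t})"
        by (rule DERIV_subset) (rule time_interval_Icc[OF t])
      then have "(f has_real_derivative ?f' s) (at s within {0..t})"
        unfolding f_def by (auto intro!: derivative_eq_intros)
      then show ?thesis by (simp only: has_field_derivative_def)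
    qed
    obtain s where s: "s \<in> {0<..<t}" "f t - f 0 = ?f' s * (t - 0)"
      using mvt_simple[OF t0 d] by blast
    have "s \<in> time_interval (ereal T)" using time_interval_Icc[OF t] s(1) by auto
    from ric[OF this c, of v] have "- Ric (\<omega> s) c z v ?w - D * \<omega> s c z v ?w \<le> 0" by simp
    then have "exp (- (D - 1) * s) * (- Ric (\<omega> s) c z v ?w - D * \<omega> s c z v ?w) \<le> 0" by (intro mult_nonneg_nonpos) auto
    moreover have "?f' s = exp (- (D - 1) * s) * (- Ric (\<omega> s) c z v ?w - D * \<omega> s c z v ?w)" by (simp add: algebra_simps)
    ultimately have "?f' s \<le> 0" by simp
    then have "?f' s * (t - 0) \<le> 0" using t0 by (intro mult_nonpos_nonneg) auto
    then show ?thesis using s(2) by simp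
  qed simp
  then have le: "exp (- (D - 1) * t) * \<omega> t c z v ?w \<le> \<omega>\<^sub>0 c z v ?w" using f0 by (simp add: f_def)
  have pos: "0 \<le> \<omega>\<^sub>0 c z v ?w"
  proof (cases "v = 0")
    case True then show ?thesis using linear_0[OF real11D(1)[OF kaehler_real11[OF k c], of v]] by (simp add: vector_smult_rzero)
  next
    case False then show ?thesis using k c by (auto simp: kaehler_form_def intro: less_imp_le)
  qed
  have "exp ((D - 1) * t) * exp (- (D - 1) * t) = 1" unfolding exp_add[symmetric] by (simp add: algebra_simps)
  then have "\<omega> t c z v ?w = exp ((D - 1) * t) * (exp (- (D - 1) * t) * \<omega> t c z v ?w)" by (simp only: mult.assoc[symmetric])
  also have "\<dots> \<le> exp ((D - 1) * t) * \<omega>\<^sub>0 c z v ?w" using le by (intro mult_left_mono) auto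
  also have "\<dots> \<le> exp (D * T) * \<omega>\<^sub>0 c z v ?w"
  proof -
    have "D * t \<le> D * T" using tT D by (intro mult_left_mono) auto
    then have "(D - 1) * t \<le> D * T" using tT by (simp add: algebra_simps)
    then show ?thesis using pos by (intro mult_right_mono) auto
  qed
  finally show ?thesis .
qed

end

text \<open>The radius is the one required by \<open>weak_harnack\<close>, so around every point
  there is a cube on which that inequality applies in one fixed chart.\<close>

locale ccm_nbhds = ccm A for A :: "('a::t2_space, 'n::finite) chart set" +
  fixes cp :: "'a \<Rightarrow> ('a, 'n) chart" and rad :: "'a \<Rightarrow> real"
  assumes cp: "cp p \<in> A" and cp_dom: "p \<in> chart_dom (cp p)" and rad: "rad p > 0"
    and nbhd: "cball (chart_map (cp p) p) (4 * rad p * real DIM(complex^'n) * real DIM(complex^'n)) \<subseteq> chart_img (cp p)"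
begin

abbreviation ctr where "ctr p \<equiv> chart_map (cp p) p"
abbreviation N where "N p \<equiv> cball (ctr p) (4 * rad p * real DIM(complex^'n) * real DIM(complex^'n))"
abbreviation Cb where "Cb p \<equiv> cube (ctr p) (rad p)"

definition U where "U p = chart_inv (cp p) ` ball (ctr p) (rad p)"

text \<open>For nonnegative \<open>w\<close> this is a local L^1 norm in the chart chosen at
  \<open>q\<close>.\<close>

definition J :: "'a \<Rightarrow> ('a \<Rightarrow> real) \<Rightarrow> real" where
  "J q w = integral (Cb q) (\<lambda>z. w (chart_inv (cp q) z))"

lemma ball_Cb: "ball (ctr p) (rad p) \<subseteq> Cb p"
  using cball_subset_cube[of "ctr p" "rad p"] ball_subset_cball by blast

lemma Cb_N: "Cb p \<subseteq> N p"
proof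
  fix z assume "z \<in> Cb p"
  then have "norm (z - ctr p) \<le> rad p * real DIM(complex^'n)" by (rule cube_norm)
  also have "\<dots> \<le> 4 * rad p * real DIM(complex^'n) * real DIM(complex^'n)"
  proof -
    have d: "1 \<le> real DIM(complex^'n)" using DIM_positive[where 'a="complex^'n"] by linarith
    have "rad p * real DIM(complex^'n) * 1 \<le> rad p * real DIM(complex^'n) * (4 * real DIM(complex^'n))"
      using rad[of p] d by (intro mult_left_mono) auto
    then show ?thesis by (simp add: mult_ac)
  qed
  finally show "z \<in> N p" by (simp add: dist_norm norm_minus_commute)
qed

lemma Cb_img: "Cb p \<subseteq> chart_img (cp p)" using Cb_N nbhd by blast

lemma ball_img: "ball (ctr p) (rad p) \<subseteq> chart_img (cp p)" using ball_Cb Cb_img by blast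

lemma open_U: "open (U p)" unfolding U_def by (rule open_chart_image[OF cp open_ball ball_img])

lemma mem_U: "p \<in> U p"
  unfolding U_def by (rule image_eqI[of _ _ "ctr p"]) (use rad chart_inv_map[OF cp cp_dom] in auto)

lemma U_dom: "U p \<subseteq> chart_dom (cp p)"
  unfolding U_def using ball_img chart_inv_dom[OF cp] by blast

lemma U_iff: "z \<in> chart_img (cp p) \<Longrightarrow> chart_inv (cp p) z \<in> U p \<longleftrightarrow> z \<in> ball (ctr p) (rad p)"
proof
  assume z: "z \<in> chart_img (cp p)" and "chart_inv (cp p) z \<in> U p"
  then obtain y where y: "y \<in> ball (ctr p) (rad p)" "chart_inv (cp p) z = chart_inv (cp p) y" unfolding U_def by blast
  then have "z = y" using chart_map_inv[OF cp, of z] chart_map_inv[OF cp, of y] z ball_img[of p] by (metis subsetD)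
  then show "z \<in> ball (ctr p) (rad p)" using y by simp
qed (auto simp: U_def)

text \<open>The bound of the Laplacian is common to the whole family \<open>W\<close>, so it can be
  absorbed into the constant; the summand 1 takes its place.\<close>

lemma local_harnack:
  assumes W: "\<And>w. w \<in> W \<Longrightarrow> smooth_fun w" "\<And>w p. w \<in> W \<Longrightarrow> 0 \<le> w p"
    and lap: "\<exists>K. \<forall>w\<in>W. \<forall>z\<in>N q. laplacian (\<lambda>z. w (chart_inv (cp q) z)) z \<le> K"
  obtains C where "C > 0" "\<And>w z. w \<in> W \<Longrightarrow> z \<in> Cb q \<Longrightarrow> J q w \<le> C * (w (chart_inv (cp q) z) + 1)"
proof -
  obtain C where C: "C > 0" and h: "\<And>w K y. smooth_on w (chart_img (cp q)) \<Longrightarrow> (\<And>x. x \<in> chart_img (cp q) \<Longrightarrow> 0 \<le> w x) \<Longrightarrow>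
      (\<And>x. x \<in> N q \<Longrightarrow> laplacian w x \<le> K) \<Longrightarrow> 0 \<le> K \<Longrightarrow> y \<in> Cb q \<Longrightarrow> integral (Cb q) w \<le> C * (w y + K)"
    using weak_harnack[OF open_img[OF cp] rad nbhd] by metis
  obtain K where K: "\<And>w z. w \<in> W \<Longrightarrow> z \<in> N q \<Longrightarrow> laplacian (\<lambda>z. w (chart_inv (cp q) z)) z \<le> K" using lap by blast
  have "J q w \<le> (C * (1 + max 0 K)) * (w (chart_inv (cp q) z) + 1)" if w: "w \<in> W" and z: "z \<in> Cb q" for w z
  proof -
    let ?y = "w (chart_inv (cp q) z)"
    have "J q w \<le> C * (?y + max 0 K)"
      unfolding J_def
    proof (rule h)
      show "smooth_on (\<lambda>z. w (chart_inv (cp q) z)) (chart_img (cp q))" using W(1)[OF w] cp by (simp add: smooth_fun_def)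
      show "laplacian (\<lambda>z. w (chart_inv (cp q) z)) x \<le> max 0 K" if "x \<in> N q" for x using K[OF w that] by simp
    qed (use W(2)[OF w] z in auto)
    also have "\<dots> \<le> C * ((1 + max 0 K) * (?y + 1))"
    proof -
      have "0 \<le> max 0 K * ?y" using W(2)[OF w] by (intro mult_nonneg_nonneg) auto
      then have "?y + max 0 K \<le> (1 + max 0 K) * (?y + 1)" by (simp add: algebra_simps)
      then show ?thesis using C by (intro mult_left_mono) auto
    qed
    finally show ?thesis by (simp add: mult.assoc)
  qed
  moreover have "C * (1 + max 0 K) > 0" using C by (intro mult_pos_pos) auto
  ultimately show ?thesis using that by blast
qed

text \<open>The set of points \<open>q\<close> near which the integral is controlled by values near \<open>p\<close> is open and
  closed.\<close>

lemma harnack_chain: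
  assumes W: "\<And>w. w \<in> W \<Longrightarrow> smooth_fun w" "\<And>w p. w \<in> W \<Longrightarrow> 0 \<le> w p"
    and lap: "\<And>q. \<exists>K. \<forall>w\<in>W. \<forall>z\<in>N q. laplacian (\<lambda>z. w (chart_inv (cp q) z)) z \<le> K"
  shows "\<exists>C. \<forall>w\<in>W. \<forall>y\<in>U p. J q w \<le> C * (w y + 1)"
proof -
  define Q where "Q = {q. \<exists>C. \<forall>w\<in>W. \<forall>y\<in>U p. J q w \<le> C * (w y + 1)}"
  \<comment> \<open>The condition that \<open>U q\<close> meets \<open>U q'\<close> is symmetric, so
    this one step yields the openness of both \<open>Q\<close> and its complement.\<close>
  have step: "q' \<in> Q" if q: "q \<in> Q" and ne: "U q \<inter> U q' \<noteq> {}" for q q'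
  proof -
    obtain C where C: "\<And>w y. w \<in> W \<Longrightarrow> y \<in> U p \<Longrightarrow> J q w \<le> C * (w y + 1)" using q unfolding Q_def by blast
    obtain C' where C': "C' > 0" "\<And>w z. w \<in> W \<Longrightarrow> z \<in> Cb q' \<Longrightarrow> J q' w \<le> C' * (w (chart_inv (cp q') z) + 1)"
      by (rule local_harnack[of W q', OF _ _ lap[of q']]) (use W in blast)+
    \<comment> \<open>The part of the ball around the centre of \<open>q\<close> that also lies in
      \<open>U q'\<close>, in the coordinates at \<open>q\<close>; a box inside it transfers the
      estimate.\<close>
    define G where "G = ball (ctr q) (rad q) \<inter> {z \<in> chart_img (cp q). chart_inv (cp q) z \<in> U q'}"
    have "open G" unfolding G_def by (intro open_Int open_ball open_chart_vimage cp open_U)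
    moreover obtain z1 where z1: "z1 \<in> G"
    proof -
      obtain x where x: "x \<in> U q" "x \<in> U q'" using ne by blast
      then obtain z where "z \<in> ball (ctr q) (rad q)" "x = chart_inv (cp q) z" unfolding U_def by blast
      then have "z \<in> G" using x ball_img[of q] by (auto simp: G_def)
      then show ?thesis by (rule that)
    qed
    ultimately obtain a b where ab: "cbox a b \<subseteq> G" "z1 \<in> box a b" using open_contains_cbox[of G z1] by metis
    define \<beta> where "\<beta> = measure lborel (cbox a b)"
    have \<beta>: "\<beta> > 0" unfolding \<beta>_def by (rule content_pos_lt) (use ab(2) in \<open>auto simp: mem_box intro: less_trans\<close>)
    have "J q' w \<le> (C' * (\<bar>C\<bar> / \<beta> + 1)) * (w y + 1)" if w: "w \<in> W" and y: "y \<in> U p" for w y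
    proof -
      let ?u = "\<lambda>z. w (chart_inv (cp q) z)"
      have sub: "cbox a b \<subseteq> Cb q" using ab(1) ball_Cb[of q] by (auto simp: G_def)
      have cu: "continuous_on (chart_img (cp q)) ?u" using W(1)[OF w] cp smooth_on_continuous by (auto simp: smooth_fun_def)
      have c1: "continuous_on (cbox a b) ?u" "continuous_on (Cb q) ?u"
        using continuous_on_subset[OF cu] sub Cb_img[of q] by (meson subset_trans)+
      have ne: "cbox a b \<noteq> {}" using ab(2) box_subset_cbox by blast
      \<comment> \<open>The minimum over the box times its volume \<beta> is at most the integral at
        \<open>q\<close>. It is attained in \<open>U q'\<close>, so it can serve as the base value
        for the cube at \<open>q'\<close>.\<close>
      obtain z2 where z2: "z2 \<in> cbox a b" "\<And>z. z \<in> cbox a b \<Longrightarrow> ?u z2 \<le> ?u z"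
        using continuous_attains_inf[OF compact_cbox ne c1(1)] by blast
      have i1: "?u integrable_on cbox a b" by (rule integrable_continuous[OF c1(1)])
      have i2: "?u integrable_on Cb q" unfolding cube_def by (rule integrable_continuous) (use c1(2) in \<open>simp add: cube_def\<close>)
      have "\<beta> * ?u z2 = integral (cbox a b) (\<lambda>z. ?u z2)" by (simp add: \<beta>_def)
      also have "\<dots> \<le> integral (cbox a b) ?u" by (rule integral_le[OF _ i1]) (use z2(2) in auto)
      also have "\<dots> \<le> J q w" unfolding J_def by (rule integral_subset_le[OF sub i1 i2]) (use W(2)[OF w] in auto)
      also have "\<dots> \<le> C * (w y + 1)" by (rule C[OF w y])
      also have "\<dots> \<le> \<bar>C\<bar> * (w y + 1)" using W(2)[OF w, of y] by (intro mult_right_mono) auto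
      finally have u2: "?u z2 \<le> \<bar>C\<bar> / \<beta> * (w y + 1)" using \<beta> by (simp add: field_simps)
      have "chart_inv (cp q) z2 \<in> U q'" using z2(1) ab(1) by (auto simp: G_def)
      then obtain z3 where z3: "z3 \<in> ball (ctr q') (rad q')" "chart_inv (cp q) z2 = chart_inv (cp q') z3" unfolding U_def by blast
      have "J q' w \<le> C' * (?u z2 + 1)" using C'(2)[OF w, of z3] z3 ball_Cb[of q'] by auto
      also have "\<dots> \<le> C' * ((\<bar>C\<bar> / \<beta> + 1) * (w y + 1))"
        using u2 W(2)[OF w, of y] C'(1) by (intro mult_left_mono) (auto simp: algebra_simps)
      finally show ?thesis by (simp add: mult.assoc)
    qed
    then show ?thesis unfolding Q_def by blast
  qed
  have "p \<in> Q"
  proof -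
    obtain C where C: "C > 0" "\<And>w z. w \<in> W \<Longrightarrow> z \<in> Cb p \<Longrightarrow> J p w \<le> C * (w (chart_inv (cp p) z) + 1)"
      by (rule local_harnack[of W p, OF _ _ lap[of p]]) (use W in blast)+
    have "J p w \<le> C * (w y + 1)" if "w \<in> W" "y \<in> U p" for w y
      using C(2)[OF that(1)] that(2) ball_Cb[of p] unfolding U_def by blast
    then show ?thesis unfolding Q_def by blast
  qed
  have "open Q"
  proof (rule topological_space_class.openI)
    fix q assume q: "q \<in> Q"
    have "U q \<subseteq> Q" using step[OF q] mem_U by blast
    then show "\<exists>T. open T \<and> q \<in> T \<and> T \<subseteq> Q" using open_U mem_U by blast
  qed
  moreover have "open (- Q)"
  proof (rule topological_space_class.openI)
    fix q assume q: "q \<in> - Q"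
    have "U q \<subseteq> - Q" using step[of _ q] q mem_U by blast
    then show "\<exists>T. open T \<and> q \<in> T \<and> T \<subseteq> - Q" using open_U mem_U by blast
  qed
  ultimately have "Q \<inter> UNIV = {} \<or> - Q \<inter> UNIV = {}"
    by (intro connectedD[OF connected_UNIV]) auto
  then have "q \<in> Q" using \<open>p \<in> Q\<close> by blast
  then show ?thesis unfolding Q_def by blast
qed

text \<open>Applied at time 0 to the initial form, and shortly before \<open>T\<close> to the flow.
  Positivity need only be checked in the charts selected by \<open>Q\<close>, since every tangent
  vector can be carried into one of them.\<close>

lemma perturbed_class_kaehler:
  assumes k0: "kaehler_form A \<omega>\<^sub>0" and k: "kaehler_form A \<omega>" and co: "cohomologous A \<omega> (limit_form \<omega>\<^sub>0 s)"
    and Q: "(\<Union>q\<in>Q. U q) = UNIV"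
    and low: "\<And>q z v. q \<in> Q \<Longrightarrow> z \<in> N q \<Longrightarrow> l * (norm v)\<^sup>2 \<le> \<omega> (cp q) z v (\<i> *s v)"
    and up: "\<And>q z v. q \<in> Q \<Longrightarrow> z \<in> N q \<Longrightarrow> \<bar>\<omega>\<^sub>0 (cp q) z v (\<i> *s v) + Ric \<omega>\<^sub>0 (cp q) z v (\<i> *s v)\<bar> \<le> b * (norm v)\<^sup>2"
    and small: "\<bar>exp (- t) - exp (- s)\<bar> * b < l"
  shows "flow_class A \<omega>\<^sub>0 t \<in> kaehler_cone A"
proof -
  define e where "e = exp (- t) - exp (- s)"
  define \<mu> where "\<mu> = (\<lambda>c z v w. 1 * \<omega>\<^sub>0 c z v w + 1 * Ric \<omega>\<^sub>0 c z v w)"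
  define \<omega>' where "\<omega>' = (\<lambda>c z v w. 1 * \<omega> c z v w + e * \<mu> c z v w)"
  have c0: "closed_form2 A \<omega>\<^sub>0" "closed_form2 A \<omega>" using k0 k by (auto simp: kaehler_form_def)
  have c\<mu>: "closed_form2 A \<mu>" unfolding \<mu>_def by (rule closed_form2_combination[OF c0(1) closed_Ric(1)[OF k0]])
  have c\<omega>': "closed_form2 A \<omega>'" unfolding \<omega>'_def by (rule closed_form2_combination[OF c0(2) c\<mu>])
  have s\<omega>': "smooth_form2 A \<omega>'" using c\<omega>' by (simp add: closed_form2_def)
  have "kaehler_form A \<omega>'"
    unfolding kaehler_form_def
  proof (intro conjI ballI allI impI)
    show "closed_form2 A \<omega>'" by (rule c\<omega>')
    show "type11 A \<omega>'"
      using k0 k closed_Ric(2)[OF k0] by (simp add: type11_def kaehler_form_def \<omega>'_def \<mu>_def)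
    fix c z and v :: "complex^'n" assume c: "c \<in> A" and z: "z \<in> chart_img c" and v: "v \<noteq> 0"
    obtain q where q: "q \<in> Q" "chart_inv c z \<in> U q" using Q by blast
    then obtain y where y: "y \<in> ball (ctr q) (rad q)" "chart_inv c z = chart_inv (cp q) y" unfolding U_def by blast
    have zo: "z \<in> overlap c (cp q)" unfolding overlap_eq[OF c] using z q(2) U_dom[of q] by blast
    have "transition c (cp q) z = y" using chart_map_inv[OF cp] y ball_img[of q] by (auto simp: transition_def)
    then have yN: "transition c (cp q) z \<in> N q" using y(1) ball_Cb[of q] Cb_N[of q] by blast
    define u where "u = dtrans c (cp q) z v"
    have u: "u \<noteq> 0" unfolding u_def by (rule dtrans_nonzero[OF c cp zo v])
    have "\<omega>' c z v (\<i> *s v) = \<omega>' (cp q) (transition c (cp q) z) u (\<i> *s u)"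
      unfolding u_def smooth_form2D(4)[OF s\<omega>' c cp zo] dtrans_smult[OF c cp zo] ..
    moreover have "\<bar>e * \<mu> (cp q) (transition c (cp q) z) u (\<i> *s u)\<bar> \<le> \<bar>e\<bar> * (b * (norm u)\<^sup>2)"
      unfolding abs_mult by (intro mult_left_mono) (use up[OF q(1) yN, of u] in \<open>auto simp: \<mu>_def\<close>)
    moreover have "\<bar>e\<bar> * (b * (norm u)\<^sup>2) < l * (norm u)\<^sup>2"
      using mult_strict_right_mono[OF small, of "(norm u)\<^sup>2"] u by (simp add: e_def mult.assoc)
    moreover have "l * (norm u)\<^sup>2 \<le> \<omega> (cp q) (transition c (cp q) z) u (\<i> *s u)" by (rule low[OF q(1) yN])
    ultimately show "0 < \<omega>' c z v (\<i> *s v)" unfolding \<omega>'_def by linarith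
  qed
  moreover have "cohomologous A \<omega>' (limit_form \<omega>\<^sub>0 t)"
  proof (rule cohomologous_trans)
    show "cohomologous A \<omega>' (\<lambda>c z v w. 1 * limit_form \<omega>\<^sub>0 s c z v w + e * \<mu> c z v w)"
      unfolding \<omega>'_def by (rule cohomologous_combination[OF co cohomologous_refl]) simp
    show "cohomologous A (\<lambda>c z v w. 1 * limit_form \<omega>\<^sub>0 s c z v w + e * \<mu> c z v w) (limit_form \<omega>\<^sub>0 t)"
      by (rule cohomologous_refl) (simp add: limit_form_def \<mu>_def e_def algebra_simps)
  qed
  then have "flow_class A \<omega>\<^sub>0 t = dR_class A \<omega>'"
    unfolding flow_class_eq[OF k0] by (rule dR_class_eq[OF cohomologous_sym])
  ultimately show ?thesis unfolding kaehler_cone_def by blast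
qed

lemma uniform_bounds:
  assumes k: "kaehler_form A \<omega>\<^sub>0"
  obtains a b where "a > 0" "b > 0" "\<And>z. z \<in> N q \<Longrightarrow> a \<le> hdet \<omega>\<^sub>0 (cp q) z" "\<And>z. z \<in> N q \<Longrightarrow> hdet \<omega>\<^sub>0 (cp q) z \<le> b"
    "\<And>z v. z \<in> N q \<Longrightarrow> \<omega>\<^sub>0 (cp q) z v (\<i> *s v) \<le> b * (norm v)\<^sup>2"
    "\<And>z v. z \<in> N q \<Longrightarrow> \<bar>Ric \<omega>\<^sub>0 (cp q) z v (\<i> *s v)\<bar> \<le> b * (norm v)\<^sup>2"
    "\<And>z v. z \<in> N q \<Longrightarrow> \<bar>\<omega>\<^sub>0 (cp q) z v (\<i> *s v) + Ric \<omega>\<^sub>0 (cp q) z v (\<i> *s v)\<bar> \<le> b * (norm v)\<^sup>2"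
proof -
  have s: "smooth_form2 A \<omega>\<^sub>0" "smooth_form2 A (Ric \<omega>\<^sub>0)" using k closed_Ric(1)[OF k] by (auto simp: kaehler_form_def closed_form2_def)
  obtain a b1 where ab: "a > 0" "b1 > 0" "\<And>z. z \<in> N q \<Longrightarrow> a \<le> hdet \<omega>\<^sub>0 (cp q) z" "\<And>z. z \<in> N q \<Longrightarrow> hdet \<omega>\<^sub>0 (cp q) z \<le> b1"
    using hdet_bounds[OF k cp compact_cball nbhd] by metis
  obtain b2 where b2: "b2 > 0" "\<And>z v. z \<in> N q \<Longrightarrow> \<bar>\<omega>\<^sub>0 (cp q) z v (\<i> *s v)\<bar> \<le> b2 * (norm v)\<^sup>2"
    using form_bound_i[OF s(1) cp compact_cball nbhd] by metis
  obtain b3 where b3: "b3 > 0" "\<And>z v. z \<in> N q \<Longrightarrow> \<bar>Ric \<omega>\<^sub>0 (cp q) z v (\<i> *s v)\<bar> \<le> b3 * (norm v)\<^sup>2"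
    using form_bound_i[OF s(2) cp compact_cball nbhd] by metis
  let ?b = "b1 + b2 + b3"
  have le: "b2 * (norm v)\<^sup>2 \<le> ?b * (norm v)\<^sup>2" "b3 * (norm v)\<^sup>2 \<le> ?b * (norm v)\<^sup>2" "b2 * (norm v)\<^sup>2 + b3 * (norm v)\<^sup>2 \<le> ?b * (norm v)\<^sup>2" for v :: "complex^'n"
    using ab(2) b2(1) b3(1) by (auto simp: algebra_simps)
  show ?thesis
  proof (rule that[OF ab(1), of ?b])
    show "hdet \<omega>\<^sub>0 (cp q) z \<le> ?b" if "z \<in> N q" for z using ab(4)[OF that] b2(1) b3(1) by linarith
    fix z v assume z: "z \<in> N q"
    show "\<omega>\<^sub>0 (cp q) z v (\<i> *s v) \<le> ?b * (norm v)\<^sup>2" using b2(2)[OF z, of v] le[of v] by linarith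
    show "\<bar>Ric \<omega>\<^sub>0 (cp q) z v (\<i> *s v)\<bar> \<le> ?b * (norm v)\<^sup>2" using b3(2)[OF z, of v] le[of v] by linarith
    show "\<bar>\<omega>\<^sub>0 (cp q) z v (\<i> *s v) + Ric \<omega>\<^sub>0 (cp q) z v (\<i> *s v)\<bar> \<le> ?b * (norm v)\<^sup>2"
      using b2(2)[OF z, of v] b3(2)[OF z, of v] le[of v] by linarith
  qed (use ab b2 b3 in auto)
qed

end

text \<open>If \<open>m = -L\<close> is very negative then \<open>exp v\<close>, bounded by \<open>E\<close>, is small except where \<open>w = v - m\<close>
  is of size \<open>L\<close>, and the integral of \<open>w\<close> is bounded.\<close>

lemma exp_le_interpolate:
  fixes v E L :: real
  assumes "L > 0" "exp v \<le> E" "- L \<le> v"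
  shows "exp v \<le> 2 / L * (1 + E * (v + L))"
proof -
  have E: "E > 0" using assms(2) exp_gt_zero[of v] by linarith
  have w: "0 \<le> E * (v + L)" using E assms(3) by (intro mult_nonneg_nonneg) auto
  show ?thesis
  \<comment> \<open>Below - L / 2 the exponential itself is at most 2 / L; above it, v + L exceeds L
    / 2, so the term with \<open>E\<close> dominates the bound \<open>E\<close>.\<close>
  proof (cases "v \<le> - L / 2")
    case True
    have "L / 2 \<le> exp (L / 2)" using exp_ge_add_one_self[of "L / 2"] by linarith
    then have "exp (- (L / 2)) \<le> 2 / L" using assms(1) by (simp add: exp_minus field_simps)
    moreover have "exp v \<le> exp (- (L / 2))" using True by simp
    ultimately have "exp v \<le> 2 / L * 1" by linarith
    also have "\<dots> \<le> 2 / L * (1 + E * (v + L))" using w assms(1) by (intro mult_left_mono) auto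
    finally show ?thesis .
  next
    case False
    then have "E * (L / 2) \<le> E * (v + L)" using E by (intro mult_left_mono) auto
    then have "E \<le> 2 / L * (E * (v + L))" using assms(1) by (simp add: field_simps)
    also have "\<dots> \<le> 2 / L * (1 + E * (v + L))" using assms(1) by (intro mult_left_mono) auto
    finally show ?thesis using assms(2) by linarith
  qed
qed

section \<open>Lower bounds along the flow\<close>

context ccm_nbhds
begin

context
  fixes \<omega>\<^sub>0 :: "('a, 'n) form2" and \<omega> :: "real \<Rightarrow> ('a, 'n) form2" and T D :: real
    and Q :: "'a set" and \<rho> :: "('a, 'n) chart \<Rightarrow> 'a \<Rightarrow> real"
  assumes k0: "kaehler_form A \<omega>\<^sub>0" and sol: "krf_solution A \<omega>\<^sub>0 (ereal T) \<omega>" and T: "0 < T" and D: "D > 0"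
    and ric: "\<And>t c z v. t \<in> time_interval (ereal T) \<Longrightarrow> c \<in> A \<Longrightarrow> z \<in> chart_img c \<Longrightarrow>
      - D * \<omega> t c z v (\<i> *s v) \<le> Ric (\<omega> t) c z v (\<i> *s v)"
    and Q: "finite Q" "(\<Union>q\<in>Q. U q) = UNIV" and pou: "partition_of_unity A (cp ` Q) \<rho>"
    and pou_U: "\<And>c x. \<rho> c x \<noteq> 0 \<Longrightarrow> \<exists>p\<in>Q. cp p = c \<and> x \<in> U p"
begin

abbreviation I where "I \<equiv> time_interval (ereal T)"
abbreviation volume where "volume t \<equiv> pou_integral (cp ` Q) \<rho> (wedge_family (\<lambda>_. \<omega> t))"

lemma flow_kaehler: "t \<in> I \<Longrightarrow> kaehler_form A (\<omega> t)"
  using sol by (simp add: krf_solution_def)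

definition log_vol :: "real \<Rightarrow> 'a \<Rightarrow> real" where "log_vol t = vol_ratio (\<omega> t) \<omega>\<^sub>0"

lemma smooth_log_vol: "t \<in> I \<Longrightarrow> smooth_fun (log_vol t)"
  unfolding log_vol_def by (rule smooth_vol_ratio[OF flow_kaehler k0])

lemma flow_upper:
  obtains B where "\<And>t z v. t \<in> I \<Longrightarrow> z \<in> N q \<Longrightarrow> \<omega> t (cp q) z v (\<i> *s v) \<le> B * (norm v)\<^sup>2"
proof -
  obtain a b where b: "\<And>z v. z \<in> N q \<Longrightarrow> \<omega>\<^sub>0 (cp q) z v (\<i> *s v) \<le> b * (norm v)\<^sup>2"
    using uniform_bounds[OF k0, of q] by metis
  have "\<omega> t (cp q) z v (\<i> *s v) \<le> (exp (D * T) * b) * (norm v)\<^sup>2" if t: "t \<in> I" and z: "z \<in> N q" for t z v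
  proof -
    have zi: "z \<in> chart_img (cp q)" using z nbhd by blast
    have "\<omega> t (cp q) z v (\<i> *s v) \<le> exp (D * T) * \<omega>\<^sub>0 (cp q) z v (\<i> *s v)"
      by (rule flow_upper_bound[OF k0 sol D ric t cp zi])
    also have "\<dots> \<le> exp (D * T) * (b * (norm v)\<^sup>2)" by (intro mult_left_mono b z) auto
    finally show ?thesis by (simp add: mult.assoc)
  qed
  then show ?thesis using that by blast
qed

text \<open>In each complex coordinate direction dd^c of the function is
  \<open>Ric \<omega>\<^sub>0\<close> minus the Ricci form at time \<open>t\<close>, thus at most a
  constant plus \<open>D\<close> times the metric, which is bounded above. The constant
  \<open>m\<close> drops out under differentiation.\<close>

lemma log_vol_laplacian_bound:
  "\<exists>K. \<forall>t\<in>I. \<forall>m. \<forall>z\<in>N q. laplacian (\<lambda>z. log_vol t (chart_inv (cp q) z) - m) z \<le> K"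
proof -
  obtain a b where b: "b > 0" "\<And>z v. z \<in> N q \<Longrightarrow> \<bar>Ric \<omega>\<^sub>0 (cp q) z v (\<i> *s v)\<bar> \<le> b * (norm v)\<^sup>2"
    using uniform_bounds[OF k0, of q] by metis
  obtain B where B: "\<And>t z v. t \<in> I \<Longrightarrow> z \<in> N q \<Longrightarrow> \<omega> t (cp q) z v (\<i> *s v) \<le> B * (norm v)\<^sup>2"
    using flow_upper by metis
  have n1: "norm (real_basis (j, False) :: complex^'n) = 1" for j by (simp add: real_basis_def)
  have "laplacian (\<lambda>z. log_vol t (chart_inv (cp q) z) - m) z \<le> (\<Sum>j\<in>(UNIV::'n set). 2 * (b + D * B))"
    if t: "t \<in> I" and z: "z \<in> N q" for t m z
  proof -
    have zi: "z \<in> chart_img (cp q)" using z nbhd by blast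
    have sm: "smooth_at (chart_img (cp q)) (\<lambda>z. log_vol t (chart_inv (cp q) z) - m)"
      by unfold_locales (use smooth_log_vol[OF t] cp open_img in \<open>auto simp: smooth_fun_def intro!: smooth_on_diff\<close>)
    show ?thesis
      unfolding laplacian_ddcl[OF sm zi] ddcl_diff_const
    proof (intro sum_mono mult_left_mono)
      fix j
      let ?e = "real_basis (j, False) :: complex^'n"
      have "ddcl (\<lambda>z. log_vol t (chart_inv (cp q) z)) z ?e (\<i> *s ?e) = Ric \<omega>\<^sub>0 (cp q) z ?e (\<i> *s ?e) - Ric (\<omega> t) (cp q) z ?e (\<i> *s ?e)"
        unfolding log_vol_def ext_deriv1_dc_form[symmetric] Ric_diff[OF flow_kaehler[OF t] k0 cp zi] ..
      also have "\<dots> \<le> b + D * \<omega> t (cp q) z ?e (\<i> *s ?e)"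
        using b(2)[OF z, of ?e] ric[OF t cp zi, of ?e] by (simp add: n1)
      also have "\<dots> \<le> b + D * B" using B[OF t z, of ?e] D by (simp add: n1)
      finally show "ddcl (\<lambda>z. log_vol t (chart_inv (cp q) z)) z ?e (\<i> *s ?e) \<le> b + D * B" .
    qed simp
  qed
  then show ?thesis by blast
qed

text \<open>A relation instead of a function of \<open>t\<close>, so that the minimum can later be
  named - \<open>L\<close>.\<close>

definition is_min :: "real \<Rightarrow> real \<Rightarrow> bool" where
  "is_min t m \<longleftrightarrow> (\<forall>x. m \<le> log_vol t x) \<and> (\<exists>y. log_vol t y = m)"

lemma is_min_exists: "t \<in> I \<Longrightarrow> \<exists>m. is_min t m"
proof -
  assume t: "t \<in> I"
  obtain y where "\<forall>x\<in>UNIV. log_vol t y \<le> log_vol t x"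
    using continuous_attains_inf[OF compact_UNIV _ smooth_fun_continuous[OF smooth_log_vol[OF t]]] by blast
  then show ?thesis unfolding is_min_def by blast
qed

text \<open>At a minimum point the function \<open>log_vol t x - m\<close> vanishes, so the chain
  estimate based there has the right side \<open>C p q\<close>. The neighbourhood \<open>U p\<close>
  containing that point varies with \<open>t\<close>, but \<open>p\<close> ranges over a finite
  set.\<close>

lemma log_vol_integral_bound:
  obtains C where "C \<ge> 0" "\<And>t m q. t \<in> I \<Longrightarrow> is_min t m \<Longrightarrow> q \<in> Q \<Longrightarrow> J q (\<lambda>x. log_vol t x - m) \<le> C"
proof -
  define W where "W = {\<lambda>x. log_vol t x - m |t m. t \<in> I \<and> is_min t m}"
  have W: "smooth_fun w" "0 \<le> w p" if "w \<in> W" for w p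
    using that smooth_log_vol unfolding W_def is_min_def smooth_fun_def by (auto intro!: smooth_on_diff)
  have lap: "\<exists>K. \<forall>w\<in>W. \<forall>z\<in>N q. laplacian (\<lambda>z. w (chart_inv (cp q) z)) z \<le> K" for q
    using log_vol_laplacian_bound[of q] unfolding W_def by blast
  have "\<exists>C. \<forall>w\<in>W. \<forall>y\<in>U p. J q w \<le> C * (w y + 1)" for p q
    by (rule harnack_chain) (use W lap in blast)+
  then obtain C where C: "\<And>p q w y. w \<in> W \<Longrightarrow> y \<in> U p \<Longrightarrow> J q w \<le> C p q * (w y + 1)" by metis
  define M where "M = (\<Sum>p\<in>Q. \<Sum>q\<in>Q. \<bar>C p q\<bar>)"
  have M: "C p q \<le> M" if "p \<in> Q" "q \<in> Q" for p q
  proof -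
    have "C p q \<le> \<bar>C p q\<bar>" by simp
    also have "\<dots> \<le> (\<Sum>q\<in>Q. \<bar>C p q\<bar>)" by (rule member_le_sum) (use that Q in auto)
    also have "\<dots> \<le> M" unfolding M_def by (rule member_le_sum) (use that Q in \<open>auto intro: sum_nonneg\<close>)
    finally show ?thesis .
  qed
  have "J q (\<lambda>x. log_vol t x - m) \<le> M" if t: "t \<in> I" and m: "is_min t m" and q: "q \<in> Q" for t m q
  proof -
    obtain y where y: "log_vol t y = m" using m unfolding is_min_def by blast
    obtain p where p: "p \<in> Q" "y \<in> U p" using Q(2) by blast
    have "(\<lambda>x. log_vol t x - m) \<in> W" unfolding W_def using t m by blast
    from C[OF this p(2), of q] have "J q (\<lambda>x. log_vol t x - m) \<le> C p q" using y by simp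
    with M[OF p(1) q] show ?thesis by linarith
  qed
  moreover have "M \<ge> 0" unfolding M_def by (intro sum_nonneg) auto
  ultimately show ?thesis using that by blast
qed

definition cube_volume :: "'a \<Rightarrow> real \<Rightarrow> real" where
  "cube_volume q t = integral (Cb q) (hdet (\<omega> t) (cp q))"

lemma continuous_hdet_flow: "t \<in> I \<Longrightarrow> continuous_on (chart_img (cp q)) (hdet (\<omega> t) (cp q))"
  by (rule smooth_on_continuous[OF smooth_hdet[OF flow_kaehler cp]])

lemma integrable_Cb:
  fixes f :: "complex^'n \<Rightarrow> real"
  shows "continuous_on (chart_img (cp q)) f \<Longrightarrow> f integrable_on Cb q"
  using integrable_continuous[OF continuous_on_subset[OF _ Cb_img[unfolded cube_def]], of q f] by (simp add: cube_def)

text \<open>The determinant is that of \<open>\<omega>\<^sub>0\<close> times the exponential of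
  \<open>log_vol\<close>, and \<open>exp_le_interpolate\<close> bounds the exponential by 1 / L
  times a function whose integral is controlled by the Harnack estimate.\<close>

lemma cube_volume_bound:
  obtains G where "G \<ge> 0" "\<And>t L. t \<in> I \<Longrightarrow> is_min t (- L) \<Longrightarrow> L > 0 \<Longrightarrow> q \<in> Q \<Longrightarrow> cube_volume q t \<le> G / L"
proof -
  obtain a b where ab: "a > 0" "b > 0" "\<And>z. z \<in> N q \<Longrightarrow> a \<le> hdet \<omega>\<^sub>0 (cp q) z" "\<And>z. z \<in> N q \<Longrightarrow> hdet \<omega>\<^sub>0 (cp q) z \<le> b"
    using uniform_bounds[OF k0, of q] by metis
  obtain B where B: "\<And>t z v. t \<in> I \<Longrightarrow> z \<in> N q \<Longrightarrow> \<omega> t (cp q) z v (\<i> *s v) \<le> B * (norm v)\<^sup>2"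
    using flow_upper by metis
  obtain C where C: "C \<ge> 0" "\<And>t m q. t \<in> I \<Longrightarrow> is_min t m \<Longrightarrow> q \<in> Q \<Longrightarrow> J q (\<lambda>x. log_vol t x - m) \<le> C"
    by (rule log_vol_integral_bound) blast
  \<comment> \<open>A bound for the exponential of \<open>log_vol\<close>: the determinant of a
    metric bounded by \<open>B\<close>, divided by the lower bound \<open>a\<close> of the initial
    determinant.\<close>
  define E where "E = \<bar>real (card {p. p permutes (UNIV::'n set)}) * B ^ CARD('n)\<bar> / a"
  have E: "E \<ge> 0" using ab(1) by (simp add: E_def)
  define G where "G = b * (2 * (measure lborel (Cb q) + E * C))"
  have Cb: "continuous_on (chart_img (cp q)) f \<Longrightarrow> f integrable_on Cb q" for f :: "complex^'n \<Rightarrow> real" by (rule integrable_Cb)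
  have "cube_volume q t \<le> G / L" if t: "t \<in> I" and m: "is_min t (- L)" and L: "L > 0" and q: "q \<in> Q" for t L
  proof -
    let ?v = "\<lambda>z. log_vol t (chart_inv (cp q) z)"
    have cv: "continuous_on (chart_img (cp q)) ?v"
      using smooth_log_vol[OF t] cp smooth_on_continuous by (auto simp: smooth_fun_def)
    have pw: "hdet (\<omega> t) (cp q) z \<le> b * (2 / L) * (1 + E * (?v z - (- L)))" if z: "z \<in> Cb q" for z
    proof -
      have zN: "z \<in> N q" using z Cb_N by blast
      have zi: "z \<in> chart_img (cp q)" using z Cb_img by blast
      have ev: "exp (?v z) = hdet (\<omega> t) (cp q) z / hdet \<omega>\<^sub>0 (cp q) z"
        unfolding log_vol_def by (rule exp_vol_ratio[OF flow_kaehler[OF t] k0 cp zi])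
      have h0: "0 < hdet \<omega>\<^sub>0 (cp q) z" by (rule hdet_pos[OF k0 cp zi])
      have "hdet (\<omega> t) (cp q) z \<le> \<bar>real (card {p. p permutes (UNIV::'n set)}) * B ^ CARD('n)\<bar>"
        using hdet_upper_bound[OF flow_kaehler[OF t] cp zi B[OF t zN]] by linarith
      then have "exp (?v z) \<le> E"
        unfolding ev E_def using ab(1) ab(3)[OF zN] by (intro frac_le) auto
      moreover have "- L \<le> ?v z" using m by (simp add: is_min_def)
      ultimately have e: "exp (?v z) \<le> 2 / L * (1 + E * (?v z + L))" by (intro exp_le_interpolate L)
      have "hdet (\<omega> t) (cp q) z = hdet \<omega>\<^sub>0 (cp q) z * exp (?v z)" unfolding ev using h0 by simp
      also have "\<dots> \<le> b * exp (?v z)" using ab(4)[OF zN] by (intro mult_right_mono) auto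
      also have "\<dots> \<le> b * (2 / L * (1 + E * (?v z + L)))" using e ab(2) by (intro mult_left_mono) auto
      finally show ?thesis by (simp add: mult.assoc)
    qed
    have i1: "(\<lambda>z. ?v z - (- L)) integrable_on Cb q" by (intro Cb continuous_intros cv)
    have "cube_volume q t \<le> integral (Cb q) (\<lambda>z. b * (2 / L) * (1 + E * (?v z - (- L))))"
      unfolding cube_volume_def
    proof (rule integral_le)
      show "hdet (\<omega> t) (cp q) integrable_on Cb q" by (rule Cb[OF continuous_hdet_flow[OF t]])
      show "(\<lambda>z. b * (2 / L) * (1 + E * (?v z - (- L)))) integrable_on Cb q" by (intro Cb continuous_intros cv)
    qed (rule pw)
    also have "\<dots> = b * (2 / L) * integral (Cb q) (\<lambda>z. 1 + E * (?v z - (- L)))" by (rule integral_mult_right)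
    also have "integral (Cb q) (\<lambda>z. 1 + E * (?v z - (- L))) = integral (Cb q) (\<lambda>z. 1) + integral (Cb q) (\<lambda>z. E * (?v z - (- L)))"
      by (rule integral_add) (intro Cb continuous_intros cv)+
    also have "integral (Cb q) (\<lambda>z. E * (?v z - (- L))) = E * J q (\<lambda>x. log_vol t x - (- L))"
      unfolding J_def by (rule integral_mult_right)
    also have "integral (Cb q) (\<lambda>z. 1::real) = measure lborel (Cb q)" by (simp add: cube_def)
    also have "b * (2 / L) * (measure lborel (Cb q) + E * J q (\<lambda>x. log_vol t x - (- L))) \<le> b * (2 / L) * (measure lborel (Cb q) + E * C)"
      using C(2)[OF t m q] E ab(2) L by (intro mult_left_mono add_left_mono) auto
    also have "\<dots> = G / L" by (simp add: G_def)
    finally show ?thesis .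
  qed
  moreover have "G \<ge> 0" unfolding G_def using ab(2) E C(1) by (intro mult_nonneg_nonneg add_nonneg_nonneg) auto
  ultimately show ?thesis using that by blast
qed

text \<open>The functions of the partition are at most 1 and vanish off the neighbourhoods
  \<open>U p\<close>, which correspond to balls inside the cubes. Overlapping cubes are counted
  repeatedly, hence only an inequality.\<close>

lemma volume_le_cube_volumes:
  assumes t: "t \<in> I"
  shows "\<bar>volume t\<bar> \<le> 2 ^ CARD('n) * \<bar>wedge_const TYPE('n)\<bar> * (\<Sum>q\<in>Q. cube_volume q t)"
proof -
  let ?k = "2 ^ CARD('n) * wedge_const TYPE('n)"
  have w: "wedge_family (\<lambda>_. \<omega> t) c z = ?k * hdet (\<omega> t) c z" if "c \<in> A" "z \<in> chart_img c" for c z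
    using wedge_power_top_family[of "\<omega> t" c z] wedge_power_top_det[OF kaehler_real11[OF flow_kaehler[OF t] that]] by (simp add: field_simps)
  let ?i = "\<lambda>c. integral (chart_img c) (\<lambda>z. \<rho> c (chart_inv c z) * hdet (\<omega> t) c z)"
  have "volume t = pou_integral (cp ` Q) \<rho> (\<lambda>c z. ?k * hdet (\<omega> t) c z)"
    by (rule pou_integral_cong) (use w cp in blast)
  also have "\<dots> = (\<Sum>c\<in>cp ` Q. ?k * ?i c)"
    unfolding pou_integral_def
  proof (rule sum.cong[OF refl])
    fix c
    show "integral (chart_img c) (\<lambda>z. \<rho> c (chart_inv c z) * (?k * hdet (\<omega> t) c z)) = ?k * ?i c"
      unfolding integral_mult_right[symmetric] by (simp add: mult.left_commute)
  qed
  also have "\<dots> = ?k * (\<Sum>c\<in>cp ` Q. ?i c)" by (simp add: sum_distrib_left)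
  finally have eq: "volume t = ?k * (\<Sum>c\<in>cp ` Q. ?i c)" .
  have i: "0 \<le> ?i c \<and> ?i c \<le> (\<Sum>q\<in>{q\<in>Q. cp q = c}. cube_volume q t)" if c: "c \<in> cp ` Q" for c
  proof -
    have cA: "c \<in> A" using c cp by blast
    have ch: "continuous_on (chart_img c) (hdet (\<omega> t) c)" by (rule smooth_on_continuous[OF smooth_hdet[OF flow_kaehler[OF t] cA]])
    have int: "(\<lambda>z. \<rho> c (chart_inv c z) * hdet (\<omega> t) c z) integrable_on chart_img c"
      by (rule compact_support.integrable[OF pou_compact_support[OF pou c ch]])
    have pos: "0 \<le> \<rho> c (chart_inv c z) * hdet (\<omega> t) c z" if "z \<in> chart_img c" for z
      using pouD(3)[OF pou c] hdet_pos[OF flow_kaehler[OF t] cA that] by (intro mult_nonneg_nonneg) auto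
    have le1: "\<rho> c x \<le> 1" for x
      using member_le_sum[OF c, of "\<lambda>c. \<rho> c x"] pouD(1,3,6)[OF pou] by simp
    let ?z = "zext (chart_img c) (\<lambda>z. \<rho> c (chart_inv c z) * hdet (\<omega> t) c z)"
    let ?f = "\<lambda>q. zext (Cb q) (hdet (\<omega> t) c)"
    have fi: "?f q integrable_on UNIV" if "q \<in> {q\<in>Q. cp q = c}" for q
      using integrable_Cb[OF continuous_hdet_flow[OF t, of q]] that unfolding zext_def
      by (simp add: Henstock_Kurzweil_Integration.integrable_restrict_UNIV)
    have nn: "0 \<le> ?f q z" if "q \<in> {q\<in>Q. cp q = c}" for q z
      using hdet_pos[OF flow_kaehler[OF t] cA, of z] that Cb_img[of q] by (auto simp: zext_def intro: less_imp_le)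
    have fin: "finite {q\<in>Q. cp q = c}" using Q(1) by simp
    have "?i c = integral UNIV ?z" by (simp add: integral_zext)
    also have "\<dots> \<le> integral UNIV (\<lambda>z. \<Sum>q\<in>{q\<in>Q. cp q = c}. ?f q z)"
    proof (rule integral_le)
      show "?z integrable_on UNIV" using int unfolding zext_def
        by (simp add: Henstock_Kurzweil_Integration.integrable_restrict_UNIV)
      show "(\<lambda>z. \<Sum>q\<in>{q\<in>Q. cp q = c}. ?f q z) integrable_on UNIV" by (rule integrable_sum[OF fin fi])
      fix z
      show "?z z \<le> (\<Sum>q\<in>{q\<in>Q. cp q = c}. ?f q z)"
      \<comment> \<open>Where the partition function is nonzero the point lies in one cube of this
        chart, and that single term already dominates the integrand.\<close>
      proof (cases "z \<in> chart_img c \<and> \<rho> c (chart_inv c z) \<noteq> 0")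
        case True
        then obtain p where p: "p \<in> Q" "cp p = c" "chart_inv c z \<in> U p" using pou_U by blast
        then have zp: "z \<in> Cb p" using U_iff[of z p] True ball_Cb[of p] by blast
        have "?z z \<le> 1 * hdet (\<omega> t) c z"
          using True le1[of "chart_inv c z"] hdet_pos[OF flow_kaehler[OF t] cA, of z] by (auto simp: zext_def intro!: mult_right_mono)
        also have "\<dots> = ?f p z" using zp by (simp add: zext_def)
        also have "\<dots> \<le> (\<Sum>q\<in>{q\<in>Q. cp q = c}. ?f q z)"
          by (rule member_le_sum) (use p fin nn in auto)
        finally show ?thesis .
      next
        case False
        then have "?z z = 0" by (auto simp: zext_def)
        also have "0 \<le> (\<Sum>q\<in>{q\<in>Q. cp q = c}. ?f q z)" by (rule sum_nonneg) (rule nn)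
        finally show ?thesis .
      qed
    qed
    also have "\<dots> = (\<Sum>q\<in>{q\<in>Q. cp q = c}. integral UNIV (?f q))" by (rule integral_sum[OF fin fi])
    also have "\<dots> = (\<Sum>q\<in>{q\<in>Q. cp q = c}. cube_volume q t)" by (rule sum.cong) (auto simp: integral_zext cube_volume_def)
    finally have "?i c \<le> (\<Sum>q\<in>{q\<in>Q. cp q = c}. cube_volume q t)" .
    moreover have "0 \<le> ?i c" by (rule integral_nonneg[OF int]) (rule pos)
    ultimately show ?thesis by simp
  qed
  have "(\<Sum>c\<in>cp ` Q. ?i c) \<le> (\<Sum>c\<in>cp ` Q. \<Sum>q\<in>{q\<in>Q. cp q = c}. cube_volume q t)" by (rule sum_mono) (use i in blast)
  also have "\<dots> = (\<Sum>q\<in>Q. cube_volume q t)" by (rule sum.image_gen[OF Q(1), symmetric])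
  finally have s: "(\<Sum>c\<in>cp ` Q. ?i c) \<le> (\<Sum>q\<in>Q. cube_volume q t)" .
  have "0 \<le> (\<Sum>c\<in>cp ` Q. ?i c)" by (rule sum_nonneg) (use i in blast)
  then have "\<bar>?k * (\<Sum>c\<in>cp ` Q. ?i c)\<bar> = 2 ^ CARD('n) * \<bar>wedge_const TYPE('n)\<bar> * (\<Sum>c\<in>cp ` Q. ?i c)" by (simp add: abs_mult)
  also have "\<dots> \<le> 2 ^ CARD('n) * \<bar>wedge_const TYPE('n)\<bar> * (\<Sum>q\<in>Q. cube_volume q t)" using s by (intro mult_left_mono) auto
  finally show ?thesis unfolding eq .
qed

text \<open>The volume is at most a constant divided by \<open>L\<close>, so a volume of at least
  \<open>c0\<close> limits \<open>L\<close>. A nonnegative minimum needs no argument because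
  \<Lambda> is nonnegative.\<close>

lemma log_vol_lower_bound:
  assumes vp: "c0 > 0"
  obtains \<Lambda> where "\<And>t x. t \<in> I \<Longrightarrow> c0 \<le> volume t \<Longrightarrow> - \<Lambda> \<le> log_vol t x"
proof -
  have "\<exists>G\<ge>0. \<forall>t L. t \<in> I \<longrightarrow> is_min t (- L) \<longrightarrow> L > 0 \<longrightarrow> q \<in> Q \<longrightarrow> cube_volume q t \<le> G / L" for q
    using cube_volume_bound by metis
  then obtain G where G: "\<And>q. G q \<ge> 0" "\<And>q t L. t \<in> I \<Longrightarrow> is_min t (- L) \<Longrightarrow> L > 0 \<Longrightarrow> q \<in> Q \<Longrightarrow> cube_volume q t \<le> G q / L"
    by metis
  let ?k = "2 ^ CARD('n) * \<bar>wedge_const TYPE('n)\<bar>"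
  define \<Lambda> where "\<Lambda> = ?k * (\<Sum>q\<in>Q. G q) / c0"
  have L0: "\<Lambda> \<ge> 0" unfolding \<Lambda>_def using vp G(1) by (intro divide_nonneg_pos mult_nonneg_nonneg sum_nonneg) auto
  have "- \<Lambda> \<le> log_vol t x" if t: "t \<in> I" and c: "c0 \<le> volume t" for t x
  proof -
    obtain m where m: "is_min t m" using is_min_exists[OF t] by blast
    have "- \<Lambda> \<le> m"
    proof (cases "m < 0")
      case True
      define L where "L = - m"
      have L: "L > 0" "is_min t (- L)" using True m by (simp_all add: L_def)
      have "c0 \<le> ?k * (\<Sum>q\<in>Q. cube_volume q t)" using c volume_le_cube_volumes[OF t] by linarith
      also have "\<dots> \<le> ?k * (\<Sum>q\<in>Q. G q / L)" by (intro mult_left_mono sum_mono G(2)[OF t L(2,1)]) auto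
      also have "\<dots> = ?k * (\<Sum>q\<in>Q. G q) / L" by (simp only: sum_divide_distrib[symmetric] times_divide_eq_right)
      finally have "L * c0 \<le> ?k * (\<Sum>q\<in>Q. G q)" using L(1) by (simp add: field_simps)
      then have "L \<le> \<Lambda>" unfolding \<Lambda>_def using vp by (simp add: field_simps)
      then show ?thesis by (simp add: L_def)
    qed (use L0 in simp)
    also have "m \<le> log_vol t x" using m by (simp add: is_min_def)
    finally show ?thesis .
  qed
  then show ?thesis using that by blast
qed

text \<open>Stated for all times with volume at least \<open>c0\<close>, so that the constant does
  not depend on the time; that all times shortly before \<open>T\<close> are of this kind is a
  matter of cohomology.\<close>

lemma flow_lower_bound:
  assumes vp: "c0 > 0"
  obtains l where "l > 0" "\<And>t q z v. t \<in> I \<Longrightarrow> c0 \<le> volume t \<Longrightarrow> q \<in> Q \<Longrightarrow> z \<in> N q \<Longrightarrow>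
    l * (norm v)\<^sup>2 \<le> \<omega> t (cp q) z v (\<i> *s v)"
proof -
  obtain \<Lambda> where \<Lambda>: "\<And>t x. t \<in> I \<Longrightarrow> c0 \<le> volume t \<Longrightarrow> - \<Lambda> \<le> log_vol t x"
    using log_vol_lower_bound[OF vp] by blast
  have "\<exists>l>0. \<forall>t z v. t \<in> I \<longrightarrow> c0 \<le> volume t \<longrightarrow> z \<in> N q \<longrightarrow>
    l * (norm v)\<^sup>2 \<le> \<omega> t (cp q) z v (\<i> *s v)" for q
  proof -
    obtain a b where ab: "a > 0" "\<And>z. z \<in> N q \<Longrightarrow> a \<le> hdet \<omega>\<^sub>0 (cp q) z"
      using uniform_bounds[OF k0, of q] by metis
    obtain B where B: "\<And>t z v. t \<in> I \<Longrightarrow> z \<in> N q \<Longrightarrow> \<omega> t (cp q) z v (\<i> *s v) \<le> B * (norm v)\<^sup>2"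
      using flow_upper by metis
    have "a * exp (- \<Lambda>) > 0" using ab(1) by simp
    then obtain l where l: "l > 0" "\<And>\<omega> c z v. kaehler_form A \<omega> \<Longrightarrow> c \<in> A \<Longrightarrow> z \<in> chart_img c \<Longrightarrow>
      (\<And>v. \<omega> c z v (\<i> *s v) \<le> B * (norm v)\<^sup>2) \<Longrightarrow> a * exp (- \<Lambda>) \<le> hdet \<omega> c z \<Longrightarrow> l * (norm v)\<^sup>2 \<le> \<omega> c z v (\<i> *s v)"
      by (rule kaehler_lower_bound) blast
    have "l * (norm v)\<^sup>2 \<le> \<omega> t (cp q) z v (\<i> *s v)"
      if t: "t \<in> I" and c: "c0 \<le> volume t" and z: "z \<in> N q" for t z v
    proof (rule l(2)[OF flow_kaehler[OF t] cp _ B[OF t z]])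
      show zi: "z \<in> chart_img (cp q)" using z nbhd by blast
      have h0: "0 < hdet \<omega>\<^sub>0 (cp q) z" by (rule hdet_pos[OF k0 cp zi])
      have "a * exp (- \<Lambda>) \<le> hdet \<omega>\<^sub>0 (cp q) z * exp (log_vol t (chart_inv (cp q) z))"
        using ab(1) ab(2)[OF z] \<Lambda>[OF t c] by (intro mult_mono) auto
      also have "\<dots> = hdet (\<omega> t) (cp q) z"
        unfolding log_vol_def exp_vol_ratio[OF flow_kaehler[OF t] k0 cp zi] using h0 by simp
      finally show "a * exp (- \<Lambda>) \<le> hdet (\<omega> t) (cp q) z" .
    qed
    then show ?thesis using l(1) by blast
  qed
  then obtain l where l: "\<And>q. l q > 0" "\<And>q t z v. t \<in> I \<Longrightarrow> c0 \<le> volume t \<Longrightarrow> z \<in> N q \<Longrightarrow>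
    l q * (norm v)\<^sup>2 \<le> \<omega> t (cp q) z v (\<i> *s v)" by metis
  \<comment> \<open>The element 1 keeps the minimum defined when \<open>Q\<close> is empty.\<close>
  define l0 where "l0 = Min (insert 1 (l ` Q))"
  have "l0 > 0" unfolding l0_def using Q(1) l(1) by (subst Min_gr_iff) auto
  moreover have "l0 * (norm v)\<^sup>2 \<le> \<omega> t (cp q) z v (\<i> *s v)"
    if "t \<in> I" "c0 \<le> volume t" "q \<in> Q" "z \<in> N q" for t q z v
  proof -
    have "l0 \<le> l q" unfolding l0_def using Q(1) that(3) by (intro Min_le) auto
    then have "l0 * (norm v)\<^sup>2 \<le> l q * (norm v)\<^sup>2" by (intro mult_right_mono) auto
    also have "\<dots> \<le> \<omega> t (cp q) z v (\<i> *s v)" by (rule l(2)[OF that(1,2,4)])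
    finally show ?thesis .
  qed
  ultimately show ?thesis using that by blast
qed

end

lemma perturbation_constant:
  assumes k0: "kaehler_form A \<omega>\<^sub>0" and Q: "finite Q"
  obtains b where "b > 0" "\<And>q z v. q \<in> Q \<Longrightarrow> z \<in> N q \<Longrightarrow> \<bar>\<omega>\<^sub>0 (cp q) z v (\<i> *s v) + Ric \<omega>\<^sub>0 (cp q) z v (\<i> *s v)\<bar> \<le> b * (norm v)\<^sup>2"
proof -
  have "\<exists>b>0. \<forall>z\<in>N q. \<forall>v. \<bar>\<omega>\<^sub>0 (cp q) z v (\<i> *s v) + Ric \<omega>\<^sub>0 (cp q) z v (\<i> *s v)\<bar> \<le> b * (norm v)\<^sup>2" for q
    using uniform_bounds[OF k0, of q] by metis
  then obtain b where b: "\<And>q. b q > 0" "\<And>q z v. z \<in> N q \<Longrightarrow> \<bar>\<omega>\<^sub>0 (cp q) z v (\<i> *s v) + Ric \<omega>\<^sub>0 (cp q) z v (\<i> *s v)\<bar> \<le> b q * (norm v)\<^sup>2"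
    by metis
  define M where "M = Max (insert 1 (b ` Q))"
  have "M \<ge> 1" unfolding M_def using Q by (intro Max_ge) auto
  then have "M > 0" by simp
  moreover have "\<bar>\<omega>\<^sub>0 (cp q) z v (\<i> *s v) + Ric \<omega>\<^sub>0 (cp q) z v (\<i> *s v)\<bar> \<le> M * (norm v)\<^sup>2" if "q \<in> Q" "z \<in> N q" for q z v
  proof -
    have "b q \<le> M" unfolding M_def using Q that(1) by (intro Max_ge) auto
    then have "b q * (norm v)\<^sup>2 \<le> M * (norm v)\<^sup>2" by (intro mult_right_mono) auto
    then show ?thesis using b(2)[OF that(2), of v] by linarith
  qed
  ultimately show ?thesis using that by blast
qed

text \<open>At the initial time the determinant is bounded below by compactness alone. The bound
  serves to show that \<open>T\<close> is positive.\<close>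

lemma initial_lower_bound:
  assumes k0: "kaehler_form A \<omega>\<^sub>0" and Q: "finite Q"
  obtains l where "l > 0" "\<And>q z v. q \<in> Q \<Longrightarrow> z \<in> N q \<Longrightarrow> l * (norm v)\<^sup>2 \<le> \<omega>\<^sub>0 (cp q) z v (\<i> *s v)"
proof -
  have "\<exists>l>0. \<forall>z\<in>N q. \<forall>v. l * (norm v)\<^sup>2 \<le> \<omega>\<^sub>0 (cp q) z v (\<i> *s v)" for q
  proof -
    obtain a b where ab: "a > 0" "\<And>z. z \<in> N q \<Longrightarrow> a \<le> hdet \<omega>\<^sub>0 (cp q) z"
      "\<And>z v. z \<in> N q \<Longrightarrow> \<omega>\<^sub>0 (cp q) z v (\<i> *s v) \<le> b * (norm v)\<^sup>2"
      using uniform_bounds[OF k0, of q] by metis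
    obtain l where l: "l > 0" "\<And>\<omega> c z v. kaehler_form A \<omega> \<Longrightarrow> c \<in> A \<Longrightarrow> z \<in> chart_img c \<Longrightarrow>
      (\<And>v. \<omega> c z v (\<i> *s v) \<le> b * (norm v)\<^sup>2) \<Longrightarrow> a \<le> hdet \<omega> c z \<Longrightarrow> l * (norm v)\<^sup>2 \<le> \<omega> c z v (\<i> *s v)"
      by (rule kaehler_lower_bound[OF ab(1)]) blast
    have "l * (norm v)\<^sup>2 \<le> \<omega>\<^sub>0 (cp q) z v (\<i> *s v)" if "z \<in> N q" for z v
      by (rule l(2)[OF k0 cp _ ab(3)[OF that] ab(2)[OF that]]) (use that nbhd in blast)
    then show ?thesis using l(1) by blast
  qed
  then obtain l where l: "\<And>q. l q > 0" "\<And>q z v. z \<in> N q \<Longrightarrow> l q * (norm v)\<^sup>2 \<le> \<omega>\<^sub>0 (cp q) z v (\<i> *s v)" by metis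
  define l0 where "l0 = Min (insert 1 (l ` Q))"
  have "l0 > 0" unfolding l0_def using Q l(1) by (subst Min_gr_iff) auto
  moreover have "l0 * (norm v)\<^sup>2 \<le> \<omega>\<^sub>0 (cp q) z v (\<i> *s v)" if "q \<in> Q" "z \<in> N q" for q z v
  proof -
    have "l0 \<le> l q" unfolding l0_def using Q that(1) by (intro Min_le) auto
    then have "l0 * (norm v)\<^sup>2 \<le> l q * (norm v)\<^sup>2" by (intro mult_right_mono) auto
    also have "\<dots> \<le> \<omega>\<^sub>0 (cp q) z v (\<i> *s v)" by (rule l(2)[OF that(2)])
    finally show ?thesis .
  qed
  ultimately show ?thesis using that by blast
qed

end

lemma (in ccm) nbhds_exist:
  obtains cp rad where "ccm_nbhds A cp rad"
proof -
  let ?d = "real DIM(complex^'n)"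
  have d: "?d > 0" using DIM_positive[where 'a="complex^'n"] by linarith
  have "\<exists>c r. c \<in> A \<and> p \<in> chart_dom c \<and> r > 0 \<and> cball (chart_map c p) (4 * r * ?d * ?d) \<subseteq> chart_img c" for p
  proof -
    obtain c where c: "c \<in> A" "p \<in> chart_dom c" using charts_cover by blast
    obtain e where e: "e > 0" "cball (chart_map c p) e \<subseteq> chart_img c"
      using open_contains_cball open_img[OF c(1)] chart_map_img[OF c] by metis
    have "4 * (e / (4 * ?d * ?d)) * ?d * ?d = e" "e / (4 * ?d * ?d) > 0" using d e(1) by (simp_all add: field_simps)
    then show ?thesis using c e(2) by metis
  qed
  then obtain cp rad where "\<And>p. cp p \<in> A \<and> p \<in> chart_dom (cp p) \<and> rad p > 0 \<and>
      cball (chart_map (cp p) p) (4 * rad p * ?d * ?d) \<subseteq> chart_img (cp p)" by metis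
  then have "ccm_nbhds A cp rad" by unfold_locales auto
  then show ?thesis by (rule that)
qed

lemma exp_perturbation:
  fixes s b l :: real
  assumes "b > 0" "l > 0"
  obtains d where "d > 0" "\<And>t u. \<bar>t - s\<bar> < d \<Longrightarrow> \<bar>u - s\<bar> < d \<Longrightarrow> \<bar>exp (- t) - exp (- u)\<bar> * b < l"
proof -
  have "isCont (\<lambda>t. exp (- t)) s" by (intro continuous_intros)
  moreover have "l / (2 * b) > 0" using assms by simp
  ultimately obtain d where d: "d > 0" "\<And>t. \<bar>t - s\<bar> < d \<Longrightarrow> \<bar>exp (- t) - exp (- s)\<bar> < l / (2 * b)"
    unfolding continuous_at_eps_delta by (metis dist_real_def)
  have "\<bar>exp (- t) - exp (- u)\<bar> * b < l" if "\<bar>t - s\<bar> < d" "\<bar>u - s\<bar> < d" for t u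
  proof -
    have "\<bar>exp (- t) - exp (- u)\<bar> < l / (2 * b) + l / (2 * b)"
      using d(2)[OF that(1)] d(2)[OF that(2)] by linarith
    then show ?thesis using assms by (simp add: field_simps)
  qed
  then show ?thesis using that d(1) by blast
qed

theorem theorem1p1:
  fixes A :: "('a::t2_space, 'n::finite) chart set"
    and \<omega>\<^sub>0 :: "('a, 'n) form2"
    and T :: ereal
    and \<omega> :: "real \<Rightarrow> ('a, 'n) form2"
  assumes "closed_complex_manifold A"
    and "CARD('n) \<ge> 2"
    and "kaehler_form A \<omega>\<^sub>0"
    and "T = max_existence_time A \<omega>\<^sub>0"
    and "maximal_krf_solution A \<omega>\<^sub>0 T \<omega>"
    and "T < \<infinity>"
    and "top_self_intersection A (flow_class A \<omega>\<^sub>0 (real_of_ereal T)) > 0"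
  shows "\<not> (\<exists>D>0. \<forall>t\<in>time_interval T.
           form_le A (\<lambda>c z v w. - D * \<omega> t c z v w) (Ric (\<omega> t)))"
proof
  assume "\<exists>D>0. \<forall>t\<in>time_interval T. form_le A (\<lambda>c z v w. - D * \<omega> t c z v w) (Ric (\<omega> t))"
  then obtain D where D: "D > 0" and fl: "\<And>t. t \<in> time_interval T \<Longrightarrow> form_le A (\<lambda>c z v w. - D * \<omega> t c z v w) (Ric (\<omega> t))" by blast
  interpret ccm A by unfold_locales (rule assms(1))
  obtain cp rad where "ccm_nbhds A cp rad" by (rule nbhds_exist)
  then interpret ccm_nbhds A cp rad .
  note k0 = assms(3)
  obtain Q \<rho> where Q: "finite Q" "partition_of_unity A (cp ` Q) \<rho>" "(\<Union>p\<in>Q. U p) = UNIV"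
    and pou_U: "\<And>c q. \<rho> c q \<noteq> 0 \<Longrightarrow> \<exists>p\<in>Q. cp p = c \<and> q \<in> U p"
    using partition_of_unity_exists[OF cp open_U mem_U U_dom] by metis
  obtain b where b: "b > 0" "\<And>q z v. q \<in> Q \<Longrightarrow> z \<in> N q \<Longrightarrow> \<bar>\<omega>\<^sub>0 (cp q) z v (\<i> *s v) + Ric \<omega>\<^sub>0 (cp q) z v (\<i> *s v)\<bar> \<le> b * (norm v)\<^sup>2"
    using perturbation_constant[OF k0 Q(1)] by metis
  have in_cone: "ereal t \<le> T" if "flow_class A \<omega>\<^sub>0 t \<in> kaehler_cone A" for t
    unfolding assms(4) max_existence_time_def by (rule Sup_upper) (use that in blast)
  \<comment> \<open>Perturbing the initial form shows that the classes at small positive times are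
    Kaehler, so the supremum is positive and there are times of the flow near it.\<close>
  have pos: "0 < T"
  proof -
    obtain l where l: "l > 0" "\<And>q z v. q \<in> Q \<Longrightarrow> z \<in> N q \<Longrightarrow> l * (norm v)\<^sup>2 \<le> \<omega>\<^sub>0 (cp q) z v (\<i> *s v)"
      using initial_lower_bound[OF k0 Q(1)] by metis
    obtain d where d: "d > 0" "\<And>t u. \<bar>t - 0\<bar> < d \<Longrightarrow> \<bar>u - 0\<bar> < d \<Longrightarrow> \<bar>exp (- t) - exp (- u)\<bar> * b < l"
      using exp_perturbation[OF b(1) l(1), of 0] by metis
    have "cohomologous A \<omega>\<^sub>0 (limit_form \<omega>\<^sub>0 0)" by (rule cohomologous_refl) (simp add: limit_form_def)
    then have "flow_class A \<omega>\<^sub>0 (d / 2) \<in> kaehler_cone A"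
      by (rule perturbed_class_kaehler[OF k0 k0 _ Q(3) l(2) b(2)]) (use d(1) d(2)[of "d / 2" 0] in auto)
    then have "ereal (d / 2) \<le> T" by (rule in_cone)
    then show ?thesis using d(1) by (metis ereal_less(2) half_gt_zero less_le_trans)
  qed
  obtain Tr where Tr: "T = ereal Tr" using assms(6) pos by (cases T) auto
  have Tr0: "0 < Tr" using pos Tr by simp
  have sol: "krf_solution A \<omega>\<^sub>0 (ereal Tr) \<omega>" using assms(5) Tr by (simp add: maximal_krf_solution_def)
  have ric: "- D * \<omega> t c z v (\<i> *s v) \<le> Ric (\<omega> t) c z v (\<i> *s v)" if "t \<in> time_interval (ereal Tr)" "c \<in> A" "z \<in> chart_img c" for t c z v
    using fl that Tr by (simp add: form_le_def)
  let ?V = "\<lambda>t. pou_integral (cp ` Q) \<rho> (wedge_family (\<lambda>_. limit_form \<omega>\<^sub>0 t))"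
  have VT: "?V Tr > 0"
    using assms(7) unfolding Tr real_of_ereal.simps flow_class_eq[OF k0] top_self_intersection_eq[OF Q(2) closed_limit_form[OF k0]]
    by (simp add: zero_less_divide_iff)
  \<comment> \<open>Half the limiting volume, so that continuity keeps the volume above it near
    \<open>T\<close>.\<close>
  define c0 where "c0 = ?V Tr / 2"
  have c0: "c0 > 0" using VT by (simp add: c0_def)
  obtain d1 where d1: "d1 > 0" "\<And>t. \<bar>t - Tr\<bar> < d1 \<Longrightarrow> \<bar>?V t - ?V Tr\<bar> < c0"
    using flow_volume_tendsto[OF k0 Q(2), of Tr] c0 unfolding continuous_at_eps_delta by (metis dist_real_def)
  \<comment> \<open>The volume of the flow is thereby a continuous function of time that extends to
    \<open>T\<close>.\<close>
  have volume: "?V t = pou_integral (cp ` Q) \<rho> (wedge_family (\<lambda>_. \<omega> t))" if t: "t \<in> time_interval (ereal Tr)" for t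
    by (rule pou_integral_cohomologous[OF Q(2) closed_limit_form[OF k0] _ cohomologous_sym[OF flow_cohomologous[OF k0 sol t]]])
      (use sol t in \<open>simp add: krf_solution_def kaehler_form_def\<close>)
  obtain l where l: "l > 0" "\<And>t q z v. t \<in> time_interval (ereal Tr) \<Longrightarrow> c0 \<le> pou_integral (cp ` Q) \<rho> (wedge_family (\<lambda>_. \<omega> t)) \<Longrightarrow> q \<in> Q \<Longrightarrow> z \<in> N q \<Longrightarrow>
    l * (norm v)\<^sup>2 \<le> \<omega> t (cp q) z v (\<i> *s v)"
    using flow_lower_bound[OF k0 sol Tr0 D ric Q(1,3,2) pou_U c0] by metis
  obtain d2 where d2: "d2 > 0" "\<And>t u. \<bar>t - Tr\<bar> < d2 \<Longrightarrow> \<bar>u - Tr\<bar> < d2 \<Longrightarrow> \<bar>exp (- t) - exp (- u)\<bar> * b < l"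
    using exp_perturbation[OF b(1) l(1), of Tr] by metis
  \<comment> \<open>Half of the minimum, so that s = Tr - d is a positive time, \<open>s\<close> is
    within both continuity radii of \<open>Tr\<close>, and Tr + d is within the second.\<close>
  define d where "d = min Tr (min d1 d2) / 2"
  have d: "d > 0" "d < Tr" "d < d1" "d < d2" using Tr0 d1(1) d2(1) by (auto simp: d_def min_def)
  define s where "s = Tr - d"
  have s: "s \<in> time_interval (ereal Tr)" using d by (auto simp: time_interval_def s_def)
  have "\<bar>?V s - ?V Tr\<bar> < c0" by (rule d1(2)) (use d in \<open>simp add: s_def\<close>)
  then have "c0 \<le> ?V s" using c0_def by linarith
  then have cs: "c0 \<le> pou_integral (cp ` Q) \<rho> (wedge_family (\<lambda>_. \<omega> s))" unfolding volume[OF s] .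
  have ks: "kaehler_form A (\<omega> s)" using sol s by (simp add: krf_solution_def)
  have "flow_class A \<omega>\<^sub>0 (Tr + d) \<in> kaehler_cone A"
    by (rule perturbed_class_kaehler[OF k0 ks flow_cohomologous[OF k0 sol s] Q(3) l(2)[OF s cs] b(2)])
      (use d(1,4) d2(2)[of "Tr + d" s] in \<open>auto simp: s_def\<close>)
  then have "ereal (Tr + d) \<le> T" by (rule in_cone)
  then show False using d(1) Tr by simp
qed

end
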